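(* Let $F$ be a field containing a primitive $n$'th root of unity $q$ ($n\geq 2$), let $s,a\in F$, let $E=E(s)=F[h]/(h^n-s)$ with the $F$-automorphism $\sigma$, $\sigma(h)=qh$, and let $\mathcal{E}=(E,\sigma,a)=E[x;\sigma]/(x^n-a)$. 1. The polynomial $h^n-s\in F[h]$ is an irreducible polynomial over $F$ if and only if $s\notin\bigcup_{m\mid n,\,m\neq 1}F^{[m]}$. 2. Suppose that the polynomial $h^n-s\in F[h]$ is irreducible over $F$. Then the field extension $E/F$ is a Galois field extension with Galois group $G(E/F)=\langle\sigma\mid\sigma^n=1\rangle$, which is a cyclic group of order $n$ where $\sigma(h)=qh$, and $[E:F]=n$. 3. (a) The algebra $\mathcal{E}$ is a simple algebra if and only if $s\ne 0$ and $a\neq 0$. If $s\neq 0$ and $a\neq 0$ then the algebra $\mathcal{E}$ is a central simple algebra of degree $n$ (i.e. $Z(\mathcal{E})=F$ and $\dim_F(\mathcal{E})=n^2$). (b) $\mathrm{rad}(\mathcal{E})=(x)$ if $s\neq 0$ and $a=0$; $\mathrm{rad}(\mathcal{E})=(h)$ if $s=0$ and $a\ne 0$; $\mathrm{rad}(\mathcal{E})=(x,h)$ if $s=0$ and $a=0$; and, respectively in these three cases, $\mathcal{E}/\mathrm{rad}(\mathcal{E})$ is $F[h]/(h^n-s)$, $F[x]/(x^n-a)$, $F$. 4. The algebra $\mathcal{E}$ is a cyclic algebra if and only if $E$ is a field and $a\neq 0$. 5. Suppose that the algebra $E$ is a field and $a\neq 0$. Then the algebra $\mathcal{E}$ is isomorphic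 to the matrix algebra $M_n(F)$ if and only if $a=N_{E/F}(b)$ for some element $b\in E^\times$.
   Context: $E[x;\sigma]$ is the skew polynomial algebra with $xe=\sigma(e)x$ for $e\in E$; the element $x^n-a$ is central in it. So $\mathcal{E}$ is the $n^2$-dimensional $F$-algebra generated by $h,x$ subject to the defining relations $xh=qhx$, $h^n=s$, $x^n=a$. For $m\geq 1$, $F^{[m]}=\{u^m\mid u\in F\}$; in the union $m$ ranges over the positive divisors of $n$ different from $1$. The degree of a central simple finite dimensional $F$-algebra of dimension $d^2$ is $d$; a subfield containing $F$ is strictly maximal if its degree over $F$ equals the degree of the algebra. A Galois field extension is cyclic if its Galois group is cyclic. A finite dimensional central simple $F$-algebra is called a cyclic algebra if there is a strictly maximal subfield $L$ of it such that the field extension $L/F$ is cyclic. $N_{E/F}(b)=\prod_{i=0}^{n-1}\sigma^i(b)$. $Z(\cdot)$ denotes the centre, the radical $\mathrm{rad}$ of a finite dimensional algebra is its largest nilpotent ideal, and $(\cdot)$ denotes the two-sided ideal generated by the given elements.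
   Formalization: Item 4 is false as stated (F=Q, n=2, s=1, a=2: E is not a field, but the algebra is M_2(Q), cyclic via Q(x)). Proved instead: it is cyclic with E as the strictly maximal subfield iff E is a field and a≠0; E a field and a≠0 imply cyclic; cyclic implies a≠0. *)

theory Defs
  imports "HOL-Algebra.Algebra" "HOL-Algebra.UnivPoly"
begin

definition primitive_root_of_unity :: "('a, 'm) ring_scheme \<Rightarrow> nat \<Rightarrow> 'a \<Rightarrow> bool" where
  "primitive_root_of_unity F n q \<longleftrightarrow>
     q \<in> carrier F \<and> q [^]\<^bsub>F\<^esub> n = \<one>\<^bsub>F\<^esub> \<and>
     (\<forall>k::nat. 0 < k \<and> k < n \<longrightarrow> q [^]\<^bsub>F\<^esub> k \<noteq> \<one>\<^bsub>F\<^esub>)"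

definition mth_powers :: "('a, 'm) ring_scheme \<Rightarrow> nat \<Rightarrow> 'a set" where
  "mth_powers F m = {u [^]\<^bsub>F\<^esub> m | u. u \<in> carrier F}"


section \<open>Algebras over a field\<close>

text \<open>
  An \<open>F\<close>-algebra is a ring \<open>A\<close> together with its structure map \<open>f\<close> from \<open>F\<close> to the
  centre of \<open>A\<close>. Dimensions, centres and subfields of \<open>A\<close> refer to the copy
  \<open>K = f ` carrier F\<close> of \<open>F\<close> inside \<open>A\<close>; an isomorphism of \<open>F\<close>-algebras is a ring isomorphism
  compatible with the structure maps.
\<close>

definition alg_isomorphic ::
  "('c, 'k) ring_scheme \<Rightarrow> ('a, 'm) ring_scheme \<Rightarrow> ('c \<Rightarrow> 'a) \<Rightarrow> ('b, 'n) ring_scheme \<Rightarrow> ('c \<Rightarrow> 'b) \<Rightarrow> bool"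
where
  "alg_isomorphic F A f B g \<longleftrightarrow> (\<exists>\<phi>\<in>ring_iso A B. \<forall>c\<in>carrier F. \<phi> (f c) = g c)"

definition ring_center :: "('a, 'm) ring_scheme \<Rightarrow> 'a set" where
  "ring_center A = {z \<in> carrier A. \<forall>y\<in>carrier A. z \<otimes>\<^bsub>A\<^esub> y = y \<otimes>\<^bsub>A\<^esub> z}"

definition simple_ring :: "('a, 'm) ring_scheme \<Rightarrow> bool" where
  "simple_ring A \<longleftrightarrow>
     ring A \<and> \<one>\<^bsub>A\<^esub> \<noteq> \<zero>\<^bsub>A\<^esub> \<and> (\<forall>I. ideal I A \<longrightarrow> I = {\<zero>\<^bsub>A\<^esub>} \<or> I = carrier A)"

definition central_simple_algebra :: "'a set \<Rightarrow> ('a, 'm) ring_scheme \<Rightarrow> bool" where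
  "central_simple_algebra K A \<longleftrightarrow>
     simple_ring A \<and> subfield K A \<and> ring_center A = K \<and> ring.finite_dimension A K (carrier A)"

definition has_degree :: "'a set \<Rightarrow> ('a, 'm) ring_scheme \<Rightarrow> nat \<Rightarrow> bool" where
  "has_degree K A d \<longleftrightarrow> ring.dimension A (d ^ 2) K (carrier A)"

definition strictly_maximal_subfield :: "'a set \<Rightarrow> ('a, 'm) ring_scheme \<Rightarrow> 'a set \<Rightarrow> bool" where
  "strictly_maximal_subfield K A L \<longleftrightarrow>
     subfield L A \<and> K \<subseteq> L \<and> (\<exists>d. has_degree K A d \<and> ring.dimension A d K L)"

definition nilpotent_ideal :: "('a, 'm) ring_scheme \<Rightarrow> 'a set \<Rightarrow> bool" where
  "nilpotent_ideal A I \<longleftrightarrow>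
     ideal I A \<and> (\<exists>m::nat. (ideal_prod A I ^^ m) (carrier A) = {\<zero>\<^bsub>A\<^esub>})"

definition radical :: "('a, 'm) ring_scheme \<Rightarrow> 'a set" where
  "radical A = (GREATEST I. nilpotent_ideal A I)"

text \<open>
  The matrix algebra \<open>M\<^sub>n(F)\<close>. Matrices are functions on the index square, made extensional so that
  each matrix has exactly one representative.
\<close>

definition matrix_ring :: "('a, 'm) ring_scheme \<Rightarrow> nat \<Rightarrow> (nat \<times> nat \<Rightarrow> 'a) ring" where
  "matrix_ring F n =
     \<lparr>carrier = ({..<n} \<times> {..<n}) \<rightarrow>\<^sub>E carrier F,
      monoid.mult = (\<lambda>A B. \<lambda>(i, j)\<in>{..<n} \<times> {..<n}. \<Oplus>\<^bsub>F\<^esub>k\<in>{..<n}. A (i, k) \<otimes>\<^bsub>F\<^esub> B (k, j)),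
      one = (\<lambda>(i, j)\<in>{..<n} \<times> {..<n}. if i = j then \<one>\<^bsub>F\<^esub> else \<zero>\<^bsub>F\<^esub>),
      ring.zero = (\<lambda>(i, j)\<in>{..<n} \<times> {..<n}. \<zero>\<^bsub>F\<^esub>),
      ring.add = (\<lambda>A B. \<lambda>(i, j)\<in>{..<n} \<times> {..<n}. A (i, j) \<oplus>\<^bsub>F\<^esub> B (i, j))\<rparr>"

definition scalar_matrix :: "('a, 'm) ring_scheme \<Rightarrow> nat \<Rightarrow> 'a \<Rightarrow> nat \<times> nat \<Rightarrow> 'a" where
  "scalar_matrix F n c = (\<lambda>(i, j)\<in>{..<n} \<times> {..<n}. if i = j then c else \<zero>\<^bsub>F\<^esub>)"


section \<open>Galois and cyclic extensions, cyclic algebras\<close>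

text \<open>
  The group of ring automorphisms of \<open>R\<close> that fix \<open>K\<close> pointwise. As in \<^const>\<open>BijGroup\<close>,
  automorphisms are extensional functions on the carrier.
\<close>

definition aut_group :: "('a, 'm) ring_scheme \<Rightarrow> 'a set \<Rightarrow> ('a \<Rightarrow> 'a) monoid" where
  "aut_group R K = BijGroup (carrier R)
     \<lparr>carrier := {f \<in> Bij (carrier R). f \<in> ring_hom R R \<and> (\<forall>c\<in>K. f c = c)}\<rparr>"

text \<open>
  Finite Galois extensions: \<open>K\<close> is exactly the fixed field of the group of \<open>K\<close>-automorphisms.
\<close>

definition galois_extension :: "('a, 'm) ring_scheme \<Rightarrow> 'a set \<Rightarrow> bool" where
  "galois_extension L K \<longleftrightarrow>
     field L \<and> subfield K L \<and> ring.finite_dimension L K (carrier L) \<and>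
     {x \<in> carrier L. \<forall>f\<in>carrier (aut_group L K). f x = x} = K"

definition cyclic_extension :: "('a, 'm) ring_scheme \<Rightarrow> 'a set \<Rightarrow> bool" where
  "cyclic_extension L K \<longleftrightarrow> galois_extension L K \<and> cyclic_group (aut_group L K)"

text \<open>
  The subfield \<open>L\<close> that makes \<open>A\<close> a cyclic algebra is far from unique, and statements about a given
  presentation \<open>(E, \<sigma>, a)\<close> depend on which one is meant: for \<open>F = \<rat>\<close>, \<open>n = 2\<close>, \<open>s = 1\<close>, \<open>a = 2\<close>
  the algebra \<open>(E, \<sigma>, a)\<close> is \<open>M\<^sub>2(\<rat>)\<close>, a cyclic algebra because of its subfield \<open>\<rat>(x)\<close> with
  \<open>x\<^sup>2 = 2\<close>, although \<open>E = \<rat>[h]/(h\<^sup>2 - 1)\<close> is not a field. Hence \<open>L\<close> is made explicit in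
  \<open>cyclic_algebra_via\<close>; \<open>cyclic_algebra\<close> quantifies it existentially.
\<close>

definition cyclic_algebra_via :: "'a set \<Rightarrow> ('a, 'm) ring_scheme \<Rightarrow> 'a set \<Rightarrow> bool" where
  "cyclic_algebra_via K A L \<longleftrightarrow>
     central_simple_algebra K A \<and> strictly_maximal_subfield K A L \<and>
     cyclic_extension (A\<lparr>carrier := L\<rparr>) K"

definition cyclic_algebra :: "'a set \<Rightarrow> ('a, 'm) ring_scheme \<Rightarrow> bool" where
  "cyclic_algebra K A \<longleftrightarrow> (\<exists>L. cyclic_algebra_via K A L)"


section \<open>The algebra \<open>E(s) = F[h]/(h\<^sup>n - s)\<close>\<close>

definition binomial_poly :: "('a, 'm) ring_scheme \<Rightarrow> nat \<Rightarrow> 'a \<Rightarrow> 'a list" where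
  "binomial_poly F n s = X\<^bsub>F\<^esub> [^]\<^bsub>poly_ring F\<^esub> n \<ominus>\<^bsub>poly_ring F\<^esub> ring.poly_of_const F s"

definition root_alg :: "('a, 'm) ring_scheme \<Rightarrow> nat \<Rightarrow> 'a \<Rightarrow> 'a list set ring" where
  "root_alg F n s = Rupt\<^bsub>F\<^esub> (carrier F) (binomial_poly F n s)"

definition root_alg_const :: "('a, 'm) ring_scheme \<Rightarrow> nat \<Rightarrow> 'a \<Rightarrow> 'a \<Rightarrow> 'a list set" where
  "root_alg_const F n s c =
     ring.rupture_surj F (carrier F) (binomial_poly F n s) (ring.poly_of_const F c)"

definition root_alg_gen :: "('a, 'm) ring_scheme \<Rightarrow> nat \<Rightarrow> 'a \<Rightarrow> 'a list set" where
  "root_alg_gen F n s = ring.rupture_surj F (carrier F) (binomial_poly F n s) X\<^bsub>F\<^esub>"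

text \<open>
  The norm of \<open>b\<close>. It lies in the copy of \<open>F\<close> inside \<open>E\<close> when \<open>E\<close> is a field.
\<close>

definition cyclic_norm :: "('a, 'm) ring_scheme \<Rightarrow> ('a \<Rightarrow> 'a) \<Rightarrow> nat \<Rightarrow> 'a \<Rightarrow> 'a" where
  "cyclic_norm E \<sigma> n b = (\<Otimes>\<^bsub>E\<^esub>i\<in>{..<n}. (\<sigma> ^^ i) b)"


section \<open>The algebra \<open>\<E> = (E, \<sigma>, a) = E[x; \<sigma>]/(x\<^sup>n - a)\<close>\<close>

text \<open>
  The skew polynomial ring \<open>R[x; \<sigma>]\<close> has the same elements and the same addition as the polynomial
  ring \<^const>\<open>UP\<close>, coefficients being written on the left. The rule \<open>x e = \<sigma>(e) x\<close> amounts to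
  \<open>(e x\<^sup>i) (e' x\<^sup>j) = e \<sigma>\<^sup>i(e') x\<^sup>i\<^sup>+\<^sup>j\<close>.
\<close>

definition skew_poly_ring :: "('a, 'm) ring_scheme \<Rightarrow> ('a \<Rightarrow> 'a) \<Rightarrow> ('a, nat \<Rightarrow> 'a) up_ring" where
  "skew_poly_ring R \<sigma> = (UP R)
     \<lparr>monoid.mult := (\<lambda>p\<in>up R. \<lambda>r\<in>up R. \<lambda>k. \<Oplus>\<^bsub>R\<^esub>i\<in>{..k}. p i \<otimes>\<^bsub>R\<^esub> (\<sigma> ^^ i) (r (k - i)))\<rparr>"

abbreviation skew_const :: "('a, 'm) ring_scheme \<Rightarrow> ('a \<Rightarrow> 'a) \<Rightarrow> 'a \<Rightarrow> nat \<Rightarrow> 'a" where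
  "skew_const R \<sigma> e \<equiv> up_ring.monom (skew_poly_ring R \<sigma>) e 0"

abbreviation skew_var :: "('a, 'm) ring_scheme \<Rightarrow> ('a \<Rightarrow> 'a) \<Rightarrow> nat \<Rightarrow> 'a" where
  "skew_var R \<sigma> \<equiv> up_ring.monom (skew_poly_ring R \<sigma>) \<one>\<^bsub>R\<^esub> 1"

definition cyc_ideal :: "('a, 'm) ring_scheme \<Rightarrow> ('a \<Rightarrow> 'a) \<Rightarrow> nat \<Rightarrow> 'a \<Rightarrow> (nat \<Rightarrow> 'a) set" where
  "cyc_ideal E \<sigma> n a = Idl\<^bsub>skew_poly_ring E \<sigma>\<^esub>
     {skew_var E \<sigma> [^]\<^bsub>skew_poly_ring E \<sigma>\<^esub> n \<ominus>\<^bsub>skew_poly_ring E \<sigma>\<^esub> skew_const E \<sigma> a}"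

definition cyc_alg :: "('a, 'm) ring_scheme \<Rightarrow> ('a \<Rightarrow> 'a) \<Rightarrow> nat \<Rightarrow> 'a \<Rightarrow> (nat \<Rightarrow> 'a) set ring" where
  "cyc_alg E \<sigma> n a = skew_poly_ring E \<sigma> Quot cyc_ideal E \<sigma> n a"

definition cyc_const :: "('a, 'm) ring_scheme \<Rightarrow> ('a \<Rightarrow> 'a) \<Rightarrow> nat \<Rightarrow> 'a \<Rightarrow> 'a \<Rightarrow> (nat \<Rightarrow> 'a) set" where
  "cyc_const E \<sigma> n a e = cyc_ideal E \<sigma> n a +>\<^bsub>skew_poly_ring E \<sigma>\<^esub> skew_const E \<sigma> e"

definition cyc_var :: "('a, 'm) ring_scheme \<Rightarrow> ('a \<Rightarrow> 'a) \<Rightarrow> nat \<Rightarrow> 'a \<Rightarrow> (nat \<Rightarrow> 'a) set" where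
  "cyc_var E \<sigma> n a = cyc_ideal E \<sigma> n a +>\<^bsub>skew_poly_ring E \<sigma>\<^esub> skew_var E \<sigma>"

end

theory Submission
  imports Defs
begin

text \<open>
  Over \<open>F\<close> the algebra \<open>(E, \<sigma>, a)\<close> has the basis \<open>h\<^sup>i x\<^sup>j\<close> with \<open>i, j < n\<close>, and multiplication by
  powers of \<open>q\<close> on this basis gives commuting diagonal automorphisms with distinct joint eigenvalues.
  A subspace stable under them is spanned by the monomials it contains. If \<open>s\<close> and \<open>a\<close> are nonzero, the
  monomials are units and conjugation by \<open>h\<close> and \<open>x\<close> realises the diagonal automorphisms, so there are
  no proper ideals. If \<open>s\<close> or \<open>a\<close> vanishes, the nil radical is stable and is spanned by the monomials
  that contain a nilpotent generator. Irreducibility of \<open>h\<^sup>n - s\<close> and the Galois group follow from Kummer theory: all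
  roots are \<open>q\<^sup>i\<close> times one of them. The algebra splits iff it has a left ideal of dimension \<open>n\<close>, which
  must be \<open>E w\<close> with \<open>x w = b w\<close>; then \<open>a = N(b)\<close>.
\<close>

text \<open>The obstacle is that \<open>E\<close> need not be a field. If \<open>s\<close> is a
  proper power, \<open>E\<close> has zero divisors and degrees in \<open>E[x; \<sigma>]\<close> are
  not additive. The monomials are still independent, because \<open>x^n - a\<close> is monic and
  central: a multiple of it that vanishes in all degrees from \<open>n\<close> on is zero. The
  radical is the greatest nilpotent ideal, whose existence must itself be proved. The invariance
  argument is therefore run for the union of all nil ideals, which exists in every ring. Nilpotent
  ideals lie in this union, the union lies in the span of the monomials with a nilpotent generator,
  and this span is nilpotent. Projections onto eigenspaces are polynomials in the operator, obtained
  by Lagrange interpolation from the distinctness of the powers of \<open>q\<close>. Hence nothing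
  is ever divided by \<open>n\<close>. Cyclicity is tied to the copy of \<open>E\<close> inside the
  algebra. If \<open>E\<close> is a field, this copy is a Kummer extension of half the dimension
  exponent. Conversely the embedding is injective for every \<open>s\<close>, so inverses in the
  image come from \<open>E\<close>.\<close>

section \<open>Algebras with a basis\<close>

text \<open>Only additivity is assumed, so the lemma also covers maps that are not ring
  homomorphisms, such as reading off a matrix entry or a coefficient. For infinite \<open>I\<close>
  both sums are zero by convention.\<close>

lemma additive_finsum:
  assumes "abelian_group R" "abelian_group S"
    and cl: "\<And>x. x \<in> carrier R \<Longrightarrow> \<phi> x \<in> carrier S"
    and add: "\<And>x y. \<lbrakk>x \<in> carrier R; y \<in> carrier R\<rbrakk> \<Longrightarrow> \<phi> (x \<oplus>\<^bsub>R\<^esub> y) = \<phi> x \<oplus>\<^bsub>S\<^esub> \<phi> y"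
    and g: "g \<in> I \<rightarrow> carrier R"
  shows "\<phi> (\<Oplus>\<^bsub>R\<^esub>p\<in>I. g p) = (\<Oplus>\<^bsub>S\<^esub>p\<in>I. \<phi> (g p))"
proof -
  interpret R: abelian_group R by fact
  interpret S: abelian_group S by fact
  have z: "\<phi> \<zero>\<^bsub>R\<^esub> = \<zero>\<^bsub>S\<^esub>"
    by (metis R.r_zero R.zero_closed S.add.l_cancel_one' add cl)
  show ?thesis
    using g
  proof (induct I rule: infinite_finite_induct)
    case (insert p I)
    then have "g p \<in> carrier R" "g \<in> I \<rightarrow> carrier R" "(\<lambda>p. \<phi> (g p)) \<in> I \<rightarrow> carrier S"
      using cl by (auto simp: Pi_def)
    then show ?case using insert by (simp add: R.finsum_insert S.finsum_insert add cl)
  qed (simp_all add: z)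
qed

section \<open>Linear combinations over a field mapped into the centre\<close>

locale central_alg = F: field F + R: ring R
  for F :: "('a, 'm) ring_scheme" and R :: "('b, 'n) ring_scheme" +
  fixes f :: "'a \<Rightarrow> 'b"
  assumes f_hom: "f \<in> ring_hom F R"
    and f_central: "\<lbrakk>c \<in> carrier F; r \<in> carrier R\<rbrakk> \<Longrightarrow> r \<otimes>\<^bsub>R\<^esub> f c = f c \<otimes>\<^bsub>R\<^esub> r"
    and nontrivial: "\<one>\<^bsub>R\<^esub> \<noteq> \<zero>\<^bsub>R\<^esub>"
begin

sublocale f: ring_hom_ring F R f
  using f_hom by (intro ring_hom_ringI2) unfold_locales

text \<open>Indexed by a set, whereas the library's \<open>combine\<close> works on lists; sets make
  reindexing and interchange of sums available. \<open>combine_eq_lc\<close> is the bridge back to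
  span, independence and dimension.\<close>

definition lc :: "('i \<Rightarrow> 'b) \<Rightarrow> 'i set \<Rightarrow> ('i \<Rightarrow> 'a) \<Rightarrow> 'b" where
  "lc v I c = (\<Oplus>\<^bsub>R\<^esub>p\<in>I. f (c p) \<otimes>\<^bsub>R\<^esub> v p)"

lemma f_inj: "inj_on f (carrier F)"
  using F.field_axioms R.ring_axioms f_hom nontrivial f.img_is_subfield(1)[OF F.carrier_is_subfield] by blast

lemma f_eq_iff [simp]: "\<lbrakk>c \<in> carrier F; d \<in> carrier F\<rbrakk> \<Longrightarrow> f c = f d \<longleftrightarrow> c = d"
  using f_inj by (auto dest: inj_onD)

lemma f_eq_zero [simp]: "c \<in> carrier F \<Longrightarrow> f c = \<zero>\<^bsub>R\<^esub> \<longleftrightarrow> c = \<zero>\<^bsub>F\<^esub>"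
  using f_eq_iff[of c "\<zero>\<^bsub>F\<^esub>"] by (simp del: f_eq_iff)

lemma f_pow: "c \<in> carrier F \<Longrightarrow> f (c [^]\<^bsub>F\<^esub> (k::nat)) = f c [^]\<^bsub>R\<^esub> k"
  by (simp add: f.hom_nat_pow)

lemma subfield_image: "subfield (f ` carrier F) R"
  using f.img_is_subfield(2)[OF F.carrier_is_subfield nontrivial] .

lemma f_Units:
  assumes "c \<in> carrier F" "c \<noteq> \<zero>\<^bsub>F\<^esub>"
  shows "f c \<in> Units R"
proof -
  define d where "d = inv\<^bsub>F\<^esub> c"
  have c: "c \<in> Units F" using assms by (simp add: F.field_Units)
  then have d: "d \<in> carrier F" "c \<otimes>\<^bsub>F\<^esub> d = \<one>\<^bsub>F\<^esub>" "d \<otimes>\<^bsub>F\<^esub> c = \<one>\<^bsub>F\<^esub>"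
    by (auto simp: d_def)
  have "f c \<otimes>\<^bsub>R\<^esub> f d = \<one>\<^bsub>R\<^esub>" "f d \<otimes>\<^bsub>R\<^esub> f c = \<one>\<^bsub>R\<^esub>"
    using d assms(1) by (simp_all flip: f.hom_mult)
  then show ?thesis using assms(1) d(1) by (auto simp: Units_def)
qed

lemma f_mult_f:
  assumes "c \<in> carrier F" "d \<in> carrier F" "r \<in> carrier R"
  shows "f c \<otimes>\<^bsub>R\<^esub> (f d \<otimes>\<^bsub>R\<^esub> r) = f (c \<otimes>\<^bsub>F\<^esub> d) \<otimes>\<^bsub>R\<^esub> r"
  using assms by (simp add: R.m_assoc)

lemma f_lcomm:
  assumes "c \<in> carrier F" "r \<in> carrier R" "r' \<in> carrier R"
  shows "r \<otimes>\<^bsub>R\<^esub> (f c \<otimes>\<^bsub>R\<^esub> r') = f c \<otimes>\<^bsub>R\<^esub> (r \<otimes>\<^bsub>R\<^esub> r')"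
proof -
  have "r \<otimes>\<^bsub>R\<^esub> (f c \<otimes>\<^bsub>R\<^esub> r') = (r \<otimes>\<^bsub>R\<^esub> f c) \<otimes>\<^bsub>R\<^esub> r'" using assms by (simp add: R.m_assoc)
  also have "\<dots> = f c \<otimes>\<^bsub>R\<^esub> (r \<otimes>\<^bsub>R\<^esub> r')" unfolding f_central[OF assms(1,2)] using assms by (simp add: R.m_assoc)
  finally show ?thesis .
qed

lemma f_mult_mult:
  assumes "c \<in> carrier F" "d \<in> carrier F" "r \<in> carrier R" "r' \<in> carrier R"
  shows "(f c \<otimes>\<^bsub>R\<^esub> r) \<otimes>\<^bsub>R\<^esub> (f d \<otimes>\<^bsub>R\<^esub> r') = f (c \<otimes>\<^bsub>F\<^esub> d) \<otimes>\<^bsub>R\<^esub> (r \<otimes>\<^bsub>R\<^esub> r')"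
proof -
  have "(f c \<otimes>\<^bsub>R\<^esub> r) \<otimes>\<^bsub>R\<^esub> (f d \<otimes>\<^bsub>R\<^esub> r') = f c \<otimes>\<^bsub>R\<^esub> (r \<otimes>\<^bsub>R\<^esub> (f d \<otimes>\<^bsub>R\<^esub> r'))"
    using assms by (simp add: R.m_assoc)
  also have "\<dots> = f c \<otimes>\<^bsub>R\<^esub> (f d \<otimes>\<^bsub>R\<^esub> (r \<otimes>\<^bsub>R\<^esub> r'))" using assms by (simp only: f_lcomm)
  also have "\<dots> = f (c \<otimes>\<^bsub>F\<^esub> d) \<otimes>\<^bsub>R\<^esub> (r \<otimes>\<^bsub>R\<^esub> r')" using assms by (intro f_mult_f) auto
  finally show ?thesis .
qed

lemma lc_term_closed:
  "\<lbrakk>v \<in> I \<rightarrow> carrier R; c \<in> I \<rightarrow> carrier F; p \<in> I\<rbrakk> \<Longrightarrow> f (c p) \<otimes>\<^bsub>R\<^esub> v p \<in> carrier R"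
  by (auto simp: Pi_def)

lemma lc_closed [intro]: "\<lbrakk>v \<in> I \<rightarrow> carrier R; c \<in> I \<rightarrow> carrier F\<rbrakk> \<Longrightarrow> lc v I c \<in> carrier R"
  unfolding lc_def by (intro R.finsum_closed) (auto simp: Pi_def)

lemma lc_cong:
  assumes "v \<in> I \<rightarrow> carrier R" "c \<in> I \<rightarrow> carrier F"
    "\<And>p. p \<in> I \<Longrightarrow> c p = d p" "\<And>p. p \<in> I \<Longrightarrow> v p = w p"
  shows "lc v I c = lc w I d"
  unfolding lc_def using assms by (intro R.finsum_cong') (auto simp: Pi_def)

lemma lc_add:
  assumes "v \<in> I \<rightarrow> carrier R" "c \<in> I \<rightarrow> carrier F" "d \<in> I \<rightarrow> carrier F"
  shows "lc v I c \<oplus>\<^bsub>R\<^esub> lc v I d = lc v I (\<lambda>p. c p \<oplus>\<^bsub>F\<^esub> d p)"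
proof -
  have "lc v I (\<lambda>p. c p \<oplus>\<^bsub>F\<^esub> d p) = (\<Oplus>\<^bsub>R\<^esub>p\<in>I. f (c p) \<otimes>\<^bsub>R\<^esub> v p \<oplus>\<^bsub>R\<^esub> f (d p) \<otimes>\<^bsub>R\<^esub> v p)"
    unfolding lc_def using assms by (intro R.finsum_cong') (auto simp: Pi_def R.l_distr)
  also have "\<dots> = lc v I c \<oplus>\<^bsub>R\<^esub> lc v I d"
    unfolding lc_def using assms by (intro R.finsum_addf) (auto simp: Pi_def)
  finally show ?thesis by simp
qed

lemma lc_scale:
  assumes "v \<in> I \<rightarrow> carrier R" "c \<in> I \<rightarrow> carrier F" "a \<in> carrier F" "finite I"
  shows "f a \<otimes>\<^bsub>R\<^esub> lc v I c = lc v I (\<lambda>p. a \<otimes>\<^bsub>F\<^esub> c p)"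
proof -
  have "f a \<otimes>\<^bsub>R\<^esub> lc v I c = (\<Oplus>\<^bsub>R\<^esub>p\<in>I. f a \<otimes>\<^bsub>R\<^esub> (f (c p) \<otimes>\<^bsub>R\<^esub> v p))"
    unfolding lc_def using assms by (intro R.finsum_rdistr) (auto simp: Pi_def)
  also have "\<dots> = lc v I (\<lambda>p. a \<otimes>\<^bsub>F\<^esub> c p)"
    unfolding lc_def using assms by (intro R.finsum_cong') (auto simp: Pi_def R.m_assoc)
  finally show ?thesis .
qed

lemma lc_mult_left:
  assumes "v \<in> I \<rightarrow> carrier R" "c \<in> I \<rightarrow> carrier F" "r \<in> carrier R" "finite I"
  shows "r \<otimes>\<^bsub>R\<^esub> lc v I c = lc (\<lambda>p. r \<otimes>\<^bsub>R\<^esub> v p) I c"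
proof -
  have "r \<otimes>\<^bsub>R\<^esub> lc v I c = (\<Oplus>\<^bsub>R\<^esub>p\<in>I. r \<otimes>\<^bsub>R\<^esub> (f (c p) \<otimes>\<^bsub>R\<^esub> v p))"
    unfolding lc_def using assms by (intro R.finsum_rdistr) (auto simp: Pi_def)
  also have "\<dots> = lc (\<lambda>p. r \<otimes>\<^bsub>R\<^esub> v p) I c"
    unfolding lc_def using assms
    by (intro R.finsum_cong') (auto simp: Pi_def R.m_assoc[symmetric] f_central)
  finally show ?thesis .
qed

lemma lc_mult_right:
  assumes "v \<in> I \<rightarrow> carrier R" "c \<in> I \<rightarrow> carrier F" "r \<in> carrier R" "finite I"
  shows "lc v I c \<otimes>\<^bsub>R\<^esub> r = lc (\<lambda>p. v p \<otimes>\<^bsub>R\<^esub> r) I c"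
proof -
  have "lc v I c \<otimes>\<^bsub>R\<^esub> r = (\<Oplus>\<^bsub>R\<^esub>p\<in>I. f (c p) \<otimes>\<^bsub>R\<^esub> v p \<otimes>\<^bsub>R\<^esub> r)"
    unfolding lc_def using assms by (intro R.finsum_ldistr) (auto simp: Pi_def)
  also have "\<dots> = lc (\<lambda>p. v p \<otimes>\<^bsub>R\<^esub> r) I c"
    unfolding lc_def using assms by (intro R.finsum_cong') (auto simp: Pi_def R.m_assoc)
  finally show ?thesis .
qed

lemma lc_zero [simp]: "v \<in> I \<rightarrow> carrier R \<Longrightarrow> lc v I (\<lambda>p. \<zero>\<^bsub>F\<^esub>) = \<zero>\<^bsub>R\<^esub>"
  unfolding lc_def by (intro R.add.finprod_one_eqI) (auto simp: Pi_def)

lemma lc_single: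
  assumes "v \<in> I \<rightarrow> carrier R" "finite I" "k \<in> I" "c \<in> carrier F"
  shows "lc v I (\<lambda>p. if p = k then c else \<zero>\<^bsub>F\<^esub>) = f c \<otimes>\<^bsub>R\<^esub> v k"
proof -
  have "lc v I (\<lambda>p. if p = k then c else \<zero>\<^bsub>F\<^esub>) = (\<Oplus>\<^bsub>R\<^esub>p\<in>I. if k = p then f c \<otimes>\<^bsub>R\<^esub> v p else \<zero>\<^bsub>R\<^esub>)"
    unfolding lc_def using assms by (intro R.finsum_cong') (auto simp: Pi_def)
  also have "\<dots> = f c \<otimes>\<^bsub>R\<^esub> v k"
    using assms R.finsum_singleton[of k I "\<lambda>p. f c \<otimes>\<^bsub>R\<^esub> v p"] by (auto simp: Pi_def)
  finally show ?thesis .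
qed

lemma lc_mono_neutral:
  assumes "v \<in> I \<rightarrow> carrier R" "c \<in> I \<rightarrow> carrier F" "finite I" "J \<subseteq> I" "\<And>p. p \<in> I - J \<Longrightarrow> c p = \<zero>\<^bsub>F\<^esub>"
  shows "lc v I c = lc v J c"
  unfolding lc_def
proof (rule R.add.finprod_mono_neutral_cong_right)
  show "(\<lambda>p. f (c p) \<otimes>\<^bsub>R\<^esub> v p) \<in> I \<rightarrow> carrier R"
    using assms(1,2) by (auto intro!: lc_term_closed)
  show "f (c p) \<otimes>\<^bsub>R\<^esub> v p = \<zero>\<^bsub>R\<^esub>" if "p \<in> I - J" for p
  proof -
    have "v p \<in> carrier R" using assms(1) that by auto
    then show ?thesis using assms(5)[OF that] by simp
  qed
qed (use assms in auto)

lemma lc_finsum: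
  assumes "v \<in> J \<rightarrow> carrier R" "\<And>p. p \<in> I \<Longrightarrow> c p \<in> J \<rightarrow> carrier F" "finite I" "finite J"
  shows "(\<Oplus>\<^bsub>R\<^esub>p\<in>I. lc v J (c p)) = lc v J (\<lambda>j. \<Oplus>\<^bsub>F\<^esub>p\<in>I. c p j)"
  using assms(3,2)
proof (induct I)
  case empty
  then show ?case using assms by simp
next
  case (insert a I)
  have "lc v J (\<lambda>j. \<Oplus>\<^bsub>F\<^esub>p\<in>insert a I. c p j) = lc v J (\<lambda>j. c a j \<oplus>\<^bsub>F\<^esub> (\<Oplus>\<^bsub>F\<^esub>p\<in>I. c p j))"
    using insert assms by (intro lc_cong) (auto simp: Pi_def intro!: F.finsum_closed F.finsum_insert)
  also have "\<dots> = lc v J (c a) \<oplus>\<^bsub>R\<^esub> lc v J (\<lambda>j. \<Oplus>\<^bsub>F\<^esub>p\<in>I. c p j)"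
    using insert assms by (intro lc_add[symmetric]) (auto simp: Pi_def intro!: F.finsum_closed)
  also have "\<dots> = (\<Oplus>\<^bsub>R\<^esub>p\<in>insert a I. lc v J (c p))"
    using insert assms by (subst R.finsum_insert) (auto simp: Pi_def intro!: lc_closed)
  finally show ?case by simp
qed

text \<open>Substituting one system of coordinates into another multiplies the coefficient matrices;
  \<open>matrix_rep\<close> reads the matrix product off this formula.\<close>

lemma lc_lc:
  assumes w: "w \<in> J \<rightarrow> carrier R" and d: "\<And>p. p \<in> I \<Longrightarrow> d p \<in> J \<rightarrow> carrier F"
    and c: "c \<in> I \<rightarrow> carrier F" and fin: "finite I" "finite J"
    and v: "\<And>p. p \<in> I \<Longrightarrow> v p = lc w J (d p)"
  shows "lc v I c = lc w J (\<lambda>j. \<Oplus>\<^bsub>F\<^esub>p\<in>I. c p \<otimes>\<^bsub>F\<^esub> d p j)"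
proof -
  have "lc v I c = (\<Oplus>\<^bsub>R\<^esub>p\<in>I. lc w J (\<lambda>j. c p \<otimes>\<^bsub>F\<^esub> d p j))"
    unfolding lc_def[of v]
    using w d c fin v by (intro R.finsum_cong') (auto simp: Pi_def lc_scale intro!: lc_closed)
  also have "\<dots> = lc w J (\<lambda>j. \<Oplus>\<^bsub>F\<^esub>p\<in>I. c p \<otimes>\<^bsub>F\<^esub> d p j)"
    using w d c fin by (intro lc_finsum) (auto simp: Pi_def)
  finally show ?thesis .
qed

lemma lc_reindex:
  assumes "bij_betw k J I" "v \<in> I \<rightarrow> carrier R" "c \<in> I \<rightarrow> carrier F"
  shows "lc v I c = lc (\<lambda>j. v (k j)) J (\<lambda>j. c (k j))"
proof -
  have k: "inj_on k J" "k ` J = I" using assms(1) by (auto simp: bij_betw_def)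
  have "(\<lambda>p. f (c p) \<otimes>\<^bsub>R\<^esub> v p) \<in> k ` J \<rightarrow> carrier R"
    unfolding k(2) using assms(2,3) by (auto intro!: lc_term_closed)
  from R.finsum_reindex[OF this k(1)] show ?thesis unfolding lc_def k(2) .
qed

lemma combine_eq_lc:
  assumes "distinct ps" "v \<in> set ps \<rightarrow> carrier R" "c \<in> set ps \<rightarrow> carrier F"
  shows "R.combine (map (\<lambda>p. f (c p)) ps) (map v ps) = lc v (set ps) c"
  using assms
proof (induct ps)
  case (Cons p ps)
  then have "v \<in> set ps \<rightarrow> carrier R" "c \<in> set ps \<rightarrow> carrier F" "v p \<in> carrier R" "c p \<in> carrier F"
    by auto
  then have "(\<lambda>p. f (c p) \<otimes>\<^bsub>R\<^esub> v p) \<in> set ps \<rightarrow> carrier R" "f (c p) \<otimes>\<^bsub>R\<^esub> v p \<in> carrier R"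
    by (auto intro!: lc_term_closed)
  then have "lc v (set (p # ps)) c = f (c p) \<otimes>\<^bsub>R\<^esub> v p \<oplus>\<^bsub>R\<^esub> lc v (set ps) c"
    unfolding lc_def list.set using Cons by (intro R.finsum_insert) simp_all
  with Cons show ?case by simp
qed (simp add: lc_def)

text \<open>Distinctness of \<open>ps\<close> allows the coefficient function to be built by
  updates, one index at a time, without disturbing earlier values.\<close>

lemma coords_of_list:
  assumes "distinct ps" "set Ks \<subseteq> f ` carrier F" "length Ks = length ps"
  obtains c where "c \<in> set ps \<rightarrow> carrier F" "Ks = map (\<lambda>p. f (c p)) ps"
proof -
  have "\<exists>c. c \<in> set ps \<rightarrow> carrier F \<and> Ks = map (\<lambda>p. f (c p)) ps"
    using assms(3,1,2)
  proof (induct Ks ps rule: list_induct2)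
    case (Cons k Ks p ps)
    then obtain c a where c: "c \<in> set ps \<rightarrow> carrier F" "Ks = map (\<lambda>p. f (c p)) ps"
      "k = f a" "a \<in> carrier F" by auto
    then have "c(p := a) \<in> set (p # ps) \<rightarrow> carrier F \<and> k # Ks = map (\<lambda>r. f ((c(p := a)) r)) (p # ps)"
      using Cons by auto
    then show ?case by (rule exI[of _ "c(p := a)"])
  qed simp
  then show ?thesis using that by blast
qed

lemma Span_eq_lc:
  assumes "distinct ps" "v \<in> set ps \<rightarrow> carrier R"
  shows "R.Span (f ` carrier F) (map v ps) = {lc v (set ps) c |c. c \<in> set ps \<rightarrow> carrier F}"
proof -
  have *: "set (map v ps) \<subseteq> carrier R" using assms by auto
  show ?thesis
    unfolding R.Span_eq_combine_set_length_version[OF subfield_image *]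
  proof (intro subset_antisym subsetI)
    fix y assume "y \<in> {R.combine Ks (map v ps) |Ks. length Ks = length (map v ps) \<and> set Ks \<subseteq> f ` carrier F}"
    then obtain Ks where Ks: "y = R.combine Ks (map v ps)" "length Ks = length ps" "set Ks \<subseteq> f ` carrier F"
      by auto
    from coords_of_list[OF assms(1) Ks(3,2)]
    obtain c where "c \<in> set ps \<rightarrow> carrier F" "Ks = map (\<lambda>p. f (c p)) ps" .
    then show "y \<in> {lc v (set ps) c |c. c \<in> set ps \<rightarrow> carrier F}"
      using combine_eq_lc[OF assms] Ks(1) by blast
  next
    fix y assume "y \<in> {lc v (set ps) c |c. c \<in> set ps \<rightarrow> carrier F}"
    then obtain c where c: "c \<in> set ps \<rightarrow> carrier F" "y = lc v (set ps) c" by blast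
    then have "y = R.combine (map (\<lambda>p. f (c p)) ps) (map v ps)"
      using combine_eq_lc[OF assms] by simp
    moreover have "set (map (\<lambda>p. f (c p)) ps) \<subseteq> f ` carrier F" using c by auto
    moreover have "length (map (\<lambda>p. f (c p)) ps) = length (map v ps)" by simp
    ultimately show "y \<in> {R.combine Ks (map v ps) |Ks. length Ks = length (map v ps) \<and> set Ks \<subseteq> f ` carrier F}"
      by blast
  qed
qed

lemma independentI:
  assumes "distinct ps" "v \<in> set ps \<rightarrow> carrier R"
    and "\<And>c p. \<lbrakk>c \<in> set ps \<rightarrow> carrier F; lc v (set ps) c = \<zero>\<^bsub>R\<^esub>; p \<in> set ps\<rbrakk> \<Longrightarrow> c p = \<zero>\<^bsub>F\<^esub>"
  shows "R.independent (f ` carrier F) (map v ps)"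
proof (rule ccontr)
  have *: "set (map v ps) \<subseteq> carrier R" using assms by auto
  assume "\<not> ?thesis"
  then obtain Ks where Ks: "length Ks = length (map v ps)" "R.combine Ks (map v ps) = \<zero>\<^bsub>R\<^esub>"
      "set Ks \<subseteq> f ` carrier F" "set Ks \<noteq> {\<zero>\<^bsub>R\<^esub>}"
    by (rule R.dependent_imp_non_trivial_combine[OF subfield_image *])
  then have "length Ks = length ps" by simp
  from coords_of_list[OF assms(1) Ks(3) this]
  obtain c where c: "c \<in> set ps \<rightarrow> carrier F" "Ks = map (\<lambda>p. f (c p)) ps" .
  then have "lc v (set ps) c = \<zero>\<^bsub>R\<^esub>" using combine_eq_lc[OF assms(1,2)] Ks by simp
  then have "\<And>p. p \<in> set ps \<Longrightarrow> c p = \<zero>\<^bsub>F\<^esub>" using assms(3) c by blast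
  then have "set Ks \<subseteq> {\<zero>\<^bsub>R\<^esub>}" using c by auto
  \<comment> \<open>The condition \<open>set Ks \<noteq> {0}\<close> supplied by the library also
    holds for the empty list. This is the only case left, and the empty family is
    independent.\<close>
  then have "Ks = []" using Ks(4) by (cases Ks) auto
  then have "R.independent (f ` carrier F) (map v ps)" using c by auto
  with \<open>\<not> ?thesis\<close> show False ..
qed

lemma dimension_lcI:
  assumes "finite I" "v \<in> I \<rightarrow> carrier R"
    and "\<And>c p. \<lbrakk>c \<in> I \<rightarrow> carrier F; lc v I c = \<zero>\<^bsub>R\<^esub>; p \<in> I\<rbrakk> \<Longrightarrow> c p = \<zero>\<^bsub>F\<^esub>"
  shows "R.dimension (card I) (f ` carrier F) {lc v I c |c. c \<in> I \<rightarrow> carrier F}"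
proof -
  obtain ps where ps: "distinct ps" "set ps = I" using assms(1) finite_distinct_list by blast
  have "R.independent (f ` carrier F) (map v ps)" using ps assms by (intro independentI) auto
  from R.dimension_independent[OF this] show ?thesis
    using Span_eq_lc[of ps v] ps assms distinct_card[of ps] by auto
qed

end

section \<open>Coordinates with respect to a finite basis\<close>

locale based_alg = central_alg F R f
  for F :: "('a, 'm) ring_scheme" and R :: "('b, 'n) ring_scheme" and f :: "'a \<Rightarrow> 'b" +
  fixes I :: "'i set" and b :: "'i \<Rightarrow> 'b"
  assumes finite_I: "finite I"
    and b_closed: "b \<in> I \<rightarrow> carrier R"
    and generating: "r \<in> carrier R \<Longrightarrow> \<exists>c\<in>I \<rightarrow> carrier F. r = lc b I c"
    and lc_eq_zeroD: "\<lbrakk>c \<in> I \<rightarrow> carrier F; lc b I c = \<zero>\<^bsub>R\<^esub>; p \<in> I\<rbrakk> \<Longrightarrow> c p = \<zero>\<^bsub>F\<^esub>"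
begin

abbreviation "el c \<equiv> lc b I c"

text \<open>Only the values on \<open>I\<close> are determined. Equality of elements is therefore
  always tested on \<open>I\<close>, through \<open>eq_by_co\<close>.\<close>

definition co :: "'b \<Rightarrow> 'i \<Rightarrow> 'a" where
  "co r = (SOME c. c \<in> I \<rightarrow> carrier F \<and> r = el c)"

lemma co: assumes "r \<in> carrier R" shows "co r \<in> I \<rightarrow> carrier F" "el (co r) = r"
proof -
  have "\<exists>c. c \<in> I \<rightarrow> carrier F \<and> r = el c" using generating[OF assms] by blast
  from someI_ex[OF this] show "co r \<in> I \<rightarrow> carrier F" "el (co r) = r" unfolding co_def by auto
qed

lemma co_closed [simp]: "r \<in> carrier R \<Longrightarrow> p \<in> I \<Longrightarrow> co r p \<in> carrier F"
  using co(1) by blast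

lemma el_closed [simp]: "c \<in> I \<rightarrow> carrier F \<Longrightarrow> el c \<in> carrier R"
  using b_closed by blast

lemma el_minus:
  assumes "c \<in> I \<rightarrow> carrier F" "d \<in> I \<rightarrow> carrier F"
  shows "el c \<ominus>\<^bsub>R\<^esub> el d = el (\<lambda>p. c p \<ominus>\<^bsub>F\<^esub> d p)"
proof -
  have "el (\<lambda>p. c p \<ominus>\<^bsub>F\<^esub> d p) \<oplus>\<^bsub>R\<^esub> el d = el (\<lambda>p. c p \<ominus>\<^bsub>F\<^esub> d p \<oplus>\<^bsub>F\<^esub> d p)"
    using assms b_closed by (intro lc_add) (auto simp: Pi_def)
  also have "\<dots> = el c"
    using assms b_closed by (intro lc_cong) (auto simp: Pi_def a_minus_def F.add.m_assoc F.l_neg)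
  finally have *: "el (\<lambda>p. c p \<ominus>\<^bsub>F\<^esub> d p) \<oplus>\<^bsub>R\<^esub> el d = el c" .
  have "(\<lambda>p. c p \<ominus>\<^bsub>F\<^esub> d p) \<in> I \<rightarrow> carrier F" using assms by (auto simp: Pi_def)
  then have "el (\<lambda>p. c p \<ominus>\<^bsub>F\<^esub> d p) \<oplus>\<^bsub>R\<^esub> el d \<ominus>\<^bsub>R\<^esub> el d = el (\<lambda>p. c p \<ominus>\<^bsub>F\<^esub> d p)"
    using assms by (simp add: a_minus_def R.a_assoc R.r_neg)
  then show ?thesis by (simp add: *)
qed

lemma el_inj:
  assumes "c \<in> I \<rightarrow> carrier F" "d \<in> I \<rightarrow> carrier F" "el c = el d" "p \<in> I"
  shows "c p = d p"
proof -
  have "el (\<lambda>p. c p \<ominus>\<^bsub>F\<^esub> d p) = \<zero>\<^bsub>R\<^esub>"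
    using el_minus[OF assms(1,2)] el_closed[OF assms(2)] R.r_right_minus_eq[of "el d" "el d"] assms(3) by simp
  moreover have "(\<lambda>p. c p \<ominus>\<^bsub>F\<^esub> d p) \<in> I \<rightarrow> carrier F" using assms by (auto simp: Pi_def)
  ultimately have "c p \<ominus>\<^bsub>F\<^esub> d p = \<zero>\<^bsub>F\<^esub>" using lc_eq_zeroD assms(4) by blast
  then show ?thesis using assms by (auto simp: Pi_def F.r_right_minus_eq)
qed

lemma co_el: "\<lbrakk>c \<in> I \<rightarrow> carrier F; p \<in> I\<rbrakk> \<Longrightarrow> co (el c) p = c p"
  using el_inj[OF co(1)[OF el_closed] _ co(2)[OF el_closed]] by blast

lemma co_eqI: "\<lbrakk>c \<in> I \<rightarrow> carrier F; r = el c; p \<in> I\<rbrakk> \<Longrightarrow> co r p = c p"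
  using co_el by simp

lemma eq_by_co:
  assumes "r \<in> carrier R" "r' \<in> carrier R" "\<And>p. p \<in> I \<Longrightarrow> co r p = co r' p"
  shows "r = r'"
proof -
  have "el (co r) = el (co r')"
    using assms co b_closed by (intro lc_cong) auto
  then show ?thesis using co assms by simp
qed

lemma co_add: "\<lbrakk>r \<in> carrier R; r' \<in> carrier R; p \<in> I\<rbrakk> \<Longrightarrow> co (r \<oplus>\<^bsub>R\<^esub> r') p = co r p \<oplus>\<^bsub>F\<^esub> co r' p"
  using co b_closed by (intro co_eqI) (auto simp: Pi_def lc_add[symmetric])

lemma co_scale: "\<lbrakk>r \<in> carrier R; a \<in> carrier F; p \<in> I\<rbrakk> \<Longrightarrow> co (f a \<otimes>\<^bsub>R\<^esub> r) p = a \<otimes>\<^bsub>F\<^esub> co r p"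
  using co b_closed finite_I by (intro co_eqI) (auto simp: Pi_def lc_scale[symmetric])

lemma co_zero: "p \<in> I \<Longrightarrow> co \<zero>\<^bsub>R\<^esub> p = \<zero>\<^bsub>F\<^esub>"
  using b_closed by (intro co_eqI) auto

lemma co_basis: "\<lbrakk>k \<in> I; p \<in> I; c \<in> carrier F\<rbrakk> \<Longrightarrow> co (f c \<otimes>\<^bsub>R\<^esub> b k) p = (if p = k then c else \<zero>\<^bsub>F\<^esub>)"
  using b_closed finite_I lc_single[of b I k c] by (intro co_eqI) auto

lemma co_basis1: "\<lbrakk>k \<in> I; p \<in> I\<rbrakk> \<Longrightarrow> co (b k) p = (if p = k then \<one>\<^bsub>F\<^esub> else \<zero>\<^bsub>F\<^esub>)"
  using co_basis[of k p "\<one>\<^bsub>F\<^esub>"] b_closed by (auto simp: Pi_def)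

lemma dimension_carrier: "R.dimension (card I) (f ` carrier F) (carrier R)"
proof -
  have "{el c |c. c \<in> I \<rightarrow> carrier F} = carrier R" using generating by auto
  moreover have "R.dimension (card I) (f ` carrier F) {el c |c. c \<in> I \<rightarrow> carrier F}"
    using finite_I b_closed lc_eq_zeroD by (rule dimension_lcI)
  ultimately show ?thesis by simp
qed

text \<open>
  By Lagrange interpolation a subspace stable under a diagonal operator contains the eigencomponents
  of its elements.
\<close>

lemma eigen_component:
  assumes sub: "N \<subseteq> carrier R"
    and add: "\<And>x y. \<lbrakk>x \<in> N; y \<in> N\<rbrakk> \<Longrightarrow> x \<oplus>\<^bsub>R\<^esub> y \<in> N"
    and scale: "\<And>a x. \<lbrakk>a \<in> carrier F; x \<in> N\<rbrakk> \<Longrightarrow> f a \<otimes>\<^bsub>R\<^esub> x \<in> N"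
    and d: "d \<in> I \<rightarrow> carrier F"
    and T: "\<And>c. \<lbrakk>c \<in> I \<rightarrow> carrier F; el c \<in> N\<rbrakk> \<Longrightarrow> el (\<lambda>p. d p \<otimes>\<^bsub>F\<^esub> c p) \<in> N"
    and c: "c \<in> I \<rightarrow> carrier F" "el c \<in> N" and l: "l \<in> carrier F"
  shows "el (\<lambda>p. if d p = l then c p else \<zero>\<^bsub>F\<^esub>) \<in> N"
proof -
  have "\<exists>c'\<in>I \<rightarrow> carrier F. el c' \<in> N \<and> (\<forall>p\<in>I. (d p \<in> S \<longrightarrow> c' p = \<zero>\<^bsub>F\<^esub>) \<and> (d p = l \<longrightarrow> c' p = c p))"
    if "finite S" "S \<subseteq> carrier F" "l \<notin> S" for S
    using that
  proof (induct S)
    case empty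
    then show ?case using c by auto
  next
    case (insert m S)
    then obtain c' where c': "c' \<in> I \<rightarrow> carrier F" "el c' \<in> N"
      "\<forall>p\<in>I. (d p \<in> S \<longrightarrow> c' p = \<zero>\<^bsub>F\<^esub>) \<and> (d p = l \<longrightarrow> c' p = c p)" by auto
    have m: "m \<in> carrier F" "l \<noteq> m" using insert by auto
    \<comment> \<open>Apply \<open>(T - m) / (l - m)\<close>, where \<open>T\<close> is the diagonal
      operator. This kills the eigenvalue \<open>m\<close>, fixes the eigencomponent for
      \<open>l\<close>, and keeps the components that already vanish.\<close>
    define u where "u = inv\<^bsub>F\<^esub> (l \<ominus>\<^bsub>F\<^esub> m)"
    have lm: "l \<ominus>\<^bsub>F\<^esub> m \<in> Units F" using m l by (simp add: F.field_Units F.r_right_minus_eq)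
    have u: "u \<in> carrier F" "u \<otimes>\<^bsub>F\<^esub> (l \<ominus>\<^bsub>F\<^esub> m) = \<one>\<^bsub>F\<^esub>"
      unfolding u_def using lm by auto
    define g where "g = (\<lambda>p. u \<otimes>\<^bsub>F\<^esub> (d p \<otimes>\<^bsub>F\<^esub> c' p \<oplus>\<^bsub>F\<^esub> (\<ominus>\<^bsub>F\<^esub> m) \<otimes>\<^bsub>F\<^esub> c' p))"
    have cl: "(\<lambda>p. d p \<otimes>\<^bsub>F\<^esub> c' p) \<in> I \<rightarrow> carrier F" "(\<lambda>p. (\<ominus>\<^bsub>F\<^esub> m) \<otimes>\<^bsub>F\<^esub> c' p) \<in> I \<rightarrow> carrier F"
      using d c' m by (auto simp: Pi_def)
    have "el (\<lambda>p. d p \<otimes>\<^bsub>F\<^esub> c' p \<oplus>\<^bsub>F\<^esub> (\<ominus>\<^bsub>F\<^esub> m) \<otimes>\<^bsub>F\<^esub> c' p) \<in> N"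
      using add[OF T[OF c'(1,2)] scale[of "\<ominus>\<^bsub>F\<^esub> m", OF _ c'(2)]] m cl c' b_closed finite_I
      by (simp add: lc_scale lc_add del: f.hom_a_inv)
    then have "f u \<otimes>\<^bsub>R\<^esub> el (\<lambda>p. d p \<otimes>\<^bsub>F\<^esub> c' p \<oplus>\<^bsub>F\<^esub> (\<ominus>\<^bsub>F\<^esub> m) \<otimes>\<^bsub>F\<^esub> c' p) \<in> N" using scale u by blast
    also have "f u \<otimes>\<^bsub>R\<^esub> el (\<lambda>p. d p \<otimes>\<^bsub>F\<^esub> c' p \<oplus>\<^bsub>F\<^esub> (\<ominus>\<^bsub>F\<^esub> m) \<otimes>\<^bsub>F\<^esub> c' p) = el g"
      unfolding g_def using d c' m b_closed u finite_I by (intro lc_scale) (auto simp: Pi_def)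
    finally have gN: "el g \<in> N" .
    have gI: "g \<in> I \<rightarrow> carrier F"
      unfolding g_def using d c' m u by (auto simp: Pi_def)
    have g_eq: "g p = u \<otimes>\<^bsub>F\<^esub> (d p \<ominus>\<^bsub>F\<^esub> m) \<otimes>\<^bsub>F\<^esub> c' p" if "p \<in> I" for p
      unfolding g_def using that d c' m u by (auto simp: Pi_def a_minus_def F.l_distr F.m_assoc)
    have "g p = \<zero>\<^bsub>F\<^esub>" if "p \<in> I" "d p \<in> insert m S" for p
    proof (cases "d p = m")
      case True
      then have "d p \<ominus>\<^bsub>F\<^esub> m = \<zero>\<^bsub>F\<^esub>" using m by (simp add: F.r_right_minus_eq)
      moreover have "c' p \<in> carrier F" using c' that by auto
      ultimately show ?thesis using g_eq[OF that(1)] u by simp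
    next
      case False
      then have "c' p = \<zero>\<^bsub>F\<^esub>" using that c'(3) by auto
      moreover have "d p \<in> carrier F" using d that by auto
      ultimately show ?thesis using g_eq[OF that(1)] u m by simp
    qed
    moreover have "g p = c p" if "p \<in> I" "d p = l" for p
    proof -
      have "c p \<in> carrier F" "c' p = c p" using c c' that by auto
      then show ?thesis using g_eq[OF that(1)] u that by simp
    qed
    ultimately show ?case
      using gI gN by (intro bexI[of _ g]) auto
  qed
  \<comment> \<open>Take all eigenvalues other than \<open>l\<close>; there are finitely many
    because \<open>I\<close> is finite.\<close>
  from this[of "d ` I - {l}"] obtain c' where c': "c' \<in> I \<rightarrow> carrier F" "el c' \<in> N"
    "\<forall>p\<in>I. (d p \<in> d ` I - {l} \<longrightarrow> c' p = \<zero>\<^bsub>F\<^esub>) \<and> (d p = l \<longrightarrow> c' p = c p)"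
    using finite_I d by (auto simp: Pi_def)
  have "el c' = el (\<lambda>p. if d p = l then c p else \<zero>\<^bsub>F\<^esub>)"
    using c' b_closed by (intro lc_cong) auto
  with c'(2) show ?thesis by simp
qed

text \<open>Both sides are bilinear over the central scalars. The identity is extended first in the
  right factor, with a basis vector on the left, and then in the left factor.\<close>

lemma multiplicative_of_basis:
  assumes "central_alg F S f'"
    and cl: "\<And>x. x \<in> carrier R \<Longrightarrow> \<phi> x \<in> carrier S"
    and add: "\<And>x y. \<lbrakk>x \<in> carrier R; y \<in> carrier R\<rbrakk> \<Longrightarrow> \<phi> (x \<oplus>\<^bsub>R\<^esub> y) = \<phi> x \<oplus>\<^bsub>S\<^esub> \<phi> y"
    and scale: "\<And>a x. \<lbrakk>a \<in> carrier F; x \<in> carrier R\<rbrakk> \<Longrightarrow> \<phi> (f a \<otimes>\<^bsub>R\<^esub> x) = f' a \<otimes>\<^bsub>S\<^esub> \<phi> x"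
    and basis: "\<And>p r. \<lbrakk>p \<in> I; r \<in> I\<rbrakk> \<Longrightarrow> \<phi> (b p \<otimes>\<^bsub>R\<^esub> b r) = \<phi> (b p) \<otimes>\<^bsub>S\<^esub> \<phi> (b r)"
    and xy: "x \<in> carrier R" "y \<in> carrier R"
  shows "\<phi> (x \<otimes>\<^bsub>R\<^esub> y) = \<phi> x \<otimes>\<^bsub>S\<^esub> \<phi> y"
proof -
  interpret S: central_alg F S f' by fact
  have lin: "\<phi> (lc v I c) = S.lc (\<lambda>p. \<phi> (v p)) I c" if v: "v \<in> I \<rightarrow> carrier R" and c: "c \<in> I \<rightarrow> carrier F" for v c
  proof -
    have "\<phi> (lc v I c) = (\<Oplus>\<^bsub>S\<^esub>p\<in>I. \<phi> (f (c p) \<otimes>\<^bsub>R\<^esub> v p))"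
      unfolding lc_def using R.abelian_group_axioms S.R.abelian_group_axioms cl add v c
      by (intro additive_finsum) (auto intro!: lc_term_closed)
    also have "\<dots> = S.lc (\<lambda>p. \<phi> (v p)) I c"
      unfolding S.lc_def using v c cl by (intro S.R.finsum_cong') (auto simp: Pi_def scale)
    finally show ?thesis .
  qed
  have \<phi>b: "(\<lambda>p. \<phi> (b p)) \<in> I \<rightarrow> carrier S" using b_closed cl by auto
  have left: "\<phi> (b p \<otimes>\<^bsub>R\<^esub> y) = \<phi> (b p) \<otimes>\<^bsub>S\<^esub> \<phi> y" if "p \<in> I" for p
  proof -
    have bp: "b p \<in> carrier R" using b_closed that by auto
    then have bb: "(\<lambda>r. b p \<otimes>\<^bsub>R\<^esub> b r) \<in> I \<rightarrow> carrier R" using b_closed by auto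
    have "b p \<otimes>\<^bsub>R\<^esub> y = lc (\<lambda>r. b p \<otimes>\<^bsub>R\<^esub> b r) I (co y)"
      using lc_mult_left[OF b_closed co(1)[OF xy(2)] bp finite_I] co(2)[OF xy(2)] by simp
    then have "\<phi> (b p \<otimes>\<^bsub>R\<^esub> y) = S.lc (\<lambda>r. \<phi> (b p \<otimes>\<^bsub>R\<^esub> b r)) I (co y)"
      using lin[OF bb co(1)[OF xy(2)]] by simp
    also have "\<dots> = S.lc (\<lambda>r. \<phi> (b p) \<otimes>\<^bsub>S\<^esub> \<phi> (b r)) I (co y)"
      using bb cl co(1)[OF xy(2)] basis that by (intro S.lc_cong) auto
    also have "\<dots> = \<phi> (b p) \<otimes>\<^bsub>S\<^esub> S.lc (\<lambda>r. \<phi> (b r)) I (co y)"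
      using \<phi>b co(1)[OF xy(2)] cl[OF bp] finite_I by (intro S.lc_mult_left[symmetric])
    also have "\<dots> = \<phi> (b p) \<otimes>\<^bsub>S\<^esub> \<phi> y"
      using lin[OF b_closed co(1)[OF xy(2)]] co(2)[OF xy(2)] by simp
    finally show ?thesis .
  qed
  have by': "(\<lambda>p. b p \<otimes>\<^bsub>R\<^esub> y) \<in> I \<rightarrow> carrier R" using b_closed xy by auto
  have "x \<otimes>\<^bsub>R\<^esub> y = lc (\<lambda>p. b p \<otimes>\<^bsub>R\<^esub> y) I (co x)"
    using lc_mult_right[OF b_closed co(1)[OF xy(1)] xy(2) finite_I] co(2)[OF xy(1)] by simp
  then have "\<phi> (x \<otimes>\<^bsub>R\<^esub> y) = S.lc (\<lambda>p. \<phi> (b p \<otimes>\<^bsub>R\<^esub> y)) I (co x)"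
    using lin[OF by' co(1)[OF xy(1)]] by simp
  also have "\<dots> = S.lc (\<lambda>p. \<phi> (b p) \<otimes>\<^bsub>S\<^esub> \<phi> y) I (co x)"
    using by' cl co(1)[OF xy(1)] left by (intro S.lc_cong) auto
  also have "\<dots> = S.lc (\<lambda>p. \<phi> (b p)) I (co x) \<otimes>\<^bsub>S\<^esub> \<phi> y"
    using \<phi>b co(1)[OF xy(1)] cl[OF xy(2)] finite_I by (intro S.lc_mult_right[symmetric])
  also have "\<dots> = \<phi> x \<otimes>\<^bsub>S\<^esub> \<phi> y"
    using lin[OF b_closed co(1)[OF xy(1)]] co(2)[OF xy(1)] by simp
  finally show ?thesis .
qed

text \<open>In the algebras considered here a product of basis vectors is a scalar times a basis
  vector, so the multiplication table is the pair \<open>\<gamma>\<close>, \<open>m\<close>. Equal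
  tables give isomorphic algebras by matching coordinates; the quotients by the radical are
  identified in this way.\<close>

lemma structure_iso:
  assumes "based_alg F S f' I b'"
    and \<gamma>: "\<And>p r. \<lbrakk>p \<in> I; r \<in> I\<rbrakk> \<Longrightarrow> \<gamma> p r \<in> carrier F"
    and m: "\<And>p r. \<lbrakk>p \<in> I; r \<in> I\<rbrakk> \<Longrightarrow> m p r \<in> I"
    and bb: "\<And>p r. \<lbrakk>p \<in> I; r \<in> I\<rbrakk> \<Longrightarrow> b p \<otimes>\<^bsub>R\<^esub> b r = f (\<gamma> p r) \<otimes>\<^bsub>R\<^esub> b (m p r)"
    and bb': "\<And>p r. \<lbrakk>p \<in> I; r \<in> I\<rbrakk> \<Longrightarrow> b' p \<otimes>\<^bsub>S\<^esub> b' r = f' (\<gamma> p r) \<otimes>\<^bsub>S\<^esub> b' (m p r)"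
    and o: "o1 \<in> I" "b o1 = \<one>\<^bsub>R\<^esub>" "b' o1 = \<one>\<^bsub>S\<^esub>"
  obtains \<phi> where "\<phi> \<in> ring_iso R S" "\<And>c. c \<in> carrier F \<Longrightarrow> \<phi> (f c) = f' c"
    "\<And>c. c \<in> I \<rightarrow> carrier F \<Longrightarrow> \<phi> (el c) = central_alg.lc S f' b' I c"
proof
  interpret S: based_alg F S f' I b' by fact
  let ?\<phi> = "\<lambda>r. S.el (co r)"
  have el: "?\<phi> (el c) = S.el c" if "c \<in> I \<rightarrow> carrier F" for c
    using that co(1)[OF el_closed[OF that]] co_el S.b_closed by (intro S.lc_cong) auto
  then show "\<And>c. c \<in> I \<rightarrow> carrier F \<Longrightarrow> ?\<phi> (el c) = S.el c" .
  have cl: "?\<phi> x \<in> carrier S" if "x \<in> carrier R" for x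
    using co(1)[OF that] by simp
  have add: "?\<phi> (x \<oplus>\<^bsub>R\<^esub> y) = ?\<phi> x \<oplus>\<^bsub>S\<^esub> ?\<phi> y" if "x \<in> carrier R" "y \<in> carrier R" for x y
    using that co(1) S.b_closed co_add
    by (subst S.lc_add) (auto intro!: S.lc_cong)
  have scale: "?\<phi> (f a \<otimes>\<^bsub>R\<^esub> x) = f' a \<otimes>\<^bsub>S\<^esub> ?\<phi> x" if "a \<in> carrier F" "x \<in> carrier R" for a x
    using that co(1) S.b_closed co_scale finite_I
    by (subst S.lc_scale) (auto intro!: S.lc_cong)
  have \<phi>b: "?\<phi> (b p) = b' p" if "p \<in> I" for p
  proof -
    have "b p \<in> carrier R" using that b_closed by auto
    then have "?\<phi> (b p) = S.el (\<lambda>r. if r = p then \<one>\<^bsub>F\<^esub> else \<zero>\<^bsub>F\<^esub>)"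
      using that co(1) S.b_closed co_basis1 by (intro S.lc_cong) auto
    also have "\<dots> = b' p" using S.lc_single[OF S.b_closed finite_I that, of "\<one>\<^bsub>F\<^esub>"] funcset_mem[OF S.b_closed that] by simp
    finally show ?thesis .
  qed
  have mult: "?\<phi> (x \<otimes>\<^bsub>R\<^esub> y) = ?\<phi> x \<otimes>\<^bsub>S\<^esub> ?\<phi> y" if "x \<in> carrier R" "y \<in> carrier R" for x y
  proof (rule multiplicative_of_basis[OF S.central_alg_axioms cl add scale _ that])
    fix p r assume pr: "p \<in> I" "r \<in> I"
    then have "b (m p r) \<in> carrier R" using m b_closed by auto
    then show "?\<phi> (b p \<otimes>\<^bsub>R\<^esub> b r) = ?\<phi> (b p) \<otimes>\<^bsub>S\<^esub> ?\<phi> (b r)"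
      unfolding bb[OF pr] \<phi>b[OF pr(1)] \<phi>b[OF pr(2)] bb'[OF pr]
      using scale[OF \<gamma>[OF pr]] \<phi>b[OF m[OF pr]] by simp
  qed
  have fc: "?\<phi> (f c) = f' c" if "c \<in> carrier F" for c
    using scale[OF that R.one_closed] \<phi>b[OF o(1)] that o by simp
  then show "\<And>c. c \<in> carrier F \<Longrightarrow> ?\<phi> (f c) = f' c" .
  have one: "?\<phi> \<one>\<^bsub>R\<^esub> = \<one>\<^bsub>S\<^esub>" using \<phi>b[OF o(1)] o by simp
  have "bij_betw ?\<phi> (carrier R) (carrier S)"
  proof (rule bij_betw_byWitness[where f' = "\<lambda>r. el (S.co r)"])
    show "\<forall>x\<in>carrier R. el (S.co (?\<phi> x)) = x"
    proof
      fix x assume x: "x \<in> carrier R"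
      have "el (S.co (?\<phi> x)) = el (co x)"
        using S.co(1)[OF cl[OF x]] S.co_el[OF co(1)[OF x]] b_closed by (intro lc_cong) auto
      then show "el (S.co (?\<phi> x)) = x" using co(2)[OF x] by simp
    qed
    show "\<forall>y\<in>carrier S. ?\<phi> (el (S.co y)) = y"
      using S.co el by simp
  qed (use cl S.co(1) in auto)
  then show "?\<phi> \<in> ring_iso R S"
    unfolding ring_iso_def using cl add mult one by (intro CollectI conjI ring_hom_memI)
qed

text \<open>Lets a basis indexed by pairs of exponents be compared with one indexed by single
  exponents.\<close>

lemma reindex:
  assumes k: "bij_betw k J I"
  shows "based_alg F R f J (\<lambda>j. b (k j))"
proof (unfold_locales)
  show "finite J" using bij_betw_finite[OF k] finite_I by simp
  have kJ: "k j \<in> I" if "j \<in> J" for j using k that by (auto simp: bij_betw_def)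
  then show "(\<lambda>j. b (k j)) \<in> J \<rightarrow> carrier R" using b_closed by auto
  show "\<exists>c\<in>J \<rightarrow> carrier F. r = lc (\<lambda>j. b (k j)) J c" if "r \<in> carrier R" for r
    using lc_reindex[OF k b_closed co(1)[OF that]] co[OF that] kJ
    by (intro bexI[of _ "\<lambda>j. co r (k j)"]) (auto simp: Pi_def)
  fix c j assume c: "c \<in> J \<rightarrow> carrier F" "lc (\<lambda>j. b (k j)) J c = \<zero>\<^bsub>R\<^esub>" "j \<in> J"
  define d where "d p = c (inv_into J k p)" for p
  have inv: "inv_into J k (k j) = j" if "j \<in> J" for j
    using k that by (auto simp: bij_betw_def)
  have d: "d \<in> I \<rightarrow> carrier F"
    unfolding d_def using c(1) k by (auto simp: bij_betw_def inv_into_into Pi_def)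
  have "el d = lc (\<lambda>j. b (k j)) J (\<lambda>j. d (k j))" by (rule lc_reindex[OF k b_closed d])
  also have "\<dots> = \<zero>\<^bsub>R\<^esub>"
    unfolding c(2)[symmetric] using c(1) b_closed kJ inv by (intro lc_cong) (auto simp: d_def Pi_def)
  finally have "d (k j) = \<zero>\<^bsub>F\<^esub>" using lc_eq_zeroD[OF d] kJ c(3) by blast
  then show "c j = \<zero>\<^bsub>F\<^esub>" using inv c(3) by (simp add: d_def)
qed

end

section \<open>Nil ideals and diagonal automorphisms\<close>

lemma (in abelian_monoid) finsum_mem:
  assumes "N \<subseteq> carrier G" "\<zero> \<in> N" "\<And>x y. \<lbrakk>x \<in> N; y \<in> N\<rbrakk> \<Longrightarrow> x \<oplus> y \<in> N"
    "\<And>p. p \<in> I \<Longrightarrow> g p \<in> N"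
  shows "(\<Oplus>p\<in>I. g p) \<in> N"
  using assms(4)
proof (induct I rule: infinite_finite_induct)
  case (insert p I)
  then have "g \<in> I \<rightarrow> carrier G" "g p \<in> carrier G" using assms(1) by auto
  with insert show ?case using assms(3) by (simp add: finsum_insert)
qed (simp_all add: assms(2))

text \<open>Without commutativity an inverse \<open>u\<close> of \<open>r^n\<close> gives a left
  inverse \<open>u r^(n-1)\<close> and a right inverse \<open>r^(n-1) u\<close> of \<open>r\<close>,
  and these must coincide.\<close>

lemma (in ring) unit_pow_imp_unit:
  assumes "r \<in> carrier R" "r [^] (n::nat) \<in> Units R" "0 < n"
  shows "r \<in> Units R"
proof -
  define u where "u = inv (r [^] n)"
  have u: "u \<in> carrier R" "u \<otimes> r [^] n = \<one>" "r [^] n \<otimes> u = \<one>"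
    unfolding u_def using assms by auto
  obtain m where m: "n = Suc m" using assms(3) by (cases n) auto
  have "(u \<otimes> r [^] m) \<otimes> r = \<one>" using u m assms(1) by (simp add: m_assoc)
  moreover have "r \<otimes> (r [^] m \<otimes> u) = \<one>"
    using u m assms(1) by (simp add: m_assoc[symmetric] nat_pow_Suc2[symmetric])
  ultimately have "r \<otimes> (u \<otimes> r [^] m) = \<one> \<and> (u \<otimes> r [^] m) \<otimes> r = \<one>"
    using inv_unique[of "u \<otimes> r [^] m" r "r [^] m \<otimes> u"] u assms(1) by simp
  then show ?thesis using assms(1) u by (auto simp: Units_def)
qed

section \<open>Nil ideals and the nil radical\<close>

definition nil_ideal :: "('a, 'm) ring_scheme \<Rightarrow> 'a set \<Rightarrow> bool" where
  "nil_ideal R J \<longleftrightarrow> ideal J R \<and> (\<forall>z\<in>J. \<exists>k::nat. z [^]\<^bsub>R\<^esub> k = \<zero>\<^bsub>R\<^esub>)"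

text \<open>The upper nilradical. It is visibly preserved by automorphisms, before anything is known
  about a greatest nilpotent ideal.\<close>

definition nil_radical :: "('a, 'm) ring_scheme \<Rightarrow> 'a set" where
  "nil_radical R = \<Union>{J. nil_ideal R J}"

context ring
begin

lemma mem_set_add_iff: "z \<in> J <+>\<^bsub>R\<^esub> J' \<longleftrightarrow> (\<exists>u\<in>J. \<exists>v\<in>J'. z = u \<oplus> v)"
  by (simp add: set_add_def')

text \<open>Modulo \<open>J'\<close> the power \<open>(u + v)^k\<close> agrees with
  \<open>u^k\<close>. Hence some power of \<open>u + v\<close> lies in \<open>J'\<close>, and a
  power of that power vanishes.\<close>

lemma nil_ideal_add:
  assumes "nil_ideal R J" "nil_ideal R J'"
  shows "nil_ideal R (J <+>\<^bsub>R\<^esub> J')"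
proof -
  interpret J: ideal J R using assms by (simp add: nil_ideal_def)
  interpret J': ideal J' R using assms by (simp add: nil_ideal_def)
  have "\<exists>k::nat. z [^] k = \<zero>" if "z \<in> J <+>\<^bsub>R\<^esub> J'" for z
  proof -
    have "\<exists>u\<in>J. \<exists>v\<in>J'. z = u \<oplus> v" using that by (simp only: mem_set_add_iff)
    then obtain u v where uv: "u \<in> J" "v \<in> J'" "z = u \<oplus> v" by blast
    have cl: "u \<in> carrier R" "v \<in> carrier R" using uv by auto
    have *: "\<exists>w\<in>J'. (u \<oplus> v) [^] k = u [^] k \<oplus> w" for k :: nat
    proof (induct k)
      case 0
      then show ?case using J'.zero_closed by (intro bexI[of _ \<zero>]) auto
    next
      case (Suc k)
      then obtain w where w: "w \<in> J'" "(u \<oplus> v) [^] k = u [^] k \<oplus> w" by blast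
      have wc: "w \<in> carrier R" using w by auto
      have "(u \<oplus> v) [^] Suc k = u [^] Suc k \<oplus> (u [^] k \<otimes> v \<oplus> w \<otimes> (u \<oplus> v))"
        using w(2) cl wc by (simp add: l_distr r_distr a_assoc a_lcomm)
      moreover have "u [^] k \<otimes> v \<oplus> w \<otimes> (u \<oplus> v) \<in> J'"
        using w uv cl by (intro J'.a_closed J'.I_l_closed J'.I_r_closed) auto
      ultimately show ?case by blast
    qed
    obtain k :: nat where "u [^] k = \<zero>" using assms(1) uv(1) by (auto simp: nil_ideal_def)
    moreover obtain w where "w \<in> J'" "(u \<oplus> v) [^] k = u [^] k \<oplus> w" using * by blast
    ultimately have "z [^] k \<in> J'" using uv(3) J'.Icarr by auto
    then obtain l :: nat where "(z [^] k) [^] l = \<zero>" using assms(2) by (auto simp: nil_ideal_def)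
    then show ?thesis using cl uv(3) by (auto simp: nat_pow_pow)
  qed
  then show ?thesis
    using add_ideals[of J J'] J.ideal_axioms J'.ideal_axioms by (auto simp: nil_ideal_def)
qed

lemma nil_radical_in_carrier: "nil_radical R \<subseteq> carrier R"
  by (auto simp: nil_radical_def nil_ideal_def dest: ideal.Icarr)

lemma nil_radical_add:
  assumes "x \<in> nil_radical R" "y \<in> nil_radical R"
  shows "x \<oplus> y \<in> nil_radical R"
proof -
  obtain J J' where J: "nil_ideal R J" "x \<in> J" "nil_ideal R J'" "y \<in> J'"
    using assms by (auto simp: nil_radical_def)
  then have "x \<oplus> y \<in> J <+>\<^bsub>R\<^esub> J'" unfolding mem_set_add_iff by blast
  then show ?thesis using nil_ideal_add[OF J(1,3)] by (auto simp: nil_radical_def)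
qed

lemma nil_radical_mult:
  assumes "x \<in> nil_radical R" "r \<in> carrier R"
  shows "r \<otimes> x \<in> nil_radical R"
  using assms by (auto simp: nil_radical_def nil_ideal_def ideal.I_l_closed)

text \<open>The preimage of a nil ideal under an injective homomorphism is a nil ideal, so
  membership is pulled back. Invariance in the other direction comes from the inverse
  isomorphism.\<close>

lemma nil_radical_iso:
  assumes "\<phi> \<in> ring_iso R S" "ring S" "x \<in> carrier R" "\<phi> x \<in> nil_radical S"
  shows "x \<in> nil_radical R"
proof -
  interpret S: ring S by fact
  interpret \<phi>: ring_hom_ring R S \<phi>
    using assms(1) by (intro ring_hom_ringI2) (auto simp: ring_iso_def ring_axioms S.ring_axioms)
  have inj: "inj_on \<phi> (carrier R)" using assms(1) by (auto simp: ring_iso_def bij_betw_def)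
  obtain J where J: "ideal J S" "\<phi> x \<in> J" "\<And>z. z \<in> J \<Longrightarrow> \<exists>k::nat. z [^]\<^bsub>S\<^esub> k = \<zero>\<^bsub>S\<^esub>"
    using assms(4) by (auto simp: nil_radical_def nil_ideal_def)
  have "\<exists>k::nat. z [^] k = \<zero>" if z: "z \<in> carrier R" "\<phi> z \<in> J" for z
  proof -
    obtain k :: nat where "\<phi> z [^]\<^bsub>S\<^esub> k = \<zero>\<^bsub>S\<^esub>" using J z by blast
    then have "\<phi> (z [^] k) = \<phi> \<zero>" using z by (simp add: \<phi>.hom_nat_pow)
    then show ?thesis using inj z by (metis inj_onD nat_pow_closed zero_closed)
  qed
  then have "nil_ideal R {r \<in> carrier R. \<phi> r \<in> J}"
    using \<phi>.ideal_vimage[OF J(1)] by (auto simp: nil_ideal_def)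
  then show ?thesis using assms(3) J(2) by (auto simp: nil_radical_def)
qed

lemma unit_notin_nil_radical:
  assumes "\<one> \<noteq> \<zero>" "u \<in> Units R" "u \<in> nil_radical R"
  shows False
proof -
  obtain J where J: "ideal J R" "u \<in> J" "\<And>z. z \<in> J \<Longrightarrow> \<exists>k::nat. z [^] k = \<zero>"
    using assms(3) by (auto simp: nil_radical_def nil_ideal_def)
  have "\<one> \<in> J" using ideal.I_l_closed[OF J(1,2), of "inv u"] assms(2) by simp
  then show False using J(3)[of \<one>] assms(1) by simp
qed

text \<open>The iterated product starts from the whole ring, which contains \<open>z^0\<close>;
  inductively its \<open>k\<close>-th stage contains \<open>z^k\<close>. So every element of
  \<open>J\<close> is nilpotent with the same exponent.\<close>

lemma nilpotent_ideal_subset_nil_radical: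
  assumes "nilpotent_ideal R J"
  shows "J \<subseteq> nil_radical R"
proof -
  interpret J: ideal J R using assms by (simp add: nilpotent_ideal_def)
  obtain m where m: "(ideal_prod R J ^^ m) (carrier R) = {\<zero>}"
    using assms by (auto simp: nilpotent_ideal_def)
  have "z [^] m = \<zero>" if z: "z \<in> J" for z
  proof -
    have "z [^] k \<in> (ideal_prod R J ^^ k) (carrier R)" for k :: nat
    proof (induct k)
      case (Suc k)
      have "z \<otimes> z [^] k \<in> J \<cdot> (ideal_prod R J ^^ k) (carrier R)" using z Suc by (rule ideal_prod.prod)
      then show ?case using J.Icarr[OF z] by (simp add: nat_pow_Suc2[symmetric])
    qed auto
    from this[of m] show ?thesis unfolding m by simp
  qed
  then have "nil_ideal R J" using J.ideal_axioms by (auto simp: nil_ideal_def)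
  then show ?thesis by (auto simp: nil_radical_def)
qed

end

section \<open>Diagonal operators on twisted monomial algebras\<close>

locale structured_alg = based_alg F R f I b
  for F :: "('a, 'm) ring_scheme" and R :: "('b, 'n) ring_scheme" and f :: "'a \<Rightarrow> 'b"
    and I :: "'i set" and b :: "'i \<Rightarrow> 'b" +
  fixes \<gamma> :: "'i \<Rightarrow> 'i \<Rightarrow> 'a" and m :: "'i \<Rightarrow> 'i \<Rightarrow> 'i" and o1 :: 'i
  assumes \<gamma>_closed [simp]: "\<lbrakk>p \<in> I; r \<in> I\<rbrakk> \<Longrightarrow> \<gamma> p r \<in> carrier F"
    and idx_closed [simp]: "\<lbrakk>p \<in> I; r \<in> I\<rbrakk> \<Longrightarrow> m p r \<in> I"
    and mult_basis: "\<lbrakk>p \<in> I; r \<in> I\<rbrakk> \<Longrightarrow> b p \<otimes>\<^bsub>R\<^esub> b r = f (\<gamma> p r) \<otimes>\<^bsub>R\<^esub> b (m p r)"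
    and o1: "o1 \<in> I" "b o1 = \<one>\<^bsub>R\<^esub>"
begin

text \<open>A multiplicative function on the indices: this is the condition under which scaling each
  basis vector by \<open>d\<close> respects products.\<close>

definition character :: "('i \<Rightarrow> 'a) \<Rightarrow> bool" where
  "character d \<longleftrightarrow> d \<in> I \<rightarrow> carrier F \<and> d o1 = \<one>\<^bsub>F\<^esub> \<and>
     (\<forall>p\<in>I. \<forall>r\<in>I. d (m p r) = d p \<otimes>\<^bsub>F\<^esub> d r)"

definition diag :: "('i \<Rightarrow> 'a) \<Rightarrow> 'b \<Rightarrow> 'b" where
  "diag d r = el (\<lambda>p. d p \<otimes>\<^bsub>F\<^esub> co r p)"

lemma diag_el:
  assumes "d \<in> I \<rightarrow> carrier F" "c \<in> I \<rightarrow> carrier F"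
  shows "diag d (el c) = el (\<lambda>p. d p \<otimes>\<^bsub>F\<^esub> c p)"
  unfolding diag_def using assms co_el b_closed co(1)[OF el_closed[OF assms(2)]]
  by (intro lc_cong) (auto simp: Pi_def)

lemma diag_closed [simp]: "\<lbrakk>d \<in> I \<rightarrow> carrier F; r \<in> carrier R\<rbrakk> \<Longrightarrow> diag d r \<in> carrier R"
  unfolding diag_def by (intro el_closed) (auto simp: Pi_def)

lemma co_diag: "\<lbrakk>d \<in> I \<rightarrow> carrier F; r \<in> carrier R; p \<in> I\<rbrakk> \<Longrightarrow> co (diag d r) p = d p \<otimes>\<^bsub>F\<^esub> co r p"
  unfolding diag_def by (intro co_el) (auto simp: Pi_def)

lemma diag_add:
  assumes "d \<in> I \<rightarrow> carrier F" "r \<in> carrier R" "r' \<in> carrier R"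
  shows "diag d (r \<oplus>\<^bsub>R\<^esub> r') = diag d r \<oplus>\<^bsub>R\<^esub> diag d r'"
proof (rule eq_by_co)
  fix p assume p: "p \<in> I"
  then have "d p \<in> carrier F" using assms by auto
  then show "co (diag d (r \<oplus>\<^bsub>R\<^esub> r')) p = co (diag d r \<oplus>\<^bsub>R\<^esub> diag d r') p"
    using p assms by (simp add: co_diag co_add F.r_distr)
qed (use assms in auto)

lemma diag_scale:
  assumes "d \<in> I \<rightarrow> carrier F" "r \<in> carrier R" "a \<in> carrier F"
  shows "diag d (f a \<otimes>\<^bsub>R\<^esub> r) = f a \<otimes>\<^bsub>R\<^esub> diag d r"
proof (rule eq_by_co)
  fix p assume p: "p \<in> I"
  then have "d p \<in> carrier F" using assms by auto
  then show "co (diag d (f a \<otimes>\<^bsub>R\<^esub> r)) p = co (f a \<otimes>\<^bsub>R\<^esub> diag d r) p"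
    using p assms by (simp add: co_diag co_scale F.m_lcomm)
qed (use assms in auto)

lemma diag_basis:
  assumes "d \<in> I \<rightarrow> carrier F" "k \<in> I"
  shows "diag d (b k) = f (d k) \<otimes>\<^bsub>R\<^esub> b k"
proof (rule eq_by_co)
  have bk: "b k \<in> carrier R" "d k \<in> carrier F" using assms b_closed by auto
  then show "diag d (b k) \<in> carrier R" "f (d k) \<otimes>\<^bsub>R\<^esub> b k \<in> carrier R" using assms by auto
  fix p assume p: "p \<in> I"
  then have "d p \<in> carrier F" using assms by auto
  then show "co (diag d (b k)) p = co (f (d k) \<otimes>\<^bsub>R\<^esub> b k) p"
    using p assms bk by (simp add: co_diag co_basis co_basis1)
qed

text \<open>The pointwise inverse \<open>e\<close> of \<open>d\<close> gives the inverse operator.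
  Multiplicativity is checked on basis vectors, where the scalar \<open>d (m p r)\<close> splits
  into \<open>d p\<close> and \<open>d r\<close> and commutes with the structure constant.\<close>

lemma diag_iso:
  assumes d: "character d" and e: "e \<in> I \<rightarrow> carrier F" "\<And>p. p \<in> I \<Longrightarrow> d p \<otimes>\<^bsub>F\<^esub> e p = \<one>\<^bsub>F\<^esub>"
  shows "diag d \<in> ring_iso R R" "\<And>c. c \<in> carrier F \<Longrightarrow> diag d (f c) = f c"
    "\<And>r. r \<in> carrier R \<Longrightarrow> diag d (diag e r) = r"
proof -
  have dI: "d \<in> I \<rightarrow> carrier F" and d1: "d o1 = \<one>\<^bsub>F\<^esub>"
    and dm: "\<And>p r. \<lbrakk>p \<in> I; r \<in> I\<rbrakk> \<Longrightarrow> d (m p r) = d p \<otimes>\<^bsub>F\<^esub> d r"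
    using d by (auto simp: character_def)
  have inv: "diag d (diag e r) = r" if r: "r \<in> carrier R" for r
  proof (rule eq_by_co)
    fix p assume p: "p \<in> I"
    have "d p \<otimes>\<^bsub>F\<^esub> (e p \<otimes>\<^bsub>F\<^esub> co r p) = (d p \<otimes>\<^bsub>F\<^esub> e p) \<otimes>\<^bsub>F\<^esub> co r p"
      using p r dI e by (intro F.m_assoc[symmetric]) auto
    then show "co (diag d (diag e r)) p = co r p"
      using p r dI e by (simp add: co_diag)
  qed (use dI e r in auto)
  have inv': "diag e (diag d r) = r" if r: "r \<in> carrier R" for r
  proof (rule eq_by_co)
    fix p assume p: "p \<in> I"
    have "e p \<otimes>\<^bsub>F\<^esub> (d p \<otimes>\<^bsub>F\<^esub> co r p) = (d p \<otimes>\<^bsub>F\<^esub> e p) \<otimes>\<^bsub>F\<^esub> co r p"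
      using p r dI e(1) by (subst F.m_assoc[symmetric]) (auto simp: F.m_comm Pi_def)
    then show "co (diag e (diag d r)) p = co r p"
      using p r dI e by (simp add: co_diag)
  qed (use dI e r in auto)
  have one: "diag d \<one>\<^bsub>R\<^esub> = \<one>\<^bsub>R\<^esub>" using diag_basis[OF dI o1(1)] o1(2) d1 by simp
  show "diag d (f c) = f c" if "c \<in> carrier F" for c
    using diag_scale[OF dI R.one_closed that] one that by simp
  show "diag d (diag e r) = r" if "r \<in> carrier R" for r using inv[OF that] .
  have mult: "diag d (x \<otimes>\<^bsub>R\<^esub> y) = diag d x \<otimes>\<^bsub>R\<^esub> diag d y" if xy: "x \<in> carrier R" "y \<in> carrier R" for x y
  proof (rule multiplicative_of_basis[OF central_alg_axioms _ _ _ _ xy])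
    fix p r assume pr: "p \<in> I" "r \<in> I"
    then have cl: "b p \<in> carrier R" "b r \<in> carrier R" "b (m p r) \<in> carrier R" "d p \<in> carrier F" "d r \<in> carrier F"
      using b_closed dI by (auto simp: Pi_def)
    have "diag d (b p \<otimes>\<^bsub>R\<^esub> b r) = f (\<gamma> p r) \<otimes>\<^bsub>R\<^esub> (f (d (m p r)) \<otimes>\<^bsub>R\<^esub> b (m p r))"
      unfolding mult_basis[OF pr] using diag_scale[OF dI cl(3)] diag_basis[OF dI] pr by simp
    also have "\<dots> = f (d p \<otimes>\<^bsub>F\<^esub> d r) \<otimes>\<^bsub>R\<^esub> (f (\<gamma> p r) \<otimes>\<^bsub>R\<^esub> b (m p r))"
      unfolding dm[OF pr] using cl pr by (intro f_lcomm) auto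
    also have "\<dots> = (f (d p) \<otimes>\<^bsub>R\<^esub> b p) \<otimes>\<^bsub>R\<^esub> (f (d r) \<otimes>\<^bsub>R\<^esub> b r)"
      unfolding mult_basis[OF pr, symmetric] using cl by (intro f_mult_mult[symmetric])
    finally show "diag d (b p \<otimes>\<^bsub>R\<^esub> b r) = diag d (b p) \<otimes>\<^bsub>R\<^esub> diag d (b r)"
      unfolding diag_basis[OF dI pr(1)] diag_basis[OF dI pr(2)] .
  qed (use dI diag_add diag_scale in auto)
  have "bij_betw (diag d) (carrier R) (carrier R)"
    by (rule bij_betw_byWitness[where f' = "diag e"]) (use inv inv' dI e in auto)
  then show "diag d \<in> ring_iso R R"
    unfolding ring_iso_def using dI diag_add mult one by (intro CollectI conjI ring_hom_memI) auto
qed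

text \<open>
  Diagonal automorphisms preserve the nil radical, so its elements split into eigencomponents.
\<close>

lemma nil_radical_component:
  assumes d: "character d" and e: "character e" "\<And>p. p \<in> I \<Longrightarrow> d p \<otimes>\<^bsub>F\<^esub> e p = \<one>\<^bsub>F\<^esub>"
    and c: "c \<in> I \<rightarrow> carrier F" "el c \<in> nil_radical R" and l: "l \<in> carrier F"
  shows "el (\<lambda>p. if d p = l then c p else \<zero>\<^bsub>F\<^esub>) \<in> nil_radical R"
proof (rule eigen_component[OF R.nil_radical_in_carrier _ _ _ _ c l])
  have dI: "d \<in> I \<rightarrow> carrier F" and eI: "e \<in> I \<rightarrow> carrier F" using d e by (auto simp: character_def)
  show "d \<in> I \<rightarrow> carrier F" by fact
  fix c assume c: "c \<in> I \<rightarrow> carrier F" "el c \<in> nil_radical R"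
  have ed: "e p \<otimes>\<^bsub>F\<^esub> d p = \<one>\<^bsub>F\<^esub>" if "p \<in> I" for p
    using e(2)[OF that] dI eI that by (auto simp: F.m_comm Pi_def)
  \<comment> \<open>Membership can only be pulled back, so \<open>diag d\<close> is handled by
    applying the automorphism \<open>diag e\<close>, which returns \<open>el c\<close>.\<close>
  have "diag d (el c) \<in> nil_radical R"
  proof (rule R.nil_radical_iso)
    show "diag e \<in> ring_iso R R" "diag e (diag d (el c)) \<in> nil_radical R"
      using diag_iso[OF e(1) dI ed] c by auto
  qed (use R.ring_axioms dI c in auto)
  then show "el (\<lambda>p. d p \<otimes>\<^bsub>F\<^esub> c p) \<in> nil_radical R" using diag_el[OF dI c(1)] by simp
qed (auto intro: R.nil_radical_add R.nil_radical_mult)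

end

section \<open>The radical of a symbol algebra\<close>

locale root_field = field F for F :: "('a, 'm) ring_scheme" (structure) +
  fixes n :: nat and q :: 'a
  assumes n2: "2 \<le> n"
    and primitive: "primitive_root_of_unity F n q"
begin

lemma q_closed [simp]: "q \<in> carrier F"
  using primitive by (simp add: primitive_root_of_unity_def)

lemma q_pow_n: "q [^] n = \<one>"
  using primitive by (simp add: primitive_root_of_unity_def)

lemma q_pow_mod: "q [^] (k mod n) = q [^] k"
proof -
  have "q [^] k = q [^] (n * (k div n) + k mod n)" by simp
  also have "\<dots> = (q [^] n) [^] (k div n) \<otimes> q [^] (k mod n)"
    by (simp only: nat_pow_mult[symmetric] nat_pow_pow q_closed)
  finally show ?thesis by (simp add: q_pow_n)
qed

lemma q_pow_eq_one_iff: "q [^] k = \<one> \<longleftrightarrow> n dvd k" for k :: nat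
proof
  assume "q [^] k = \<one>"
  then have "q [^] (k mod n) = \<one>" by (simp add: q_pow_mod)
  moreover have "k mod n < n" using n2 by simp
  ultimately have "k mod n = 0" using primitive by (auto simp: primitive_root_of_unity_def)
  then show "n dvd k" by auto
next
  assume "n dvd k"
  then show "q [^] k = \<one>" using q_pow_mod[of k] by simp
qed

lemma q_Units: "q \<in> Units F"
  using n2 unit_pow_imp_unit[of q n] by (simp add: q_pow_n)

lemma q_pow_inj:
  fixes i j :: nat
  assumes "q [^] i = q [^] j" "i < n" "j < n"
  shows "i = j"
proof -
  have *: "j = i" if "q [^] i = q [^] j" "i \<le> j" "j < n" for i j :: nat
  proof -
    have "q [^] i \<otimes> q [^] (j - i) = q [^] j"
      using that(2) by (subst nat_pow_mult) auto
    then have "q [^] i \<otimes> q [^] (j - i) = q [^] i \<otimes> \<one>"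
      using that(1) by simp
    then have "q [^] (j - i) = \<one>"
      using Units_l_cancel[OF Units_pow_closed[OF q_Units, of i], of "q [^] (j - i)" \<one>] by simp
    then have "n dvd j - i" by (simp add: q_pow_eq_one_iff)
    then show ?thesis using that by (auto dest: dvd_imp_le)
  qed
  show ?thesis using *[of i j] *[of j i] assms by (metis nat_le_linear)
qed

end

section \<open>Symbol algebras and their monomial basis\<close>

locale symbol_alg = root_field F n q + based_alg F A f "{..<n} \<times> {..<n}" "\<lambda>(i, j). h [^]\<^bsub>A\<^esub> i \<otimes>\<^bsub>A\<^esub> x [^]\<^bsub>A\<^esub> j"
  for F :: "('a, 'm) ring_scheme" and n :: nat and q :: 'a
    and A :: "('b, 'n) ring_scheme" and f :: "'a \<Rightarrow> 'b" and h x :: 'b +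
  fixes s a :: 'a
  assumes s_closed [simp]: "s \<in> carrier F" and a_closed' [simp]: "a \<in> carrier F"
    and h_closed [simp]: "h \<in> carrier A" and x_closed [simp]: "x \<in> carrier A"
    and xh: "x \<otimes>\<^bsub>A\<^esub> h = f q \<otimes>\<^bsub>A\<^esub> (h \<otimes>\<^bsub>A\<^esub> x)"
    and h_pow_n: "h [^]\<^bsub>A\<^esub> n = f s" and x_pow_n: "x [^]\<^bsub>A\<^esub> n = f a"
begin

abbreviation "B \<equiv> \<lambda>(i, j). h [^]\<^bsub>A\<^esub> (i::nat) \<otimes>\<^bsub>A\<^esub> x [^]\<^bsub>A\<^esub> (j::nat)"
abbreviation "IJ \<equiv> {..<n} \<times> {..<n}"

lemma x_h_pow: "x \<otimes>\<^bsub>A\<^esub> h [^]\<^bsub>A\<^esub> (i::nat) = f (q [^]\<^bsub>F\<^esub> i) \<otimes>\<^bsub>A\<^esub> (h [^]\<^bsub>A\<^esub> i \<otimes>\<^bsub>A\<^esub> x)"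
proof (induct i)
  case (Suc i)
  have "x \<otimes>\<^bsub>A\<^esub> h [^]\<^bsub>A\<^esub> Suc i = (x \<otimes>\<^bsub>A\<^esub> h [^]\<^bsub>A\<^esub> i) \<otimes>\<^bsub>A\<^esub> h" by (simp add: R.m_assoc)
  also have "\<dots> = f (q [^]\<^bsub>F\<^esub> i) \<otimes>\<^bsub>A\<^esub> (h [^]\<^bsub>A\<^esub> i \<otimes>\<^bsub>A\<^esub> (x \<otimes>\<^bsub>A\<^esub> h))" unfolding Suc by (simp add: R.m_assoc)
  also have "\<dots> = f (q [^]\<^bsub>F\<^esub> i) \<otimes>\<^bsub>A\<^esub> (f q \<otimes>\<^bsub>A\<^esub> (h [^]\<^bsub>A\<^esub> i \<otimes>\<^bsub>A\<^esub> (h \<otimes>\<^bsub>A\<^esub> x)))"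
    unfolding xh by (subst f_lcomm) auto
  also have "\<dots> = f (q [^]\<^bsub>F\<^esub> Suc i) \<otimes>\<^bsub>A\<^esub> (h [^]\<^bsub>A\<^esub> Suc i \<otimes>\<^bsub>A\<^esub> x)"
    by (subst f_mult_f) (auto simp: R.m_assoc)
  finally show ?case .
qed simp

lemma x_pow_h_pow:
  "x [^]\<^bsub>A\<^esub> j \<otimes>\<^bsub>A\<^esub> h [^]\<^bsub>A\<^esub> i = f (q [^]\<^bsub>F\<^esub> (i * j)) \<otimes>\<^bsub>A\<^esub> (h [^]\<^bsub>A\<^esub> i \<otimes>\<^bsub>A\<^esub> x [^]\<^bsub>A\<^esub> j)" for i j :: nat
proof (induct j)
  case (Suc j)
  have "x [^]\<^bsub>A\<^esub> Suc j \<otimes>\<^bsub>A\<^esub> h [^]\<^bsub>A\<^esub> i = x [^]\<^bsub>A\<^esub> j \<otimes>\<^bsub>A\<^esub> (x \<otimes>\<^bsub>A\<^esub> h [^]\<^bsub>A\<^esub> i)" by (simp add: R.m_assoc)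
  also have "\<dots> = f (q [^]\<^bsub>F\<^esub> i) \<otimes>\<^bsub>A\<^esub> ((x [^]\<^bsub>A\<^esub> j \<otimes>\<^bsub>A\<^esub> h [^]\<^bsub>A\<^esub> i) \<otimes>\<^bsub>A\<^esub> x)"
    unfolding x_h_pow by (subst f_lcomm) (auto simp: R.m_assoc)
  also have "\<dots> = f (q [^]\<^bsub>F\<^esub> i) \<otimes>\<^bsub>A\<^esub> (f (q [^]\<^bsub>F\<^esub> (i * j)) \<otimes>\<^bsub>A\<^esub> (h [^]\<^bsub>A\<^esub> i \<otimes>\<^bsub>A\<^esub> x [^]\<^bsub>A\<^esub> Suc j))"
    unfolding Suc by (simp add: R.m_assoc)
  also have "\<dots> = f (q [^]\<^bsub>F\<^esub> (i * Suc j)) \<otimes>\<^bsub>A\<^esub> (h [^]\<^bsub>A\<^esub> i \<otimes>\<^bsub>A\<^esub> x [^]\<^bsub>A\<^esub> Suc j)"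
    by (subst f_mult_f) (auto simp: nat_pow_mult)
  finally show ?case .
qed simp

lemma h_pow_mod: "h [^]\<^bsub>A\<^esub> k = f (s [^]\<^bsub>F\<^esub> (k div n)) \<otimes>\<^bsub>A\<^esub> h [^]\<^bsub>A\<^esub> (k mod n)"
proof -
  have "h [^]\<^bsub>A\<^esub> k = h [^]\<^bsub>A\<^esub> (n * (k div n) + k mod n)" by simp
  also have "\<dots> = (h [^]\<^bsub>A\<^esub> n) [^]\<^bsub>A\<^esub> (k div n) \<otimes>\<^bsub>A\<^esub> h [^]\<^bsub>A\<^esub> (k mod n)"
    by (simp only: R.nat_pow_mult[symmetric] R.nat_pow_pow h_closed)
  finally show ?thesis by (simp add: h_pow_n f_pow)
qed

lemma x_pow_mod: "x [^]\<^bsub>A\<^esub> k = f (a [^]\<^bsub>F\<^esub> (k div n)) \<otimes>\<^bsub>A\<^esub> x [^]\<^bsub>A\<^esub> (k mod n)"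
proof -
  have "x [^]\<^bsub>A\<^esub> k = x [^]\<^bsub>A\<^esub> (n * (k div n) + k mod n)" by simp
  also have "\<dots> = (x [^]\<^bsub>A\<^esub> n) [^]\<^bsub>A\<^esub> (k div n) \<otimes>\<^bsub>A\<^esub> x [^]\<^bsub>A\<^esub> (k mod n)"
    by (simp only: R.nat_pow_mult[symmetric] R.nat_pow_pow x_closed)
  finally show ?thesis by (simp add: x_pow_n f_pow)
qed

lemma B_closed [simp]: "B p \<in> carrier A"
  by (cases p) simp

text \<open>The power of \<open>q\<close> comes from moving the \<open>x\<close>-part of the first
  monomial past the \<open>h\<close>-part of the second. The powers of \<open>s\<close> and
  \<open>a\<close> are the carries when exponents are added modulo \<open>n\<close>; on
  \<open>IJ\<close> each carry is 0 or 1.\<close>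

definition str :: "nat \<times> nat \<Rightarrow> nat \<times> nat \<Rightarrow> 'a" where
  "str p r = q [^]\<^bsub>F\<^esub> (fst r * snd p) \<otimes>\<^bsub>F\<^esub>
     (s [^]\<^bsub>F\<^esub> ((fst p + fst r) div n) \<otimes>\<^bsub>F\<^esub> a [^]\<^bsub>F\<^esub> ((snd p + snd r) div n))"

definition add_mod :: "nat \<times> nat \<Rightarrow> nat \<times> nat \<Rightarrow> nat \<times> nat" where
  "add_mod p r = ((fst p + fst r) mod n, (snd p + snd r) mod n)"

lemma B_mult: "B p \<otimes>\<^bsub>A\<^esub> B r = f (str p r) \<otimes>\<^bsub>A\<^esub> B (add_mod p r)"
proof -
  obtain i j k l where p: "p = (i, j)" and r: "r = (k, l)" by fastforce
  have "B p \<otimes>\<^bsub>A\<^esub> B r = h [^]\<^bsub>A\<^esub> i \<otimes>\<^bsub>A\<^esub> ((x [^]\<^bsub>A\<^esub> j \<otimes>\<^bsub>A\<^esub> h [^]\<^bsub>A\<^esub> k) \<otimes>\<^bsub>A\<^esub> x [^]\<^bsub>A\<^esub> l)"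
    by (simp add: p r R.m_assoc)
  also have "\<dots> = h [^]\<^bsub>A\<^esub> i \<otimes>\<^bsub>A\<^esub> (f (q [^]\<^bsub>F\<^esub> (k * j)) \<otimes>\<^bsub>A\<^esub> (h [^]\<^bsub>A\<^esub> k \<otimes>\<^bsub>A\<^esub> x [^]\<^bsub>A\<^esub> (j + l)))"
    unfolding x_pow_h_pow by (simp add: R.m_assoc R.nat_pow_mult)
  also have "\<dots> = f (q [^]\<^bsub>F\<^esub> (k * j)) \<otimes>\<^bsub>A\<^esub> (h [^]\<^bsub>A\<^esub> i \<otimes>\<^bsub>A\<^esub> (h [^]\<^bsub>A\<^esub> k \<otimes>\<^bsub>A\<^esub> x [^]\<^bsub>A\<^esub> (j + l)))"
    by (subst f_lcomm) auto
  also have "h [^]\<^bsub>A\<^esub> i \<otimes>\<^bsub>A\<^esub> (h [^]\<^bsub>A\<^esub> k \<otimes>\<^bsub>A\<^esub> x [^]\<^bsub>A\<^esub> (j + l)) = h [^]\<^bsub>A\<^esub> (i + k) \<otimes>\<^bsub>A\<^esub> x [^]\<^bsub>A\<^esub> (j + l)"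
    by (simp add: R.m_assoc[symmetric] R.nat_pow_mult)
  also have "\<dots> = (f (s [^]\<^bsub>F\<^esub> ((i + k) div n)) \<otimes>\<^bsub>A\<^esub> h [^]\<^bsub>A\<^esub> ((i + k) mod n)) \<otimes>\<^bsub>A\<^esub>
      (f (a [^]\<^bsub>F\<^esub> ((j + l) div n)) \<otimes>\<^bsub>A\<^esub> x [^]\<^bsub>A\<^esub> ((j + l) mod n))"
    by (simp only: h_pow_mod[symmetric] x_pow_mod[symmetric])
  also have "\<dots> = f (s [^]\<^bsub>F\<^esub> ((i + k) div n) \<otimes>\<^bsub>F\<^esub> a [^]\<^bsub>F\<^esub> ((j + l) div n)) \<otimes>\<^bsub>A\<^esub> B (add_mod p r)"
    by (subst f_mult_mult) (auto simp: add_mod_def p r)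
  finally show ?thesis
    by (subst (asm) f_mult_f) (auto simp: str_def p r split: prod.split)
qed

sublocale structured_alg F A f "{..<n} \<times> {..<n}" B str add_mod "(0, 0)"
proof (unfold_locales)
  show "str p r \<in> carrier F" for p r by (simp add: str_def)
  show "add_mod p r \<in> IJ" for p r using n2 by (simp add: add_mod_def)
  show "B p \<otimes>\<^bsub>A\<^esub> B r = f (str p r) \<otimes>\<^bsub>A\<^esub> B (add_mod p r)" for p r by (rule B_mult)
  show "(0, 0) \<in> IJ" using n2 by simp
  show "B (0, 0) = \<one>\<^bsub>A\<^esub>" by simp
qed

text \<open>
  The diagonal operator with eigenvalues \<open>chr u v\<close> is the automorphism \<open>h \<mapsto> q\<^sup>u h\<close>, \<open>x \<mapsto> q\<^sup>v x\<close>.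
\<close>

definition chr :: "nat \<Rightarrow> nat \<Rightarrow> nat \<times> nat \<Rightarrow> 'a" where
  "chr u v p = q [^]\<^bsub>F\<^esub> (u * fst p + v * snd p)"

lemma chr_closed [simp]: "chr u v p \<in> carrier F" by (simp add: chr_def)

text \<open>Reducing exponents modulo \<open>n\<close> does not change the power of
  \<open>q\<close>, since \<open>q^n = 1\<close>.\<close>

lemma character_chr: "character (chr u v)"
proof -
  have "chr u v (add_mod p r) = chr u v p \<otimes>\<^bsub>F\<^esub> chr u v r" for p r
  proof -
    have "chr u v (add_mod p r) = q [^]\<^bsub>F\<^esub> ((u * ((fst p + fst r) mod n) + v * ((snd p + snd r) mod n)) mod n)"
      by (simp add: chr_def add_mod_def q_pow_mod)
    also have "(u * ((fst p + fst r) mod n) + v * ((snd p + snd r) mod n)) mod n =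
        (u * (fst p + fst r) + v * (snd p + snd r)) mod n"
      by (intro mod_add_cong mod_mult_right_eq)
    also have "q [^]\<^bsub>F\<^esub> \<dots> = q [^]\<^bsub>F\<^esub> (u * (fst p + fst r) + v * (snd p + snd r))" by (rule q_pow_mod)
    also have "\<dots> = chr u v p \<otimes>\<^bsub>F\<^esub> chr u v r"
      by (simp add: chr_def nat_pow_mult algebra_simps)
    finally show ?thesis .
  qed
  then show ?thesis by (auto simp: character_def) (simp add: chr_def)
qed

text \<open>The factor \<open>n - 1\<close> stands for \<open>-1\<close> modulo \<open>n\<close> and
  keeps the exponents natural numbers.\<close>

lemma chr_inverse: "chr u v p \<otimes>\<^bsub>F\<^esub> chr ((n - 1) * u) ((n - 1) * v) p = \<one>\<^bsub>F\<^esub>"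
proof -
  have "u * i + v * j + ((n - 1) * u * i + (n - 1) * v * j) = n * (u * i + v * j)" for i j
  proof -
    obtain k where "n = Suc k" using n2 by (cases n) auto
    then show ?thesis by (simp add: algebra_simps)
  qed
  then show ?thesis by (simp add: chr_def nat_pow_mult q_pow_eq_one_iff)
qed

text \<open>\<open>chr 1 0\<close> reads off the exponent of \<open>h\<close> and
  \<open>chr 0 1\<close> that of \<open>x\<close>. As the powers \<open>q^i\<close> with
  \<open>i < n\<close> are distinct, two successive projections isolate one monomial. The set
  \<open>N\<close> is left general because both the nil radical and arbitrary ideals are
  treated.\<close>

lemma chr_components:
  assumes "\<And>c u v l. \<lbrakk>(u, v) \<in> {(1, 0), (0, 1)}; c \<in> IJ \<rightarrow> carrier F; el c \<in> N; l \<in> carrier F\<rbrakk> \<Longrightarrow>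
      el (\<lambda>p. if chr u v p = l then c p else \<zero>\<^bsub>F\<^esub>) \<in> N"
    and c: "c \<in> IJ \<rightarrow> carrier F" "el c \<in> N" and p: "p \<in> IJ"
  shows "f (c p) \<otimes>\<^bsub>A\<^esub> B p \<in> N"
proof -
  define c1 where "c1 = (\<lambda>r. if chr 1 0 r = chr 1 0 p then c r else \<zero>\<^bsub>F\<^esub>)"
  define c2 where "c2 = (\<lambda>r. if chr 0 1 r = chr 0 1 p then c1 r else \<zero>\<^bsub>F\<^esub>)"
  have c1: "c1 \<in> IJ \<rightarrow> carrier F" "el c1 \<in> N"
    using assms(1)[OF _ c, of 1 0 "chr 1 0 p"] c by (auto simp: c1_def)
  have c2: "c2 \<in> IJ \<rightarrow> carrier F" "el c2 \<in> N"
    using assms(1)[OF _ c1, of 0 1 "chr 0 1 p"] c1 by (auto simp: c2_def)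
  have "c2 r = (if r = p then c p else \<zero>\<^bsub>F\<^esub>)" if "r \<in> IJ" for r
    using q_pow_inj[of "fst r" "fst p"] q_pow_inj[of "snd r" "snd p"] that p
    by (auto simp: c2_def c1_def chr_def)
  then have "el c2 = el (\<lambda>r. if r = p then c p else \<zero>\<^bsub>F\<^esub>)"
    using c2 b_closed by (intro lc_cong) auto
  also have "\<dots> = f (c p) \<otimes>\<^bsub>A\<^esub> B p"
    using c(1) p finite_I b_closed by (intro lc_single) auto
  finally show ?thesis using c2 by simp
qed

lemma nil_radical_components:
  assumes "c \<in> IJ \<rightarrow> carrier F" "el c \<in> nil_radical A" "p \<in> IJ"
  shows "f (c p) \<otimes>\<^bsub>A\<^esub> B p \<in> nil_radical A"
  by (rule chr_components[OF _ assms]) (rule nil_radical_component[OF character_chr character_chr chr_inverse])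

text \<open>
  Give the generators that are nilpotent weight one and the invertible ones weight zero; \<open>W k\<close> is
  spanned by the monomials of weight at least \<open>k\<close>, and \<open>W 1\<close> is the radical.
\<close>

definition wt :: "nat \<times> nat \<Rightarrow> nat" where
  "wt p = (if s = \<zero>\<^bsub>F\<^esub> then fst p else 0) + (if a = \<zero>\<^bsub>F\<^esub> then snd p else 0)"

lemma h_Units: "s \<noteq> \<zero>\<^bsub>F\<^esub> \<Longrightarrow> h \<in> Units A"
  using R.unit_pow_imp_unit[of h n] f_Units[of s] n2 by (simp add: h_pow_n)

lemma x_Units: "a \<noteq> \<zero>\<^bsub>F\<^esub> \<Longrightarrow> x \<in> Units A"
  using R.unit_pow_imp_unit[of x n] f_Units[of a] n2 by (simp add: x_pow_n)

lemma B_Units: "wt p = 0 \<Longrightarrow> B p \<in> Units A"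
  using h_Units x_Units R.Units_pow_closed R.Units_one_closed
  by (cases p) (auto simp: wt_def split: if_splits)

lemma term_Units: "\<lbrakk>wt p = 0; c \<in> carrier F; c \<noteq> \<zero>\<^bsub>F\<^esub>\<rbrakk> \<Longrightarrow> f c \<otimes>\<^bsub>A\<^esub> B p \<in> Units A"
  using f_Units B_Units by simp

text \<open>A carry in the exponent of a nilpotent generator puts a positive power of zero into the
  structure constant. If the constant is nonzero there is no such carry, and exponents of invertible
  generators do not count for the weight.\<close>

lemma wt_add_mod:
  assumes "p \<in> IJ" "r \<in> IJ" "str p r \<noteq> \<zero>\<^bsub>F\<^esub>"
  shows "wt (add_mod p r) = wt p + wt r"
proof -
  have "(fst p + fst r) mod n = fst p + fst r" if "s = \<zero>\<^bsub>F\<^esub>"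
  proof (rule mod_less, rule ccontr)
    assume "\<not> fst p + fst r < n"
    then have "(fst p + fst r) div n \<noteq> 0" using n2 by (simp add: div_eq_0_iff)
    then have "s [^]\<^bsub>F\<^esub> ((fst p + fst r) div n) = \<zero>\<^bsub>F\<^esub>"
      unfolding that by (intro nat_pow_zero)
    then show False using assms(3) by (simp add: str_def)
  qed
  moreover have "(snd p + snd r) mod n = snd p + snd r" if "a = \<zero>\<^bsub>F\<^esub>"
  proof (rule mod_less, rule ccontr)
    assume "\<not> snd p + snd r < n"
    then have "(snd p + snd r) div n \<noteq> 0" using n2 by (simp add: div_eq_0_iff)
    then have "a [^]\<^bsub>F\<^esub> ((snd p + snd r) div n) = \<zero>\<^bsub>F\<^esub>"
      unfolding that by (intro nat_pow_zero)
    then show False using assms(3) by (simp add: str_def)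
  qed
  ultimately show ?thesis by (simp add: wt_def add_mod_def)
qed

definition W :: "nat \<Rightarrow> 'b set" where
  "W k = {r \<in> carrier A. \<forall>p\<in>IJ. wt p < k \<longrightarrow> co r p = \<zero>\<^bsub>F\<^esub>}"

lemma W_carrier: "W k \<subseteq> carrier A" by (auto simp: W_def)

lemma W_0: "W 0 = carrier A" by (auto simp: W_def)

lemma W_zero: "\<zero>\<^bsub>A\<^esub> \<in> W k" using co_zero by (auto simp: W_def)

lemma W_add: "\<lbrakk>u \<in> W k; v \<in> W k\<rbrakk> \<Longrightarrow> u \<oplus>\<^bsub>A\<^esub> v \<in> W k"
  using co_add by (auto simp: W_def)

lemma W_scale: "\<lbrakk>c \<in> carrier F; u \<in> W k\<rbrakk> \<Longrightarrow> f c \<otimes>\<^bsub>A\<^esub> u \<in> W k"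
  using co_scale by (auto simp: W_def)

lemma W_lc:
  assumes "c \<in> IJ \<rightarrow> carrier F" "v \<in> IJ \<rightarrow> carrier A" "\<And>p. p \<in> IJ \<Longrightarrow> c p = \<zero>\<^bsub>F\<^esub> \<or> v p \<in> W k"
  shows "lc v IJ c \<in> W k"
  unfolding lc_def
proof (rule R.finsum_mem[OF W_carrier W_zero W_add])
  fix p assume p: "p \<in> IJ"
  then have "c p \<in> carrier F" "v p \<in> carrier A" using assms(1,2) by auto
  then show "f (c p) \<otimes>\<^bsub>A\<^esub> v p \<in> W k"
    using assms(3)[OF p] W_zero W_scale by auto
qed

lemma B_in_W: "p \<in> IJ \<Longrightarrow> k \<le> wt p \<Longrightarrow> B p \<in> W k"
  using co_basis1[of p] by (auto simp: W_def)

lemma co_W: "\<lbrakk>r \<in> W k; p \<in> IJ\<rbrakk> \<Longrightarrow> co r p = \<zero>\<^bsub>F\<^esub> \<or> k \<le> wt p"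
  by (auto simp: W_def not_less)

text \<open>The \<open>W k\<close> form a multiplicative filtration: a product of two monomials
  either vanishes or has the sum of their weights.\<close>

lemma W_mult:
  assumes u: "u \<in> W k" and v: "v \<in> W l"
  shows "u \<otimes>\<^bsub>A\<^esub> v \<in> W (k + l)"
proof -
  have cl: "u \<in> carrier A" "v \<in> carrier A" using u v W_carrier by auto
  have Bv: "B p \<otimes>\<^bsub>A\<^esub> v \<in> W (k + l)" if p: "p \<in> IJ" "k \<le> wt p" for p
  proof -
    have "B p \<otimes>\<^bsub>A\<^esub> v = lc (\<lambda>r. B p \<otimes>\<^bsub>A\<^esub> B r) IJ (co v)"
      using lc_mult_left[OF b_closed co(1)[OF cl(2)] B_closed finite_I] co(2)[OF cl(2)] by simp
    also have "\<dots> \<in> W (k + l)"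
    proof (rule W_lc[OF co(1)[OF cl(2)]])
      fix r assume r: "r \<in> IJ"
      have "B p \<otimes>\<^bsub>A\<^esub> B r \<in> W (k + l)" if "l \<le> wt r"
      proof (cases "str p r = \<zero>\<^bsub>F\<^esub>")
        case True
        then show ?thesis using mult_basis[OF p(1) r] W_zero by (simp add: R.l_null[OF B_closed])
      next
        case False
        then have "k + l \<le> wt (add_mod p r)" using wt_add_mod[OF p(1) r] p that by simp
        then show ?thesis
          unfolding mult_basis[OF p(1) r] using p r by (intro W_scale B_in_W \<gamma>_closed idx_closed)
      qed
      then show "co v r = \<zero>\<^bsub>F\<^esub> \<or> B p \<otimes>\<^bsub>A\<^esub> B r \<in> W (k + l)" using co_W[OF v r] by blast
    qed (intro Pi_I R.m_closed B_closed)
    finally show ?thesis .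
  qed
  have "u \<otimes>\<^bsub>A\<^esub> v = lc (\<lambda>p. B p \<otimes>\<^bsub>A\<^esub> v) IJ (co u)"
    using lc_mult_right[OF b_closed co(1)[OF cl(1)] cl(2) finite_I] co(2)[OF cl(1)] by simp
  also have "\<dots> \<in> W (k + l)"
    using co(1)[OF cl(1)] co_W[OF u] Bv cl by (intro W_lc Pi_I R.m_closed B_closed) auto
  finally show ?thesis .
qed

text \<open>\<open>W 0\<close> is the whole algebra, so absorption is \<open>W_mult\<close> with one
  index zero.\<close>

lemma W_ideal: "ideal (W k) A"
proof (rule idealI)
  show "subgroup (W k) (add_monoid A)"
  proof (rule R.add.subgroupI)
    show "\<ominus>\<^bsub>A\<^esub> u \<in> W k" if "u \<in> W k" for u
    proof -
      have "f (\<ominus>\<^bsub>F\<^esub> \<one>\<^bsub>F\<^esub>) \<otimes>\<^bsub>A\<^esub> u \<in> W k" using that by (intro W_scale) auto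
      moreover have "u \<in> carrier A" using that W_carrier by auto
      ultimately show ?thesis by (simp add: R.l_minus)
    qed
  qed (use W_zero[of k] W_carrier[of k] W_add[of _ k] in auto)
qed (use W_mult[of _ 0 _ k] W_mult[of _ k _ 0] R.ring_axioms in \<open>auto simp: W_0\<close>)

text \<open>Both exponents are below \<open>n\<close>, so no monomial has weight
  \<open>2 * n\<close>.\<close>

lemma W_large: "W (2 * n) = {\<zero>\<^bsub>A\<^esub>}"
proof -
  have "r = \<zero>\<^bsub>A\<^esub>" if "r \<in> W (2 * n)" for r
  proof (rule eq_by_co)
    fix p assume p: "p \<in> IJ"
    have "wt p \<le> fst p + snd p" by (simp add: wt_def)
    also have "\<dots> < 2 * n" using p by auto
    finally show "co r p = co \<zero>\<^bsub>A\<^esub> p" using co_W[OF that p] co_zero[OF p] by auto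
  qed (use that W_carrier in auto)
  then show ?thesis using W_zero by auto
qed

text \<open>By multiplicativity of the filtration the \<open>k\<close>-th power of
  \<open>W 1\<close> lies in \<open>W k\<close>, which is zero for \<open>k = 2 * n\<close>.\<close>

lemma W1_nilpotent: "nilpotent_ideal A (W 1)"
proof -
  have "(ideal_prod A (W 1) ^^ k) (carrier A) \<subseteq> W k" for k
  proof (induct k)
    case (Suc k)
    have "ideal_prod A (W 1) J \<subseteq> W (Suc k)" if "J \<subseteq> W k" for J
    proof
      fix z assume "z \<in> ideal_prod A (W 1) J"
      then show "z \<in> W (Suc k)"
      proof induct
        case (prod i j)
        then show ?case using W_mult[of i 1 j k] that by auto
      qed (rule W_add)
    qed
    with Suc show ?case by simp
  qed (simp add: W_0)
  then have "(ideal_prod A (W 1) ^^ (2 * n)) (carrier A) \<subseteq> {\<zero>\<^bsub>A\<^esub>}" using W_large by blast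
  moreover have "\<zero>\<^bsub>A\<^esub> \<in> (ideal_prod A (W 1) ^^ k) (carrier A)" for k
  proof (induct k)
    case (Suc k)
    then have "\<zero>\<^bsub>A\<^esub> \<otimes>\<^bsub>A\<^esub> \<zero>\<^bsub>A\<^esub> \<in> ideal_prod A (W 1) ((ideal_prod A (W 1) ^^ k) (carrier A))"
      using W_zero by (intro ideal_prod.prod)
    then show ?case by simp
  qed simp
  ultimately have "(ideal_prod A (W 1) ^^ (2 * n)) (carrier A) = {\<zero>\<^bsub>A\<^esub>}" by blast
  then show ?thesis using W_ideal by (auto simp: nilpotent_ideal_def)
qed

text \<open>A monomial of weight zero with nonzero coefficient is a unit. As the nil radical
  contains every term of each of its elements, such a term would be a unit inside a nil
  ideal.\<close>

lemma nil_radical_subset_W1: "nil_radical A \<subseteq> W 1"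
proof
  fix z assume z: "z \<in> nil_radical A"
  then have zA: "z \<in> carrier A" using R.nil_radical_in_carrier by auto
  have "co z p = \<zero>\<^bsub>F\<^esub>" if p: "p \<in> IJ" "wt p = 0" for p
  proof (rule ccontr)
    assume "co z p \<noteq> \<zero>\<^bsub>F\<^esub>"
    then have "f (co z p) \<otimes>\<^bsub>A\<^esub> B p \<in> Units A" using p zA by (intro term_Units) auto
    moreover have "f (co z p) \<otimes>\<^bsub>A\<^esub> B p \<in> nil_radical A"
      using nil_radical_components[OF co(1)[OF zA] _ p(1)] co(2)[OF zA] z by simp
    ultimately show False using R.unit_notin_nil_radical[OF nontrivial] by blast
  qed
  then show "z \<in> W 1" using zA by (auto simp: W_def)
qed

text \<open>The nil radical is only an intermediate bound: every nilpotent ideal lies in it, it lies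
  in \<open>W 1\<close>, and \<open>W 1\<close> is nilpotent. Thus the greatest nilpotent ideal
  exists.\<close>

theorem radical_eq: "radical A = W 1"
  unfolding radical_def
proof (rule Greatest_equality)
  show "nilpotent_ideal A (W 1)" by (rule W1_nilpotent)
  fix J assume "nilpotent_ideal A J"
  then show "J \<subseteq> W 1"
    using R.nilpotent_ideal_subset_nil_radical nil_radical_subset_W1 by blast
qed

text \<open>Every monomial of positive weight has a nilpotent generator as a factor, which can be
  split off.\<close>

lemma W1_subset:
  assumes J: "ideal J A" and "s = \<zero>\<^bsub>F\<^esub> \<Longrightarrow> h \<in> J" "a = \<zero>\<^bsub>F\<^esub> \<Longrightarrow> x \<in> J"
  shows "W 1 \<subseteq> J"
proof
  interpret J: ideal J A by fact
  fix r assume r: "r \<in> W 1"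
  then have rA: "r \<in> carrier A" using W_carrier by auto
  have "el (co r) \<in> J"
    unfolding lc_def
  proof (rule R.finsum_mem)
    fix p assume p: "p \<in> IJ"
    obtain i j where ij: "p = (i, j)" by fastforce
    have "B p \<in> J" if "wt p \<noteq> 0"
    proof (cases "s = \<zero>\<^bsub>F\<^esub> \<and> i \<noteq> 0")
      case True
      then obtain i' where "i = Suc i'" by (cases i) auto
      then have "B p = h [^]\<^bsub>A\<^esub> i' \<otimes>\<^bsub>A\<^esub> h \<otimes>\<^bsub>A\<^esub> x [^]\<^bsub>A\<^esub> j" by (simp add: ij)
      also have "\<dots> \<in> J" using assms(2) True by (intro J.I_r_closed J.I_l_closed) auto
      finally show ?thesis .
    next
      case False
      then have *: "a = \<zero>\<^bsub>F\<^esub>" "j \<noteq> 0" using that by (auto simp: wt_def ij split: if_splits)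
      then obtain j' where "j = Suc j'" by (cases j) auto
      then have "B p = h [^]\<^bsub>A\<^esub> i \<otimes>\<^bsub>A\<^esub> (x [^]\<^bsub>A\<^esub> j' \<otimes>\<^bsub>A\<^esub> x)" by (simp add: ij)
      also have "\<dots> \<in> J" using assms(3) * by (intro J.I_l_closed) auto
      finally show ?thesis .
    qed
    then have "co r p = \<zero>\<^bsub>F\<^esub> \<or> B p \<in> J" using co_W[OF r p] by auto
    then show "f (co r p) \<otimes>\<^bsub>A\<^esub> B p \<in> J"
      using rA p J.zero_closed J.I_l_closed R.l_null[OF B_closed[of p]] by (metis co_closed f.hom_closed f.hom_zero)
  qed (auto intro: J.zero_closed J.a_closed J.Icarr)
  then show "r \<in> J" using co(2)[OF rA] by simp
qed

lemma h_in_W1: "s = \<zero>\<^bsub>F\<^esub> \<Longrightarrow> h \<in> W 1"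
  using B_in_W[of "(1, 0)" 1] n2 wt_def[of "(1, 0)"] by simp

lemma x_in_W1: "a = \<zero>\<^bsub>F\<^esub> \<Longrightarrow> x \<in> W 1"
  using B_in_W[of "(0, 1)" 1] n2 wt_def[of "(0, 1)"] by simp

text \<open>One statement for all degenerate cases, with \<open>S\<close> equal to
  \<open>{x}\<close>, \<open>{h}\<close> or \<open>{x, h}\<close>.\<close>

lemma radical_eq_genideal:
  assumes "S \<subseteq> W 1" "s = \<zero>\<^bsub>F\<^esub> \<Longrightarrow> h \<in> S" "a = \<zero>\<^bsub>F\<^esub> \<Longrightarrow> x \<in> S"
  shows "radical A = Idl\<^bsub>A\<^esub> S"
proof -
  have S: "S \<subseteq> carrier A" using assms(1) W_carrier by auto
  have "W 1 \<subseteq> Idl\<^bsub>A\<^esub> S"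
    using assms(2,3) R.genideal_self[OF S] by (intro W1_subset R.genideal_ideal[OF S]) auto
  moreover have "Idl\<^bsub>A\<^esub> S \<subseteq> W 1" using R.genideal_minimal[OF W_ideal assms(1)] .
  ultimately show ?thesis using radical_eq by simp
qed

end

section \<open>Simple symbol algebras and quotients by the radical\<close>

lemma (in ideal) coset_eq_zero_iff:
  assumes "r \<in> carrier R"
  shows "I +> r = \<zero>\<^bsub>R Quot I\<^esub> \<longleftrightarrow> r \<in> I"
proof -
  have "\<zero>\<^bsub>R Quot I\<^esub> = I" by (simp add: FactRing_def)
  then show ?thesis using a_rcos_const[of r] a_rcos_self[OF assms] by auto
qed

lemma (in ring) FactRing_carrierD: "y \<in> carrier (R Quot I) \<Longrightarrow> \<exists>r\<in>carrier R. y = I +> r"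
  by (auto simp: FactRing_def A_RCOSETS_def')

context symbol_alg
begin

text \<open>Keeps the \<open>1\<close> in \<open>chr 1 0\<close> and \<open>W 1\<close> from being
  rewritten to \<open>Suc 0\<close>.\<close>

declare One_nat_def [simp del]

lemma B_h: "B p \<otimes>\<^bsub>A\<^esub> h = f (chr 0 1 p) \<otimes>\<^bsub>A\<^esub> (h \<otimes>\<^bsub>A\<^esub> B p)"
proof -
  obtain i j where p: "p = (i, j)" by fastforce
  have "B p \<otimes>\<^bsub>A\<^esub> h = h [^]\<^bsub>A\<^esub> i \<otimes>\<^bsub>A\<^esub> (x [^]\<^bsub>A\<^esub> j \<otimes>\<^bsub>A\<^esub> h [^]\<^bsub>A\<^esub> (1::nat))" by (simp add: p R.m_assoc)
  also have "\<dots> = f (q [^]\<^bsub>F\<^esub> j) \<otimes>\<^bsub>A\<^esub> (h [^]\<^bsub>A\<^esub> i \<otimes>\<^bsub>A\<^esub> (h \<otimes>\<^bsub>A\<^esub> x [^]\<^bsub>A\<^esub> j))"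
    unfolding x_pow_h_pow by (subst f_lcomm) auto
  also have "h [^]\<^bsub>A\<^esub> i \<otimes>\<^bsub>A\<^esub> (h \<otimes>\<^bsub>A\<^esub> x [^]\<^bsub>A\<^esub> j) = h [^]\<^bsub>A\<^esub> Suc i \<otimes>\<^bsub>A\<^esub> x [^]\<^bsub>A\<^esub> j"
    by (simp add: R.m_assoc)
  also have "h [^]\<^bsub>A\<^esub> Suc i = h \<otimes>\<^bsub>A\<^esub> h [^]\<^bsub>A\<^esub> i" by (rule R.nat_pow_Suc2) simp
  finally show ?thesis by (simp add: p R.m_assoc chr_def)
qed

lemma x_B: "x \<otimes>\<^bsub>A\<^esub> B p = f (chr 1 0 p) \<otimes>\<^bsub>A\<^esub> (B p \<otimes>\<^bsub>A\<^esub> x)"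
proof -
  obtain i j where p: "p = (i, j)" by fastforce
  have "x \<otimes>\<^bsub>A\<^esub> B p = (x \<otimes>\<^bsub>A\<^esub> h [^]\<^bsub>A\<^esub> i) \<otimes>\<^bsub>A\<^esub> x [^]\<^bsub>A\<^esub> j" by (simp add: p R.m_assoc)
  also have "\<dots> = f (q [^]\<^bsub>F\<^esub> i) \<otimes>\<^bsub>A\<^esub> (h [^]\<^bsub>A\<^esub> i \<otimes>\<^bsub>A\<^esub> (x \<otimes>\<^bsub>A\<^esub> x [^]\<^bsub>A\<^esub> j))"
    unfolding x_h_pow by (simp add: R.m_assoc)
  also have "x \<otimes>\<^bsub>A\<^esub> x [^]\<^bsub>A\<^esub> j = x [^]\<^bsub>A\<^esub> j \<otimes>\<^bsub>A\<^esub> x" using R.nat_pow_Suc2[of x j] by simp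
  finally show ?thesis by (simp add: p R.m_assoc chr_def)
qed

lemma chr_Pi [simp]: "chr u v \<in> IJ \<rightarrow> carrier F" by simp

text \<open>
  Since \<open>h\<close> is invertible when \<open>s \<noteq> 0\<close>, ideals are stable under the diagonal operator \<open>chr 0 1\<close>;
  the same holds for \<open>x\<close> and \<open>chr 1 0\<close>. So an ideal is spanned by the monomials it contains.
\<close>

lemma mult_h: 
  assumes r: "r \<in> carrier A" shows "r \<otimes>\<^bsub>A\<^esub> h = h \<otimes>\<^bsub>A\<^esub> diag (chr 0 1) r"
proof -
  have cl: "(\<lambda>p. chr 0 1 p \<otimes>\<^bsub>F\<^esub> co r p) \<in> IJ \<rightarrow> carrier F" using co(1)[OF r] by auto
  have hB: "(\<lambda>p. h \<otimes>\<^bsub>A\<^esub> B p) \<in> IJ \<rightarrow> carrier A" by (intro Pi_I R.m_closed B_closed h_closed)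
  have "r \<otimes>\<^bsub>A\<^esub> h = lc (\<lambda>p. B p \<otimes>\<^bsub>A\<^esub> h) IJ (co r)"
    using lc_mult_right[OF b_closed co(1)[OF r] h_closed finite_I] co(2)[OF r] by simp
  also have "\<dots> = lc (\<lambda>p. h \<otimes>\<^bsub>A\<^esub> B p) IJ (\<lambda>p. chr 0 1 p \<otimes>\<^bsub>F\<^esub> co r p)"
    unfolding lc_def
  proof (rule R.finsum_cong'[OF refl])
    show "(\<lambda>p. f (chr 0 1 p \<otimes>\<^bsub>F\<^esub> co r p) \<otimes>\<^bsub>A\<^esub> (h \<otimes>\<^bsub>A\<^esub> B p)) \<in> IJ \<rightarrow> carrier A"
      using r by (intro Pi_I R.m_closed B_closed h_closed f.hom_closed m_closed chr_closed co_closed)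
    fix p assume p: "p \<in> IJ"
    have "f (co r p) \<otimes>\<^bsub>A\<^esub> (f (chr 0 1 p) \<otimes>\<^bsub>A\<^esub> (h \<otimes>\<^bsub>A\<^esub> B p)) = f (co r p \<otimes>\<^bsub>F\<^esub> chr 0 1 p) \<otimes>\<^bsub>A\<^esub> (h \<otimes>\<^bsub>A\<^esub> B p)"
      using p r by (intro f_mult_f co_closed chr_closed R.m_closed h_closed B_closed)
    then show "f (co r p) \<otimes>\<^bsub>A\<^esub> (B p \<otimes>\<^bsub>A\<^esub> h) = f (chr 0 1 p \<otimes>\<^bsub>F\<^esub> co r p) \<otimes>\<^bsub>A\<^esub> (h \<otimes>\<^bsub>A\<^esub> B p)"
      unfolding B_h using p r by (simp only: m_comm co_closed chr_closed)
  qed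
  also have "\<dots> = h \<otimes>\<^bsub>A\<^esub> diag (chr 0 1) r"
    unfolding diag_def using lc_mult_left[OF b_closed cl h_closed finite_I] by simp
  finally show ?thesis .
qed

lemma mult_x:
  assumes r: "r \<in> carrier A" shows "x \<otimes>\<^bsub>A\<^esub> r = diag (chr 1 0) r \<otimes>\<^bsub>A\<^esub> x"
proof -
  have cl: "(\<lambda>p. chr 1 0 p \<otimes>\<^bsub>F\<^esub> co r p) \<in> IJ \<rightarrow> carrier F" using co(1)[OF r] by auto
  have "x \<otimes>\<^bsub>A\<^esub> r = lc (\<lambda>p. x \<otimes>\<^bsub>A\<^esub> B p) IJ (co r)"
    using lc_mult_left[OF b_closed co(1)[OF r] x_closed finite_I] co(2)[OF r] by simp
  also have "\<dots> = lc (\<lambda>p. B p \<otimes>\<^bsub>A\<^esub> x) IJ (\<lambda>p. chr 1 0 p \<otimes>\<^bsub>F\<^esub> co r p)"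
    unfolding lc_def
  proof (rule R.finsum_cong'[OF refl])
    show "(\<lambda>p. f (chr 1 0 p \<otimes>\<^bsub>F\<^esub> co r p) \<otimes>\<^bsub>A\<^esub> (B p \<otimes>\<^bsub>A\<^esub> x)) \<in> IJ \<rightarrow> carrier A"
      using r by (intro Pi_I R.m_closed B_closed x_closed f.hom_closed m_closed chr_closed co_closed)
    fix p assume p: "p \<in> IJ"
    have "f (co r p) \<otimes>\<^bsub>A\<^esub> (f (chr 1 0 p) \<otimes>\<^bsub>A\<^esub> (B p \<otimes>\<^bsub>A\<^esub> x)) = f (co r p \<otimes>\<^bsub>F\<^esub> chr 1 0 p) \<otimes>\<^bsub>A\<^esub> (B p \<otimes>\<^bsub>A\<^esub> x)"
      using p r by (intro f_mult_f co_closed chr_closed R.m_closed x_closed B_closed)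
    then show "f (co r p) \<otimes>\<^bsub>A\<^esub> (x \<otimes>\<^bsub>A\<^esub> B p) = f (chr 1 0 p \<otimes>\<^bsub>F\<^esub> co r p) \<otimes>\<^bsub>A\<^esub> (B p \<otimes>\<^bsub>A\<^esub> x)"
      unfolding x_B using p r by (simp only: m_comm co_closed chr_closed)
  qed
  also have "\<dots> = diag (chr 1 0) r \<otimes>\<^bsub>A\<^esub> x"
    unfolding diag_def using lc_mult_right[OF b_closed cl x_closed finite_I] by simp
  finally show ?thesis .
qed

text \<open>The two conjugations run in opposite directions, because \<open>mult_h\<close> moves
  \<open>h\<close> from right to left while \<open>mult_x\<close> moves \<open>x\<close> from left
  to right.\<close>

lemma diag_chr_conj:
  assumes "s \<noteq> \<zero>\<^bsub>F\<^esub>" "a \<noteq> \<zero>\<^bsub>F\<^esub>" "r \<in> carrier A"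
  shows "diag (chr 0 1) r = inv\<^bsub>A\<^esub> h \<otimes>\<^bsub>A\<^esub> r \<otimes>\<^bsub>A\<^esub> h" "diag (chr 1 0) r = x \<otimes>\<^bsub>A\<^esub> r \<otimes>\<^bsub>A\<^esub> inv\<^bsub>A\<^esub> x"
proof -
  have u: "h \<in> Units A" "x \<in> Units A" using h_Units x_Units assms by auto
  have "inv\<^bsub>A\<^esub> h \<otimes>\<^bsub>A\<^esub> (r \<otimes>\<^bsub>A\<^esub> h) = inv\<^bsub>A\<^esub> h \<otimes>\<^bsub>A\<^esub> h \<otimes>\<^bsub>A\<^esub> diag (chr 0 1) r"
    unfolding mult_h[OF assms(3)] using u assms(3) by (subst R.m_assoc) auto
  then show "diag (chr 0 1) r = inv\<^bsub>A\<^esub> h \<otimes>\<^bsub>A\<^esub> r \<otimes>\<^bsub>A\<^esub> h"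
    using u assms(3) by (simp add: R.m_assoc)
  have "(x \<otimes>\<^bsub>A\<^esub> r) \<otimes>\<^bsub>A\<^esub> inv\<^bsub>A\<^esub> x = diag (chr 1 0) r \<otimes>\<^bsub>A\<^esub> (x \<otimes>\<^bsub>A\<^esub> inv\<^bsub>A\<^esub> x)"
    unfolding mult_x[OF assms(3)] using u assms(3) by (subst R.m_assoc) auto
  then show "diag (chr 1 0) r = x \<otimes>\<^bsub>A\<^esub> r \<otimes>\<^bsub>A\<^esub> inv\<^bsub>A\<^esub> x"
    using u assms(3) by simp
qed

lemma co_one: "co \<one>\<^bsub>A\<^esub> (0, 0) = \<one>\<^bsub>F\<^esub>"
  using co_basis1[of "(0, 0)" "(0, 0)"] o1 by simp

lemma W1_proper: "\<one>\<^bsub>A\<^esub> \<notin> W 1"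
proof
  assume "\<one>\<^bsub>A\<^esub> \<in> W 1"
  from co_W[OF this o1(1)] show False using co_one by (auto simp: wt_def split: if_splits)
qed

section \<open>Simplicity and the centre\<close>

lemma not_simple:
  assumes "s = \<zero>\<^bsub>F\<^esub> \<or> a = \<zero>\<^bsub>F\<^esub>" shows "\<not> simple_ring A"
proof
  assume "simple_ring A"
  \<comment> \<open>\<open>W 1\<close> is a proper ideal. It contains \<open>h\<close> or
    \<open>x\<close>, which are basis vectors because \<open>n \<ge> 2\<close> and hence
    nonzero.\<close>
  then have "W 1 = {\<zero>\<^bsub>A\<^esub>}" using W_ideal W1_proper by (auto simp: simple_ring_def)
  moreover have "h \<noteq> \<zero>\<^bsub>A\<^esub>"
    using co_basis1[of "(1, 0)" "(1, 0)"] co_zero[of "(1, 0)"] n2 by auto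
  moreover have "x \<noteq> \<zero>\<^bsub>A\<^esub>"
    using co_basis1[of "(0, 1)" "(0, 1)"] co_zero[of "(0, 1)"] n2 by auto
  ultimately show False using assms h_in_W1 x_in_W1 by auto
qed

lemma simple:
  assumes sa: "s \<noteq> \<zero>\<^bsub>F\<^esub>" "a \<noteq> \<zero>\<^bsub>F\<^esub>" shows "simple_ring A"
proof -
  have "J = {\<zero>\<^bsub>A\<^esub>} \<or> J = carrier A" if J: "ideal J A" for J
  proof (rule disjCI)
    interpret J: ideal J A by fact
    assume "J \<noteq> carrier A"
    have "z = \<zero>\<^bsub>A\<^esub>" if z: "z \<in> J" for z
    proof (rule eq_by_co)
      have zA: "z \<in> carrier A" using z J.Icarr by auto
      fix p assume p: "p \<in> IJ"
      have "f (co z p) \<otimes>\<^bsub>A\<^esub> B p \<in> J"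
      proof (rule chr_components[OF _ co(1)[OF zA] _ p])
        show "el (co z) \<in> J" using co(2)[OF zA] z by simp
        fix c u v l assume uv: "(u, v) \<in> {(1::nat, 0::nat), (0, 1)}" and c: "c \<in> IJ \<rightarrow> carrier F" "el c \<in> J" and l: "l \<in> carrier F"
        show "el (\<lambda>p. if chr u v p = l then c p else \<zero>\<^bsub>F\<^esub>) \<in> J"
        proof (rule eigen_component[OF J.a_subset J.a_closed _ chr_Pi _ c l])
          show "f d \<otimes>\<^bsub>A\<^esub> y \<in> J" if "d \<in> carrier F" "y \<in> J" for d y
            using that by (intro J.I_l_closed) auto
          fix c assume c: "c \<in> IJ \<rightarrow> carrier F" "el c \<in> J"
          have "diag (chr u v) (el c) \<in> J"
          proof (cases "(u, v) = (1, 0)")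
            case True
            have "x \<otimes>\<^bsub>A\<^esub> el c \<otimes>\<^bsub>A\<^esub> inv\<^bsub>A\<^esub> x \<in> J"
              using c(2) x_Units[OF sa(2)] by (intro J.I_l_closed J.I_r_closed) auto
            then show ?thesis using True diag_chr_conj(2)[OF sa el_closed[OF c(1)]] by simp
          next
            case False
            have "inv\<^bsub>A\<^esub> h \<otimes>\<^bsub>A\<^esub> el c \<otimes>\<^bsub>A\<^esub> h \<in> J"
              using c(2) h_Units[OF sa(1)] by (intro J.I_l_closed J.I_r_closed) auto
            moreover have "u = 0" "v = 1" using False uv by auto
            ultimately show ?thesis using diag_chr_conj(1)[OF sa el_closed[OF c(1)]] by simp
          qed
          then show "el (\<lambda>p. chr u v p \<otimes>\<^bsub>F\<^esub> c p) \<in> J" using diag_el[OF chr_Pi c(1)] by simp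
        qed
      qed
      \<comment> \<open>All weights are zero now, so a term of \<open>z\<close> with nonzero
        coefficient would be a unit in the proper ideal \<open>J\<close>.\<close>
      moreover have "u \<notin> J" if "u \<in> Units A" for u
      proof
        assume "u \<in> J"
        then have "inv\<^bsub>A\<^esub> u \<otimes>\<^bsub>A\<^esub> u \<in> J" using that by (intro J.I_l_closed) auto
        then show False using that \<open>J \<noteq> carrier A\<close> J.one_imp_carrier by simp
      qed
      moreover have "wt p = 0" using sa by (simp add: wt_def)
      ultimately have "co z p = \<zero>\<^bsub>F\<^esub>" using term_Units[of p "co z p"] zA p by auto
      then show "co z p = co \<zero>\<^bsub>A\<^esub> p" using co_zero[OF p] by simp
    qed (use z J.Icarr in auto)
    then show "J = {\<zero>\<^bsub>A\<^esub>}" using J.zero_closed by auto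
  qed
  then show ?thesis using nontrivial R.ring_axioms by (auto simp: simple_ring_def)
qed

lemma simple_iff: "simple_ring A \<longleftrightarrow> s \<noteq> \<zero>\<^bsub>F\<^esub> \<and> a \<noteq> \<zero>\<^bsub>F\<^esub>"
  using simple not_simple by blast

text \<open>A central element is fixed by conjugation with \<open>h\<close> and with
  \<open>x\<close>, that is, by both diagonal operators. A monomial \<open>p\<close> occurring in it
  therefore satisfies \<open>q^(fst p) = q^(snd p) = 1\<close>, which leaves only
  \<open>(0, 0)\<close>.\<close>

lemma center_eq:
  assumes sa: "s \<noteq> \<zero>\<^bsub>F\<^esub>" "a \<noteq> \<zero>\<^bsub>F\<^esub>" shows "ring_center A = f ` carrier F"
proof (intro subset_antisym subsetI)
  fix z assume "z \<in> ring_center A"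
  then have z: "z \<in> carrier A" "\<And>y. y \<in> carrier A \<Longrightarrow> z \<otimes>\<^bsub>A\<^esub> y = y \<otimes>\<^bsub>A\<^esub> z"
    by (auto simp: ring_center_def)
  have u: "h \<in> Units A" "x \<in> Units A" using h_Units x_Units sa by auto
  have "inv\<^bsub>A\<^esub> h \<otimes>\<^bsub>A\<^esub> z \<otimes>\<^bsub>A\<^esub> h = z"
    using z(1) z(2)[OF h_closed] R.Units_l_inv[OF u(1)] R.Units_inv_closed[OF u(1)]
    by (simp add: R.m_assoc) (simp add: R.m_assoc[symmetric])
  then have 1: "diag (chr 0 1) z = z" using diag_chr_conj(1)[OF sa z(1)] by simp
  have "x \<otimes>\<^bsub>A\<^esub> z \<otimes>\<^bsub>A\<^esub> inv\<^bsub>A\<^esub> x = z"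
    using z(1) z(2)[OF x_closed, symmetric] R.Units_r_inv[OF u(2)] R.Units_inv_closed[OF u(2)]
    by (simp add: R.m_assoc)
  then have 2: "diag (chr 1 0) z = z" using diag_chr_conj(2)[OF sa z(1)] by simp
  have "co z p = \<zero>\<^bsub>F\<^esub>" if p: "p \<in> IJ" "p \<noteq> (0, 0)" for p
  proof (rule ccontr)
    assume nz: "co z p \<noteq> \<zero>\<^bsub>F\<^esub>"
    have "chr u v p = \<one>\<^bsub>F\<^esub>" if "diag (chr u v) z = z" for u v
    proof -
      have "chr u v p \<otimes>\<^bsub>F\<^esub> co z p = \<one>\<^bsub>F\<^esub> \<otimes>\<^bsub>F\<^esub> co z p"
        using co_diag[OF chr_Pi z(1) p(1), of u v] that z(1) p(1) by simp
      then show ?thesis using nz z(1) p(1) m_rcancel[of "co z p" "chr u v p" "\<one>\<^bsub>F\<^esub>"] by simp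
    qed
    from this[OF 1] this[OF 2] have "n dvd snd p" "n dvd fst p"
      by (simp_all add: chr_def q_pow_eq_one_iff)
    then show False using p by (auto dest: dvd_imp_le)
  qed
  then have "el (co z) = el (\<lambda>p. if p = (0, 0) then co z (0, 0) else \<zero>\<^bsub>F\<^esub>)"
    using co(1)[OF z(1)] b_closed by (intro lc_cong) auto
  also have "\<dots> = f (co z (0, 0)) \<otimes>\<^bsub>A\<^esub> B (0, 0)"
    using b_closed finite_I o1(1) co_closed[OF z(1) o1(1)] by (rule lc_single)
  finally show "z \<in> f ` carrier F" using co(2)[OF z(1)] co_closed[OF z(1) o1(1)] by auto
qed (auto simp: ring_center_def f_central)

lemma dimension_A: "R.dimension (n\<^sup>2) (f ` carrier F) (carrier A)"
  using dimension_carrier by (simp add: power2_eq_square)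

lemma central_simple:
  assumes sa: "s \<noteq> \<zero>\<^bsub>F\<^esub>" "a \<noteq> \<zero>\<^bsub>F\<^esub>"
  shows "central_simple_algebra (f ` carrier F) A" "has_degree (f ` carrier F) A n"
  using simple[OF sa] subfield_image center_eq[OF sa] dimension_A
  by (auto simp: central_simple_algebra_def has_degree_def R.finite_dimension_def)

section \<open>The quotient by the radical\<close>

definition "I0 = {p \<in> IJ. wt p = 0}"

abbreviation "Q \<equiv> A Quot W 1"
abbreviation "cls r \<equiv> W 1 +>\<^bsub>A\<^esub> r"

lemma cls_hom: "ring_hom_ring A Q cls"
  using ideal.rcos_ring_hom_ring[OF W_ideal] .

text \<open>\<open>W 1\<close> consists of the elements whose coordinates of weight zero all vanish,
  so the monomials of weight zero stay independent modulo \<open>W 1\<close> and span the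
  quotient.\<close>

lemma quot_based: "based_alg F Q (\<lambda>c. cls (f c)) I0 (\<lambda>p. cls (B p))"
proof -
  interpret W: ideal "W 1" A by (rule W_ideal)
  interpret cls: ring_hom_ring A Q cls by (rule cls_hom)
  have cls_eq_zero: "cls r = \<zero>\<^bsub>Q\<^esub> \<longleftrightarrow> r \<in> W 1" if "r \<in> carrier A" for r
    using W.coset_eq_zero_iff[OF that] .
  have surj: "\<exists>r\<in>carrier A. y = cls r" if "y \<in> carrier Q" for y
    using R.FactRing_carrierD[OF that] .
  interpret Q: central_alg F Q "\<lambda>c. cls (f c)"
  proof (unfold_locales)
    show "(\<lambda>c. cls (f c)) \<in> ring_hom F Q"
      using ring_hom_trans[OF f_hom cls.homh] by (simp add: comp_def)
    show "y \<otimes>\<^bsub>Q\<^esub> cls (f c) = cls (f c) \<otimes>\<^bsub>Q\<^esub> y" if "c \<in> carrier F" "y \<in> carrier Q" for c y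
    proof -
      obtain r where "r \<in> carrier A" "y = cls r" using surj[OF \<open>y \<in> carrier Q\<close>] by auto
      then show ?thesis
        using f_central[OF that(1), of r] that(1) cls.hom_mult[of r "f c"] cls.hom_mult[of "f c" r] by simp
    qed
    show "\<one>\<^bsub>Q\<^esub> \<noteq> \<zero>\<^bsub>Q\<^esub>" using cls_eq_zero[OF R.one_closed] W1_proper by simp
  qed
  have I0: "I0 \<subseteq> IJ" by (auto simp: I0_def)
  have BI0: "B \<in> I0 \<rightarrow> carrier A" by (intro Pi_I B_closed)
  have lc_cls: "cls (lc B I0 c) = Q.lc (\<lambda>p. cls (B p)) I0 c" if c: "c \<in> I0 \<rightarrow> carrier F" for c
  proof -
    have "cls (lc B I0 c) = (\<Oplus>\<^bsub>Q\<^esub>p\<in>I0. cls (f (c p) \<otimes>\<^bsub>A\<^esub> B p))"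
      unfolding lc_def
    proof (rule additive_finsum)
      show "(\<lambda>p. f (c p) \<otimes>\<^bsub>A\<^esub> B p) \<in> I0 \<rightarrow> carrier A"
        using BI0 c by (auto intro!: lc_term_closed simp del: case_prod_beta)
    qed (use R.abelian_group_axioms cls.S.abelian_group_axioms in auto)
    also have "\<dots> = Q.lc (\<lambda>p. cls (B p)) I0 c"
      unfolding Q.lc_def
    proof (rule cls.S.finsum_cong'[OF refl])
      have cc: "c p \<in> carrier F" if "p \<in> I0" for p using c that by auto
      then show "(\<lambda>p. cls (f (c p)) \<otimes>\<^bsub>Q\<^esub> cls (B p)) \<in> I0 \<rightarrow> carrier Q"
        by (intro Pi_I cls.S.m_closed cls.hom_closed f.hom_closed B_closed)
      show "cls (f (c p) \<otimes>\<^bsub>A\<^esub> B p) = cls (f (c p)) \<otimes>\<^bsub>Q\<^esub> cls (B p)" if "p \<in> I0" for p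
        using cc[OF that] by (intro cls.hom_mult f.hom_closed B_closed)
    qed
    finally show ?thesis .
  qed
  show ?thesis
  proof (unfold_locales)
    show "finite I0" using I0 finite_I finite_subset by auto
    show "(\<lambda>p. cls (B p)) \<in> I0 \<rightarrow> carrier Q" by (intro Pi_I cls.hom_closed B_closed)
    show "\<exists>c\<in>I0 \<rightarrow> carrier F. y = Q.lc (\<lambda>p. cls (B p)) I0 c" if "y \<in> carrier Q" for y
    proof -
      obtain r where r: "r \<in> carrier A" "y = cls r" using surj[OF \<open>y \<in> carrier Q\<close>] by auto
      \<comment> \<open>Dropping the terms of positive weight changes \<open>r\<close> by an element
        of \<open>W 1\<close>.\<close>
      define c where "c p = (if p \<in> I0 then co r p else \<zero>\<^bsub>F\<^esub>)" for p
      have cIJ: "c \<in> IJ \<rightarrow> carrier F" and cI0: "c \<in> I0 \<rightarrow> carrier F"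
        using r I0 by (auto simp: c_def)
      have c_eq: "el c = lc B I0 c"
        using b_closed cIJ finite_I I0 by (intro lc_mono_neutral) (auto simp: c_def)
      have "r \<ominus>\<^bsub>A\<^esub> el c = el (\<lambda>p. co r p \<ominus>\<^bsub>F\<^esub> c p)"
        using el_minus[OF co(1)[OF r(1)] cIJ] co(2)[OF r(1)] by simp
      also have "\<dots> \<in> W 1"
      proof (rule W_lc)
        show "(\<lambda>p. co r p \<ominus>\<^bsub>F\<^esub> c p) \<in> IJ \<rightarrow> carrier F" using cIJ r by auto
        fix p assume p: "p \<in> IJ"
        show "co r p \<ominus>\<^bsub>F\<^esub> c p = \<zero>\<^bsub>F\<^esub> \<or> B p \<in> W 1"
        proof (cases "p \<in> I0")
          case True
          then show ?thesis using r p by (simp add: c_def r_right_minus_eq)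
        next
          case False
          then show ?thesis using p B_in_W[of p 1] by (auto simp: I0_def)
        qed
      qed (rule b_closed)
      finally have "cls (r \<ominus>\<^bsub>A\<^esub> el c) = \<zero>\<^bsub>Q\<^esub>" using cls_eq_zero r cIJ by simp
      then have "cls r = cls (el c)"
        using r cIJ cls.S.r_right_minus_eq[of "cls r" "cls (el c)"] by (simp add: a_minus_def)
      then have "y = Q.lc (\<lambda>p. cls (B p)) I0 c"
        unfolding r(2) c_eq lc_cls[OF cI0] .
      then show ?thesis using cI0 by (rule bexI)
    qed
    fix c p assume c: "c \<in> I0 \<rightarrow> carrier F" "Q.lc (\<lambda>p. cls (B p)) I0 c = \<zero>\<^bsub>Q\<^esub>" and p: "p \<in> I0"
    \<comment> \<open>Coordinates are known on \<open>IJ\<close> only, so \<open>c\<close> is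
      extended by zero from \<open>I0\<close>.\<close>
    define d where "d p = (if p \<in> I0 then c p else \<zero>\<^bsub>F\<^esub>)" for p
    have d: "d \<in> IJ \<rightarrow> carrier F" using c by (auto simp: d_def)
    have "el d = lc B I0 d"
      using b_closed d finite_I I0 by (intro lc_mono_neutral) (auto simp: d_def)
    also have "\<dots> = lc B I0 c"
      using BI0 d I0 by (intro lc_cong) (auto simp: d_def)
    finally have *: "el d = lc B I0 c" .
    have "cls (el d) = \<zero>\<^bsub>Q\<^esub>" unfolding * lc_cls[OF c(1)] by (rule c(2))
    then have "el d \<in> W 1" using cls_eq_zero d by simp
    moreover have pp: "p \<in> IJ" "wt p = 0" using p by (simp_all add: I0_def)
    ultimately have "co (el d) p = \<zero>\<^bsub>F\<^esub>" using co_W[of "el d" 1 p] by simp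
    then show "c p = \<zero>\<^bsub>F\<^esub>" using co_el[OF d pp(1)] p by (simp add: d_def)
  qed
qed

text \<open>\<open>k\<close> sends an index of the target algebra to the exponent pair of a
  surviving monomial and respects addition of indices. Equality of the structure constants is then
  all that \<open>structure_iso\<close> needs.\<close>

lemma quot_iso:
  assumes k: "bij_betw k J I0" and S: "based_alg F S f' J b'"
    and m: "\<And>i j. \<lbrakk>i \<in> J; j \<in> J\<rbrakk> \<Longrightarrow> m i j \<in> J \<and> k (m i j) = add_mod (k i) (k j)"
    and bb': "\<And>i j. \<lbrakk>i \<in> J; j \<in> J\<rbrakk> \<Longrightarrow> b' i \<otimes>\<^bsub>S\<^esub> b' j = f' (str (k i) (k j)) \<otimes>\<^bsub>S\<^esub> b' (m i j)"
    and o: "o1 \<in> J" "k o1 = (0, 0)" "b' o1 = \<one>\<^bsub>S\<^esub>"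
  shows "alg_isomorphic F Q (\<lambda>c. cls (f c)) S f'"
proof -
  interpret cls: ring_hom_ring A Q cls by (rule cls_hom)
  interpret Q0: based_alg F Q "\<lambda>c. cls (f c)" I0 "\<lambda>p. cls (B p)" by (rule quot_based)
  interpret Q: based_alg F Q "\<lambda>c. cls (f c)" J "\<lambda>j. cls (B (k j))" by (rule Q0.reindex[OF k])
  have str: "str p r \<in> carrier F" for p r by (simp add: str_def)
  have "\<exists>\<phi>\<in>ring_iso Q S. \<forall>c\<in>carrier F. \<phi> (cls (f c)) = f' c"
  proof (rule Q.structure_iso[OF S, of "\<lambda>i j. str (k i) (k j)" m o1])
    fix i j assume ij: "i \<in> J" "j \<in> J"
    show "cls (B (k i)) \<otimes>\<^bsub>Q\<^esub> cls (B (k j)) = cls (f (str (k i) (k j))) \<otimes>\<^bsub>Q\<^esub> cls (B (k (m i j)))"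
      using m[OF ij] B_mult[of "k i" "k j"] str[of "k i" "k j"]
      by (metis B_closed cls.hom_mult f.hom_closed)
    show "str (k i) (k j) \<in> carrier F" by (rule str)
    show "m i j \<in> J" using m[OF ij] by simp
    show "b' i \<otimes>\<^bsub>S\<^esub> b' j = f' (str (k i) (k j)) \<otimes>\<^bsub>S\<^esub> b' (m i j)" by (rule bb'[OF ij])
  next
    show "o1 \<in> J" "b' o1 = \<one>\<^bsub>S\<^esub>" using o by simp_all
    show "cls (B (k o1)) = \<one>\<^bsub>Q\<^esub>" unfolding o(2) structured_alg.o1(2)[OF structured_alg_axioms] by (rule cls.hom_one)
  next
    fix \<phi> assume "\<phi> \<in> ring_iso Q S" "\<And>c. c \<in> carrier F \<Longrightarrow> \<phi> (cls (f c)) = f' c"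
    then show "\<exists>\<phi>\<in>ring_iso Q S. \<forall>c\<in>carrier F. \<phi> (cls (f c)) = f' c" by blast
  qed
  then show ?thesis unfolding alg_isomorphic_def .
qed

end

section \<open>The commutative algebras \<open>F[g]/(g^n - t)\<close>\<close>

locale binom_alg = based_alg F R f "{..<n}" "\<lambda>i. g [^]\<^bsub>R\<^esub> i"
  for F :: "('a, 'm) ring_scheme" and R :: "('b, 'n) ring_scheme" and f :: "'a \<Rightarrow> 'b"
    and n :: nat and g :: 'b +
  fixes t :: 'a
  assumes n_pos: "0 < n" and t_closed [simp]: "t \<in> carrier F" and g_closed [simp]: "g \<in> carrier R"
    and g_pow_n: "g [^]\<^bsub>R\<^esub> n = f t"
begin

lemma g_pow_mod: "g [^]\<^bsub>R\<^esub> k = f (t [^]\<^bsub>F\<^esub> (k div n)) \<otimes>\<^bsub>R\<^esub> g [^]\<^bsub>R\<^esub> (k mod n)"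
proof -
  have "g [^]\<^bsub>R\<^esub> k = g [^]\<^bsub>R\<^esub> (n * (k div n) + k mod n)" by simp
  also have "\<dots> = (g [^]\<^bsub>R\<^esub> n) [^]\<^bsub>R\<^esub> (k div n) \<otimes>\<^bsub>R\<^esub> g [^]\<^bsub>R\<^esub> (k mod n)"
    by (simp only: R.nat_pow_mult[symmetric] R.nat_pow_pow g_closed)
  finally show ?thesis by (simp add: g_pow_n f_pow)
qed

sublocale structured_alg F R f "{..<n}" "\<lambda>i. g [^]\<^bsub>R\<^esub> i"
  "\<lambda>i j. t [^]\<^bsub>F\<^esub> ((i + j) div n)" "\<lambda>i j. (i + j) mod n" 0
proof unfold_locales
  show "g [^]\<^bsub>R\<^esub> i \<otimes>\<^bsub>R\<^esub> g [^]\<^bsub>R\<^esub> j = f (t [^]\<^bsub>F\<^esub> ((i + j) div n)) \<otimes>\<^bsub>R\<^esub> g [^]\<^bsub>R\<^esub> ((i + j) mod n)" for i j :: nat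
    unfolding g_pow_mod[of "i + j", symmetric] by (rule R.nat_pow_mult) simp
qed (use n_pos in auto)

end

context symbol_alg
begin

declare One_nat_def [simp del]

text \<open>The surviving monomials are the powers of \<open>h\<close>. On the pairs
  \<open>(i, 0)\<close> the constant \<open>str\<close> has no power of \<open>q\<close> and no
  carry in the second exponent, so it reduces to the structure constant of
  \<open>F[h]/(h^n - s)\<close>.\<close>

lemma quot_iso_h:
  assumes "s \<noteq> \<zero>\<^bsub>F\<^esub>" "a = \<zero>\<^bsub>F\<^esub>" and S: "binom_alg F S f' n g s"
  shows "alg_isomorphic F Q (\<lambda>c. cls (f c)) S f'"
proof -
  interpret S: binom_alg F S f' n g s by fact
  have wt: "wt p = snd p" for p by (simp only: wt_def) (simp add: assms)
  have k: "bij_betw (\<lambda>i. (i, 0::nat)) {..<n} I0"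
    using n2 by (auto simp: bij_betw_def inj_on_def I0_def wt)
  show ?thesis
    using n2 S.mult_basis
    by (rule_tac quot_iso[OF k S.based_alg_axioms, where m = "\<lambda>i j. (i + j) mod n" and ?o1.0 = 0])
      (auto simp: add_mod_def str_def)
qed

lemma quot_iso_x:
  assumes "s = \<zero>\<^bsub>F\<^esub>" "a \<noteq> \<zero>\<^bsub>F\<^esub>" and S: "binom_alg F S f' n g a"
  shows "alg_isomorphic F Q (\<lambda>c. cls (f c)) S f'"
proof -
  interpret S: binom_alg F S f' n g a by fact
  have wt: "wt p = fst p" for p by (simp only: wt_def) (simp add: assms)
  have k: "bij_betw (\<lambda>i. (0::nat, i)) {..<n} I0"
    using n2 by (auto simp: bij_betw_def inj_on_def I0_def wt)
  show ?thesis
    using n2 S.mult_basis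
    by (rule_tac quot_iso[OF k S.based_alg_axioms, where m = "\<lambda>i j. (i + j) mod n" and ?o1.0 = 0])
      (auto simp: add_mod_def str_def)
qed

text \<open>Only the monomial \<open>1\<close> survives; \<open>F\<close> is viewed as an algebra
  over itself with a basis of one element.\<close>

lemma quot_iso_trivial:
  assumes "s = \<zero>\<^bsub>F\<^esub>" "a = \<zero>\<^bsub>F\<^esub>"
  shows "alg_isomorphic F Q (\<lambda>c. cls (f c)) F (\<lambda>c. c)"
proof -
  have S0: "central_alg F F (\<lambda>c. c)"
  proof unfold_locales
    show "(\<lambda>c. c) \<in> ring_hom F F" by (rule ring_hom_memI) simp_all
    show "\<one>\<^bsub>F\<^esub> \<noteq> \<zero>\<^bsub>F\<^esub>" by (rule one_not_zero)
  qed (rule m_comm)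
  have lc: "central_alg.lc F (\<lambda>c. c) (\<lambda>i. \<one>\<^bsub>F\<^esub>) {0::nat} c = c 0" if "c \<in> {0::nat} \<rightarrow> carrier F" for c
    using that unfolding central_alg.lc_def[OF S0] by simp
  have S: "based_alg F F (\<lambda>c. c) {0::nat} (\<lambda>i. \<one>\<^bsub>F\<^esub>)"
  proof (rule based_alg.intro[OF S0], rule based_alg_axioms.intro)
    show "\<exists>c\<in>{0::nat} \<rightarrow> carrier F. r = central_alg.lc F (\<lambda>c. c) (\<lambda>i. \<one>\<^bsub>F\<^esub>) {0} c" if "r \<in> carrier F" for r
      using that lc by (intro bexI[of _ "\<lambda>i. r"]) auto
  qed (use lc in auto)
  have wt: "wt p = fst p + snd p" for p by (simp only: wt_def) (simp add: assms)
  have k: "bij_betw (\<lambda>i::nat. (0::nat, 0::nat)) {0} I0"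
    using n2 by (auto simp: bij_betw_def I0_def wt)
  show ?thesis
    using n2 by (rule_tac quot_iso[OF k S, where m = "\<lambda>i j. 0" and ?o1.0 = 0]) (auto simp: add_mod_def str_def)
qed

end

section \<open>Binomials and their rupture algebras\<close>

context field
begin

text \<open>Coefficient lists start with the leading term, and the constant polynomial zero is the
  empty list, whence the separate case \<open>s = 0\<close>. The explicit list makes the degree and
  the effect of a coefficient map visible.\<close>

lemma binomial_poly_eq:
  assumes "0 < n" "s \<in> carrier R"
  shows "binomial_poly R n s = \<one> # replicate (n - 1) \<zero> @ [\<ominus> s]"
proof -
  interpret UP: domain "poly_ring R" by (rule univ_poly_is_domain[OF carrier_is_subring])
  obtain k where k: "n = Suc k" using assms(1) by (cases n) auto
  have const: "poly_of_const s \<in> carrier (poly_ring R)"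
    using assms(2) by (auto simp: poly_of_const_def univ_poly_carrier[symmetric] polynomial_def)
  have X: "X [^]\<^bsub>poly_ring R\<^esub> n = (\<one> # replicate k \<zero>) @ [\<zero>]"
    unfolding unitary_monom_eq_var_pow[OF carrier_is_subring, symmetric]
    by (simp add: monom_def k replicate_append_same)
  have neg: "\<ominus>\<^bsub>poly_ring R\<^esub> poly_of_const s = (if s = \<zero> then [] else [\<ominus> s])"
    unfolding univ_poly_a_inv_def'[OF carrier_is_subring const] by (simp add: poly_of_const_def)
  have eq: "binomial_poly R n s = poly_add ((\<one> # replicate k \<zero>) @ [\<zero>]) (if s = \<zero> then [] else [\<ominus> s])"
    unfolding binomial_poly_def a_minus_def X neg univ_poly_add ..
  show ?thesis
  proof (cases "s = \<zero>")
    case True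
    have "set ((\<one> # replicate k \<zero>) @ [\<zero>]) \<subseteq> carrier R" by auto
    from poly_add_zero'(1)[OF this] show ?thesis unfolding eq using True by (simp add: k)
  next
    case False
    have "map2 (\<oplus>) ((\<one> # replicate k \<zero>) @ [\<zero>]) (replicate (Suc k) \<zero> @ [\<ominus> s]) = \<one> # replicate k \<zero> @ [\<ominus> s]"
      using assms(2) by (simp add: zip_append)
    then show ?thesis unfolding eq using False by (simp add: k)
  qed
qed

lemma binomial_poly:
  assumes "0 < n" "s \<in> carrier R"
  shows "binomial_poly R n s \<in> carrier (poly_ring R)" "degree (binomial_poly R n s) = n"
    "binomial_poly R n s \<noteq> []"
    "y \<in> carrier R \<Longrightarrow> eval (binomial_poly R n s) y = y [^] n \<ominus> s"
proof -
  note eq = binomial_poly_eq[OF assms]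
  show bp: "binomial_poly R n s \<in> carrier (poly_ring R)" "binomial_poly R n s \<noteq> []"
    unfolding eq univ_poly_carrier[symmetric] polynomial_def using assms by auto
  show "degree (binomial_poly R n s) = n"
    unfolding eq using assms by simp
  interpret UP: domain "poly_ring R" by (rule univ_poly_is_domain[OF carrier_is_subring])
  have const: "poly_of_const s \<in> carrier (poly_ring R)"
    using assms(2) by (auto simp: poly_of_const_def univ_poly_carrier[symmetric] polynomial_def)
  assume y: "y \<in> carrier R"
  interpret ev: ring_hom_ring "poly_ring R" R "\<lambda>p. eval p y" by (rule eval_ring_hom[OF carrier_is_subring y])
  have X: "X \<in> carrier (poly_ring R)" by (rule var_closed(1)[OF carrier_is_subring])
  have "eval (X [^]\<^bsub>poly_ring R\<^esub> n) y = y [^] n"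
    unfolding ev.hom_nat_pow[OF X] eval_var[OF y] ..
  moreover have "eval (poly_of_const s) y = s"
    using assms(2) y by (simp add: poly_of_const_def)
  moreover have "X [^]\<^bsub>poly_ring R\<^esub> n \<in> carrier (poly_ring R)" by (rule var_pow_closed[OF carrier_is_subring])
  ultimately show "eval (binomial_poly R n s) y = y [^] n \<ominus> s"
    unfolding binomial_poly_def a_minus_def using const by simp
qed

lemma mset_set_subset_roots:
  assumes p: "p \<in> carrier (poly_ring R)" "p \<noteq> []" and S: "finite S" "S \<subseteq> carrier R" "\<And>y. y \<in> S \<Longrightarrow> eval p y = \<zero>"
  shows "mset_set S \<subseteq># roots p" "card S \<le> degree p"
proof -
  have "y \<in># roots p" if "y \<in> S" for y
    using that S p roots_mem_iff_is_root[OF p(1)] by (auto simp: is_root_def)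
  then show *: "mset_set S \<subseteq># roots p"
    using S(1) by (auto simp: subseteq_mset_def count_mset_set' Suc_le_eq)
  show "card S \<le> degree p"
    using size_mset_mono[OF *] size_roots_le_degree[OF p(1)] by simp
qed

text \<open>The constant term is the leading coefficient times the product of the negated roots,
  each in \<open>U \<alpha>\<close> with \<open>U\<close> closed under products. Linear factors are
  split off one at a time; putting the sign into the hypothesis on the roots avoids powers of
  \<open>-1\<close>.\<close>

lemma splitted_const_term:
  assumes U: "U \<subseteq> carrier R" "\<one> \<in> U" "\<And>u v. \<lbrakk>u \<in> U; v \<in> U\<rbrakk> \<Longrightarrow> u \<otimes> v \<in> U" and \<alpha>: "\<alpha> \<in> carrier R"
    and p: "p \<in> carrier (poly_ring R)" "p \<noteq> []" "splitted p"
    and rts: "\<And>y. y \<in># roots p \<Longrightarrow> \<exists>u\<in>U. \<ominus> y = u \<otimes> \<alpha>"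
  shows "\<exists>u\<in>U. const_term p = lead_coeff p \<otimes> (u \<otimes> \<alpha> [^] degree p)"
  using p rts
proof (induct "degree p" arbitrary: p)
  case 0
  then obtain k where k: "p = [k]"
    by (cases p) auto
  then have "k \<in> carrier R" using 0 by (auto simp: univ_poly_carrier[symmetric] polynomial_def)
  then show ?case using U k by (intro bexI[of _ \<one>]) (auto simp: const_term_def)
next
  case (Suc d)
  interpret UP: domain "poly_ring R" by (rule univ_poly_is_domain[OF carrier_is_subring])
  have "size (roots p) = Suc d" using Suc by (simp add: splitted_def)
  then have "roots p \<noteq> {#}" by auto
  then obtain y where y: "y \<in> carrier R" "y \<in># roots p" "[\<one>, \<ominus> y] \<in> carrier (poly_ring R)" "[\<one>, \<ominus> y] pdivides p"
    using not_empty_rootsE[OF Suc(3)] by blast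
  then obtain r where r: "r \<in> carrier (poly_ring R)" "p = [\<one>, \<ominus> y] \<otimes>\<^bsub>poly_ring R\<^esub> r"
    unfolding pdivides_def factor_def by blast
  have r0: "r \<noteq> []"
    using r(2) Suc(4) UP.r_null[OF y(3)] by (auto simp: univ_poly_zero)
  have poly: "polynomial (carrier R) r" "polynomial (carrier R) [\<one>, \<ominus> y]"
    using r(1) y(3) by (simp_all add: univ_poly_carrier)
  have deg: "degree p = Suc (degree r)"
    unfolding r(2) univ_poly_mult poly_mult_degree_eq[OF carrier_is_subring poly(2,1)] using r0 by simp
  have "lead_coeff r \<in> carrier R" using poly(1) r0 by (auto simp: polynomial_def)
  then have lc: "lead_coeff p = lead_coeff r"
    unfolding r(2) univ_poly_mult using poly_mult_lead_coeff[OF carrier_is_subring poly(2,1) _ r0]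
    by (simp del: poly_mult.simps)
  have rts: "roots p = add_mset y (roots r)"
    unfolding r(2) by (rule poly_mult_degree_one_monic_imp_same_roots[OF y(1) r(1) r0])
  then have "splitted r" using Suc(5) deg by (simp add: splitted_def)
  moreover have "d = degree r" using deg Suc(2) by simp
  ultimately obtain u where u: "u \<in> U" "const_term r = lead_coeff r \<otimes> (u \<otimes> \<alpha> [^] degree r)"
    using Suc(1)[of r] r r0 deg Suc(2,6) rts by auto
  obtain v where v: "v \<in> U" "\<ominus> y = v \<otimes> \<alpha>" using Suc(6) y(2) by blast
  have lr: "lead_coeff r \<in> carrier R" using poly(1) r0 by (auto simp: polynomial_def)
  have "const_term p = const_term [\<one>, \<ominus> y] \<otimes> const_term r"
    unfolding r(2) by (rule const_term_simprules_shell(2)[OF carrier_is_subring y(3) r(1)])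
  also have "const_term [\<one>, \<ominus> y] = \<ominus> y" using y(1) by (simp add: const_term_def)
  also have "\<ominus> y \<otimes> const_term r = lead_coeff r \<otimes> ((v \<otimes> u) \<otimes> \<alpha> [^] degree p)"
  proof -
    have "u \<in> carrier R" "v \<in> carrier R" using u v U by auto
    then show ?thesis unfolding u(2) v(2) deg using \<alpha> lr
      by (simp add: m_ac)
  qed
  finally show ?case unfolding lc using U(3)[OF v(1) u(1)] by blast
qed

end

lemma (in central_alg) based_algI:
  assumes ps: "distinct ps" "v \<in> set ps \<rightarrow> carrier R"
    and ind: "R.independent (f ` carrier F) (map v ps)"
    and span: "R.Span (f ` carrier F) (map v ps) = carrier R"
  shows "based_alg F R f (set ps) v"
proof unfold_locales
  show "\<exists>c\<in>set ps \<rightarrow> carrier F. r = lc v (set ps) c" if "r \<in> carrier R" for r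
    using that Span_eq_lc[OF ps] span by auto
  fix c p assume c: "c \<in> set ps \<rightarrow> carrier F" "lc v (set ps) c = \<zero>\<^bsub>R\<^esub>" "p \<in> set ps"
  then have *: "R.combine (map (\<lambda>p. f (c p)) ps) (map v ps) = \<zero>\<^bsub>R\<^esub>" using combine_eq_lc[OF ps] by simp
  have "set (map (\<lambda>p. f (c p)) ps) \<subseteq> f ` carrier F" using c(1) by auto
  from R.independent_imp_trivial_combine[OF subfield_image ind this *]
  have "f (c p) = \<zero>\<^bsub>R\<^esub>" using c(3) by auto
  moreover have "c p \<in> carrier F" using c(1,3) by auto
  ultimately show "c p = \<zero>\<^bsub>F\<^esub>" by simp
qed (use ps in auto)

section \<open>Rupture algebras as algebras with a basis\<close>

context field
begin

lemma Rupt_cring: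
  assumes "p \<in> carrier (poly_ring R)"
  shows "cring (Rupt (carrier R) p)"
proof -
  interpret UP: domain "poly_ring R" by (rule univ_poly_is_domain[OF carrier_is_subring])
  show ?thesis unfolding rupture_def
    using ideal.quotient_is_cring[OF UP.cgenideal_ideal[OF assms] UP.is_cring] .
qed

lemma rupture_const_hom:
  assumes "p \<in> carrier (poly_ring R)"
  shows "(\<lambda>c. rupture_surj (carrier R) p (poly_of_const c)) \<in> ring_hom R (Rupt (carrier R) p)"
proof -
  have "poly_of_const \<in> ring_hom R (poly_ring R)"
    using canonical_embedding_is_hom[OF carrier_is_subring] by simp
  from ring_hom_trans[OF this rupture_surj_hom(1)[OF carrier_is_subring assms]] show ?thesis
    by (simp add: comp_def)
qed

text \<open>Remainders modulo \<open>h^n - s\<close> are the polynomials of length at most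
  \<open>n\<close>, and the projection is bijective on them. The independent powers of
  \<open>X\<close> that span this space therefore map to a basis, irrespective of
  irreducibility.\<close>

lemma root_alg_binom_alg:
  assumes n: "0 < n" and s: "s \<in> carrier R"
  shows "binom_alg R (root_alg R n s) (root_alg_const R n s) n (root_alg_gen R n s) s"
proof -
  let ?p = "binomial_poly R n s" and ?E = "root_alg R n s" and ?\<iota> = "root_alg_const R n s" and ?h = "root_alg_gen R n s"
  let ?surj = "rupture_surj (carrier R) ?p"
  note bp = binomial_poly[OF n s]
  interpret UP: domain "poly_ring R" by (rule univ_poly_is_domain[OF carrier_is_subring])
  interpret E: cring ?E unfolding root_alg_def by (rule Rupt_cring[OF bp(1)])
  interpret surj: ring_hom_ring "poly_ring R" ?E ?surj
    unfolding root_alg_def by (rule rupture_surj_hom(2)[OF carrier_is_subring bp(1)])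
  have one: "\<one>\<^bsub>?E\<^esub> \<noteq> \<zero>\<^bsub>?E\<^esub>"
    unfolding root_alg_def using bp(2) n by (intro rupture_one_not_zero[OF carrier_is_subfield bp(1)]) simp
  have hom: "?\<iota> \<in> ring_hom R ?E"
    using rupture_const_hom[OF bp(1)] by (simp add: root_alg_def root_alg_const_def[abs_def])
  interpret C: central_alg R ?E ?\<iota>
  proof unfold_locales
    show "?\<iota> \<in> ring_hom R ?E" by (rule hom)
    then show "r \<otimes>\<^bsub>?E\<^esub> ?\<iota> c = ?\<iota> c \<otimes>\<^bsub>?E\<^esub> r" if "c \<in> carrier R" "r \<in> carrier ?E" for c r
      using that by (intro E.m_comm) (auto intro: ring_hom_closed)
  qed (rule one)
  have X: "X \<in> carrier (poly_ring R)" by (rule var_closed(1)[OF carrier_is_subring])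
  have h: "?h \<in> carrier ?E" unfolding root_alg_gen_def using X by simp
  have img: "?\<iota> ` carrier R = ?surj ` poly_of_const ` carrier R"
    by (simp add: root_alg_const_def image_image)
  \<comment> \<open>\<open>exp_base\<close> lists the powers of \<open>X\<close> in decreasing
    order, hence \<open>rev\<close>.\<close>
  have base: "map ?surj (UP.exp_base X n) = map (\<lambda>i. ?h [^]\<^bsub>?E\<^esub> i) (rev [0..<n])"
    unfolding UP.exp_base_def map_map comp_def root_alg_gen_def using X by (simp add: surj.hom_nat_pow)
  have Us: "set (UP.exp_base X n) \<subseteq> carrier (poly_ring R)" using UP.exp_base_closed[OF X] .
  have Span: "UP.Span (poly_of_const ` carrier R) (UP.exp_base X n) = {r \<in> carrier (poly_ring R). length r \<le> n}"
    by (rule Span_var_pow_base[OF carrier_is_subfield])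
  have pm: "(\<lambda>r. r pmod ?p) ` carrier (poly_ring R) = {r \<in> carrier (poly_ring R). length r \<le> n}"
    using pmod_image_characterization[OF carrier_is_subfield bp(1,3)] bp(2) by simp
  have inj: "inj_on ?surj {r \<in> carrier (poly_ring R). length r \<le> n}"
    using rupture_surj_inj_on[OF carrier_is_subfield bp(1)] unfolding pm .
  have onto: "?surj ` {r \<in> carrier (poly_ring R). length r \<le> n} = carrier ?E"
    unfolding pm[symmetric] root_alg_def by (rule rupture_carrier_as_pmod_image[OF carrier_is_subfield bp(1)])
  have subf: "subfield (poly_of_const ` carrier R) (poly_ring R)"
    by (rule univ_poly_subfield_of_consts[OF carrier_is_subfield])
  have ind: "E.independent (?\<iota> ` carrier R) (map (\<lambda>i. ?h [^]\<^bsub>?E\<^esub> i) (rev [0..<n]))"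
    unfolding img base[symmetric]
    by (rule surj.inj_hom_preserves_independent[OF subf one _ var_pow_base_independent[OF carrier_is_subfield]])
      (simp only: Span inj)
  have span: "E.Span (?\<iota> ` carrier R) (map (\<lambda>i. ?h [^]\<^bsub>?E\<^esub> i) (rev [0..<n])) = carrier ?E"
    unfolding img base[symmetric] surj.Span_hom[OF subfieldE(3)[OF subf] Us] Span onto ..
  have "based_alg R ?E ?\<iota> (set (rev [0..<n])) (\<lambda>i. ?h [^]\<^bsub>?E\<^esub> i)"
    using h ind span by (intro C.based_algI) auto
  moreover have "set (rev [0..<n]) = {..<n}" by auto
  ultimately have B: "based_alg R ?E ?\<iota> {..<n} (\<lambda>i. ?h [^]\<^bsub>?E\<^esub> i)" by simp
  have pow: "?h [^]\<^bsub>?E\<^esub> n = ?\<iota> s"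
  proof -
    have const: "poly_of_const s \<in> carrier (poly_ring R)"
      using s by (auto simp: poly_of_const_def univ_poly_carrier[symmetric] polynomial_def)
    have "?surj ?p = \<zero>\<^bsub>?E\<^esub>"
      unfolding root_alg_def rupture_def
      using ideal.coset_eq_zero_iff[OF UP.cgenideal_ideal[OF bp(1)] bp(1)] UP.cgenideal_self[OF bp(1)] by simp
    moreover have "?surj ?p = ?h [^]\<^bsub>?E\<^esub> n \<ominus>\<^bsub>?E\<^esub> ?\<iota> s"
      unfolding root_alg_gen_def root_alg_const_def surj.hom_nat_pow[OF X, symmetric]
      by (subst (2) binomial_poly_def) (use X const in \<open>simp add: a_minus_def\<close>)
    ultimately show ?thesis using h s by simp
  qed
  show ?thesis
    using n s h pow by (intro binom_alg.intro[OF B] binom_alg_axioms.intro) auto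
qed

end

section \<open>Irreducibility of binomials\<close>

context root_field
begin

lemma inj_on_q_pow: "inj_on (\<lambda>i::nat. q [^] i) {..<n}"
  using q_pow_inj by (auto intro!: inj_onI)

lemma q_pow_pow_n: "(q [^] (i::nat)) [^] n = \<one>"
  using q_pow_eq_one_iff[of "i * n"] by (simp add: nat_pow_pow)

text \<open>The \<open>n\<close> powers of \<open>q\<close> are already roots of
  \<open>X^n - 1\<close>; another root would be one too many for the degree.\<close>

lemma root_of_unity_eq_q_pow:
  assumes y: "y \<in> carrier F" "y [^] n = \<one>"
  shows "\<exists>i<n. y = q [^] i"
proof (rule ccontr)
  assume "\<not> ?thesis"
  then have y': "y \<notin> (\<lambda>i::nat. q [^] i) ` {..<n}" by auto
  have n: "0 < n" using n2 by simp
  note bp = binomial_poly[OF n one_closed]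
  have "card (insert y ((\<lambda>i::nat. q [^] i) ` {..<n})) \<le> degree (binomial_poly F n \<one>)"
    using y q_pow_pow_n bp(4) by (intro mset_set_subset_roots(2)[OF bp(1,3)]) (auto simp: r_right_minus_eq)
  then show False using bp(2) y' card_image[OF inj_on_q_pow] by simp
qed

lemma eq_pow_of_pow_eq:
  assumes y: "y \<in> carrier F" "z \<in> carrier F" "z \<noteq> \<zero>" "y [^] n = z [^] n"
  shows "\<exists>i<n. y = q [^] i \<otimes> z"
proof -
  have z: "z \<in> Units F" using y by (simp add: field_Units)
  have zn: "z [^] n \<in> Units F" using z by (rule Units_pow_closed)
  have "(y \<otimes> inv z) [^] n \<otimes> z [^] n = (y \<otimes> inv z \<otimes> z) [^] n"
    using y z by (simp add: nat_pow_distrib)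
  also have "\<dots> = y [^] n" using y z by (simp add: m_assoc)
  finally have "(y \<otimes> inv z) [^] n \<otimes> z [^] n = \<one> \<otimes> z [^] n" using y by simp
  then have "(y \<otimes> inv z) [^] n = \<one>" using zn y z m_rcancel[of "z [^] n" "(y \<otimes> inv z) [^] n" \<one>] by (simp add: field_Units)
  then obtain i where i: "i < n" "y \<otimes> inv z = q [^] i" using root_of_unity_eq_q_pow[of "y \<otimes> inv z"] y z by auto
  have "y = y \<otimes> inv z \<otimes> z" using y z by (simp add: m_assoc)
  then show ?thesis using i by auto
qed

text \<open>Homomorphisms of fields are injective, so \<open>q\<close> stays primitive. This makes
  the statements on roots of unity available in extensions of \<open>F\<close>.\<close>

lemma root_field_hom:
  assumes "field L" "\<phi> \<in> ring_hom F L"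
  shows "root_field L n (\<phi> q)"
proof -
  interpret L: field L by fact
  interpret \<phi>: ring_hom_ring F L \<phi>
    using assms(2) by (intro ring_hom_ringI2) unfold_locales
  have inj: "inj_on \<phi> (carrier F)" using non_trivial_field_hom_is_inj[OF assms(2) field_axioms assms(1)] .
  have "primitive_root_of_unity L n (\<phi> q)"
    unfolding primitive_root_of_unity_def
  proof (intro conjI allI impI)
    show "\<phi> q [^]\<^bsub>L\<^esub> n = \<one>\<^bsub>L\<^esub>" using q_pow_n by (simp flip: \<phi>.hom_nat_pow)
    fix k :: nat assume k: "0 < k \<and> k < n"
    then have "q [^] k \<noteq> \<one>" using primitive by (auto simp: primitive_root_of_unity_def)
    then have "\<phi> (q [^] k) \<noteq> \<phi> \<one>" using inj_onD[OF inj, of "q [^] k" \<one>] by auto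
    then show "\<phi> q [^]\<^bsub>L\<^esub> k \<noteq> \<one>\<^bsub>L\<^esub>" by (simp add: \<phi>.hom_nat_pow)
  qed simp
  then show ?thesis using n2 by unfold_locales
qed

lemma not_power_if_field:
  assumes s: "s \<in> carrier F" and E: "field (root_alg F n s)"
  shows "s \<notin> (\<Union>m\<in>{m. m dvd n \<and> m \<noteq> 1}. mth_powers F m)"
proof
  let ?E = "root_alg F n s" and ?\<iota> = "root_alg_const F n s" and ?h = "root_alg_gen F n s"
  assume "s \<in> (\<Union>m\<in>{m. m dvd n \<and> m \<noteq> 1}. mth_powers F m)"
  then obtain m u where mu: "m dvd n" "m \<noteq> 1" "u \<in> carrier F" "s = u [^] m"
    by (auto simp: mth_powers_def)
  obtain k where k: "n = m * k" using mu(1) by auto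
  have k': "m * k = n" "k * m = n" by (simp_all add: k)
  have "0 < k" "1 < m" using k mu(2) n2 by (cases "k = 0"; cases "m = 0"; simp)+
  then have km: "0 < k" "k < n" using k by simp_all
  have n: "0 < n" using n2 by simp
  interpret E: binom_alg F ?E ?\<iota> n ?h s by (rule root_alg_binom_alg[OF n s])
  interpret Ef: field ?E by fact
  interpret Er: root_field ?E n "?\<iota> q" by (rule root_field_hom[OF E E.f_hom])
  \<comment> \<open>\<open>h\<^sup>k\<close> and \<open>u\<close> have the same \<open>n\<close>-th power, so \<open>h\<^sup>k\<close> is a root of unity times \<open>u\<close> and lies in \<open>F\<close>, although \<open>k < n\<close>.\<close>
  have "(?h [^]\<^bsub>?E\<^esub> k) [^]\<^bsub>?E\<^esub> m = ?h [^]\<^bsub>?E\<^esub> n" by (simp add: E.R.nat_pow_pow k')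
  also have "\<dots> = ?\<iota> u [^]\<^bsub>?E\<^esub> m" using E.g_pow_n E.f_pow[OF mu(3), of m, folded mu(4)] by simp
  finally have "((?h [^]\<^bsub>?E\<^esub> k) [^]\<^bsub>?E\<^esub> m) [^]\<^bsub>?E\<^esub> k = (?\<iota> u [^]\<^bsub>?E\<^esub> m) [^]\<^bsub>?E\<^esub> k" by simp
  then have eq: "(?h [^]\<^bsub>?E\<^esub> k) [^]\<^bsub>?E\<^esub> n = ?\<iota> u [^]\<^bsub>?E\<^esub> n"
    using mu(3) by (simp only: k' mult.commute[of n k] E.R.nat_pow_pow E.R.nat_pow_closed E.g_closed E.f.hom_closed)
  have "\<exists>c\<in>carrier F. ?h [^]\<^bsub>?E\<^esub> k = ?\<iota> c"
  \<comment> \<open>If \<open>u = 0\<close>, then \<open>h^k\<close> is nilpotent in a field, hence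
    zero. Otherwise \<open>u\<close> can be divided out and a root of unity remains.\<close>
  proof (cases "u = \<zero>")
    case True
    then have "(?h [^]\<^bsub>?E\<^esub> k) [^]\<^bsub>?E\<^esub> n = \<zero>\<^bsub>?E\<^esub>" using eq n E.R.nat_pow_zero by simp
    then have "(?h [^]\<^bsub>?E\<^esub> k) [^]\<^bsub>?E\<^esub> n \<notin> Units ?E" by (simp add: Ef.field_Units)
    then have "?h [^]\<^bsub>?E\<^esub> k \<notin> Units ?E" using E.R.Units_pow_closed by blast
    then have "?h [^]\<^bsub>?E\<^esub> k = \<zero>\<^bsub>?E\<^esub>" by (simp add: Ef.field_Units)
    then show ?thesis by (intro bexI[of _ \<zero>]) auto
  next
    case False
    then have "?\<iota> u \<noteq> \<zero>\<^bsub>?E\<^esub>" using mu(3) by simp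
    from Er.eq_pow_of_pow_eq[OF _ _ this eq] obtain i :: nat where "?h [^]\<^bsub>?E\<^esub> k = ?\<iota> q [^]\<^bsub>?E\<^esub> i \<otimes>\<^bsub>?E\<^esub> ?\<iota> u"
      using mu(3) by auto
    then show ?thesis using mu(3) by (intro bexI[of _ "q [^] i \<otimes> u"]) (auto simp: E.f_pow)
  qed
  then obtain c where c: "c \<in> carrier F" "?h [^]\<^bsub>?E\<^esub> k = ?\<iota> c \<otimes>\<^bsub>?E\<^esub> ?h [^]\<^bsub>?E\<^esub> (0::nat)"
    by auto
  \<comment> \<open>Since \<open>0 < k < n\<close>, the \<open>k\<close>-th coordinate of
    \<open>h^k\<close> is one, while that of the scalar \<open>c\<close> is zero.\<close>
  show False
    using E.co_basis1[of k k] E.co_basis[of 0 k c] km c by simp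
qed

text \<open>
  Over the field generated by a root \<open>\<alpha>\<close> of a proper irreducible factor, all roots of \<open>h\<^sup>n - s\<close> are
  \<open>q\<^sup>i \<alpha>\<close>. The constant term of the factor, of degree \<open>m\<close>, then shows \<open>\<alpha>\<^sup>m \<in> F\<close>; with \<open>g = gcd m n\<close>
  also \<open>\<alpha>\<^sup>g \<in> F\<close>, and \<open>s = (\<alpha>\<^sup>g)\<^sup>n\<^sup>/\<^sup>g\<close> is a proper power.
\<close>

lemma field_if_not_power:
  assumes s: "s \<in> carrier F" and np: "s \<notin> (\<Union>m\<in>{m. m dvd n \<and> m \<noteq> 1}. mth_powers F m)"
  shows "pirreducible\<^bsub>F\<^esub> (carrier F) (binomial_poly F n s)"
proof (rule ccontr)
  let ?p = "binomial_poly F n s"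
  have n: "0 < n" using n2 by simp
  note bp = binomial_poly[OF n s]
  \<comment> \<open>Zero is its own \<open>n\<close>-th power, and \<open>n\<close> is not
    1.\<close>
  have s0: "s \<noteq> \<zero>"
  proof
    assume "s = \<zero>"
    then have "s \<in> mth_powers F n" using n nat_pow_zero[of n] by (auto simp: mth_powers_def intro!: exI[of _ \<zero>])
    moreover have "n \<in> {m. m dvd n \<and> m \<noteq> 1}" using n2 by auto
    ultimately show False using np by blast
  qed
  interpret UP: principal_domain "poly_ring F" by (rule univ_poly_is_principal[OF carrier_is_subfield])
  assume "\<not> pirreducible\<^bsub>F\<^esub> (carrier F) ?p"
  moreover have "degree ?p \<noteq> 0" using bp(2) n by simp
  then have "?p \<notin> Units (poly_ring F)"
    by (simp add: univ_poly_units'[OF carrier_is_subfield])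
  ultimately obtain r1 r2 where r12: "r1 \<in> carrier (poly_ring F)" "r2 \<in> carrier (poly_ring F)"
    "?p = r1 \<otimes>\<^bsub>poly_ring F\<^esub> r2" "r1 \<notin> Units (poly_ring F)" "r2 \<notin> Units (poly_ring F)"
    using pirreducibleI[OF carrier_is_subring bp(1,3)] by blast
  have nz: "r1 \<noteq> []" "r2 \<noteq> []"
    using bp(3) r12 UP.l_null[OF r12(2)] UP.r_null[OF r12(1)] by (auto simp: univ_poly_zero)
  have "degree r1 \<noteq> 0" "degree r2 \<noteq> 0"
    using r12 nz by (simp_all add: univ_poly_units'[OF carrier_is_subfield])
  moreover have "n = degree r1 + degree r2"
    using bp(2) nz poly_mult_degree_eq[OF carrier_is_subring, of r1 r2] r12(1-3)
    by (simp add: univ_poly_mult univ_poly_carrier)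
  ultimately have deg1: "degree r1 < n" by simp
  have "r1 \<in> carrier (poly_ring F) - {\<zero>\<^bsub>poly_ring F\<^esub>}" using r12(1) nz(1) by (simp add: univ_poly_zero)
  from UP.exists_irreducible_divisor[OF this r12(4)]
  obtain r where r: "r \<in> carrier (poly_ring F)" "pirreducible\<^bsub>F\<^esub> (carrier F) r" "r divides\<^bsub>poly_ring F\<^esub> r1" .
  have rm: "degree r \<le> degree r1"
    using pdivides_imp_degree_le[OF carrier_is_subring r(1) r12(1) nz(1)] r(3) by (simp add: pdivides_def)
  define m where "m = degree r"
  have m: "0 < m" "m < n"
    using pirreducible_degree[OF carrier_is_subfield r(1,2)] rm deg1 by (simp_all add: m_def)
  have "r1 divides\<^bsub>poly_ring F\<^esub> ?p" using r12 by (auto simp: factor_def)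
  then have "r divides\<^bsub>poly_ring F\<^esub> ?p" using UP.divides_trans[OF r(3) _ r(1)] by simp
  then obtain w where w: "w \<in> carrier (poly_ring F)" "?p = r \<otimes>\<^bsub>poly_ring F\<^esub> w" by (auto simp: factor_def)
  \<comment> \<open>One root is enough: \<open>q\<close> lies in \<open>F\<close>, so
    \<open>L\<close> contains every \<open>q^i \<alpha>\<close> and the binomial splits
    there.\<close>
  define L where "L = Rupt\<^bsub>F\<^esub> (carrier F) r"
  define \<phi> where "\<phi> = (\<lambda>c. rupture_surj (carrier F) r (poly_of_const c))"
  define \<alpha> where "\<alpha> = rupture_surj (carrier F) r X"
  have L: "field L"
    unfolding L_def using rupture_is_field_iff_pirreducible[OF carrier_is_subfield r(1)] r(2) by simp
  interpret L: field L by fact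
  have \<phi>_hom: "\<phi> \<in> ring_hom F L" unfolding \<phi>_def L_def by (rule rupture_const_hom[OF r(1)])
  interpret \<phi>: ring_hom_ring F L \<phi> using \<phi>_hom by (intro ring_hom_ringI2) unfold_locales
  have inj: "inj_on \<phi> (carrier F)" using non_trivial_field_hom_is_inj[OF \<phi>_hom field_axioms L] .
  have \<phi>0: "\<phi> c = \<zero>\<^bsub>L\<^esub> \<longleftrightarrow> c = \<zero>" if "c \<in> carrier F" for c
    using inj_onD[OF inj, of c \<zero>] that by auto
  interpret Lr: root_field L n "\<phi> q" by (rule root_field_hom[OF L \<phi>_hom])
  interpret surj: ring_hom_ring "poly_ring F" L "rupture_surj (carrier F) r"
    unfolding L_def by (rule rupture_surj_hom(2)[OF carrier_is_subring r(1)])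
  have \<alpha>: "\<alpha> \<in> carrier L" unfolding \<alpha>_def using var_closed(1)[OF carrier_is_subring] by simp
  have \<phi>s: "\<phi> s \<in> carrier L" using s by simp
  note bp' = L.binomial_poly[OF n \<phi>s]
  define r' where "r' = map \<phi> r"
  have r': "r' \<in> carrier (poly_ring L)" "r' \<noteq> []" "degree r' = m"
    unfolding r'_def m_def using polynomial_hom[OF \<phi>_hom field_axioms L r(1)] m by (auto simp: m_def)
  have w': "map \<phi> w \<in> carrier (poly_ring L)"
    by (rule polynomial_hom[OF \<phi>_hom field_axioms L w(1)])
  have map_p: "map \<phi> ?p = binomial_poly L n (\<phi> s)"
    unfolding binomial_poly_eq[OF n s] L.binomial_poly_eq[OF n \<phi>s] using s by simp
  have sub: "set r \<subseteq> carrier F" "set w \<subseteq> carrier F"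
    using r(1) w(1) by (auto simp: univ_poly_carrier[symmetric] polynomial_def)
  have "L.normalize (map \<phi> ?p) = L.poly_mult r' (map \<phi> w)"
    unfolding w(2) univ_poly_mult r'_def by (rule \<phi>.poly_mult_hom'[OF sub])
  moreover have "L.normalize (binomial_poly L n (\<phi> s)) = binomial_poly L n (\<phi> s)"
    using bp'(1) by (intro L.normalize_polynomial) (simp add: univ_poly_carrier)
  ultimately have p': "binomial_poly L n (\<phi> s) = r' \<otimes>\<^bsub>poly_ring L\<^esub> map \<phi> w"
    by (simp add: map_p univ_poly_mult)
  then have dvd: "r' pdivides\<^bsub>L\<^esub> binomial_poly L n (\<phi> s)"
    using w' by (auto simp: pdivides_def factor_def)
  have "L.eval r' \<alpha> = \<zero>\<^bsub>L\<^esub>"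
    unfolding r'_def \<alpha>_def \<phi>_def L_def using polynomial_rupture[OF carrier_is_subring r(1)] by (simp add: comp_def)
  then have "L.eval (binomial_poly L n (\<phi> s)) \<alpha> = \<zero>\<^bsub>L\<^esub>"
    by (rule L.pdivides_imp_root_sharing[OF r'(1) dvd \<alpha>])
  then have \<alpha>n: "\<alpha> [^]\<^bsub>L\<^esub> n = \<phi> s" using bp'(4)[OF \<alpha>] \<alpha> \<phi>s by (simp add: L.r_right_minus_eq)
  have \<alpha>0: "\<alpha> \<noteq> \<zero>\<^bsub>L\<^esub>" using \<alpha>n \<phi>0[OF s] s0 n L.nat_pow_zero by auto
  define S where "S = (\<lambda>i::nat. \<phi> q [^]\<^bsub>L\<^esub> i \<otimes>\<^bsub>L\<^esub> \<alpha>) ` {..<n}"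
  have S: "finite S" "S \<subseteq> carrier L" using \<alpha> by (auto simp: S_def)
  have cardS: "card S = n"
  proof -
    have "inj_on (\<lambda>i::nat. \<phi> q [^]\<^bsub>L\<^esub> i \<otimes>\<^bsub>L\<^esub> \<alpha>) {..<n}"
      using \<alpha> \<alpha>0 Lr.q_pow_inj by (intro inj_onI) (simp add: L.m_rcancel)
    then show ?thesis by (simp add: S_def card_image)
  qed
  have "L.eval (binomial_poly L n (\<phi> s)) y = \<zero>\<^bsub>L\<^esub>" if yS: "y \<in> S" for y
  proof -
    obtain i :: nat where y: "y = \<phi> q [^]\<^bsub>L\<^esub> i \<otimes>\<^bsub>L\<^esub> \<alpha>" using yS by (auto simp: S_def)
    have "y [^]\<^bsub>L\<^esub> n = \<phi> s"
      unfolding y using \<alpha> \<alpha>n Lr.q_pow_pow_n \<phi>s by (simp add: L.nat_pow_distrib)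
    then show ?thesis using bp'(4)[OF subsetD[OF S(2) yS]] \<phi>s L.r_right_minus_eq[of "\<phi> s" "\<phi> s"] by simp
  qed
  from L.mset_set_subset_roots(1)[OF bp'(1,3) S this]
  have subm: "mset_set S \<subseteq># L.roots (binomial_poly L n (\<phi> s))" .
  \<comment> \<open>The \<open>n\<close> distinct elements of \<open>S\<close> exhaust the degree,
    so they are all the roots and each is simple. The divisor \<open>r'\<close> then splits too,
    with roots in \<open>S\<close>.\<close>
  have "size (L.roots (binomial_poly L n (\<phi> s))) \<le> size (mset_set S)"
    using L.size_roots_le_degree[OF bp'(1)] bp'(2) cardS by simp
  with subm have rts: "L.roots (binomial_poly L n (\<phi> s)) = mset_set S"
    by (metis mset_subset_size subset_mset.le_imp_less_or_eq not_less)
  have "L.splitted (binomial_poly L n (\<phi> s))"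
    unfolding L.splitted_def rts bp'(2) using cardS by simp
  then have spl: "L.splitted r'" using L.pdivides_imp_splitted[OF r'(1) bp'(1,3) _ dvd] by simp
  have rts': "y \<in> S" if "y \<in># L.roots r'" for y
    using mset_subset_eqD[OF L.pdivides_imp_roots_incl[OF r'(1) bp'(1,3) dvd] that] rts S(1) by simp
  \<comment> \<open>With \<open>U\<close> the nonzero scalars, a negated root
    \<open>-q^i \<alpha>\<close> lies in \<open>U \<alpha>\<close>.\<close>
  define U where "U = \<phi> ` (carrier F - {\<zero>})"
  have "\<exists>u\<in>U. L.const_term r' = lead_coeff r' \<otimes>\<^bsub>L\<^esub> (u \<otimes>\<^bsub>L\<^esub> \<alpha> [^]\<^bsub>L\<^esub> degree r')"
  proof (rule L.splitted_const_term[OF _ _ _ \<alpha> r'(1,2) spl])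
    show "U \<subseteq> carrier L" by (auto simp: U_def)
    show "\<one>\<^bsub>L\<^esub> \<in> U" unfolding U_def by (rule image_eqI[of _ _ \<one>]) auto
    show "u \<otimes>\<^bsub>L\<^esub> v \<in> U" if uv: "u \<in> U" "v \<in> U" for u v
    proof -
      obtain c d where "c \<in> carrier F" "c \<noteq> \<zero>" "u = \<phi> c" "d \<in> carrier F" "d \<noteq> \<zero>" "v = \<phi> d"
        using uv by (auto simp: U_def)
      then show ?thesis unfolding U_def by (intro image_eqI[of _ _ "c \<otimes> d"]) (auto simp: integral_iff)
    qed
    show "\<exists>u\<in>U. \<ominus>\<^bsub>L\<^esub> y = u \<otimes>\<^bsub>L\<^esub> \<alpha>" if yr: "y \<in># L.roots r'" for y
    proof -
      obtain i :: nat where y: "y = \<phi> q [^]\<^bsub>L\<^esub> i \<otimes>\<^bsub>L\<^esub> \<alpha>" using rts'[OF yr] by (auto simp: S_def)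
      have "\<ominus> (q [^] i) \<noteq> \<zero>"
        using Units_pow_closed[OF q_Units, of i] by (simp add: field_Units)
      then have "\<phi> (\<ominus> (q [^] i)) \<in> U" unfolding U_def by (intro imageI) simp
      moreover have "\<ominus>\<^bsub>L\<^esub> y = \<phi> (\<ominus> (q [^] i)) \<otimes>\<^bsub>L\<^esub> \<alpha>"
        unfolding y using \<alpha> by (simp add: \<phi>.hom_nat_pow L.l_minus)
      ultimately show ?thesis by blast
    qed
  qed
  then obtain c where c: "c \<in> carrier F" "c \<noteq> \<zero>"
    and ct: "L.const_term r' = lead_coeff r' \<otimes>\<^bsub>L\<^esub> (\<phi> c \<otimes>\<^bsub>L\<^esub> \<alpha> [^]\<^bsub>L\<^esub> m)"
    unfolding r'(3) U_def by auto
  \<comment> \<open>Leading coefficient and constant term of \<open>r\<close> lie in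
    \<open>F\<close>, so a nonzero scalar multiple of \<open>\<alpha>^m\<close> does as
    well.\<close>
  have "r \<noteq> []" using m by (auto simp: m_def)
  moreover from this have "lead_coeff r \<in> carrier F" "lead_coeff r \<noteq> \<zero>"
    using r(1) sub(1) by (auto simp: univ_poly_carrier[symmetric] polynomial_def)
  moreover have "L.const_term r' = \<phi> (const_term r)"
    unfolding L.const_term_def const_term_def r'_def using \<phi>.eval_hom'[OF zero_closed sub(1)] by simp
  moreover have "const_term r \<in> carrier F"
    by (rule const_term_simprules_shell(1)[OF carrier_is_subring r(1)])
  moreover have "lead_coeff r' = \<phi> (lead_coeff r)" using \<open>r \<noteq> []\<close> by (simp add: r'_def hd_map)
  ultimately obtain c1 c2 where c12: "c1 \<in> carrier F" "c2 \<in> carrier F" "c2 \<noteq> \<zero>"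
    "\<phi> c1 = \<phi> c2 \<otimes>\<^bsub>L\<^esub> \<alpha> [^]\<^bsub>L\<^esub> m"
    using ct c \<alpha> by (intro that[of "const_term r" "lead_coeff r \<otimes> c"]) (auto simp: L.m_assoc integral_iff)
  \<comment> \<open>An element of \<open>L\<close> with a nonzero scalar multiple in
    \<open>F\<close> lies in \<open>F\<close>; needed for \<open>\<alpha>^m\<close> and then for
    \<open>\<alpha>^g\<close>.\<close>
  have quot: "\<exists>d\<in>carrier F. z = \<phi> d" if z: "z \<in> carrier L" "c1 \<in> carrier F" "c2 \<in> carrier F" "c2 \<noteq> \<zero>" "\<phi> c1 = \<phi> c2 \<otimes>\<^bsub>L\<^esub> z" for z c1 c2
  proof -
    have u: "c2 \<in> Units F" using z by (simp add: field_Units)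
    have "\<phi> (inv c2 \<otimes> c1) = \<phi> (inv c2) \<otimes>\<^bsub>L\<^esub> \<phi> c2 \<otimes>\<^bsub>L\<^esub> z" using z u by (simp add: L.m_assoc)
    also have "\<dots> = z" using u z by (simp flip: \<phi>.hom_mult)
    finally show ?thesis using u z by (intro bexI[of _ "inv c2 \<otimes> c1"]) auto
  qed
  obtain d where d: "d \<in> carrier F" "\<alpha> [^]\<^bsub>L\<^esub> m = \<phi> d" using quot[OF _ c12] \<alpha> by auto
  define g where "g = gcd m n"
  \<comment> \<open>Bezout without negative exponents:
    \<open>(\<alpha>^m)^u = s^v \<alpha>^g\<close>, with a nonzero factor
    \<open>s^v\<close>.\<close>
  obtain u v where uv: "m * u = n * v + g" using bezout_nat[of m n] m(1) by (auto simp: g_def)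
  have "\<phi> (d [^] u) = \<phi> (s [^] v) \<otimes>\<^bsub>L\<^esub> \<alpha> [^]\<^bsub>L\<^esub> g"
  proof -
    have "\<phi> (d [^] u) = \<alpha> [^]\<^bsub>L\<^esub> (m * u)" using d \<alpha> by (simp add: \<phi>.hom_nat_pow L.nat_pow_pow[symmetric])
    also have "\<dots> = (\<alpha> [^]\<^bsub>L\<^esub> n) [^]\<^bsub>L\<^esub> v \<otimes>\<^bsub>L\<^esub> \<alpha> [^]\<^bsub>L\<^esub> g"
      unfolding uv using \<alpha> by (simp add: L.nat_pow_mult[symmetric] L.nat_pow_pow)
    finally show ?thesis using \<alpha>n s by (simp add: \<phi>.hom_nat_pow)
  qed
  moreover have "s [^] v \<noteq> \<zero>"
  proof -
    have "s \<in> Units F" using s s0 by (simp add: field_Units)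
    from Units_pow_closed[OF this, of v] show ?thesis by (simp add: field_Units)
  qed
  ultimately obtain e where e: "e \<in> carrier F" "\<alpha> [^]\<^bsub>L\<^esub> g = \<phi> e"
    using quot[of "\<alpha> [^]\<^bsub>L\<^esub> g" "d [^] u" "s [^] v"] d s \<alpha> by auto
  \<comment> \<open>From \<open>g \<le> m < n\<close> the cofactor \<open>k = n / g\<close> is
    different from 1, so \<open>s = e^k\<close> contradicts the assumption.\<close>
  have g: "g dvd n" "g < n" using m by (auto simp: g_def intro: le_less_trans[OF gcd_le1_nat])
  then obtain k where k: "n = g * k" by auto
  have "\<phi> s = \<phi> (e [^] k)"
    unfolding \<phi>.hom_nat_pow[OF e(1)] e(2)[symmetric] \<alpha>n[symmetric] k using \<alpha> by (simp add: L.nat_pow_pow)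
  then have "s = e [^] k" using inj s e by (auto dest: inj_onD)
  then have "s \<in> mth_powers F k" using e by (auto simp: mth_powers_def)
  moreover have "k dvd n" "k \<noteq> 1" using k g by auto
  ultimately show False using np by blast
qed

theorem irreducible_iff:
  assumes "s \<in> carrier F"
  shows "pirreducible\<^bsub>F\<^esub> (carrier F) (binomial_poly F n s) \<longleftrightarrow>
    s \<notin> (\<Union>m\<in>{m. m dvd n \<and> m \<noteq> 1}. mth_powers F m)"
    "pirreducible\<^bsub>F\<^esub> (carrier F) (binomial_poly F n s) \<longleftrightarrow> field (root_alg F n s)"
proof -
  have n: "0 < n" using n2 by simp
  show *: "pirreducible\<^bsub>F\<^esub> (carrier F) (binomial_poly F n s) \<longleftrightarrow> field (root_alg F n s)"
    unfolding root_alg_def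
    using rupture_is_field_iff_pirreducible[OF carrier_is_subfield binomial_poly(1)[OF n assms]] by simp
  show "pirreducible\<^bsub>F\<^esub> (carrier F) (binomial_poly F n s) \<longleftrightarrow>
    s \<notin> (\<Union>m\<in>{m. m dvd n \<and> m \<noteq> 1}. mth_powers F m)"
    using * field_if_not_power[OF assms] not_power_if_field[OF assms] by blast
qed

end

section \<open>Kummer extensions\<close>

lemma mem_aut_group:
  "\<tau> \<in> carrier (aut_group R K) \<longleftrightarrow> \<tau> \<in> Bij (carrier R) \<and> \<tau> \<in> ring_hom R R \<and> (\<forall>c\<in>K. \<tau> c = c)"
  by (simp add: aut_group_def)

lemma aut_group_mult:
  "\<lbrakk>\<tau> \<in> carrier (aut_group R K); \<rho> \<in> carrier (aut_group R K)\<rbrakk> \<Longrightarrow>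
    \<tau> \<otimes>\<^bsub>aut_group R K\<^esub> \<rho> = compose (carrier R) \<tau> \<rho>"
  by (simp add: aut_group_def BijGroup_def)

lemma aut_group_one: "\<one>\<^bsub>aut_group R K\<^esub> = (\<lambda>x\<in>carrier R. x)"
  by (simp add: aut_group_def BijGroup_def)

lemma (in ring) aut_group_group:
  assumes K: "K \<subseteq> carrier R"
  shows "group (aut_group R K)"
proof -
  let ?H = "{\<tau> \<in> Bij (carrier R). \<tau> \<in> ring_hom R R \<and> (\<forall>c\<in>K. \<tau> c = c)}"
  interpret B: group "BijGroup (carrier R)" by (rule group_BijGroup)
  have B: "carrier (BijGroup (carrier R)) = Bij (carrier R)" by (simp add: BijGroup_def)
  have "subgroup ?H (BijGroup (carrier R))"
  proof (rule B.subgroupI)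
    show "?H \<subseteq> carrier (BijGroup (carrier R))" by (auto simp: B)
    have "(\<lambda>x\<in>carrier R. x) \<in> ?H" using K by (auto simp: id_Bij intro!: ring_hom_memI)
    then show "?H \<noteq> {}" by blast
  next
    fix \<tau> assume \<tau>: "\<tau> \<in> ?H"
    define \<rho> where "\<rho> = (\<lambda>x\<in>carrier R. inv_into (carrier R) \<tau> x)"
    have bij: "bij_betw \<tau> (carrier R) (carrier R)" using \<tau> by (auto simp: Bij_def)
    have \<tau>\<rho>: "\<tau> (\<rho> x) = x" "\<rho> x \<in> carrier R" if "x \<in> carrier R" for x
      using that bij by (auto simp: \<rho>_def bij_betw_def f_inv_into_f inv_into_into)
    have inj: "x = y" if "\<tau> x = \<tau> y" "x \<in> carrier R" "y \<in> carrier R" for x y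
      using that bij by (auto simp: bij_betw_def dest: inj_onD)
    have hom: "\<tau> (x \<otimes> y) = \<tau> x \<otimes> \<tau> y" "\<tau> (x \<oplus> y) = \<tau> x \<oplus> \<tau> y" "\<tau> \<one> = \<one>"
      if "x \<in> carrier R" "y \<in> carrier R" for x y
      using \<tau> that by (auto simp: ring_hom_def)
    have "\<rho> \<in> ring_hom R R"
    proof (rule ring_hom_memI)
      fix x y assume xy: "x \<in> carrier R" "y \<in> carrier R"
      show "\<rho> x \<in> carrier R" by (rule \<tau>\<rho>(2)[OF xy(1)])
      show "\<rho> (x \<otimes> y) = \<rho> x \<otimes> \<rho> y" by (rule inj) (use xy \<tau>\<rho> hom in auto)
      show "\<rho> (x \<oplus> y) = \<rho> x \<oplus> \<rho> y" by (rule inj) (use xy \<tau>\<rho> hom in auto)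
    next
      show "\<rho> \<one> = \<one>" by (rule inj) (use \<tau>\<rho> hom(3)[of \<one> \<one>] in auto)
    qed
    moreover have "\<rho> c = c" if "c \<in> K" for c
      by (rule inj) (use that \<tau> K \<tau>\<rho> in auto)
    moreover have "\<rho> \<in> Bij (carrier R)" unfolding \<rho>_def using \<tau> by (intro restrict_inv_into_Bij) auto
    ultimately have "\<rho> \<in> ?H" by blast
    moreover have "inv\<^bsub>BijGroup (carrier R)\<^esub> \<tau> = \<rho>" unfolding \<rho>_def using \<tau> by (intro inv_BijGroup) auto
    ultimately show "inv\<^bsub>BijGroup (carrier R)\<^esub> \<tau> \<in> ?H" by simp
  next
    fix \<tau> \<rho> assume \<tau>: "\<tau> \<in> ?H" and \<rho>: "\<rho> \<in> ?H"
    have "compose (carrier R) \<tau> \<rho> \<in> ring_hom R R"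
      using \<tau> \<rho> by (intro ring_hom_memI) (auto simp: compose_def ring_hom_def Pi_def)
    moreover have "compose (carrier R) \<tau> \<rho> c = c" if "c \<in> K" for c
      using that \<tau> \<rho> K by (auto simp: compose_def)
    ultimately show "\<tau> \<otimes>\<^bsub>BijGroup (carrier R)\<^esub> \<rho> \<in> ?H"
      using \<tau> \<rho> by (auto simp: BijGroup_def compose_Bij)
  qed
  then show ?thesis unfolding aut_group_def by (rule subgroup.subgroup_is_group) (rule group_BijGroup)
qed

lemma aut_group_pow:
  assumes "group (aut_group R K)" "\<tau> \<in> carrier (aut_group R K)" "x \<in> carrier R"
  shows "(\<tau> [^]\<^bsub>aut_group R K\<^esub> (k::nat)) x = (\<tau> ^^ k) x"
  using assms(3)
proof (induct k arbitrary: x)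
  interpret G: group "aut_group R K" by fact
  case 0
  then show ?case by (simp add: aut_group_one)
next
  interpret G: group "aut_group R K" by fact
  case (Suc k)
  have "\<tau> x \<in> carrier R" using assms(2) Suc(2) by (auto simp: mem_aut_group ring_hom_def)
  have "(\<tau> [^]\<^bsub>aut_group R K\<^esub> Suc k) x = (\<tau> [^]\<^bsub>aut_group R K\<^esub> k) (\<tau> x)"
    using assms(2) Suc(2) by (simp add: aut_group_mult compose_def)
  also have "\<dots> = (\<tau> ^^ k) (\<tau> x)" using \<open>\<tau> x \<in> carrier R\<close> by (rule Suc(1))
  finally show ?case by (simp add: funpow_swap1)
qed

section \<open>The Galois group of a Kummer extension\<close>

locale kummer_field = root_field F n q + binom_alg F L f n g t + L: field L
  for F :: "('a, 'm) ring_scheme" and n :: nat and q :: 'a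
    and L :: "('b, 'n) ring_scheme" and f :: "'a \<Rightarrow> 'b" and g :: 'b and t :: 'a
begin

abbreviation "K \<equiv> f ` carrier F"
abbreviation "G \<equiv> aut_group L K"

lemma G_group: "group G"
  by (rule R.aut_group_group) auto

lemma g_nonzero: "g \<noteq> \<zero>\<^bsub>L\<^esub>"
  using co_basis1[of 1 1] co_zero[of 1] n2 by auto

lemma aut_el:
  assumes \<tau>: "\<tau> \<in> carrier G" and c: "c \<in> {..<n} \<rightarrow> carrier F"
  shows "\<tau> (el c) = lc (\<lambda>i. \<tau> g [^]\<^bsub>L\<^esub> i) {..<n} c"
proof -
  have hom: "\<tau> \<in> ring_hom L L" and fix_K: "\<And>c. c \<in> carrier F \<Longrightarrow> \<tau> (f c) = f c"
    using \<tau> by (auto simp: mem_aut_group)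
  interpret \<tau>: ring_hom_ring L L \<tau>
    using hom by (intro ring_hom_ringI2) (simp_all add: R.ring_axioms)
  have cc: "c i \<in> carrier F" if "i < n" for i using c that by auto
  have "\<tau> (el c) = (\<Oplus>\<^bsub>L\<^esub>i\<in>{..<n}. \<tau> (f (c i) \<otimes>\<^bsub>L\<^esub> g [^]\<^bsub>L\<^esub> i))"
    unfolding lc_def using cc
    by (intro additive_finsum) (auto simp: R.abelian_group_axioms)
  also have "\<dots> = lc (\<lambda>i. \<tau> g [^]\<^bsub>L\<^esub> i) {..<n} c"
    unfolding lc_def using cc
    by (intro R.finsum_cong') (auto simp: fix_K \<tau>.hom_nat_pow)
  finally show ?thesis .
qed

text \<open>\<open>g\<close> generates, and members of \<open>aut_group\<close> are extensional, so
  agreement on the carrier is equality of functions.\<close>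

lemma aut_eqI:
  assumes \<tau>: "\<tau> \<in> carrier G" and \<rho>: "\<rho> \<in> carrier G" and eq: "\<tau> g = \<rho> g"
  shows "\<tau> = \<rho>"
proof (rule extensionalityI)
  show "\<tau> \<in> extensional (carrier L)" "\<rho> \<in> extensional (carrier L)"
    using \<tau> \<rho> by (auto simp: mem_aut_group Bij_def)
  fix r assume "r \<in> carrier L"
  then show "\<tau> r = \<rho> r" using aut_el[OF \<tau> co(1)] aut_el[OF \<rho> co(1)] co(2) eq by metis
qed

lemma root_field_L: "root_field L n (f q)"
  using root_field_hom[OF L.field_axioms f_hom] .

text \<open>An automorphism fixes \<open>g^n = t\<close>, so the image of \<open>g\<close> has the
  same \<open>n\<close>-th power as \<open>g\<close>.\<close>

lemma aut_g:
  assumes \<tau>: "\<tau> \<in> carrier G"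
  shows "\<exists>i<n. \<tau> g = f (q [^]\<^bsub>F\<^esub> i) \<otimes>\<^bsub>L\<^esub> g"
proof -
  interpret L: root_field L n "f q" by (rule root_field_L)
  have hom: "\<tau> \<in> ring_hom L L" and fix_K: "\<And>c. c \<in> carrier F \<Longrightarrow> \<tau> (f c) = f c"
    using \<tau> by (auto simp: mem_aut_group)
  interpret \<tau>: ring_hom_ring L L \<tau>
    using hom by (intro ring_hom_ringI2) (simp_all add: R.ring_axioms)
  have "\<tau> g [^]\<^bsub>L\<^esub> n = \<tau> (g [^]\<^bsub>L\<^esub> n)" by (simp add: \<tau>.hom_nat_pow)
  also have "\<dots> = g [^]\<^bsub>L\<^esub> n" by (simp add: g_pow_n fix_K)
  finally show ?thesis
    using L.eq_pow_of_pow_eq[of "\<tau> g" g] g_nonzero by (auto simp: f_pow)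
qed

lemma funpow_g:
  assumes \<rho>: "\<rho> \<in> carrier G" "\<rho> g = f q \<otimes>\<^bsub>L\<^esub> g"
  shows "(\<rho> ^^ k) g = f (q [^]\<^bsub>F\<^esub> k) \<otimes>\<^bsub>L\<^esub> g"
proof (induct k)
  case (Suc k)
  have hom: "\<rho> \<in> ring_hom L L" and fix_K: "\<And>c. c \<in> carrier F \<Longrightarrow> \<rho> (f c) = f c"
    using \<rho> by (auto simp: mem_aut_group)
  have "\<rho> (f (q [^]\<^bsub>F\<^esub> k) \<otimes>\<^bsub>L\<^esub> g) = f (q [^]\<^bsub>F\<^esub> k) \<otimes>\<^bsub>L\<^esub> (f q \<otimes>\<^bsub>L\<^esub> g)"
    using ring_hom_mult[OF hom] \<rho>(2) by (simp add: fix_K)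
  also have "\<dots> = f (q [^]\<^bsub>F\<^esub> Suc k) \<otimes>\<^bsub>L\<^esub> g" by (subst f_mult_f) auto
  finally show ?case using Suc by simp
qed simp

lemma q_pow_g_inj:
  "f (q [^]\<^bsub>F\<^esub> (i::nat)) \<otimes>\<^bsub>L\<^esub> g = f (q [^]\<^bsub>F\<^esub> (j::nat)) \<otimes>\<^bsub>L\<^esub> g \<longleftrightarrow> q [^]\<^bsub>F\<^esub> i = q [^]\<^bsub>F\<^esub> j"
  using L.m_rcancel[of g "f (q [^]\<^bsub>F\<^esub> i)" "f (q [^]\<^bsub>F\<^esub> j)"] g_nonzero by simp

text \<open>An automorphism is determined by the root of unity \<open>q^i\<close> by which it scales
  \<open>g\<close>, and \<open>\<rho>^k\<close> scales by \<open>q^k\<close>. So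
  \<open>\<rho>\<close> has order \<open>n\<close> and its powers are all automorphisms. If
  \<open>\<rho>\<close> fixes an element with coordinates \<open>c i\<close>, then
  \<open>c i = c i q^i\<close>, which leaves only \<open>c 0\<close>.\<close>

lemma galois_generated:
  assumes \<rho>: "\<rho> \<in> carrier G" "\<rho> g = f q \<otimes>\<^bsub>L\<^esub> g"
  shows "galois_extension L K" "cyclic_group G" "carrier G = generate G {\<rho>}"
    "group.ord G \<rho> = n" "order G = n"
proof -
  interpret G: group G by (rule G_group)
  have pow_g: "(\<rho> [^]\<^bsub>G\<^esub> k) g = f (q [^]\<^bsub>F\<^esub> k) \<otimes>\<^bsub>L\<^esub> g" for k :: nat
    using aut_group_pow[OF G_group \<rho>(1), of g] funpow_g[OF \<rho>] by simp
  have "\<rho> [^]\<^bsub>G\<^esub> k = \<one>\<^bsub>G\<^esub> \<longleftrightarrow> n dvd k" for k :: nat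
  proof -
    have "\<rho> [^]\<^bsub>G\<^esub> k = \<one>\<^bsub>G\<^esub> \<longleftrightarrow> (\<rho> [^]\<^bsub>G\<^esub> k) g = \<one>\<^bsub>G\<^esub> g"
      using aut_eqI[of "\<rho> [^]\<^bsub>G\<^esub> k" "\<one>\<^bsub>G\<^esub>"] \<rho>(1) by auto
    also have "\<dots> \<longleftrightarrow> f (q [^]\<^bsub>F\<^esub> k) \<otimes>\<^bsub>L\<^esub> g = f (q [^]\<^bsub>F\<^esub> (0::nat)) \<otimes>\<^bsub>L\<^esub> g"
      unfolding pow_g by (simp add: aut_group_one)
    also have "\<dots> \<longleftrightarrow> n dvd k" unfolding q_pow_g_inj using q_pow_eq_one_iff by simp
    finally show ?thesis .
  qed
  then have dvd: "G.ord \<rho> dvd k \<longleftrightarrow> n dvd k" for k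
    using G.pow_eq_id[OF \<rho>(1)] by simp
  show ord: "G.ord \<rho> = n"
    using dvd[of n] dvd[of "G.ord \<rho>"] by (intro dvd_antisym) simp_all
  have pow: "\<exists>i::nat. \<tau> = \<rho> [^]\<^bsub>G\<^esub> i" if \<tau>: "\<tau> \<in> carrier G" for \<tau>
  proof -
    obtain i :: nat where "\<tau> g = f (q [^]\<^bsub>F\<^esub> i) \<otimes>\<^bsub>L\<^esub> g" using aut_g[OF \<tau>] by auto
    then have "\<tau> g = (\<rho> [^]\<^bsub>G\<^esub> i) g" unfolding pow_g .
    then show ?thesis using aut_eqI[OF \<tau>] \<rho>(1) by blast
  qed
  have gen: "carrier G = {\<rho> [^]\<^bsub>G\<^esub> (k :: int) |k. k \<in> UNIV}"
  proof (intro subset_antisym subsetI)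
    fix \<tau> assume "\<tau> \<in> carrier G"
    then obtain i :: nat where "\<tau> = \<rho> [^]\<^bsub>G\<^esub> i" using pow by blast
    then have "\<tau> = \<rho> [^]\<^bsub>G\<^esub> int i" by (simp add: int_pow_int)
    then show "\<tau> \<in> {\<rho> [^]\<^bsub>G\<^esub> (k :: int) |k. k \<in> UNIV}" by blast
  qed (use \<rho>(1) G.int_pow_closed in auto)
  then show *: "carrier G = generate G {\<rho>}" using G.generate_pow[OF \<rho>(1)] by simp
  show "order G = n" using G.generate_pow_card[OF \<rho>(1)] ord * by (simp add: order_def)
  have "carrier G = range (\<lambda>k::int. \<rho> [^]\<^bsub>G\<^esub> k)" using gen by auto
  then show "cyclic_group G" unfolding G.cyclic_group using \<rho>(1) by blast
  have "x \<in> K" if x: "x \<in> carrier L" and fixed: "\<And>\<tau>. \<tau> \<in> carrier G \<Longrightarrow> \<tau> x = x" for x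
  proof -
    have "f q \<otimes>\<^bsub>L\<^esub> g \<in> carrier L" by simp
    have pw: "(f q \<otimes>\<^bsub>L\<^esub> g) [^]\<^bsub>L\<^esub> i = f (q [^]\<^bsub>F\<^esub> i) \<otimes>\<^bsub>L\<^esub> g [^]\<^bsub>L\<^esub> i" for i :: nat
      by (simp add: L.nat_pow_distrib f_pow)
    have "x = \<rho> (el (co x))" using fixed[OF \<rho>(1)] co(2)[OF x] by simp
    also have "\<dots> = lc (\<lambda>i. f (q [^]\<^bsub>F\<^esub> i) \<otimes>\<^bsub>L\<^esub> g [^]\<^bsub>L\<^esub> i) {..<n} (co x)"
      unfolding aut_el[OF \<rho>(1) co(1)[OF x]] \<rho>(2) pw ..
    also have "\<dots> = el (\<lambda>i. co x i \<otimes>\<^bsub>F\<^esub> q [^]\<^bsub>F\<^esub> i)"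
      unfolding lc_def using co_closed[OF x] by (intro R.finsum_cong') (auto simp: R.m_assoc)
    finally have eq: "x = el (\<lambda>i. co x i \<otimes>\<^bsub>F\<^esub> q [^]\<^bsub>F\<^esub> i)" .
    have "co x i = \<zero>\<^bsub>F\<^esub>" if i: "i < n" "i \<noteq> 0" for i
    proof (rule ccontr)
      assume nz: "co x i \<noteq> \<zero>\<^bsub>F\<^esub>"
      have cx: "co x i \<in> carrier F" using co_closed[OF x, of i] i by simp
      have "co x i = co x i \<otimes>\<^bsub>F\<^esub> q [^]\<^bsub>F\<^esub> i"
        using co_eqI[OF _ eq, of i] co_closed[OF x] i by auto
      then have "co x i \<otimes>\<^bsub>F\<^esub> q [^]\<^bsub>F\<^esub> i = co x i \<otimes>\<^bsub>F\<^esub> \<one>\<^bsub>F\<^esub>" using cx by simp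
      then have "q [^]\<^bsub>F\<^esub> i = \<one>\<^bsub>F\<^esub>" using nz cx m_lcancel[of "co x i" "q [^]\<^bsub>F\<^esub> i" "\<one>\<^bsub>F\<^esub>"] by simp
      then show False using q_pow_eq_one_iff i by (auto dest: dvd_imp_le)
    qed
    then have "el (co x) = el (\<lambda>i. if i = 0 then co x 0 else \<zero>\<^bsub>F\<^esub>)"
      using co(1)[OF x] b_closed by (intro lc_cong) auto
    also have "\<dots> = f (co x 0) \<otimes>\<^bsub>L\<^esub> g [^]\<^bsub>L\<^esub> (0::nat)"
      using n_pos co_closed[OF x] by (intro lc_single[OF b_closed finite_I]) auto
    finally have "x = f (co x 0)" using co(2)[OF x] co_closed[OF x, of 0] n_pos by simp
    then show ?thesis using co_closed[OF x, of 0] n_pos by auto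
  qed
  then have "{x \<in> carrier L. \<forall>\<tau>\<in>carrier G. \<tau> x = x} = K"
    by (auto simp: mem_aut_group)
  moreover have "R.finite_dimension K (carrier L)"
    using dimension_carrier unfolding R.finite_dimension_def by blast
  ultimately show "galois_extension L K"
    unfolding galois_extension_def using L.field_axioms subfield_image by blast
qed

lemma dimension_L: "R.dimension n K (carrier L)"
  using dimension_carrier by simp

text \<open>The diagonal operator \<open>g^i \<mapsto> q^i g^i\<close>, restricted to the carrier so
  that it is extensional. It supplies a generator where no automorphism is given in advance, namely
  for the copy of \<open>E\<close> inside the algebra.\<close>

lemma exists_generator: "\<exists>\<rho>\<in>carrier G. \<rho> g = f q \<otimes>\<^bsub>L\<^esub> g"
proof -
  define d where "d i = q [^]\<^bsub>F\<^esub> i" for i :: nat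
  define e where "e i = q [^]\<^bsub>F\<^esub> ((n - 1) * i)" for i :: nat
  have d: "character d"
  proof -
    have "d ((i + j) mod n) = d i \<otimes>\<^bsub>F\<^esub> d j" for i j
      unfolding d_def q_pow_mod by (simp add: nat_pow_mult)
    then show ?thesis by (auto simp: character_def d_def)
  qed
  have dI: "d \<in> {..<n} \<rightarrow> carrier F" by (simp add: d_def)
  have e: "e \<in> {..<n} \<rightarrow> carrier F" by (simp add: e_def)
  have de: "d i \<otimes>\<^bsub>F\<^esub> e i = \<one>\<^bsub>F\<^esub>" for i
  proof -
    obtain k where "n = Suc k" using n_pos by (cases n) auto
    then have "i + (n - 1) * i = n * i" by simp
    then show ?thesis unfolding d_def e_def by (simp add: nat_pow_mult q_pow_eq_one_iff del: mult_Suc)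
  qed
  note iso = diag_iso[OF d e de]
  define \<rho> where "\<rho> = restrict (diag d) (carrier L)"
  have "\<rho> \<in> Bij (carrier L)"
    using iso(1) by (auto simp: \<rho>_def Bij_def ring_iso_def cong: bij_betw_cong)
  moreover have "\<rho> \<in> ring_hom L L"
    using iso(1) by (auto simp: \<rho>_def ring_iso_def ring_hom_def Pi_def)
  moreover have "\<forall>c\<in>K. \<rho> c = c" using iso(2) by (auto simp: \<rho>_def)
  ultimately have "\<rho> \<in> carrier G" by (simp add: mem_aut_group)
  moreover have "\<rho> g = f q \<otimes>\<^bsub>L\<^esub> g"
    using diag_basis[OF dI, of 1] n2 by (simp add: \<rho>_def d_def)
  ultimately show ?thesis by blast
qed

lemma cyclic: "cyclic_extension L K"
  using exists_generator galois_generated by (auto simp: cyclic_extension_def)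

end

section \<open>Splitting and norms\<close>

lemma (in ring) finsum_subring:
  assumes "subring H R" "g \<in> I \<rightarrow> H"
  shows "finsum (R\<lparr>carrier := H\<rparr>) g I = finsum R g I"
proof -
  interpret H: ring "R\<lparr>carrier := H\<rparr>" by (rule subring_is_ring[OF assms(1)])
  show ?thesis
    using additive_finsum[of "R\<lparr>carrier := H\<rparr>" R "\<lambda>r. r" g I] assms subringE(1)[OF assms(1)]
    by (auto simp: H.abelian_group_axioms abelian_group_axioms)
qed

section \<open>Matrix representations on left ideals\<close>

context central_alg
begin

text \<open>The image of \<open>v j\<close> under left multiplication by \<open>z\<close> is the
  \<open>j\<close>-th column of \<open>M z\<close>. With columns, composition of multiplications
  corresponds to the matrix product in the same order. The last clause characterises the entries, by
  independence of \<open>v\<close>.\<close>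

lemma matrix_rep:
  fixes v :: "nat \<Rightarrow> 'b"
  assumes v: "v \<in> {..<n} \<rightarrow> carrier R"
    and ind: "\<And>c i. \<lbrakk>c \<in> {..<n} \<rightarrow> carrier F; lc v {..<n} c = \<zero>\<^bsub>R\<^esub>; i < n\<rbrakk> \<Longrightarrow> c i = \<zero>\<^bsub>F\<^esub>"
    and stable: "\<And>z j. \<lbrakk>z \<in> carrier R; j < n\<rbrakk> \<Longrightarrow> \<exists>c\<in>{..<n} \<rightarrow> carrier F. z \<otimes>\<^bsub>R\<^esub> v j = lc v {..<n} c"
  obtains M where "M \<in> ring_hom R (matrix_ring F n)"
    "\<And>c. c \<in> carrier F \<Longrightarrow> M (f c) = scalar_matrix F n c"
    "\<And>z j. \<lbrakk>z \<in> carrier R; j < n\<rbrakk> \<Longrightarrow> z \<otimes>\<^bsub>R\<^esub> v j = lc v {..<n} (\<lambda>i. M z (i, j))"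
    "\<And>z c i j. \<lbrakk>z \<in> carrier R; i < n; j < n; c \<in> {..<n} \<rightarrow> carrier F; z \<otimes>\<^bsub>R\<^esub> v j = lc v {..<n} c\<rbrakk> \<Longrightarrow> M z (i, j) = c i"
proof -
  have inj: "c i = d i" if c: "c \<in> {..<n} \<rightarrow> carrier F" and d: "d \<in> {..<n} \<rightarrow> carrier F"
    and eq: "lc v {..<n} c = lc v {..<n} d" and i: "i < n" for c d i
  proof -
    have ci: "c i \<in> carrier F" "d i \<in> carrier F" if "i < n" for i using c d that by auto
    have neg: "(\<lambda>i. (\<ominus>\<^bsub>F\<^esub> \<one>\<^bsub>F\<^esub>) \<otimes>\<^bsub>F\<^esub> d i) \<in> {..<n} \<rightarrow> carrier F"
      "(\<lambda>i. c i \<oplus>\<^bsub>F\<^esub> (\<ominus>\<^bsub>F\<^esub> \<one>\<^bsub>F\<^esub>) \<otimes>\<^bsub>F\<^esub> d i) \<in> {..<n} \<rightarrow> carrier F"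
      using ci by auto
    have "lc v {..<n} (\<lambda>i. c i \<oplus>\<^bsub>F\<^esub> (\<ominus>\<^bsub>F\<^esub> \<one>\<^bsub>F\<^esub>) \<otimes>\<^bsub>F\<^esub> d i) =
        lc v {..<n} c \<oplus>\<^bsub>R\<^esub> f (\<ominus>\<^bsub>F\<^esub> \<one>\<^bsub>F\<^esub>) \<otimes>\<^bsub>R\<^esub> lc v {..<n} d"
      unfolding lc_add[OF v c neg(1), symmetric] using lc_scale[OF v d, of "\<ominus>\<^bsub>F\<^esub> \<one>\<^bsub>F\<^esub>"] by simp
    also have "\<dots> = \<zero>\<^bsub>R\<^esub>"
      using lc_closed[OF v d] by (simp add: eq R.l_minus R.r_neg)
    finally have "c i \<oplus>\<^bsub>F\<^esub> (\<ominus>\<^bsub>F\<^esub> \<one>\<^bsub>F\<^esub>) \<otimes>\<^bsub>F\<^esub> d i = \<zero>\<^bsub>F\<^esub>" by (rule ind[OF neg(2) _ i])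
    then have "c i \<ominus>\<^bsub>F\<^esub> d i = \<zero>\<^bsub>F\<^esub>" using ci[OF i] by (simp add: a_minus_def F.l_minus)
    then show ?thesis using ci[OF i] by (simp add: F.r_right_minus_eq)
  qed
  define co where "co z j = (SOME c. c \<in> {..<n} \<rightarrow> carrier F \<and> z \<otimes>\<^bsub>R\<^esub> v j = lc v {..<n} c)" for z j
  have co: "co z j \<in> {..<n} \<rightarrow> carrier F" "z \<otimes>\<^bsub>R\<^esub> v j = lc v {..<n} (co z j)"
    if "z \<in> carrier R" "j < n" for z j
  proof -
    have "\<exists>c. c \<in> {..<n} \<rightarrow> carrier F \<and> z \<otimes>\<^bsub>R\<^esub> v j = lc v {..<n} c" using stable[OF that] by blast
    from someI_ex[OF this] show "co z j \<in> {..<n} \<rightarrow> carrier F" "z \<otimes>\<^bsub>R\<^esub> v j = lc v {..<n} (co z j)"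
      unfolding co_def by auto
  qed
  have co_unique: "co z j i = c i"
    if "z \<in> carrier R" "j < n" "i < n" "c \<in> {..<n} \<rightarrow> carrier F" "z \<otimes>\<^bsub>R\<^esub> v j = lc v {..<n} c" for z i j c
    using inj[OF co(1)[OF that(1,2)] that(4) _ that(3)] co(2)[OF that(1,2)] that(5) by simp
  define M where "M z = (\<lambda>(i, j)\<in>{..<n} \<times> {..<n}. co z j i)" for z
  have M: "M z (i, j) = co z j i" if "i < n" "j < n" for z i j using that by (simp add: M_def)
  have vj: "v j \<in> carrier R" if "j < n" for j using v that by auto
  have cl: "co z j i \<in> carrier F" if "z \<in> carrier R" "i < n" "j < n" for z i j
    using co(1)[of z j] that by auto
  have mat_eq: "A = B" if "A \<in> extensional ({..<n} \<times> {..<n})" "B \<in> extensional ({..<n} \<times> {..<n})"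
    "\<And>i j. \<lbrakk>i < n; j < n\<rbrakk> \<Longrightarrow> A (i, j) = B (i, j)" for A B :: "nat \<times> nat \<Rightarrow> 'a"
    by (rule extensionalityI[OF that(1,2)]) (use that(3) in auto)
  have M_scalar: "M (f c) = scalar_matrix F n c" if c: "c \<in> carrier F" for c
  proof (rule mat_eq)
    fix i j assume ij: "i < n" "j < n"
    have "co (f c) j i = (if i = j then c else \<zero>\<^bsub>F\<^esub>)"
      using c ij v lc_single[OF v _ _ c, of j] by (intro co_unique) auto
    then show "M (f c) (i, j) = scalar_matrix F n c (i, j)" using ij by (simp add: M scalar_matrix_def)
  qed (simp_all add: M_def scalar_matrix_def)
  have "M \<in> ring_hom R (matrix_ring F n)"
  proof (rule ring_hom_memI)
    fix z assume z: "z \<in> carrier R"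
    then show "M z \<in> carrier (matrix_ring F n)"
      using cl by (auto simp: matrix_ring_def M_def)
  next
    fix z z' assume z: "z \<in> carrier R" "z' \<in> carrier R"
    show "M (z \<otimes>\<^bsub>R\<^esub> z') = M z \<otimes>\<^bsub>matrix_ring F n\<^esub> M z'"
    proof (rule mat_eq)
      fix i j assume ij: "i < n" "j < n"
      have "(z \<otimes>\<^bsub>R\<^esub> z') \<otimes>\<^bsub>R\<^esub> v j = z \<otimes>\<^bsub>R\<^esub> lc v {..<n} (co z' j)"
        using z vj[OF ij(2)] co(2)[OF z(2) ij(2)] by (simp add: R.m_assoc)
      also have "\<dots> = lc (\<lambda>k. z \<otimes>\<^bsub>R\<^esub> v k) {..<n} (co z' j)"
        by (rule lc_mult_left[OF v co(1)[OF z(2) ij(2)] z(1)]) simp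
      also have "\<dots> = lc v {..<n} (\<lambda>i. \<Oplus>\<^bsub>F\<^esub>k\<in>{..<n}. co z' j k \<otimes>\<^bsub>F\<^esub> co z k i)"
        using z ij co by (intro lc_lc[OF v]) auto
      finally have *: "(z \<otimes>\<^bsub>R\<^esub> z') \<otimes>\<^bsub>R\<^esub> v j = lc v {..<n} (\<lambda>i. \<Oplus>\<^bsub>F\<^esub>k\<in>{..<n}. co z' j k \<otimes>\<^bsub>F\<^esub> co z k i)" .
      have "co (z \<otimes>\<^bsub>R\<^esub> z') j i = (\<Oplus>\<^bsub>F\<^esub>k\<in>{..<n}. co z' j k \<otimes>\<^bsub>F\<^esub> co z k i)"
        by (rule co_unique[OF _ ij(2,1) _ *]) (use z ij cl in \<open>auto intro!: F.finsum_closed\<close>)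
      also have "\<dots> = (\<Oplus>\<^bsub>F\<^esub>k\<in>{..<n}. M z (i, k) \<otimes>\<^bsub>F\<^esub> M z' (k, j))"
        using z ij cl by (intro F.finsum_cong') (auto simp: M F.m_comm)
      finally show "M (z \<otimes>\<^bsub>R\<^esub> z') (i, j) = (M z \<otimes>\<^bsub>matrix_ring F n\<^esub> M z') (i, j)"
        using ij by (simp add: M matrix_ring_def)
    qed (simp_all add: M_def matrix_ring_def)
    show "M (z \<oplus>\<^bsub>R\<^esub> z') = M z \<oplus>\<^bsub>matrix_ring F n\<^esub> M z'"
    proof (rule mat_eq)
      fix i j assume ij: "i < n" "j < n"
      have "co (z \<oplus>\<^bsub>R\<^esub> z') j i = co z j i \<oplus>\<^bsub>F\<^esub> co z' j i"
      proof (rule co_unique)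
        show "(z \<oplus>\<^bsub>R\<^esub> z') \<otimes>\<^bsub>R\<^esub> v j = lc v {..<n} (\<lambda>i. co z j i \<oplus>\<^bsub>F\<^esub> co z' j i)"
          using z vj[OF ij(2)] co(2)[OF z(1) ij(2)] co(2)[OF z(2) ij(2)]
            lc_add[OF v co(1)[OF z(1) ij(2)] co(1)[OF z(2) ij(2)]] by (simp add: R.l_distr)
      qed (use z ij cl in auto)
      then show "M (z \<oplus>\<^bsub>R\<^esub> z') (i, j) = (M z \<oplus>\<^bsub>matrix_ring F n\<^esub> M z') (i, j)"
        using ij by (simp add: M matrix_ring_def)
    qed (simp_all add: M_def matrix_ring_def)
  next
    have "M \<one>\<^bsub>R\<^esub> = scalar_matrix F n \<one>\<^bsub>F\<^esub>" using M_scalar[of "\<one>\<^bsub>F\<^esub>"] by simp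
    then show "M \<one>\<^bsub>R\<^esub> = \<one>\<^bsub>matrix_ring F n\<^esub>" by (simp add: scalar_matrix_def matrix_ring_def)
  qed
  moreover have "z \<otimes>\<^bsub>R\<^esub> v j = lc v {..<n} (\<lambda>i. M z (i, j))" if "z \<in> carrier R" "j < n" for z j
    unfolding co(2)[OF that] using co(1)[OF that] that by (intro lc_cong[OF v]) (auto simp: M)
  ultimately show thesis using M_scalar M co_unique by (intro that) auto
qed

end

section \<open>Symbol algebras containing the field \<open>E\<close>\<close>

locale cyclic_symbol = symbol_alg F n q A f h x s a + E: field E + E: binom_alg F E \<iota> n hE s
  for F :: "('a, 'm) ring_scheme" and n :: nat and q :: 'a
    and A :: "('b, 'n) ring_scheme" and f :: "'a \<Rightarrow> 'b" and h x :: 'b and s a :: 'a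
    and E :: "('c, 'k) ring_scheme" and \<iota> :: "'a \<Rightarrow> 'c" and hE :: 'c +
  fixes \<epsilon> :: "'c \<Rightarrow> 'b" and \<sigma> :: "'c \<Rightarrow> 'c"
  assumes a_nonzero: "a \<noteq> \<zero>\<^bsub>F\<^esub>"
    and \<epsilon>_hom: "\<epsilon> \<in> ring_hom E A" and f_eq: "\<And>c. c \<in> carrier F \<Longrightarrow> \<epsilon> (\<iota> c) = f c"
    and \<epsilon>_hE: "\<epsilon> hE = h" and \<sigma>_hom: "\<sigma> \<in> ring_hom E E" and \<sigma>_hE: "\<sigma> hE = \<iota> q \<otimes>\<^bsub>E\<^esub> hE"
    and x_\<epsilon>: "\<And>e. e \<in> carrier E \<Longrightarrow> x \<otimes>\<^bsub>A\<^esub> \<epsilon> e = \<epsilon> (\<sigma> e) \<otimes>\<^bsub>A\<^esub> x"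
begin

sublocale \<epsilon>: ring_hom_ring E A \<epsilon>
  using \<epsilon>_hom by (intro ring_hom_ringI2) unfold_locales

sublocale \<sigma>: ring_hom_ring E E \<sigma>
  using \<sigma>_hom by (intro ring_hom_ringI2) unfold_locales

lemma s_nonzero: "s \<noteq> \<zero>\<^bsub>F\<^esub>"
proof
  assume "s = \<zero>\<^bsub>F\<^esub>"
  then have "hE [^]\<^bsub>E\<^esub> n \<notin> Units E" using E.g_pow_n by (simp add: E.field_Units)
  then have "hE \<notin> Units E" using E.Units_pow_closed by blast
  then have "hE = \<zero>\<^bsub>E\<^esub>" by (simp add: E.field_Units)
  then show False using E.co_basis1[of 1 1] E.co_zero[of 1] n2 by auto
qed

lemma \<epsilon>_Units: "e \<in> carrier E \<Longrightarrow> e \<noteq> \<zero>\<^bsub>E\<^esub> \<Longrightarrow> \<epsilon> e \<in> Units A"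
proof -
  assume e: "e \<in> carrier E" "e \<noteq> \<zero>\<^bsub>E\<^esub>"
  then have u: "e \<in> Units E" by (simp add: E.field_Units)
  define d where "d = inv\<^bsub>E\<^esub> e"
  have d: "d \<in> carrier E" "e \<otimes>\<^bsub>E\<^esub> d = \<one>\<^bsub>E\<^esub>" "d \<otimes>\<^bsub>E\<^esub> e = \<one>\<^bsub>E\<^esub>" using u by (auto simp: d_def)
  then have "\<epsilon> e \<otimes>\<^bsub>A\<^esub> \<epsilon> d = \<one>\<^bsub>A\<^esub>" "\<epsilon> d \<otimes>\<^bsub>A\<^esub> \<epsilon> e = \<one>\<^bsub>A\<^esub>"
    using e by (simp_all flip: \<epsilon>.hom_mult)
  then show ?thesis using e d by (auto simp: Units_def)
qed

text \<open>Nonzero elements of \<open>E\<close> act by units, so the algebra is a left vector space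
  over \<open>E\<close>. Hence the \<open>h^i w\<close> are independent over \<open>F\<close> for
  every \<open>w \<noteq> 0\<close>, and \<open>w\<close> can be cancelled from
  \<open>e w = e' w\<close>.\<close>

lemma \<epsilon>_mult_eq_zero:
  assumes "e \<in> carrier E" "w \<in> carrier A" "w \<noteq> \<zero>\<^bsub>A\<^esub>" "\<epsilon> e \<otimes>\<^bsub>A\<^esub> w = \<zero>\<^bsub>A\<^esub>"
  shows "e = \<zero>\<^bsub>E\<^esub>"
proof (rule ccontr)
  assume "e \<noteq> \<zero>\<^bsub>E\<^esub>"
  then have u: "\<epsilon> e \<in> Units A" using assms(1) by (intro \<epsilon>_Units)
  have "w = (inv\<^bsub>A\<^esub> \<epsilon> e \<otimes>\<^bsub>A\<^esub> \<epsilon> e) \<otimes>\<^bsub>A\<^esub> w" using u assms(2) by simp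
  also have "\<dots> = inv\<^bsub>A\<^esub> \<epsilon> e \<otimes>\<^bsub>A\<^esub> (\<epsilon> e \<otimes>\<^bsub>A\<^esub> w)" using u assms(1,2) by (intro R.m_assoc) auto
  finally show False using u assms by simp
qed

lemma \<epsilon>_el:
  assumes "c \<in> {..<n} \<rightarrow> carrier F"
  shows "\<epsilon> (E.el c) = lc (\<lambda>i. h [^]\<^bsub>A\<^esub> i) {..<n} c"
proof -
  have cc: "c i \<in> carrier F" if "i < n" for i using assms that by auto
  have "\<epsilon> (E.el c) = (\<Oplus>\<^bsub>A\<^esub>i\<in>{..<n}. \<epsilon> (\<iota> (c i) \<otimes>\<^bsub>E\<^esub> hE [^]\<^bsub>E\<^esub> i))"
    unfolding E.lc_def using cc
    by (intro additive_finsum) (auto simp: R.abelian_group_axioms E.abelian_group_axioms)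
  also have "\<dots> = lc (\<lambda>i. h [^]\<^bsub>A\<^esub> i) {..<n} c"
    unfolding lc_def using cc
    by (intro R.finsum_cong') (auto simp: f_eq \<epsilon>.hom_nat_pow \<epsilon>_hE)
  finally show ?thesis .
qed

lemma \<epsilon>_el_mult:
  assumes c: "c \<in> {..<n} \<rightarrow> carrier F" and w: "w \<in> carrier A"
  shows "lc (\<lambda>i. h [^]\<^bsub>A\<^esub> i \<otimes>\<^bsub>A\<^esub> w) {..<n} c = \<epsilon> (E.el c) \<otimes>\<^bsub>A\<^esub> w"
  unfolding \<epsilon>_el[OF c] by (rule lc_mult_right[symmetric]) (use c w in auto)

lemma \<epsilon>_lc_ind:
  assumes w: "w \<in> carrier A" "w \<noteq> \<zero>\<^bsub>A\<^esub>" and c: "c \<in> {..<n} \<rightarrow> carrier F"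
    and eq: "lc (\<lambda>i. h [^]\<^bsub>A\<^esub> i \<otimes>\<^bsub>A\<^esub> w) {..<n} c = \<zero>\<^bsub>A\<^esub>" and i: "i < n"
  shows "c i = \<zero>\<^bsub>F\<^esub>"
proof -
  have "E.el c = \<zero>\<^bsub>E\<^esub>"
    using eq \<epsilon>_mult_eq_zero[OF E.el_closed[OF c] w] by (simp add: \<epsilon>_el_mult[OF c w(1)])
  then show ?thesis using E.lc_eq_zeroD[OF c] i by simp
qed

lemma \<sigma>_pow_closed [simp]: "e \<in> carrier E \<Longrightarrow> (\<sigma> ^^ k) e \<in> carrier E"
  by (induct k) auto

lemma x_pow_\<epsilon>: "e \<in> carrier E \<Longrightarrow> x [^]\<^bsub>A\<^esub> k \<otimes>\<^bsub>A\<^esub> \<epsilon> e = \<epsilon> ((\<sigma> ^^ k) e) \<otimes>\<^bsub>A\<^esub> x [^]\<^bsub>A\<^esub> k" for k :: nat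
proof (induct k arbitrary: e)
  case (Suc k)
  have "x [^]\<^bsub>A\<^esub> Suc k \<otimes>\<^bsub>A\<^esub> \<epsilon> e = x [^]\<^bsub>A\<^esub> k \<otimes>\<^bsub>A\<^esub> (x \<otimes>\<^bsub>A\<^esub> \<epsilon> e)" using Suc(2) by (simp add: R.m_assoc)
  also have "\<dots> = (x [^]\<^bsub>A\<^esub> k \<otimes>\<^bsub>A\<^esub> \<epsilon> (\<sigma> e)) \<otimes>\<^bsub>A\<^esub> x" using Suc(2) by (simp add: x_\<epsilon> R.m_assoc)
  also have "\<dots> = \<epsilon> ((\<sigma> ^^ k) (\<sigma> e)) \<otimes>\<^bsub>A\<^esub> x [^]\<^bsub>A\<^esub> k \<otimes>\<^bsub>A\<^esub> x" using Suc by simp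
  finally show ?case using Suc(2) \<sigma>_pow_closed[of "\<sigma> e" k] by (simp add: R.m_assoc funpow_swap1)
qed simp

text \<open>Norm products of every length \<open>k\<close> are needed, since
  \<open>x^k w = N_k(b) w\<close> is proved by induction on \<open>k\<close>.\<close>

lemma norm_Suc: "b \<in> carrier E \<Longrightarrow> cyclic_norm E \<sigma> (Suc k) b = (\<sigma> ^^ k) b \<otimes>\<^bsub>E\<^esub> cyclic_norm E \<sigma> k b"
  unfolding cyclic_norm_def lessThan_Suc by (intro E.finprod_insert) auto

lemma norm_closed [simp]: "b \<in> carrier E \<Longrightarrow> cyclic_norm E \<sigma> k b \<in> carrier E"
  unfolding cyclic_norm_def by (intro E.finprod_closed) auto

lemma norm_0: "cyclic_norm E \<sigma> 0 b = \<one>\<^bsub>E\<^esub>"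
  by (simp add: cyclic_norm_def)

lemma \<sigma>_pow_mult: "\<lbrakk>d \<in> carrier E; e \<in> carrier E\<rbrakk> \<Longrightarrow> (\<sigma> ^^ k) (d \<otimes>\<^bsub>E\<^esub> e) = (\<sigma> ^^ k) d \<otimes>\<^bsub>E\<^esub> (\<sigma> ^^ k) e"
  by (induct k) auto

lemma \<sigma>_pow_one: "(\<sigma> ^^ k) \<one>\<^bsub>E\<^esub> = \<one>\<^bsub>E\<^esub>"
  by (induct k) auto

lemma norm_inverse:
  assumes "b \<in> carrier E" "c \<in> carrier E" "c \<otimes>\<^bsub>E\<^esub> b = \<one>\<^bsub>E\<^esub>"
  shows "cyclic_norm E \<sigma> k c \<otimes>\<^bsub>E\<^esub> cyclic_norm E \<sigma> k b = \<one>\<^bsub>E\<^esub>"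
proof (induct k)
  case (Suc k)
  have "cyclic_norm E \<sigma> (Suc k) c \<otimes>\<^bsub>E\<^esub> cyclic_norm E \<sigma> (Suc k) b =
    ((\<sigma> ^^ k) c \<otimes>\<^bsub>E\<^esub> (\<sigma> ^^ k) b) \<otimes>\<^bsub>E\<^esub> (cyclic_norm E \<sigma> k c \<otimes>\<^bsub>E\<^esub> cyclic_norm E \<sigma> k b)"
    using assms by (simp add: norm_Suc E.m_ac)
  then show ?case unfolding Suc \<sigma>_pow_mult[OF assms(2,1), symmetric] assms(3) \<sigma>_pow_one by simp
qed (simp add: norm_0)

text \<open>
  In \<open>M\<^sub>n(F)\<close> the matrices supported on the first column form an \<open>n\<close>-dimensional left ideal. It is
  \<open>E w\<close> for each of its nonzero elements \<open>w\<close>; hence \<open>x w = b w\<close> for some \<open>b \<in> E\<close>, and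
  \<open>a w = x\<^sup>n w = N(b) w\<close>.
\<close>

lemma norm_if_split:
  assumes iso: "\<phi> \<in> ring_iso A (matrix_ring F n)" and \<phi>f: "\<And>c. c \<in> carrier F \<Longrightarrow> \<phi> (f c) = scalar_matrix F n c"
  shows "\<exists>b\<in>Units E. \<iota> a = cyclic_norm E \<sigma> n b"
proof -
  let ?N = "{..<n} \<times> {..<n}"
  have n: "0 < n" using n2 by simp
  have \<phi>: "\<phi> \<in> ring_hom A (matrix_ring F n)" and bij: "bij_betw \<phi> (carrier A) (carrier (matrix_ring F n))"
    using iso by (auto simp: ring_iso_def)
  have \<phi>_carrier: "\<phi> z \<in> ?N \<rightarrow>\<^sub>E carrier F" if "z \<in> carrier A" for z
    using ring_hom_closed[OF \<phi> that] by (simp add: matrix_ring_def)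
  have ent_closed: "\<phi> z (i, j) \<in> carrier F" if "z \<in> carrier A" "i < n" "j < n" for z i j
    using \<phi>_carrier[OF that(1)] that by auto
  have ent_add: "\<phi> (z \<oplus>\<^bsub>A\<^esub> z') (i, j) = \<phi> z (i, j) \<oplus>\<^bsub>F\<^esub> \<phi> z' (i, j)"
    if "z \<in> carrier A" "z' \<in> carrier A" "i < n" "j < n" for z z' i j
    using ring_hom_add[OF \<phi> that(1,2)] that by (simp add: matrix_ring_def)
  have ent_mult: "\<phi> (z \<otimes>\<^bsub>A\<^esub> z') (i, j) = (\<Oplus>\<^bsub>F\<^esub>k\<in>{..<n}. \<phi> z (i, k) \<otimes>\<^bsub>F\<^esub> \<phi> z' (k, j))"
    if "z \<in> carrier A" "z' \<in> carrier A" "i < n" "j < n" for z z' i j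
    using ring_hom_mult[OF \<phi> that(1,2)] that by (simp add: matrix_ring_def)
  have single: "(\<Oplus>\<^bsub>F\<^esub>k\<in>{..<n}. if i = k then g k else \<zero>\<^bsub>F\<^esub>) = g i" if "i < n" "g \<in> {..<n} \<rightarrow> carrier F" for i g
    using finsum_singleton[of i "{..<n}" g] that by simp
  have ent_scale: "\<phi> (f c \<otimes>\<^bsub>A\<^esub> z) (i, j) = c \<otimes>\<^bsub>F\<^esub> \<phi> z (i, j)"
    if "c \<in> carrier F" "z \<in> carrier A" "i < n" "j < n" for c z i j
  proof -
    have "\<phi> (f c \<otimes>\<^bsub>A\<^esub> z) (i, j) = (\<Oplus>\<^bsub>F\<^esub>k\<in>{..<n}. if i = k then c \<otimes>\<^bsub>F\<^esub> \<phi> z (k, j) else \<zero>\<^bsub>F\<^esub>)"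
      unfolding ent_mult[OF f.hom_closed[OF that(1)] that(2-4)] \<phi>f[OF that(1)]
      using that ent_closed by (intro finsum_cong') (auto simp: scalar_matrix_def)
    also have "\<dots> = c \<otimes>\<^bsub>F\<^esub> \<phi> z (i, j)" using that ent_closed by (intro single) auto
    finally show ?thesis .
  qed
  have ent_eq: "z = z'" if "z \<in> carrier A" "z' \<in> carrier A" "\<And>i j. \<lbrakk>i < n; j < n\<rbrakk> \<Longrightarrow> \<phi> z (i, j) = \<phi> z' (i, j)" for z z'
  proof -
    have "\<phi> z = \<phi> z'"
      using \<phi>_carrier[OF that(1)] \<phi>_carrier[OF that(2)] that(3) by (intro PiE_ext[of _ ?N]) auto
    then show ?thesis using bij that by (auto simp: bij_betw_def dest: inj_onD)
  qed
  have ent_lc: "\<phi> (lc v {..<n} c) (i, j) = (\<Oplus>\<^bsub>F\<^esub>k\<in>{..<n}. c k \<otimes>\<^bsub>F\<^esub> \<phi> (v k) (i, j))"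
    if v: "v \<in> {..<n} \<rightarrow> carrier A" and c: "c \<in> {..<n} \<rightarrow> carrier F" and ij: "i < n" "j < n" for v c i j
  proof -
    have vc: "v k \<in> carrier A" "c k \<in> carrier F" if "k < n" for k using v c that by auto
    have "\<phi> (lc v {..<n} c) (i, j) = (\<Oplus>\<^bsub>F\<^esub>k\<in>{..<n}. \<phi> (f (c k) \<otimes>\<^bsub>A\<^esub> v k) (i, j))"
      unfolding lc_def
      by (rule additive_finsum[where \<phi> = "\<lambda>z. \<phi> z (i, j)"])
        (use vc ij ent_add ent_closed R.abelian_group_axioms abelian_group_axioms in auto)
    also have "\<dots> = (\<Oplus>\<^bsub>F\<^esub>k\<in>{..<n}. c k \<otimes>\<^bsub>F\<^esub> \<phi> (v k) (i, j))"
      using vc ij ent_closed by (intro finsum_cong') (auto simp: ent_scale)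
    finally show ?thesis .
  qed
  \<comment> \<open>The matrix units of the first column. Their preimages \<open>v i\<close> span
    the left ideal \<open>A w\<close> with \<open>w = v 0\<close>, because \<open>z w\<close>
    corresponds to the first column of \<open>z\<close>.\<close>
  define unit_col where "unit_col i = (\<lambda>(r, s)\<in>?N. if i = r \<and> s = 0 then \<one>\<^bsub>F\<^esub> else \<zero>\<^bsub>F\<^esub>)" for i
  define v where "v i = inv_into (carrier A) \<phi> (unit_col i)" for i
  have "unit_col i \<in> carrier (matrix_ring F n)" for i
    by (auto simp: unit_col_def matrix_ring_def)
  then have v: "v i \<in> carrier A" "\<phi> (v i) = unit_col i" for i
    using bij unfolding v_def bij_betw_def by (metis inv_into_into, metis f_inv_into_f)
  have vPi: "v \<in> {..<n} \<rightarrow> carrier A" using v by auto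
  have ent_v: "\<phi> (v i) (r, c) = (if i = r then if c = 0 then \<one>\<^bsub>F\<^esub> else \<zero>\<^bsub>F\<^esub> else \<zero>\<^bsub>F\<^esub>)" if "r < n" "c < n" for i r c
    unfolding v(2) using that by (simp add: unit_col_def)
  have ent_lc_v: "\<phi> (lc v {..<n} c) (r, j) = (if j = 0 then c r else \<zero>\<^bsub>F\<^esub>)"
    if c: "c \<in> {..<n} \<rightarrow> carrier F" and ij: "r < n" "j < n" for c r j
  proof -
    have cc: "c k \<in> carrier F" if "k < n" for k using c that by auto
    have "\<phi> (lc v {..<n} c) (r, j) = (\<Oplus>\<^bsub>F\<^esub>k\<in>{..<n}. if r = k then if j = 0 then c k else \<zero>\<^bsub>F\<^esub> else \<zero>\<^bsub>F\<^esub>)"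
      unfolding ent_lc[OF vPi c ij] using ij cc by (intro finsum_cong') (auto simp: ent_v)
    also have "\<dots> = (if j = 0 then c r else \<zero>\<^bsub>F\<^esub>)" using ij cc by (intro single) auto
    finally show ?thesis .
  qed
  define w where "w = v 0"
  have w: "w \<in> carrier A" using v by (simp add: w_def)
  have col: "z \<otimes>\<^bsub>A\<^esub> w = lc v {..<n} (\<lambda>i. \<phi> z (i, 0))" if z: "z \<in> carrier A" for z
  proof (rule ent_eq)
    have zc: "(\<lambda>i. \<phi> z (i, 0)) \<in> {..<n} \<rightarrow> carrier F" using ent_closed[OF z] n by auto
    then show "lc v {..<n} (\<lambda>i. \<phi> z (i, 0)) \<in> carrier A" using vPi by auto
    show "z \<otimes>\<^bsub>A\<^esub> w \<in> carrier A" using z w by simp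
    fix r j assume ij: "r < n" "j < n"
    have "\<phi> (z \<otimes>\<^bsub>A\<^esub> w) (r, j) = (\<Oplus>\<^bsub>F\<^esub>k\<in>{..<n}. if 0 = k then if j = 0 then \<phi> z (r, k) else \<zero>\<^bsub>F\<^esub> else \<zero>\<^bsub>F\<^esub>)"
      unfolding ent_mult[OF z w ij] using ij ent_closed[OF z]
      by (intro finsum_cong') (auto simp: ent_v w_def)
    also have "\<dots> = (if j = 0 then \<phi> z (r, 0) else \<zero>\<^bsub>F\<^esub>)"
      using ij ent_closed[OF z] n by (intro single) auto
    finally show "\<phi> (z \<otimes>\<^bsub>A\<^esub> w) (r, j) = \<phi> (lc v {..<n} (\<lambda>i. \<phi> z (i, 0))) (r, j)"
      using ent_lc_v[OF zc ij] by simp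
  qed
  have ent_zero: "\<phi> \<zero>\<^bsub>A\<^esub> (i, j) = \<zero>\<^bsub>F\<^esub>" if "i < n" "j < n" for i j
    using ent_scale[of "\<zero>\<^bsub>F\<^esub>" "\<zero>\<^bsub>A\<^esub>" i j] ent_closed[of "\<zero>\<^bsub>A\<^esub>"] that by simp
  have w0: "w \<noteq> \<zero>\<^bsub>A\<^esub>"
    using ent_v[OF n n, of 0] ent_zero[OF n n] by (auto simp: w_def)
  let ?K = "f ` carrier F" and ?V = "{lc v {..<n} c |c. c \<in> {..<n} \<rightarrow> carrier F}"
  have dim: "R.dimension n ?K ?V"
  proof -
    have "R.dimension (card {..<n}) ?K ?V"
    proof (rule dimension_lcI[OF _ vPi])
      fix c i assume c: "c \<in> {..<n} \<rightarrow> carrier F" "lc v {..<n} c = \<zero>\<^bsub>A\<^esub>" "i \<in> {..<n}"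
      then show "c i = \<zero>\<^bsub>F\<^esub>" using ent_lc_v[OF c(1), of i 0] ent_zero[of i 0] n by simp
    qed simp
    then show ?thesis by simp
  qed
  let ?u = "\<lambda>i. h [^]\<^bsub>A\<^esub> (i::nat) \<otimes>\<^bsub>A\<^esub> w"
  have uPi: "?u \<in> set [0..<n] \<rightarrow> carrier A" using w by auto
  have upt: "set [0..<n] = {..<n}" by auto
  have ind: "R.independent ?K (map ?u [0..<n])"
    by (rule independentI[OF _ uPi]) (use \<epsilon>_lc_ind[OF w w0] upt in auto)
  have in_V: "z \<otimes>\<^bsub>A\<^esub> w \<in> ?V" if "z \<in> carrier A" for z
    using col[OF that] ent_closed[OF that] n by blast
  \<comment> \<open>The \<open>n\<close> independent elements \<open>h^i w\<close> lie in the
    \<open>n\<close>-dimensional space \<open>?V\<close> and so span it. Thus \<open>x w\<close> is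
    a combination of them, which means \<open>x w = b w\<close> with \<open>b\<close> in
    \<open>E\<close>.\<close>
  have "set (map ?u [0..<n]) \<subseteq> ?V" using in_V by auto
  then have "R.Span ?K (map ?u [0..<n]) = ?V"
    using R.independent_length_eq_dimension[OF subfield_image dim ind] by simp
  then have "x \<otimes>\<^bsub>A\<^esub> w \<in> R.Span ?K (map ?u [0..<n])" using in_V by simp
  then obtain c where c: "c \<in> {..<n} \<rightarrow> carrier F" "x \<otimes>\<^bsub>A\<^esub> w = lc ?u {..<n} c"
    using Span_eq_lc[OF _ uPi] upt by auto
  define b where "b = E.el c"
  have b: "b \<in> carrier E" "x \<otimes>\<^bsub>A\<^esub> w = \<epsilon> b \<otimes>\<^bsub>A\<^esub> w"
    using c \<epsilon>_el_mult[OF c(1) w] by (simp_all add: b_def)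
  have pow: "x [^]\<^bsub>A\<^esub> k \<otimes>\<^bsub>A\<^esub> w = \<epsilon> (cyclic_norm E \<sigma> k b) \<otimes>\<^bsub>A\<^esub> w" for k :: nat
  proof (induct k)
    case (Suc k)
    have "x [^]\<^bsub>A\<^esub> Suc k \<otimes>\<^bsub>A\<^esub> w = (x [^]\<^bsub>A\<^esub> k \<otimes>\<^bsub>A\<^esub> \<epsilon> b) \<otimes>\<^bsub>A\<^esub> w" using b w by (simp add: R.m_assoc)
    also have "\<dots> = \<epsilon> ((\<sigma> ^^ k) b) \<otimes>\<^bsub>A\<^esub> (x [^]\<^bsub>A\<^esub> k \<otimes>\<^bsub>A\<^esub> w)" using b w by (simp add: x_pow_\<epsilon> R.m_assoc)
    also have "\<dots> = \<epsilon> (cyclic_norm E \<sigma> (Suc k) b) \<otimes>\<^bsub>A\<^esub> w" unfolding Suc using b w by (simp add: norm_Suc R.m_assoc)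
    finally show ?case .
  qed (use w in \<open>simp add: norm_0\<close>)
  \<comment> \<open>Both \<open>a\<close> and \<open>N(b)\<close> act on \<open>w\<close> as
    \<open>x^n\<close>, and \<open>w\<close> can be cancelled.\<close>
  have "\<epsilon> (\<iota> a \<ominus>\<^bsub>E\<^esub> cyclic_norm E \<sigma> n b) \<otimes>\<^bsub>A\<^esub> w = x [^]\<^bsub>A\<^esub> n \<otimes>\<^bsub>A\<^esub> w \<ominus>\<^bsub>A\<^esub> \<epsilon> (cyclic_norm E \<sigma> n b) \<otimes>\<^bsub>A\<^esub> w"
    using b w by (simp add: a_minus_def R.l_distr R.l_minus x_pow_n f_eq)
  also have "\<dots> = \<zero>\<^bsub>A\<^esub>" unfolding pow using b w R.r_right_minus_eq by simp
  finally have "\<iota> a \<ominus>\<^bsub>E\<^esub> cyclic_norm E \<sigma> n b = \<zero>\<^bsub>E\<^esub>"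
    using b by (intro \<epsilon>_mult_eq_zero[OF _ w w0]) auto
  then have "\<iota> a = cyclic_norm E \<sigma> n b" using b by (simp add: E.r_right_minus_eq)
  moreover have "b \<noteq> \<zero>\<^bsub>E\<^esub>"
  proof
    assume "b = \<zero>\<^bsub>E\<^esub>"
    then have "x \<otimes>\<^bsub>A\<^esub> w = \<zero>\<^bsub>A\<^esub>" using b w by simp
    moreover have xu: "x \<in> Units A" by (rule x_Units[OF a_nonzero])
    moreover have "w = inv\<^bsub>A\<^esub> x \<otimes>\<^bsub>A\<^esub> (x \<otimes>\<^bsub>A\<^esub> w)"
      using xu w by (subst R.m_assoc[symmetric]) auto
    ultimately show False using w0 by simp
  qed
  ultimately show ?thesis using b(1) by (auto simp: E.field_Units)
qed

text \<open>
  Put \<open>y = b\<^sup>-\<^sup>1 x\<close>, so that \<open>y\<^sup>n = 1\<close>, and \<open>w = 1 + y + \<dots> + y\<^sup>n\<^sup>-\<^sup>1\<close>. The left ideal \<open>E w\<close> has the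
  basis \<open>h\<^sup>i w\<close>, and \<open>y (h\<^sup>i w) = q\<^sup>i h\<^sup>i w\<close>, so Lagrange interpolation in \<open>y\<close> gives the projections onto
  the basis vectors and the action of the algebra on \<open>E w\<close> is onto \<open>M\<^sub>n(F)\<close>.
\<close>

lemma split_if_norm:
  assumes b: "b \<in> Units E" "\<iota> a = cyclic_norm E \<sigma> n b"
  shows "alg_isomorphic F A f (matrix_ring F n) (scalar_matrix F n)"
proof -
  have n: "0 < n" using n2 by simp
  define \<beta> where "\<beta> = inv\<^bsub>E\<^esub> b"
  have bE: "b \<in> carrier E" and \<beta>: "\<beta> \<in> carrier E" "\<beta> \<otimes>\<^bsub>E\<^esub> b = \<one>\<^bsub>E\<^esub>" "b \<otimes>\<^bsub>E\<^esub> \<beta> = \<one>\<^bsub>E\<^esub>"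
    using b(1) by (auto simp: \<beta>_def)
  define y where "y = \<epsilon> \<beta> \<otimes>\<^bsub>A\<^esub> x"
  have y: "y \<in> carrier A" using \<beta> by (simp add: y_def)
  have y_\<epsilon>: "y \<otimes>\<^bsub>A\<^esub> \<epsilon> e = \<epsilon> (\<sigma> e) \<otimes>\<^bsub>A\<^esub> y" if e: "e \<in> carrier E" for e
  proof -
    have "y \<otimes>\<^bsub>A\<^esub> \<epsilon> e = \<epsilon> \<beta> \<otimes>\<^bsub>A\<^esub> (\<epsilon> (\<sigma> e) \<otimes>\<^bsub>A\<^esub> x)" using \<beta> e by (simp add: y_def R.m_assoc x_\<epsilon>)
    also have "\<dots> = \<epsilon> (\<beta> \<otimes>\<^bsub>E\<^esub> \<sigma> e) \<otimes>\<^bsub>A\<^esub> x" using \<beta> e by (simp add: R.m_assoc)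
    also have "\<beta> \<otimes>\<^bsub>E\<^esub> \<sigma> e = \<sigma> e \<otimes>\<^bsub>E\<^esub> \<beta>" using \<beta> e by (intro E.m_comm) auto
    also have "\<epsilon> (\<sigma> e \<otimes>\<^bsub>E\<^esub> \<beta>) \<otimes>\<^bsub>A\<^esub> x = \<epsilon> (\<sigma> e) \<otimes>\<^bsub>A\<^esub> y" using \<beta> e by (simp add: y_def R.m_assoc)
    finally show ?thesis .
  qed
  have y_pow: "y [^]\<^bsub>A\<^esub> k = \<epsilon> (cyclic_norm E \<sigma> k \<beta>) \<otimes>\<^bsub>A\<^esub> x [^]\<^bsub>A\<^esub> k" for k :: nat
  proof (induct k)
    case (Suc k)
    have "y [^]\<^bsub>A\<^esub> Suc k = \<epsilon> (cyclic_norm E \<sigma> k \<beta>) \<otimes>\<^bsub>A\<^esub> (x [^]\<^bsub>A\<^esub> k \<otimes>\<^bsub>A\<^esub> \<epsilon> \<beta>) \<otimes>\<^bsub>A\<^esub> x"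
      using \<beta> by (simp add: Suc y_def[symmetric]) (simp add: y_def R.m_assoc)
    also have "\<dots> = \<epsilon> (cyclic_norm E \<sigma> k \<beta> \<otimes>\<^bsub>E\<^esub> (\<sigma> ^^ k) \<beta>) \<otimes>\<^bsub>A\<^esub> x [^]\<^bsub>A\<^esub> Suc k"
      using \<beta> by (simp add: x_pow_\<epsilon> R.m_assoc)
    also have "cyclic_norm E \<sigma> k \<beta> \<otimes>\<^bsub>E\<^esub> (\<sigma> ^^ k) \<beta> = cyclic_norm E \<sigma> (Suc k) \<beta>"
      using \<beta> by (simp add: norm_Suc E.m_comm)
    finally show ?case .
  qed (simp add: norm_0)
  have y_n: "y [^]\<^bsub>A\<^esub> n = \<one>\<^bsub>A\<^esub>"
  proof -
    have "y [^]\<^bsub>A\<^esub> n = \<epsilon> (cyclic_norm E \<sigma> n \<beta>) \<otimes>\<^bsub>A\<^esub> \<epsilon> (cyclic_norm E \<sigma> n b)"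
      unfolding y_pow x_pow_n b(2)[symmetric] by (simp add: f_eq)
    also have "\<dots> = \<epsilon> (cyclic_norm E \<sigma> n \<beta> \<otimes>\<^bsub>E\<^esub> cyclic_norm E \<sigma> n b)" using \<beta> bE by simp
    finally show ?thesis using norm_inverse[OF bE \<beta>(1,2)] by simp
  qed
  define w where "w = (\<Oplus>\<^bsub>A\<^esub>i\<in>{..<n}. y [^]\<^bsub>A\<^esub> i)"
  have w: "w \<in> carrier A" unfolding w_def using y by (intro R.finsum_closed) auto
  \<comment> \<open>Adding 1 to \<open>y w\<close>, or \<open>y^n\<close> to \<open>w\<close>, gives
    the same sum of all \<open>y^i\<close> with \<open>i \<le> n\<close>; now use
    \<open>y^n = 1\<close>.\<close>
  have yw: "y \<otimes>\<^bsub>A\<^esub> w = w"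
  proof -
    obtain m where m: "n = Suc m" using n by (cases n) auto
    have w_m: "w = (\<Oplus>\<^bsub>A\<^esub>i\<in>{..m}. y [^]\<^bsub>A\<^esub> i)" unfolding w_def m lessThan_Suc_atMost ..
    have "y \<otimes>\<^bsub>A\<^esub> w = (\<Oplus>\<^bsub>A\<^esub>i\<in>{..m}. y [^]\<^bsub>A\<^esub> Suc i)"
      unfolding w_m using y by (subst R.finsum_rdistr) (auto simp: R.nat_pow_Suc2[symmetric] simp del: R.nat_pow_Suc)
    then have "y \<otimes>\<^bsub>A\<^esub> w \<oplus>\<^bsub>A\<^esub> \<one>\<^bsub>A\<^esub> = (\<Oplus>\<^bsub>A\<^esub>i\<in>{..Suc m}. y [^]\<^bsub>A\<^esub> i)"
      using y R.finsum_Suc2[of "\<lambda>i. y [^]\<^bsub>A\<^esub> i" m] by simp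
    also have "\<dots> = y [^]\<^bsub>A\<^esub> n \<oplus>\<^bsub>A\<^esub> w"
      unfolding w_m m using y by (intro R.finsum_Suc) auto
    also have "\<dots> = w \<oplus>\<^bsub>A\<^esub> \<one>\<^bsub>A\<^esub>" unfolding y_n using w by (simp add: R.a_comm)
    finally show ?thesis using y w by simp
  qed
  \<comment> \<open>For \<open>0 < i < n\<close> the power \<open>y^i\<close> lies in
    \<open>E x^i\<close>, so it cannot cancel the term 1 of \<open>w\<close>. This shows
    \<open>w \<noteq> 0\<close>.\<close>
  define N where "N = {r \<in> carrier A. co r (0, 0) = \<zero>\<^bsub>F\<^esub>}"
  have o: "(0, 0) \<in> IJ" using n by simp
  have N: "N \<subseteq> carrier A" "\<zero>\<^bsub>A\<^esub> \<in> N" "\<And>u v. \<lbrakk>u \<in> N; v \<in> N\<rbrakk> \<Longrightarrow> u \<oplus>\<^bsub>A\<^esub> v \<in> N"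
    using co_zero[OF o] co_add[OF _ _ o] by (auto simp: N_def)
  have "y [^]\<^bsub>A\<^esub> i \<in> N" if i: "0 < i" "i < n" for i
  proof -
    define d where "d = E.co (cyclic_norm E \<sigma> i \<beta>)"
    have d: "d \<in> {..<n} \<rightarrow> carrier F" "E.el d = cyclic_norm E \<sigma> i \<beta>"
      using E.co[OF norm_closed[OF \<beta>(1)]] by (simp_all add: d_def)
    have dk: "d k \<in> carrier F" if "k < n" for k using d(1) that by auto
    have "y [^]\<^bsub>A\<^esub> i = lc (\<lambda>k. h [^]\<^bsub>A\<^esub> k \<otimes>\<^bsub>A\<^esub> x [^]\<^bsub>A\<^esub> i) {..<n} d"
      unfolding y_pow d(2)[symmetric] by (rule \<epsilon>_el_mult[OF d(1), symmetric]) simp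
    also have "\<dots> \<in> N"
      unfolding lc_def
    proof (rule R.finsum_mem[OF N])
      fix k assume k: "k \<in> {..<n}"
      then have p: "(k, i) \<in> IJ" using i by simp
      show "f (d k) \<otimes>\<^bsub>A\<^esub> (h [^]\<^bsub>A\<^esub> k \<otimes>\<^bsub>A\<^esub> x [^]\<^bsub>A\<^esub> i) \<in> N"
        using co_basis[OF p o, of "d k"] dk k i by (simp add: N_def)
    qed
    finally show ?thesis .
  qed
  then have "(\<Oplus>\<^bsub>A\<^esub>i\<in>{..<n} - {0}. y [^]\<^bsub>A\<^esub> i) \<in> N" by (intro R.finsum_mem[OF N]) auto
  moreover have "w = \<one>\<^bsub>A\<^esub> \<oplus>\<^bsub>A\<^esub> (\<Oplus>\<^bsub>A\<^esub>i\<in>{..<n} - {0}. y [^]\<^bsub>A\<^esub> i)"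
  proof -
    have "{..<n} = insert 0 ({..<n} - {0})" using n by auto
    then have "w = (\<Oplus>\<^bsub>A\<^esub>i\<in>insert 0 ({..<n} - {0}). y [^]\<^bsub>A\<^esub> i)" unfolding w_def by simp
    also have "\<dots> = y [^]\<^bsub>A\<^esub> (0::nat) \<oplus>\<^bsub>A\<^esub> (\<Oplus>\<^bsub>A\<^esub>i\<in>{..<n} - {0}. y [^]\<^bsub>A\<^esub> i)"
      using y by (intro R.finsum_insert) auto
    finally show ?thesis by simp
  qed
  ultimately have "co w (0, 0) = \<one>\<^bsub>F\<^esub>"
    using co_add[OF R.one_closed _ o] co_one by (simp add: N_def)
  then have w0: "w \<noteq> \<zero>\<^bsub>A\<^esub>" using co_zero[OF o] by auto
  define v where "v i = h [^]\<^bsub>A\<^esub> (i::nat) \<otimes>\<^bsub>A\<^esub> w" for i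
  have v: "v \<in> {..<n} \<rightarrow> carrier A" and vc: "v i \<in> carrier A" for i using w by (auto simp: v_def)
  have v_eq: "v = (\<lambda>i. h [^]\<^bsub>A\<^esub> i \<otimes>\<^bsub>A\<^esub> w)" by (simp add: v_def[abs_def])
  define V where "V = {\<epsilon> e \<otimes>\<^bsub>A\<^esub> w |e. e \<in> carrier E}"
  have V_lc: "\<exists>c\<in>{..<n} \<rightarrow> carrier F. u = lc v {..<n} c" if "u \<in> V" for u
  proof -
    obtain e where e: "e \<in> carrier E" "u = \<epsilon> e \<otimes>\<^bsub>A\<^esub> w" using \<open>u \<in> V\<close> by (auto simp: V_def)
    then have "u = lc v {..<n} (E.co e)"
      unfolding v_eq using \<epsilon>_el_mult[OF E.co(1)[OF e(1)] w] E.co(2)[OF e(1)] by simp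
    then show ?thesis using E.co(1)[OF e(1)] by (rule bexI)
  qed
  \<comment> \<open>\<open>y w = w\<close> multiplied by \<open>b\<close>. It makes
    \<open>E w\<close> stable under \<open>x\<close> and hence a left ideal.\<close>
  have xw: "x \<otimes>\<^bsub>A\<^esub> w = \<epsilon> b \<otimes>\<^bsub>A\<^esub> w"
  proof -
    have "x = \<epsilon> (b \<otimes>\<^bsub>E\<^esub> \<beta>) \<otimes>\<^bsub>A\<^esub> x" unfolding \<beta>(3) by simp
    also have "\<dots> = \<epsilon> b \<otimes>\<^bsub>A\<^esub> y"
      unfolding \<epsilon>.hom_mult[OF bE \<beta>(1)] y_def using bE \<beta>(1) by (intro R.m_assoc) auto
    finally have "x \<otimes>\<^bsub>A\<^esub> w = (\<epsilon> b \<otimes>\<^bsub>A\<^esub> y) \<otimes>\<^bsub>A\<^esub> w" by (rule arg_cong)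
    also have "\<dots> = \<epsilon> b \<otimes>\<^bsub>A\<^esub> (y \<otimes>\<^bsub>A\<^esub> w)" using bE y w by (intro R.m_assoc) auto
    finally show ?thesis unfolding yw .
  qed
  have V_memI: "\<epsilon> e \<otimes>\<^bsub>A\<^esub> w \<in> V" if "e \<in> carrier E" for e
    unfolding V_def using that by (intro CollectI exI[of _ e] conjI refl)
  have VA: "V \<subseteq> carrier A" using w by (auto simp: V_def)
  have V_add: "u \<oplus>\<^bsub>A\<^esub> u' \<in> V" if uu: "u \<in> V" "u' \<in> V" for u u'
  proof -
    obtain e e' where e: "e \<in> carrier E" "u = \<epsilon> e \<otimes>\<^bsub>A\<^esub> w" "e' \<in> carrier E" "u' = \<epsilon> e' \<otimes>\<^bsub>A\<^esub> w"
      using uu by (auto simp: V_def)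
    then have "u \<oplus>\<^bsub>A\<^esub> u' = \<epsilon> (e \<oplus>\<^bsub>E\<^esub> e') \<otimes>\<^bsub>A\<^esub> w" using w by (simp add: R.l_distr)
    then show ?thesis using V_memI[of "e \<oplus>\<^bsub>E\<^esub> e'"] e by (simp del: \<epsilon>.hom_add)
  qed
  have V_\<epsilon>: "\<epsilon> d \<otimes>\<^bsub>A\<^esub> u \<in> V" if d: "d \<in> carrier E" and u: "u \<in> V" for d u
  proof -
    obtain e where e: "e \<in> carrier E" "u = \<epsilon> e \<otimes>\<^bsub>A\<^esub> w" using u by (auto simp: V_def)
    then have "\<epsilon> d \<otimes>\<^bsub>A\<^esub> u = \<epsilon> (d \<otimes>\<^bsub>E\<^esub> e) \<otimes>\<^bsub>A\<^esub> w" using w d by (simp add: R.m_assoc)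
    then show ?thesis using V_memI[of "d \<otimes>\<^bsub>E\<^esub> e"] e d by (simp del: \<epsilon>.hom_mult)
  qed
  have V_x: "x \<otimes>\<^bsub>A\<^esub> u \<in> V" if u: "u \<in> V" for u
  proof -
    obtain e where e: "e \<in> carrier E" "u = \<epsilon> e \<otimes>\<^bsub>A\<^esub> w" using u by (auto simp: V_def)
    then have "x \<otimes>\<^bsub>A\<^esub> u = (x \<otimes>\<^bsub>A\<^esub> \<epsilon> e) \<otimes>\<^bsub>A\<^esub> w" using w by (simp add: R.m_assoc)
    also have "\<dots> = \<epsilon> (\<sigma> e) \<otimes>\<^bsub>A\<^esub> (x \<otimes>\<^bsub>A\<^esub> w)" using w e by (simp add: x_\<epsilon> R.m_assoc)
    also have "\<dots> = \<epsilon> (\<sigma> e \<otimes>\<^bsub>E\<^esub> b) \<otimes>\<^bsub>A\<^esub> w" unfolding xw using w e bE by (simp add: R.m_assoc)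
    finally show ?thesis using V_memI[of "\<sigma> e \<otimes>\<^bsub>E\<^esub> b"] e bE by (simp del: \<epsilon>.hom_mult)
  qed
  have V_x_pow: "x [^]\<^bsub>A\<^esub> k \<otimes>\<^bsub>A\<^esub> u \<in> V" if "u \<in> V" for k :: nat and u
    using that
  proof (induct k arbitrary: u)
    case (Suc k)
    have "x [^]\<^bsub>A\<^esub> Suc k \<otimes>\<^bsub>A\<^esub> u = x [^]\<^bsub>A\<^esub> k \<otimes>\<^bsub>A\<^esub> (x \<otimes>\<^bsub>A\<^esub> u)"
      unfolding R.nat_pow_Suc using subsetD[OF VA Suc(2)] by (intro R.m_assoc) auto
    also have "\<dots> \<in> V" by (rule Suc(1)[OF V_x[OF Suc(2)]])
    finally show ?case .
  next
    case 0
    then show ?case using subsetD[OF VA 0] by simp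
  qed
  have V_zero: "\<zero>\<^bsub>A\<^esub> \<in> V"
    unfolding V_def using w by (intro CollectI exI[of _ "\<zero>\<^bsub>E\<^esub>"]) auto
  have V_stable: "z \<otimes>\<^bsub>A\<^esub> u \<in> V" if z: "z \<in> carrier A" and u: "u \<in> V" for z u
  proof -
    have uA: "u \<in> carrier A" using u VA by auto
    have "z \<otimes>\<^bsub>A\<^esub> u = lc (\<lambda>p. B p \<otimes>\<^bsub>A\<^esub> u) IJ (co z)"
      using lc_mult_right[OF b_closed co(1)[OF z] uA finite_I] co(2)[OF z] by simp
    also have "\<dots> \<in> V"
      unfolding lc_def
    proof (rule R.finsum_mem[OF VA V_zero V_add])
      fix p assume p: "p \<in> IJ"
      obtain i j where ij: "p = (i, j)" by fastforce
      have "B p \<otimes>\<^bsub>A\<^esub> u = \<epsilon> (hE [^]\<^bsub>E\<^esub> i) \<otimes>\<^bsub>A\<^esub> (x [^]\<^bsub>A\<^esub> j \<otimes>\<^bsub>A\<^esub> u)"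
        using uA by (simp add: ij R.m_assoc \<epsilon>.hom_nat_pow \<epsilon>_hE)
      also have "\<dots> \<in> V" using V_x_pow[OF u] by (intro V_\<epsilon>) auto
      finally have "\<epsilon> (\<iota> (co z p)) \<otimes>\<^bsub>A\<^esub> (B p \<otimes>\<^bsub>A\<^esub> u) \<in> V"
        using z p by (intro V_\<epsilon>) auto
      then show "f (co z p) \<otimes>\<^bsub>A\<^esub> (B p \<otimes>\<^bsub>A\<^esub> u) \<in> V" using z p by (simp add: f_eq)
    qed
    finally show ?thesis .
  qed
  have v_V: "v i \<in> V" for i
    unfolding V_def v_def by (intro CollectI exI[of _ "hE [^]\<^bsub>E\<^esub> i"]) (auto simp: \<epsilon>.hom_nat_pow \<epsilon>_hE)
  have ind: "c i = \<zero>\<^bsub>F\<^esub>" if "c \<in> {..<n} \<rightarrow> carrier F" "lc v {..<n} c = \<zero>\<^bsub>A\<^esub>" "i < n" for c i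
    using \<epsilon>_lc_ind[OF w w0 that(1) _ that(3)] that(2) by (simp add: v_eq)
  have stable: "\<exists>c\<in>{..<n} \<rightarrow> carrier F. z \<otimes>\<^bsub>A\<^esub> v j = lc v {..<n} c" if "z \<in> carrier A" "j < n" for z j
    by (rule V_lc[OF V_stable[OF that(1) v_V]])
  obtain M where M: "M \<in> ring_hom A (matrix_ring F n)"
    and M_f: "\<And>c. c \<in> carrier F \<Longrightarrow> M (f c) = scalar_matrix F n c"
    and M_v: "\<And>z j. \<lbrakk>z \<in> carrier A; j < n\<rbrakk> \<Longrightarrow> z \<otimes>\<^bsub>A\<^esub> v j = lc v {..<n} (\<lambda>i. M z (i, j))"
    and M_eq: "\<And>z c i j. \<lbrakk>z \<in> carrier A; i < n; j < n; c \<in> {..<n} \<rightarrow> carrier F; z \<otimes>\<^bsub>A\<^esub> v j = lc v {..<n} c\<rbrakk> \<Longrightarrow> M z (i, j) = c i"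
    by (rule matrix_rep[OF v], erule (2) ind, erule (1) stable, rule that)
  have M_carrier: "M z \<in> ({..<n} \<times> {..<n}) \<rightarrow>\<^sub>E carrier F" if "z \<in> carrier A" for z
    using ring_hom_closed[OF M that] by (simp add: matrix_ring_def)
  have inj: "inj_on M (carrier A)"
  proof (rule inj_onI)
    \<comment> \<open>The annihilator of the left ideal \<open>V\<close> is a two-sided ideal. It
      does not contain 1 because \<open>w\<close> is nonzero, so simplicity makes it zero and the
      representation faithful.\<close>
    define J where "J = {z \<in> carrier A. \<forall>u\<in>V. z \<otimes>\<^bsub>A\<^esub> u = \<zero>\<^bsub>A\<^esub>}"
    have "ideal J A"
    proof (rule idealI[OF R.ring_axioms])
      show "subgroup J (add_monoid A)"
      proof (rule R.add.subgroupI)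
        have "\<zero>\<^bsub>A\<^esub> \<in> J" using VA by (auto simp: J_def)
        then show "J \<noteq> {}" by blast
      qed (use VA in \<open>auto simp: J_def R.l_distr R.l_minus subset_iff\<close>)
      show "r \<otimes>\<^bsub>A\<^esub> z \<in> J" "z \<otimes>\<^bsub>A\<^esub> r \<in> J" if "z \<in> J" "r \<in> carrier A" for z r
        using that VA V_stable[OF that(2)] by (auto simp: J_def R.m_assoc subset_iff)
    qed
    moreover have "\<one>\<^bsub>A\<^esub> \<notin> J" using v_V[of 0] w w0 by (auto simp: J_def v_def intro!: bexI[of _ w])
    then have "J \<noteq> carrier A" by auto
    ultimately have J: "J = {\<zero>\<^bsub>A\<^esub>}"
      using simple[OF s_nonzero a_nonzero] by (auto simp: simple_ring_def)
    fix z z' assume z: "z \<in> carrier A" "z' \<in> carrier A" "M z = M z'"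
    have eq: "z \<otimes>\<^bsub>A\<^esub> v j = z' \<otimes>\<^bsub>A\<^esub> v j" if "j < n" for j
      unfolding M_v[OF z(1) that] M_v[OF z(2) that] z(3) ..
    have "z \<ominus>\<^bsub>A\<^esub> z' \<in> J"
      unfolding J_def
    proof (intro CollectI conjI ballI)
      fix u assume "u \<in> V"
      then obtain c where c: "c \<in> {..<n} \<rightarrow> carrier F" "u = lc v {..<n} c" using V_lc by blast
      have zz: "z \<ominus>\<^bsub>A\<^esub> z' \<in> carrier A" using z by simp
      have zv: "(\<lambda>i. (z \<ominus>\<^bsub>A\<^esub> z') \<otimes>\<^bsub>A\<^esub> v i) \<in> {..<n} \<rightarrow> carrier A" using zz vc by auto
      have "(z \<ominus>\<^bsub>A\<^esub> z') \<otimes>\<^bsub>A\<^esub> u = lc (\<lambda>i. (z \<ominus>\<^bsub>A\<^esub> z') \<otimes>\<^bsub>A\<^esub> v i) {..<n} c"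
        unfolding c(2) by (rule lc_mult_left[OF v c(1) zz]) simp
      also have "\<dots> = \<zero>\<^bsub>A\<^esub>"
        unfolding lc_def
      proof (rule R.add.finprod_one_eqI)
        fix i assume i: "i \<in> {..<n}"
        have "(z \<ominus>\<^bsub>A\<^esub> z') \<otimes>\<^bsub>A\<^esub> v i = \<zero>\<^bsub>A\<^esub>"
          using eq[of i] z vc[of i] i by (simp add: a_minus_def R.l_distr R.l_minus R.r_neg)
        then show "f (c i) \<otimes>\<^bsub>A\<^esub> ((z \<ominus>\<^bsub>A\<^esub> z') \<otimes>\<^bsub>A\<^esub> v i) = \<zero>\<^bsub>A\<^esub>" using funcset_mem[OF c(1) i] by simp
      qed
      finally show "(z \<ominus>\<^bsub>A\<^esub> z') \<otimes>\<^bsub>A\<^esub> u = \<zero>\<^bsub>A\<^esub>" .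
    qed (use z in simp)
    then show "z = z'" using z by (simp add: J R.r_right_minus_eq)
  qed
  have \<sigma>_pow_hE: "\<sigma> (hE [^]\<^bsub>E\<^esub> i) = \<iota> (q [^]\<^bsub>F\<^esub> i) \<otimes>\<^bsub>E\<^esub> hE [^]\<^bsub>E\<^esub> i" for i :: nat
    by (simp add: \<sigma>.hom_nat_pow \<sigma>_hE E.nat_pow_distrib E.f_pow)
  have yv: "y \<otimes>\<^bsub>A\<^esub> v i = f (q [^]\<^bsub>F\<^esub> i) \<otimes>\<^bsub>A\<^esub> v i" for i
  proof -
    have "y \<otimes>\<^bsub>A\<^esub> v i = (y \<otimes>\<^bsub>A\<^esub> \<epsilon> (hE [^]\<^bsub>E\<^esub> i)) \<otimes>\<^bsub>A\<^esub> w"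
      using y w by (simp add: v_def \<epsilon>.hom_nat_pow \<epsilon>_hE R.m_assoc)
    also have "\<dots> = \<epsilon> (\<sigma> (hE [^]\<^bsub>E\<^esub> i)) \<otimes>\<^bsub>A\<^esub> (y \<otimes>\<^bsub>A\<^esub> w)"
      using y w by (subst y_\<epsilon>) (auto simp: R.m_assoc)
    also have "\<dots> = f (q [^]\<^bsub>F\<^esub> i) \<otimes>\<^bsub>A\<^esub> v i"
      unfolding yw \<sigma>_pow_hE using w by (simp add: f_eq v_def \<epsilon>.hom_nat_pow \<epsilon>_hE R.m_assoc)
    finally show ?thesis .
  qed
  have proj: "\<exists>P\<in>carrier A. \<exists>c. c k = \<one>\<^bsub>F\<^esub> \<and> (\<forall>j\<in>S. c j = \<zero>\<^bsub>F\<^esub>) \<and>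
      (\<forall>i<n. c i \<in> carrier F \<and> P \<otimes>\<^bsub>A\<^esub> v i = f (c i) \<otimes>\<^bsub>A\<^esub> v i)"
    if "finite S" "S \<subseteq> {..<n} - {k}" "k < n" for S k
    using that
  proof (induct S)
    case empty
    show ?case
      using vc by (intro bexI[of _ "\<one>\<^bsub>A\<^esub>"] exI[of _ "\<lambda>i. \<one>\<^bsub>F\<^esub>"]) auto
  next
    case (insert j S)
    then obtain P c where P: "P \<in> carrier A" and c: "c k = \<one>\<^bsub>F\<^esub>" "\<forall>j\<in>S. c j = \<zero>\<^bsub>F\<^esub>"
      "\<forall>i<n. c i \<in> carrier F \<and> P \<otimes>\<^bsub>A\<^esub> v i = f (c i) \<otimes>\<^bsub>A\<^esub> v i" by auto
    have jk: "j < n" "j \<noteq> k" using insert by auto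
    define u where "u = inv\<^bsub>F\<^esub> (q [^]\<^bsub>F\<^esub> k \<ominus>\<^bsub>F\<^esub> q [^]\<^bsub>F\<^esub> j)"
    have "q [^]\<^bsub>F\<^esub> k \<noteq> q [^]\<^bsub>F\<^esub> j" using q_pow_inj[of k j] jk insert(5) by auto
    then have "q [^]\<^bsub>F\<^esub> k \<ominus>\<^bsub>F\<^esub> q [^]\<^bsub>F\<^esub> j \<in> Units F" by (simp add: field_Units r_right_minus_eq)
    then have u: "u \<in> carrier F" "u \<otimes>\<^bsub>F\<^esub> (q [^]\<^bsub>F\<^esub> k \<ominus>\<^bsub>F\<^esub> q [^]\<^bsub>F\<^esub> j) = \<one>\<^bsub>F\<^esub>" by (auto simp: u_def)
    \<comment> \<open>The factor \<open>(y - q^j) / (q^k - q^j)\<close> kills \<open>v j\<close> and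
      acts as the identity on \<open>v k\<close>.\<close>
    define P' where "P' = f u \<otimes>\<^bsub>A\<^esub> ((y \<ominus>\<^bsub>A\<^esub> f (q [^]\<^bsub>F\<^esub> j)) \<otimes>\<^bsub>A\<^esub> P)"
    define c' where "c' i = u \<otimes>\<^bsub>F\<^esub> ((q [^]\<^bsub>F\<^esub> i \<ominus>\<^bsub>F\<^esub> q [^]\<^bsub>F\<^esub> j) \<otimes>\<^bsub>F\<^esub> c i)" for i
    have P': "P' \<in> carrier A" using P u y by (simp add: P'_def)
    have "P' \<otimes>\<^bsub>A\<^esub> v i = f (c' i) \<otimes>\<^bsub>A\<^esub> v i" "c' i \<in> carrier F" if i: "i < n" for i
    proof -
      have ci: "c i \<in> carrier F" "P \<otimes>\<^bsub>A\<^esub> v i = f (c i) \<otimes>\<^bsub>A\<^esub> v i" using c i by auto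
      then show "c' i \<in> carrier F" using u by (simp add: c'_def)
      have yf: "(y \<ominus>\<^bsub>A\<^esub> f (q [^]\<^bsub>F\<^esub> j)) \<otimes>\<^bsub>A\<^esub> v i = f (q [^]\<^bsub>F\<^esub> i \<ominus>\<^bsub>F\<^esub> q [^]\<^bsub>F\<^esub> j) \<otimes>\<^bsub>A\<^esub> v i"
        using y vc[of i] yv[of i] by (simp add: a_minus_def R.l_distr)
      have "P' \<otimes>\<^bsub>A\<^esub> v i = f u \<otimes>\<^bsub>A\<^esub> ((y \<ominus>\<^bsub>A\<^esub> f (q [^]\<^bsub>F\<^esub> j)) \<otimes>\<^bsub>A\<^esub> (f (c i) \<otimes>\<^bsub>A\<^esub> v i))"
        unfolding P'_def using P u y vc[of i] ci(2) by (simp add: R.m_assoc)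
      also have "(y \<ominus>\<^bsub>A\<^esub> f (q [^]\<^bsub>F\<^esub> j)) \<otimes>\<^bsub>A\<^esub> (f (c i) \<otimes>\<^bsub>A\<^esub> v i) = f (c i) \<otimes>\<^bsub>A\<^esub> ((y \<ominus>\<^bsub>A\<^esub> f (q [^]\<^bsub>F\<^esub> j)) \<otimes>\<^bsub>A\<^esub> v i)"
        using y ci(1) vc by (intro f_lcomm) auto
      also have "\<dots> = f (c i \<otimes>\<^bsub>F\<^esub> (q [^]\<^bsub>F\<^esub> i \<ominus>\<^bsub>F\<^esub> q [^]\<^bsub>F\<^esub> j)) \<otimes>\<^bsub>A\<^esub> v i"
        unfolding yf using ci(1) vc by (intro f_mult_f) auto
      also have "f u \<otimes>\<^bsub>A\<^esub> \<dots> = f (u \<otimes>\<^bsub>F\<^esub> (c i \<otimes>\<^bsub>F\<^esub> (q [^]\<^bsub>F\<^esub> i \<ominus>\<^bsub>F\<^esub> q [^]\<^bsub>F\<^esub> j))) \<otimes>\<^bsub>A\<^esub> v i"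
        using ci(1) vc u(1) by (intro f_mult_f) auto
      also have "c i \<otimes>\<^bsub>F\<^esub> (q [^]\<^bsub>F\<^esub> i \<ominus>\<^bsub>F\<^esub> q [^]\<^bsub>F\<^esub> j) = (q [^]\<^bsub>F\<^esub> i \<ominus>\<^bsub>F\<^esub> q [^]\<^bsub>F\<^esub> j) \<otimes>\<^bsub>F\<^esub> c i"
        using ci(1) by (intro m_comm) auto
      finally show "P' \<otimes>\<^bsub>A\<^esub> v i = f (c' i) \<otimes>\<^bsub>A\<^esub> v i" unfolding c'_def .
    qed
    moreover have "c' k = \<one>\<^bsub>F\<^esub>" using c(1) u by (simp add: c'_def)
    moreover have "c' i = \<zero>\<^bsub>F\<^esub>" if "i \<in> insert j S" for i
    proof (cases "i = j")
      case True
      have "c j \<in> carrier F" using c(3) jk by simp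
      then show ?thesis unfolding True c'_def a_minus_def using u by (simp add: r_neg)
    next
      case False
      then have "c i = \<zero>\<^bsub>F\<^esub>" using c(2) that by auto
      then show ?thesis using u by (simp add: c'_def)
    qed
    ultimately show ?case using P' by (intro bexI[of _ P'] exI[of _ c']) auto
  qed
  have "\<exists>P\<in>carrier A. \<forall>i<n. P \<otimes>\<^bsub>A\<^esub> v i = (if i = k then v i else \<zero>\<^bsub>A\<^esub>)" if k: "k < n" for k
  proof -
    obtain P c where "P \<in> carrier A" "c k = \<one>\<^bsub>F\<^esub>" "\<forall>j\<in>{..<n} - {k}. c j = \<zero>\<^bsub>F\<^esub>"
      "\<forall>i<n. c i \<in> carrier F \<and> P \<otimes>\<^bsub>A\<^esub> v i = f (c i) \<otimes>\<^bsub>A\<^esub> v i"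
      using proj[of "{..<n} - {k}" k] k by auto
    then show ?thesis using vc by (intro bexI[of _ P]) auto
  qed
  then obtain P where P: "\<And>k. k < n \<Longrightarrow> P k \<in> carrier A"
    "\<And>k i. \<lbrakk>k < n; i < n\<rbrakk> \<Longrightarrow> P k \<otimes>\<^bsub>A\<^esub> v i = (if i = k then v i else \<zero>\<^bsub>A\<^esub>)"
    by metis
  have surj: "\<exists>z\<in>carrier A. M z = m" if m: "m \<in> carrier (matrix_ring F n)" for m
  proof -
    have mP: "m \<in> ({..<n} \<times> {..<n}) \<rightarrow>\<^sub>E carrier F" using m by (simp add: matrix_ring_def)
    define e where "e k = E.el (\<lambda>i. m (i, k))" for k
    have mk: "(\<lambda>i. m (i, k)) \<in> {..<n} \<rightarrow> carrier F" if "k < n" for k using mP that by auto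
    have e: "e k \<in> carrier E" if "k < n" for k using E.el_closed[OF mk[OF that]] by (simp add: e_def)
    have hu: "h [^]\<^bsub>A\<^esub> k \<in> Units A" for k :: nat using h_Units[OF s_nonzero] by (rule R.Units_pow_closed)
    \<comment> \<open>\<open>P k\<close> isolates \<open>v k = h^k w\<close>, the inverse of
      \<open>h^k\<close> takes it to \<open>w\<close>, and \<open>e k\<close> takes \<open>w\<close>
      to the prescribed \<open>k\<close>-th column. Summing over \<open>k\<close> realises the
      matrix \<open>m\<close>.\<close>
    define u where "u k = \<epsilon> (e k) \<otimes>\<^bsub>A\<^esub> (inv\<^bsub>A\<^esub> (h [^]\<^bsub>A\<^esub> k) \<otimes>\<^bsub>A\<^esub> P k)" for k
    have u: "u k \<in> carrier A" if "k < n" for k using e[OF that] P(1)[OF that] hu by (simp add: u_def)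
    have uv: "u k \<otimes>\<^bsub>A\<^esub> v j = (if j = k then lc v {..<n} (\<lambda>i. m (i, j)) else \<zero>\<^bsub>A\<^esub>)" if k: "k < n" and j: "j < n" for k j
    proof -
      have "u k \<otimes>\<^bsub>A\<^esub> v j = \<epsilon> (e k) \<otimes>\<^bsub>A\<^esub> (inv\<^bsub>A\<^esub> (h [^]\<^bsub>A\<^esub> k) \<otimes>\<^bsub>A\<^esub> (P k \<otimes>\<^bsub>A\<^esub> v j))"
        using e[OF k] P(1)[OF k] hu vc by (simp add: u_def R.m_assoc)
      also have "\<dots> = (if j = k then lc v {..<n} (\<lambda>i. m (i, j)) else \<zero>\<^bsub>A\<^esub>)"
      proof (cases "j = k")
        case True
        have "inv\<^bsub>A\<^esub> (h [^]\<^bsub>A\<^esub> k) \<otimes>\<^bsub>A\<^esub> v k = (inv\<^bsub>A\<^esub> (h [^]\<^bsub>A\<^esub> k) \<otimes>\<^bsub>A\<^esub> h [^]\<^bsub>A\<^esub> k) \<otimes>\<^bsub>A\<^esub> w"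
          unfolding v_def using hu w by (intro R.m_assoc[symmetric]) auto
        then have "inv\<^bsub>A\<^esub> (h [^]\<^bsub>A\<^esub> k) \<otimes>\<^bsub>A\<^esub> v k = w" using hu w by simp
        then show ?thesis using True P(2)[OF k k] \<epsilon>_el_mult[OF mk[OF k] w] by (simp add: e_def v_eq)
      next
        case False
        then show ?thesis using P(2)[OF k j] e[OF k] hu by simp
      qed
      finally show ?thesis .
    qed
    define z where "z = (\<Oplus>\<^bsub>A\<^esub>k\<in>{..<n}. u k)"
    have z: "z \<in> carrier A" unfolding z_def using u by (intro R.finsum_closed) auto
    have zv: "z \<otimes>\<^bsub>A\<^esub> v j = lc v {..<n} (\<lambda>i. m (i, j))" if j: "j < n" for j
    proof -
      have l: "lc v {..<n} (\<lambda>i. m (i, j)) \<in> carrier A" using v mk[OF j] by auto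
      have "z \<otimes>\<^bsub>A\<^esub> v j = (\<Oplus>\<^bsub>A\<^esub>k\<in>{..<n}. u k \<otimes>\<^bsub>A\<^esub> v j)"
        unfolding z_def using u vc by (intro R.finsum_ldistr) auto
      also have "\<dots> = (\<Oplus>\<^bsub>A\<^esub>k\<in>{..<n}. if j = k then lc v {..<n} (\<lambda>i. m (i, j)) else \<zero>\<^bsub>A\<^esub>)"
        using uv j l by (intro R.finsum_cong') auto
      also have "\<dots> = lc v {..<n} (\<lambda>i. m (i, j))"
        using R.finsum_singleton[of j "{..<n}" "\<lambda>k. lc v {..<n} (\<lambda>i. m (i, j))"] j l by simp
      finally show ?thesis .
    qed
    have "M z = m"
      using M_carrier[OF z] mP M_eq[OF z _ _ mk zv] by (intro PiE_ext[of _ "{..<n} \<times> {..<n}"]) auto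
    then show ?thesis using z by blast
  qed
  have "bij_betw M (carrier A) (carrier (matrix_ring F n))"
    unfolding bij_betw_def using inj surj ring_hom_closed[OF M] by auto
  then have "M \<in> ring_iso A (matrix_ring F n)" using M by (simp add: ring_iso_def)
  then show ?thesis using M_f unfolding alg_isomorphic_def by (intro bexI[of _ M]) auto
qed

theorem split_iff_norm:
  "alg_isomorphic F A f (matrix_ring F n) (scalar_matrix F n) \<longleftrightarrow>
    (\<exists>b\<in>Units E. \<iota> a = cyclic_norm E \<sigma> n b)"
proof
  assume "alg_isomorphic F A f (matrix_ring F n) (scalar_matrix F n)"
  then obtain \<phi> where "\<phi> \<in> ring_iso A (matrix_ring F n)" "\<forall>c\<in>carrier F. \<phi> (f c) = scalar_matrix F n c"
    unfolding alg_isomorphic_def by (elim bexE)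
  then show "\<exists>b\<in>Units E. \<iota> a = cyclic_norm E \<sigma> n b" by (intro norm_if_split) auto
next
  assume "\<exists>b\<in>Units E. \<iota> a = cyclic_norm E \<sigma> n b"
  then obtain b where b: "b \<in> Units E" "\<iota> a = cyclic_norm E \<sigma> n b" by (elim bexE)
  show "alg_isomorphic F A f (matrix_ring F n) (scalar_matrix F n)"
    by (rule split_if_norm[OF b])
qed

text \<open>\<open>cyclic_extension\<close> speaks of the algebra with its carrier restricted to the
  image of \<open>E\<close>. The basis of powers of \<open>h\<close> is therefore transported there,
  and Kummer theory is applied to this restricted ring.\<close>

lemma cyclic_via: "cyclic_algebra_via (f ` carrier F) A (\<epsilon> ` carrier E)"
proof -
  let ?K = "f ` carrier F" and ?H = "\<epsilon> ` carrier E"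
  let ?L = "A\<lparr>carrier := ?H\<rparr>"
  have inj: "inj_on \<epsilon> (carrier E)" and H: "subfield ?H A"
    using \<epsilon>.img_is_subfield[OF E.carrier_is_subfield nontrivial] by auto
  have K: "?K = \<epsilon> ` (\<iota> ` carrier F)" using f_eq by (auto simp: image_image)
  have KH: "?K \<subseteq> ?H" unfolding K by auto
  have "R.dimension n (\<epsilon> ` (\<iota> ` carrier F)) ?H"
    using \<epsilon>.inj_hom_dimension[OF E.subfield_image nontrivial inj] E.dimension_carrier by simp
  then have max: "strictly_maximal_subfield ?K A ?H"
    unfolding strictly_maximal_subfield_def K[symmetric]
    using H KH central_simple(2)[OF s_nonzero a_nonzero] by blast
  have fieldL: "field ?L" by (rule R.subfield_iff(2)[OF H])
  have sub: "subring ?H A" by (rule subfieldE(1)[OF H])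
  interpret L: field ?L by (rule fieldL)
  have fL: "f c \<in> ?H" if "c \<in> carrier F" for c using KH that by auto
  have hL: "h \<in> ?H" using \<epsilon>_hE by force
  interpret C: central_alg F ?L f
  proof unfold_locales
    show "f \<in> ring_hom F ?L" using fL by (intro ring_hom_memI) auto
    show "r \<otimes>\<^bsub>?L\<^esub> f c = f c \<otimes>\<^bsub>?L\<^esub> r" if "c \<in> carrier F" "r \<in> carrier ?L" for c r
      using that fL by (intro L.m_comm) auto
  qed (use nontrivial in simp)
  have pow: "h [^]\<^bsub>?L\<^esub> i = h [^]\<^bsub>A\<^esub> i" for i :: nat by (simp add: R.nat_pow_consistent[symmetric])
  have powH: "h [^]\<^bsub>A\<^esub> i \<in> ?H" for i :: nat
    using L.nat_pow_closed[of h i] hL by (simp add: pow)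
  have lc_eq: "C.lc (\<lambda>i. h [^]\<^bsub>?L\<^esub> i) {..<n} c = \<epsilon> (E.el c)" if c: "c \<in> {..<n} \<rightarrow> carrier F" for c
  proof -
    have "(\<lambda>i. f (c i) \<otimes>\<^bsub>A\<^esub> h [^]\<^bsub>A\<^esub> i) \<in> {..<n} \<rightarrow> ?H"
    proof
      fix i assume "i \<in> {..<n}"
      then have "c i \<in> carrier F" using c by auto
      then show "f (c i) \<otimes>\<^bsub>A\<^esub> h [^]\<^bsub>A\<^esub> i \<in> ?H" by (intro subringE(6)[OF sub] fL powH)
    qed
    then show ?thesis unfolding \<epsilon>_el[OF c] C.lc_def lc_def pow by (simp add: R.finsum_subring[OF sub])
  qed
  have B: "based_alg F ?L f {..<n} (\<lambda>i. h [^]\<^bsub>?L\<^esub> i)"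
  proof unfold_locales
    show "\<exists>c\<in>{..<n} \<rightarrow> carrier F. r = C.lc (\<lambda>i. h [^]\<^bsub>?L\<^esub> i) {..<n} c" if r: "r \<in> carrier ?L" for r
    proof -
      obtain e where e: "e \<in> carrier E" "r = \<epsilon> e" using r by auto
      have "r = C.lc (\<lambda>i. h [^]\<^bsub>?L\<^esub> i) {..<n} (E.co e)"
        unfolding lc_eq[OF E.co(1)[OF e(1)]] E.co(2)[OF e(1)] by (rule e(2))
      then show ?thesis using E.co(1)[OF e(1)] by (rule bexI)
    qed
    fix c i assume c: "c \<in> {..<n} \<rightarrow> carrier F" "C.lc (\<lambda>i. h [^]\<^bsub>?L\<^esub> i) {..<n} c = \<zero>\<^bsub>?L\<^esub>" and i: "i \<in> {..<n}"
    then have "\<epsilon> (E.el c) = \<epsilon> \<zero>\<^bsub>E\<^esub>" using lc_eq[OF c(1)] by simp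
    then have "E.el c = \<zero>\<^bsub>E\<^esub>" by (rule inj_onD[OF inj _ E.el_closed[OF c(1)] E.zero_closed])
    then show "c i = \<zero>\<^bsub>F\<^esub>" by (rule E.lc_eq_zeroD[OF c(1) _ i])
  qed (use powH pow in auto)
  have "binom_alg F ?L f n h s"
    by (intro binom_alg.intro[OF B] binom_alg_axioms.intro) (use n2 hL h_pow_n pow in auto)
  then interpret K: kummer_field F n q ?L f h s
    using root_field_axioms fieldL by (intro kummer_field.intro)
  show ?thesis
    unfolding cyclic_algebra_via_def using K.cyclic max central_simple(1)[OF s_nonzero a_nonzero] by blast
qed

end

section \<open>Skew polynomial rings\<close>

text \<open>Both sides sum \<open>g i j\<close> over \<open>i + j \<le> n\<close>, once by diagonals
  and once by rows; this reorders the triple sum in the associativity proof.\<close>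

lemma (in abelian_monoid) finsum_triangle:
  fixes g :: "nat \<Rightarrow> nat \<Rightarrow> _"
  assumes "\<And>i j. g i j \<in> carrier G"
  shows "(\<Oplus>k\<in>{..n}. \<Oplus>i\<in>{..k}. g i (k - i)) = (\<Oplus>i\<in>{..n}. \<Oplus>j\<in>{..n - i}. g i j)"
proof (induct n)
  case (Suc n)
  have "(\<Oplus>i\<in>{..n}. \<Oplus>j\<in>{..Suc n - i}. g i j) = (\<Oplus>i\<in>{..n}. g i (Suc n - i) \<oplus> (\<Oplus>j\<in>{..n - i}. g i j))"
    using assms by (intro finsum_cong') (auto simp: Suc_diff_le Pi_def)
  also have "\<dots> = (\<Oplus>i\<in>{..n}. g i (Suc n - i)) \<oplus> (\<Oplus>i\<in>{..n}. \<Oplus>j\<in>{..n - i}. g i j)"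
    using assms by (intro finsum_addf) (auto simp: Pi_def)
  finally have *: "(\<Oplus>i\<in>{..n}. \<Oplus>j\<in>{..Suc n - i}. g i j) =
    (\<Oplus>i\<in>{..n}. g i (Suc n - i)) \<oplus> (\<Oplus>i\<in>{..n}. \<Oplus>j\<in>{..n - i}. g i j)" .
  have "(\<Oplus>i\<in>{..Suc n}. \<Oplus>j\<in>{..Suc n - i}. g i j) =
      g (Suc n) 0 \<oplus> (\<Oplus>i\<in>{..n}. \<Oplus>j\<in>{..Suc n - i}. g i j)"
    using assms by (subst finsum_Suc) (auto simp: Pi_def)
  also have "\<dots> = (\<Oplus>i\<in>{..Suc n}. g i (Suc n - i)) \<oplus> (\<Oplus>i\<in>{..n}. \<Oplus>j\<in>{..n - i}. g i j)"
    unfolding * using assms by (subst finsum_Suc) (auto simp: Pi_def a_assoc)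
  also have "\<dots> = (\<Oplus>k\<in>{..Suc n}. \<Oplus>i\<in>{..k}. g i (k - i))"
    using assms Suc by (subst finsum_Suc) (auto simp: Pi_def)
  finally show ?case by simp
qed (use assms in simp)

section \<open>Multiplication and ring axioms for skew polynomials\<close>

locale skew_poly = cring R for R :: "('a, 'm) ring_scheme" (structure) and \<sigma> :: "'a \<Rightarrow> 'a" +
  assumes \<sigma>_hom: "\<sigma> \<in> ring_hom R R"
begin

definition "P = skew_poly_ring R \<sigma>"

abbreviation "mterm \<equiv> up_ring.monom P"

sublocale \<sigma>: ring_hom_ring R R \<sigma>
  using \<sigma>_hom by (intro ring_hom_ringI2) unfold_locales

lemma \<sigma>_pow_hom: "\<sigma> ^^ k \<in> ring_hom R R"
proof (induct k)
  case (Suc k)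
  from ring_hom_trans[OF this \<sigma>_hom] show ?case by (simp add: comp_def o_def)
qed (auto intro!: ring_hom_memI)

lemma \<sigma>_pow [simp]:
  "e \<in> carrier R \<Longrightarrow> (\<sigma> ^^ k) e \<in> carrier R"
  "\<lbrakk>d \<in> carrier R; e \<in> carrier R\<rbrakk> \<Longrightarrow> (\<sigma> ^^ k) (d \<otimes> e) = (\<sigma> ^^ k) d \<otimes> (\<sigma> ^^ k) e"
  "\<lbrakk>d \<in> carrier R; e \<in> carrier R\<rbrakk> \<Longrightarrow> (\<sigma> ^^ k) (d \<oplus> e) = (\<sigma> ^^ k) d \<oplus> (\<sigma> ^^ k) e"
  "(\<sigma> ^^ k) \<one> = \<one>"
  using \<sigma>_pow_hom[of k] by (auto simp: ring_hom_def)

lemma \<sigma>_pow_zero [simp]: "(\<sigma> ^^ k) \<zero> = \<zero>"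
  using ring_hom_zero[OF \<sigma>_pow_hom ring_axioms ring_axioms] .

lemma carrier_P: "carrier P = up R"
  by (simp add: P_def skew_poly_ring_def UP_def)

lemma coef_closed [simp]: "p \<in> carrier P \<Longrightarrow> p k \<in> carrier R"
  unfolding carrier_P by (rule mem_upD)

lemma zero_P: "\<zero>\<^bsub>P\<^esub> = (\<lambda>k. \<zero>)"
  by (simp add: P_def skew_poly_ring_def UP_def)

lemma one_P: "\<one>\<^bsub>P\<^esub> = (\<lambda>k. if k = 0 then \<one> else \<zero>)"
  by (simp add: P_def skew_poly_ring_def UP_def)

lemma add_P: "\<lbrakk>p \<in> carrier P; r \<in> carrier P\<rbrakk> \<Longrightarrow> p \<oplus>\<^bsub>P\<^esub> r = (\<lambda>k. p k \<oplus> r k)"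
  unfolding carrier_P by (simp add: P_def skew_poly_ring_def UP_def)

lemma mult_P: "\<lbrakk>p \<in> carrier P; r \<in> carrier P\<rbrakk> \<Longrightarrow> p \<otimes>\<^bsub>P\<^esub> r = (\<lambda>k. \<Oplus>i\<in>{..k}. p i \<otimes> (\<sigma> ^^ i) (r (k - i)))"
  unfolding carrier_P by (simp add: P_def skew_poly_ring_def)

lemma mterm_P: "e \<in> carrier R \<Longrightarrow> mterm e m = (\<lambda>k. if k = m then e else \<zero>)"
  by (simp add: P_def skew_poly_ring_def UP_def)

lemma mterm_closed [simp]: "e \<in> carrier R \<Longrightarrow> mterm e m \<in> carrier P"
  unfolding carrier_P mterm_P by (auto simp: up_def)

lemma mult_closed:
  assumes p: "p \<in> carrier P" and r: "r \<in> carrier P"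
  shows "p \<otimes>\<^bsub>P\<^esub> r \<in> carrier P"
proof -
  obtain m m' where m: "bound \<zero> m p" "bound \<zero> m' r"
    using bound_upD p r unfolding carrier_P by blast
  have "bound \<zero> (m + m') (p \<otimes>\<^bsub>P\<^esub> r)"
  proof
    fix k assume k: "m + m' < k"
    have "p i \<otimes> (\<sigma> ^^ i) (r (k - i)) = \<zero>" for i
    proof (cases "m < i")
      case True
      then have "p i = \<zero>" using m(1) by auto
      then show ?thesis using r by simp
    next
      case False
      then have "m' < k - i" using k by arith
      then have "r (k - i) = \<zero>" using m(2) by auto
      then show ?thesis using p by simp
    qed
    then show "(p \<otimes>\<^bsub>P\<^esub> r) k = \<zero>" using p r by (simp add: mult_P)
  qed
  moreover have "(p \<otimes>\<^bsub>P\<^esub> r) k \<in> carrier R" for k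
    using p r by (simp add: mult_P)
  ultimately show ?thesis
    unfolding carrier_P by (intro mem_upI exI[of _ "m + m'"])
qed

lemma finsum_coef: "g \<in> I \<rightarrow> carrier R \<Longrightarrow> d \<in> carrier R \<Longrightarrow>
    d \<otimes> (\<sigma> ^^ i) (\<Oplus>j\<in>I. g j) = (\<Oplus>j\<in>I. d \<otimes> (\<sigma> ^^ i) (g j))"
  by (rule additive_finsum[where \<phi> = "\<lambda>e. d \<otimes> (\<sigma> ^^ i) e"])
    (auto simp: r_distr intro: abelian_group_axioms)

text \<open>Either way the coefficient of degree \<open>k\<close> is the sum of
  \<open>p_i \<sigma>^i(r_j) \<sigma>^(i+j)(t_l)\<close> over \<open>i + j + l = k\<close>; the
  right bracketing uses that \<open>\<sigma>^i\<close> is a ring homomorphism.\<close>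

lemma mult_assoc:
  assumes p: "p \<in> carrier P" and r: "r \<in> carrier P" and t: "t \<in> carrier P"
  shows "(p \<otimes>\<^bsub>P\<^esub> r) \<otimes>\<^bsub>P\<^esub> t = p \<otimes>\<^bsub>P\<^esub> (r \<otimes>\<^bsub>P\<^esub> t)"
proof
  fix k
  define g where "g i j = p i \<otimes> ((\<sigma> ^^ i) (r j) \<otimes> (\<sigma> ^^ (i + j)) (t (k - i - j)))" for i j
  have g: "g i j \<in> carrier R" for i j using assms by (simp add: g_def)
  have "((p \<otimes>\<^bsub>P\<^esub> r) \<otimes>\<^bsub>P\<^esub> t) k = (\<Oplus>j\<in>{..k}. (\<Oplus>i\<in>{..j}. p i \<otimes> (\<sigma> ^^ i) (r (j - i))) \<otimes> (\<sigma> ^^ j) (t (k - j)))"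
    unfolding mult_P[OF mult_closed[OF p r] t] unfolding mult_P[OF p r] ..
  also have "\<dots> = (\<Oplus>j\<in>{..k}. \<Oplus>i\<in>{..j}. g i (j - i))"
  proof (intro finsum_cong' refl)
    fix j
    have "(\<Oplus>i\<in>{..j}. p i \<otimes> (\<sigma> ^^ i) (r (j - i))) \<otimes> (\<sigma> ^^ j) (t (k - j)) =
        (\<Oplus>i\<in>{..j}. (p i \<otimes> (\<sigma> ^^ i) (r (j - i))) \<otimes> (\<sigma> ^^ j) (t (k - j)))"
      using assms by (intro finsum_ldistr) auto
    also have "\<dots> = (\<Oplus>i\<in>{..j}. g i (j - i))"
      using assms by (intro finsum_cong') (auto simp: g_def m_assoc)
    finally show "(\<Oplus>i\<in>{..j}. p i \<otimes> (\<sigma> ^^ i) (r (j - i))) \<otimes> (\<sigma> ^^ j) (t (k - j)) =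
        (\<Oplus>i\<in>{..j}. g i (j - i))" .
  qed (use g in auto)
  also have "\<dots> = (\<Oplus>i\<in>{..k}. \<Oplus>j\<in>{..k - i}. g i j)" using g by (rule finsum_triangle)
  also have "\<dots> = (\<Oplus>i\<in>{..k}. p i \<otimes> (\<sigma> ^^ i) (\<Oplus>j\<in>{..k - i}. r j \<otimes> (\<sigma> ^^ j) (t (k - i - j))))"
  proof (intro finsum_cong' refl)
    fix i
    have "p i \<otimes> (\<sigma> ^^ i) (\<Oplus>j\<in>{..k - i}. r j \<otimes> (\<sigma> ^^ j) (t (k - i - j))) =
        (\<Oplus>j\<in>{..k - i}. p i \<otimes> (\<sigma> ^^ i) (r j \<otimes> (\<sigma> ^^ j) (t (k - i - j))))"
      using assms by (intro finsum_coef) auto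
    also have "\<dots> = (\<Oplus>j\<in>{..k - i}. g i j)"
      using assms by (intro finsum_cong') (auto simp: g_def funpow_add)
    finally show "(\<Oplus>j\<in>{..k - i}. g i j) =
        p i \<otimes> (\<sigma> ^^ i) (\<Oplus>j\<in>{..k - i}. r j \<otimes> (\<sigma> ^^ j) (t (k - i - j)))" by simp
  qed (use assms in auto)
  also have "\<dots> = (p \<otimes>\<^bsub>P\<^esub> (r \<otimes>\<^bsub>P\<^esub> t)) k"
    unfolding mult_P[OF p mult_closed[OF r t]] unfolding mult_P[OF r t] ..
  finally show "((p \<otimes>\<^bsub>P\<^esub> r) \<otimes>\<^bsub>P\<^esub> t) k = (p \<otimes>\<^bsub>P\<^esub> (r \<otimes>\<^bsub>P\<^esub> t)) k" .
qed

lemma mterm_mult: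
  assumes e: "e \<in> carrier R" and r: "r \<in> carrier P"
  shows "mterm e m \<otimes>\<^bsub>P\<^esub> r = (\<lambda>k. if m \<le> k then e \<otimes> (\<sigma> ^^ m) (r (k - m)) else \<zero>)"
proof
  fix k
  have "(mterm e m \<otimes>\<^bsub>P\<^esub> r) k = (\<Oplus>i\<in>{..k}. if m = i then e \<otimes> (\<sigma> ^^ i) (r (k - i)) else \<zero>)"
    using assms by (simp add: mult_P, intro finsum_cong') (auto simp: mterm_P fun_eq_iff)
  also have "\<dots> = (if m \<le> k then e \<otimes> (\<sigma> ^^ m) (r (k - m)) else \<zero>)"
  proof (cases "m \<le> k")
    case True
    then show ?thesis
      using assms finsum_singleton[of m "{..k}" "\<lambda>i. e \<otimes> (\<sigma> ^^ i) (r (k - i))"] by simp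
  next
    case False
    then have "(\<Oplus>i\<in>{..k}. if m = i then e \<otimes> (\<sigma> ^^ i) (r (k - i)) else \<zero>) = (\<Oplus>i\<in>{..k}. \<zero>)"
      by (intro finsum_cong') auto
    then show ?thesis using False by simp
  qed
  finally show "(mterm e m \<otimes>\<^bsub>P\<^esub> r) k = (if m \<le> k then e \<otimes> (\<sigma> ^^ m) (r (k - m)) else \<zero>)" .
qed

lemma mult_mterm:
  assumes e: "e \<in> carrier R" and r: "r \<in> carrier P"
  shows "r \<otimes>\<^bsub>P\<^esub> mterm e m = (\<lambda>k. if m \<le> k then r (k - m) \<otimes> (\<sigma> ^^ (k - m)) e else \<zero>)"
proof
  fix k
  have "(r \<otimes>\<^bsub>P\<^esub> mterm e m) k = (\<Oplus>i\<in>{..k}. if m \<le> k \<and> k - m = i then r i \<otimes> (\<sigma> ^^ i) e else \<zero>)"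
    using assms by (simp add: mult_P, intro finsum_cong') (auto simp: mterm_P fun_eq_iff)
  also have "\<dots> = (if m \<le> k then r (k - m) \<otimes> (\<sigma> ^^ (k - m)) e else \<zero>)"
  proof (cases "m \<le> k")
    case True
    then show ?thesis
      using assms finsum_singleton[of "k - m" "{..k}" "\<lambda>i. r i \<otimes> (\<sigma> ^^ i) e"] by simp
  next
    case False
    then show ?thesis by simp
  qed
  finally show "(r \<otimes>\<^bsub>P\<^esub> mterm e m) k = (if m \<le> k then r (k - m) \<otimes> (\<sigma> ^^ (k - m)) e else \<zero>)" .
qed

lemma add_closed: "\<lbrakk>p \<in> carrier P; r \<in> carrier P\<rbrakk> \<Longrightarrow> p \<oplus>\<^bsub>P\<^esub> r \<in> carrier P"
  using up_add_closed by (simp add: add_P carrier_P)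

lemma one_eq: "\<one>\<^bsub>P\<^esub> = mterm \<one> 0"
  by (simp add: one_P mterm_P)

sublocale P: ring P
proof (rule ringI)
  show "abelian_group P"
  proof (rule abelian_groupI)
    show "\<exists>r\<in>carrier P. r \<oplus>\<^bsub>P\<^esub> p = \<zero>\<^bsub>P\<^esub>" if p: "p \<in> carrier P" for p
    proof
      show *: "(\<lambda>k. \<ominus> p k) \<in> carrier P" using p up_a_inv_closed by (simp add: carrier_P)
      show "(\<lambda>k. \<ominus> p k) \<oplus>\<^bsub>P\<^esub> p = \<zero>\<^bsub>P\<^esub>" using p by (simp add: add_P[OF *] zero_P l_neg)
    qed
    show "p \<oplus>\<^bsub>P\<^esub> r \<in> carrier P" if "p \<in> carrier P" "r \<in> carrier P" for p r
      by (rule add_closed[OF that])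
    show z: "\<zero>\<^bsub>P\<^esub> \<in> carrier P" by (auto simp: zero_P carrier_P)
    show "\<zero>\<^bsub>P\<^esub> \<oplus>\<^bsub>P\<^esub> p = p" if "p \<in> carrier P" for p
      using that by (simp add: add_P[OF z]) (simp add: zero_P)
    show "(p \<oplus>\<^bsub>P\<^esub> r) \<oplus>\<^bsub>P\<^esub> t = p \<oplus>\<^bsub>P\<^esub> (r \<oplus>\<^bsub>P\<^esub> t)"
      if "p \<in> carrier P" "r \<in> carrier P" "t \<in> carrier P" for p r t
      using that add_closed by (simp add: add_P[of "p \<oplus>\<^bsub>P\<^esub> r"] add_P[of p "r \<oplus>\<^bsub>P\<^esub> t"]) (simp add: add_P a_assoc)
    show "p \<oplus>\<^bsub>P\<^esub> r = r \<oplus>\<^bsub>P\<^esub> p" if "p \<in> carrier P" "r \<in> carrier P" for p r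
      using that by (simp add: add_P a_comm)
  qed
  show "monoid P"
  proof (rule monoidI)
    show "\<one>\<^bsub>P\<^esub> \<otimes>\<^bsub>P\<^esub> p = p" if "p \<in> carrier P" for p
      using that by (simp add: one_eq mterm_mult)
    show "p \<otimes>\<^bsub>P\<^esub> \<one>\<^bsub>P\<^esub> = p" if "p \<in> carrier P" for p
      using that by (simp add: one_eq mult_mterm)
  qed (auto simp: mult_closed mult_assoc one_eq)
  show "(p \<oplus>\<^bsub>P\<^esub> r) \<otimes>\<^bsub>P\<^esub> t = p \<otimes>\<^bsub>P\<^esub> t \<oplus>\<^bsub>P\<^esub> r \<otimes>\<^bsub>P\<^esub> t"
    if *: "p \<in> carrier P" "r \<in> carrier P" "t \<in> carrier P" for p r t
  proof
    fix k
    have "((p \<oplus>\<^bsub>P\<^esub> r) \<otimes>\<^bsub>P\<^esub> t) k = (\<Oplus>i\<in>{..k}. p i \<otimes> (\<sigma> ^^ i) (t (k - i)) \<oplus> r i \<otimes> (\<sigma> ^^ i) (t (k - i)))"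
      unfolding mult_P[OF add_closed[OF *(1,2)] *(3)] using * by (intro finsum_cong') (auto simp: add_P l_distr)
    then show "((p \<oplus>\<^bsub>P\<^esub> r) \<otimes>\<^bsub>P\<^esub> t) k = (p \<otimes>\<^bsub>P\<^esub> t \<oplus>\<^bsub>P\<^esub> r \<otimes>\<^bsub>P\<^esub> t) k"
      unfolding add_P[OF mult_closed[OF *(1,3)] mult_closed[OF *(2,3)]]
      unfolding mult_P[OF *(1,3)] mult_P[OF *(2,3)]
      using * by (simp add: finsum_addf)
  qed
  show "t \<otimes>\<^bsub>P\<^esub> (p \<oplus>\<^bsub>P\<^esub> r) = t \<otimes>\<^bsub>P\<^esub> p \<oplus>\<^bsub>P\<^esub> t \<otimes>\<^bsub>P\<^esub> r"
    if *: "p \<in> carrier P" "r \<in> carrier P" "t \<in> carrier P" for p r t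
  proof
    fix k
    have "(t \<otimes>\<^bsub>P\<^esub> (p \<oplus>\<^bsub>P\<^esub> r)) k = (\<Oplus>i\<in>{..k}. t i \<otimes> (\<sigma> ^^ i) (p (k - i)) \<oplus> t i \<otimes> (\<sigma> ^^ i) (r (k - i)))"
      unfolding mult_P[OF *(3) add_closed[OF *(1,2)]] using * by (intro finsum_cong') (auto simp: add_P r_distr)
    then show "(t \<otimes>\<^bsub>P\<^esub> (p \<oplus>\<^bsub>P\<^esub> r)) k = (t \<otimes>\<^bsub>P\<^esub> p \<oplus>\<^bsub>P\<^esub> t \<otimes>\<^bsub>P\<^esub> r) k"
      unfolding add_P[OF mult_closed[OF *(3,1)] mult_closed[OF *(3,2)]]
      unfolding mult_P[OF *(3,1)] mult_P[OF *(3,2)]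
      using * by (simp add: finsum_addf)
  qed
qed

lemma minus_P: "\<lbrakk>p \<in> carrier P; r \<in> carrier P\<rbrakk> \<Longrightarrow> p \<ominus>\<^bsub>P\<^esub> r = (\<lambda>k. p k \<ominus> r k)"
proof
  fix k assume *: "p \<in> carrier P" "r \<in> carrier P"
  have "p k = ((p \<ominus>\<^bsub>P\<^esub> r) \<oplus>\<^bsub>P\<^esub> r) k"
    using * by (simp add: a_minus_def P.a_assoc P.l_neg)
  also have "\<dots> = (p \<ominus>\<^bsub>P\<^esub> r) k \<oplus> r k" by (subst add_P) (use * in auto)
  finally show "(p \<ominus>\<^bsub>P\<^esub> r) k = p k \<ominus> r k"
    using * by (simp add: a_minus_def a_assoc r_neg)
qed

lemma const_hom: "(\<lambda>e. mterm e 0) \<in> ring_hom R P"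
proof (rule ring_hom_memI)
  show "mterm (d \<otimes> e) 0 = mterm d 0 \<otimes>\<^bsub>P\<^esub> mterm e 0" if "d \<in> carrier R" "e \<in> carrier R" for d e
    using that by (simp add: mterm_mult) (auto simp: mterm_P fun_eq_iff)
  show "mterm (d \<oplus> e) 0 = mterm d 0 \<oplus>\<^bsub>P\<^esub> mterm e 0" if "d \<in> carrier R" "e \<in> carrier R" for d e
    using that by (simp add: add_P) (auto simp: mterm_P fun_eq_iff)
qed (simp_all add: one_eq)

lemma var_pow: "mterm \<one> 1 [^]\<^bsub>P\<^esub> k = mterm \<one> k"
proof (induct k)
  case (Suc k)
  then show ?case by (simp add: mterm_mult) (auto simp: mterm_P fun_eq_iff)
qed (simp add: one_eq)

lemma mterm_eq: "e \<in> carrier R \<Longrightarrow> mterm e k = mterm e 0 \<otimes>\<^bsub>P\<^esub> mterm \<one> 1 [^]\<^bsub>P\<^esub> k"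
  unfolding var_pow by (simp add: mterm_mult) (auto simp: mterm_P fun_eq_iff)

lemma var_const: "e \<in> carrier R \<Longrightarrow> mterm \<one> 1 \<otimes>\<^bsub>P\<^esub> mterm e 0 = mterm (\<sigma> e) 0 \<otimes>\<^bsub>P\<^esub> mterm \<one> 1"
  by (simp add: mterm_mult) (auto simp: mterm_P fun_eq_iff)

lemma finsum_mterm:
  assumes p: "p \<in> carrier P" and m: "bound \<zero> m p"
  shows "p = (\<Oplus>\<^bsub>P\<^esub>i\<in>{..m}. mterm (p i) i)"
proof
  fix k
  have "(\<Oplus>\<^bsub>P\<^esub>i\<in>{..m}. mterm (p i) i) k = (\<Oplus>i\<in>{..m}. mterm (p i) i k)"
    using p by (intro additive_finsum[where \<phi> = "\<lambda>r. r k"])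
      (auto simp: add_P intro: P.abelian_group_axioms abelian_group_axioms)
  also have "\<dots> = (\<Oplus>i\<in>{..m}. if k = i then p i else \<zero>)"
    using p by (intro finsum_cong') (auto simp: mterm_P fun_eq_iff)
  also have "\<dots> = p k"
  proof (cases "k \<le> m")
    case True
    then show ?thesis using p finsum_singleton[of k "{..m}" p] by simp
  next
    case False
    then have "(\<Oplus>i\<in>{..m}. if k = i then p i else \<zero>) = (\<Oplus>i\<in>{..m}. \<zero>)" by (intro finsum_cong') auto
    then show ?thesis using bound.bound[OF m, of k] False by simp
  qed
  finally show "p k = (\<Oplus>\<^bsub>P\<^esub>i\<in>{..m}. mterm (p i) i) k" by simp
qed

end

section \<open>The presentation of the algebra by generators and relations\<close>

locale cyclic_presentation = root_field F n q + E: cring E + E: binom_alg F E \<iota> n h s + S: skew_poly E \<sigma>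
  for F :: "('a, 'm) ring_scheme" and n :: nat and q :: 'a
    and E :: "('c, 'o) ring_scheme" and \<iota> :: "'a \<Rightarrow> 'c" and h :: 'c and s :: 'a and \<sigma> :: "'c \<Rightarrow> 'c" +
  fixes a :: 'a
  assumes a_closed [simp]: "a \<in> carrier F"
    and \<sigma>_\<iota>: "c \<in> carrier F \<Longrightarrow> \<sigma> (\<iota> c) = \<iota> c"
    and \<sigma>_h: "\<sigma> h = \<iota> q \<otimes>\<^bsub>E\<^esub> h"
begin

lemma \<sigma>_pow_\<iota>: "c \<in> carrier F \<Longrightarrow> (\<sigma> ^^ k) (\<iota> c) = \<iota> c"
  by (induct k) (auto simp: \<sigma>_\<iota>)

lemma \<sigma>_pow_h: "(\<sigma> ^^ k) h = \<iota> (q [^]\<^bsub>F\<^esub> k) \<otimes>\<^bsub>E\<^esub> h"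
proof (induct k)
  case (Suc k)
  have "(\<sigma> ^^ Suc k) h = \<sigma> (\<iota> (q [^]\<^bsub>F\<^esub> k)) \<otimes>\<^bsub>E\<^esub> (\<iota> q \<otimes>\<^bsub>E\<^esub> h)"
    by (simp add: Suc \<sigma>_h)
  also have "\<dots> = \<iota> (q [^]\<^bsub>F\<^esub> Suc k) \<otimes>\<^bsub>E\<^esub> h"
    unfolding \<sigma>_\<iota>[OF nat_pow_closed[OF q_closed]] by (subst E.f_mult_f) auto
  finally show ?case .
qed simp

text \<open>\<open>\<sigma>^n\<close> fixes \<open>F\<close> and, because \<open>q^n = 1\<close>,
  also the generator \<open>h\<close>. This is what makes \<open>x^n\<close> central.\<close>

lemma \<sigma>_pow_n:
  assumes "e \<in> carrier E"
  shows "(\<sigma> ^^ n) e = e"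
proof -
  interpret \<sigma>n: ring_hom_ring E E "\<sigma> ^^ n"
    using S.\<sigma>_pow_hom by (intro ring_hom_ringI2) unfold_locales
  define c where "c = E.co e"
  have c: "c \<in> {..<n} \<rightarrow> carrier F" "e = E.el c" using E.co[OF assms] by (simp_all add: c_def)
  then have ci: "c i \<in> carrier F" if "i < n" for i using that by auto
  have h: "(\<sigma> ^^ n) h = h" unfolding \<sigma>_pow_h q_pow_n by simp
  have "(\<sigma> ^^ n) e = (\<Oplus>\<^bsub>E\<^esub>i\<in>{..<n}. (\<sigma> ^^ n) (\<iota> (c i) \<otimes>\<^bsub>E\<^esub> h [^]\<^bsub>E\<^esub> i))"
    unfolding c(2) E.lc_def using ci
    by (intro additive_finsum) (auto intro: E.abelian_group_axioms)
  also have "\<dots> = e"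
    unfolding c(2) E.lc_def using ci
    by (intro E.finsum_cong') (auto simp: \<sigma>n.hom_nat_pow h \<sigma>_pow_\<iota>)
  finally show ?thesis .
qed

definition "z = S.mterm \<one>\<^bsub>E\<^esub> n \<ominus>\<^bsub>S.P\<^esub> S.mterm (\<iota> a) 0"

lemma z_closed [simp]: "z \<in> carrier S.P"
  by (simp add: z_def)

lemma z_mult:
  assumes r: "r \<in> carrier S.P"
  shows "z \<otimes>\<^bsub>S.P\<^esub> r = (\<lambda>k. (if n \<le> k then r (k - n) else \<zero>\<^bsub>E\<^esub>) \<ominus>\<^bsub>E\<^esub> \<iota> a \<otimes>\<^bsub>E\<^esub> r k)"
proof -
  have "z \<otimes>\<^bsub>S.P\<^esub> r = S.mterm \<one>\<^bsub>E\<^esub> n \<otimes>\<^bsub>S.P\<^esub> r \<ominus>\<^bsub>S.P\<^esub> S.mterm (\<iota> a) 0 \<otimes>\<^bsub>S.P\<^esub> r"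
    using r by (simp add: z_def a_minus_def S.P.l_distr S.P.l_minus)
  also have "\<dots> = (\<lambda>k. (S.mterm \<one>\<^bsub>E\<^esub> n \<otimes>\<^bsub>S.P\<^esub> r) k \<ominus>\<^bsub>E\<^esub> (S.mterm (\<iota> a) 0 \<otimes>\<^bsub>S.P\<^esub> r) k)"
    using r by (intro S.minus_P) auto
  also have "\<dots> = (\<lambda>k. (if n \<le> k then r (k - n) else \<zero>\<^bsub>E\<^esub>) \<ominus>\<^bsub>E\<^esub> \<iota> a \<otimes>\<^bsub>E\<^esub> r k)"
    using r by (intro ext) (simp add: S.mterm_mult \<sigma>_pow_n)
  finally show ?thesis .
qed

text \<open>\<open>x^n\<close> commutes with coefficients because \<open>\<sigma>^n\<close> is the
  identity, and \<open>a\<close> commutes with \<open>x\<close> because \<open>\<sigma>\<close>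
  fixes it.\<close>

lemma mult_z:
  assumes r: "r \<in> carrier S.P"
  shows "r \<otimes>\<^bsub>S.P\<^esub> z = z \<otimes>\<^bsub>S.P\<^esub> r"
proof -
  have "r \<otimes>\<^bsub>S.P\<^esub> z = r \<otimes>\<^bsub>S.P\<^esub> S.mterm \<one>\<^bsub>E\<^esub> n \<ominus>\<^bsub>S.P\<^esub> r \<otimes>\<^bsub>S.P\<^esub> S.mterm (\<iota> a) 0"
    using r by (simp add: z_def a_minus_def S.P.r_distr S.P.r_minus)
  also have "\<dots> = (\<lambda>k. (r \<otimes>\<^bsub>S.P\<^esub> S.mterm \<one>\<^bsub>E\<^esub> n) k \<ominus>\<^bsub>E\<^esub> (r \<otimes>\<^bsub>S.P\<^esub> S.mterm (\<iota> a) 0) k)"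
    using r by (intro S.minus_P) auto
  also have "\<dots> = z \<otimes>\<^bsub>S.P\<^esub> r"
    unfolding z_mult[OF r] using r by (intro ext) (simp add: S.mult_mterm \<sigma>_pow_\<iota> E.m_comm)
  finally show ?thesis .
qed

abbreviation "I \<equiv> cyc_ideal E \<sigma> n (\<iota> a)"

lemma I_eq: "I = Idl\<^bsub>S.P\<^esub> {z}"
  by (simp add: cyc_ideal_def S.P_def[symmetric] z_def S.var_pow[simplified])

sublocale I: ideal I S.P
  unfolding I_eq by (rule S.P.genideal_ideal) simp

lemma z_in_I: "z \<in> I"
  unfolding I_eq by (rule S.P.genideal_self') simp

text \<open>For a central generator the set of its right multiples is already a two-sided
  ideal.\<close>

lemma in_I:
  assumes "p \<in> I"
  shows "\<exists>r\<in>carrier S.P. p = z \<otimes>\<^bsub>S.P\<^esub> r"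
proof -
  define J where "J = {z \<otimes>\<^bsub>S.P\<^esub> r |r. r \<in> carrier S.P}"
  have JI: "z \<otimes>\<^bsub>S.P\<^esub> r \<in> J" if "r \<in> carrier S.P" for r
    unfolding J_def using that by (intro CollectI exI[of _ r] conjI refl)
  have JD: "\<exists>r\<in>carrier S.P. u = z \<otimes>\<^bsub>S.P\<^esub> r" if "u \<in> J" for u
    using that by (auto simp: J_def)
  have "ideal J S.P"
  proof (rule idealI[OF S.P.ring_axioms])
    show "subgroup J (add_monoid S.P)"
    proof (rule S.P.add.subgroupI)
      show "J \<subseteq> carrier S.P" by (auto simp: J_def)
      show "J \<noteq> {}" using JI[OF S.P.zero_closed] by (rule ex_in_conv[THEN iffD1, OF exI])
    next
      fix u assume "u \<in> J"
      then obtain r where r: "r \<in> carrier S.P" "u = z \<otimes>\<^bsub>S.P\<^esub> r" using JD by (elim bexE[OF JD])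
      then have "\<ominus>\<^bsub>S.P\<^esub> u = z \<otimes>\<^bsub>S.P\<^esub> (\<ominus>\<^bsub>S.P\<^esub> r)" by (simp add: S.P.r_minus)
      then show "\<ominus>\<^bsub>S.P\<^esub> u \<in> J" using JI[of "\<ominus>\<^bsub>S.P\<^esub> r"] r(1) by simp
    next
      fix u v assume u: "u \<in> J" and v: "v \<in> J"
      obtain r where r: "r \<in> carrier S.P" "u = z \<otimes>\<^bsub>S.P\<^esub> r" using JD[OF u] by (elim bexE)
      obtain t where t: "t \<in> carrier S.P" "v = z \<otimes>\<^bsub>S.P\<^esub> t" using JD[OF v] by (elim bexE)
      have "u \<oplus>\<^bsub>S.P\<^esub> v = z \<otimes>\<^bsub>S.P\<^esub> (r \<oplus>\<^bsub>S.P\<^esub> t)" using r t by (simp add: S.P.r_distr)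
      then show "u \<oplus>\<^bsub>S.P\<^esub> v \<in> J" using JI[of "r \<oplus>\<^bsub>S.P\<^esub> t"] r(1) t(1) by simp
    qed
  next
    fix u t assume u: "u \<in> J" and t: "t \<in> carrier S.P"
    obtain r where r: "r \<in> carrier S.P" "u = z \<otimes>\<^bsub>S.P\<^esub> r" using JD[OF u] by (elim bexE)
    have "u \<otimes>\<^bsub>S.P\<^esub> t = z \<otimes>\<^bsub>S.P\<^esub> (r \<otimes>\<^bsub>S.P\<^esub> t)" using r t by (simp add: S.P.m_assoc)
    then show "u \<otimes>\<^bsub>S.P\<^esub> t \<in> J" using JI[of "r \<otimes>\<^bsub>S.P\<^esub> t"] r(1) t by simp
    have "t \<otimes>\<^bsub>S.P\<^esub> u = (t \<otimes>\<^bsub>S.P\<^esub> z) \<otimes>\<^bsub>S.P\<^esub> r" using r t by (simp add: S.P.m_assoc)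
    also have "\<dots> = z \<otimes>\<^bsub>S.P\<^esub> (t \<otimes>\<^bsub>S.P\<^esub> r)" unfolding mult_z[OF t] using r t by (simp add: S.P.m_assoc)
    finally show "t \<otimes>\<^bsub>S.P\<^esub> u \<in> J" using JI[of "t \<otimes>\<^bsub>S.P\<^esub> r"] r(1) t by simp
  qed
  moreover have "{z} \<subseteq> J" using JI[of "\<one>\<^bsub>S.P\<^esub>"] by simp
  ultimately have "I \<subseteq> J" unfolding I_eq by (rule S.P.genideal_minimal)
  then show ?thesis using assms JD by (intro JD) (rule subsetD)
qed

text \<open>
  The coefficients of \<open>(x\<^sup>n - a) r\<close> in degrees at least \<open>n\<close> determine \<open>r\<close>, by descending from a bound of
  \<open>r\<close>.
\<close>

lemma reduced_zero:
  assumes "p \<in> I" and p: "\<And>k. n \<le> k \<Longrightarrow> p k = \<zero>\<^bsub>E\<^esub>"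
  shows "p = \<zero>\<^bsub>S.P\<^esub>"
proof -
  obtain r where r: "r \<in> carrier S.P" "p = z \<otimes>\<^bsub>S.P\<^esub> r" using in_I[OF assms(1)] by (elim bexE)
  then obtain m where m: "bound \<zero>\<^bsub>E\<^esub> m r" using E.bound_upD by (auto simp: S.carrier_P)
  have step: "r k = \<iota> a \<otimes>\<^bsub>E\<^esub> r (k + n)" for k
  proof -
    have "r k \<ominus>\<^bsub>E\<^esub> \<iota> a \<otimes>\<^bsub>E\<^esub> r (k + n) = \<zero>\<^bsub>E\<^esub>"
      using p[of "k + n"] unfolding r(2) z_mult[OF r(1)] by simp
    then show ?thesis using r(1) by (subst (asm) E.r_right_minus_eq) auto
  qed
  have r0: "r k = \<zero>\<^bsub>E\<^esub>" if "m < k + d" for k d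
    using that
  proof (induct d arbitrary: k)
    case 0
    then show ?case using bound.bound[OF m, of k] by simp
  next
    case (Suc d)
    then have "r (k + n) = \<zero>\<^bsub>E\<^esub>" using E.n_pos by (intro Suc(1)) simp
    then show ?case using step[of k] by simp
  qed
  have "r = \<zero>\<^bsub>S.P\<^esub>" unfolding S.zero_P using r0[of _ "Suc m"] by (intro ext) simp
  then show ?thesis using r(2) by simp
qed

abbreviation "\<E> \<equiv> cyc_alg E \<sigma> n (\<iota> a)"
abbreviation "\<epsilon> \<equiv> cyc_const E \<sigma> n (\<iota> a)"
abbreviation "x \<equiv> cyc_var E \<sigma> n (\<iota> a)"

definition "cls p = I +>\<^bsub>S.P\<^esub> p"

lemma \<E>_eq: "\<E> = S.P Quot I"
  by (simp add: cyc_alg_def S.P_def)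

lemma \<epsilon>_eq: "\<epsilon> e = cls (S.mterm e 0)"
  by (simp add: cyc_const_def cls_def S.P_def)

lemma x_eq: "x = cls (S.mterm \<one>\<^bsub>E\<^esub> 1)"
  by (simp add: cyc_var_def cls_def S.P_def)

sublocale Q: ring \<E>
  unfolding \<E>_eq by (rule I.quotient_is_ring)

sublocale cls: ring_hom_ring S.P \<E> cls
  using I.rcos_ring_hom_ring by (simp add: \<E>_eq cls_def[abs_def])

lemma cls_zero_iff: "p \<in> carrier S.P \<Longrightarrow> cls p = \<zero>\<^bsub>\<E>\<^esub> \<longleftrightarrow> p \<in> I"
  unfolding \<E>_eq cls_def by (rule I.coset_eq_zero_iff)

lemma cls_surj: "y \<in> carrier \<E> \<Longrightarrow> \<exists>p\<in>carrier S.P. y = cls p"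
  unfolding \<E>_eq cls_def by (rule S.P.FactRing_carrierD)

lemma \<epsilon>_hom: "\<epsilon> \<in> ring_hom E \<E>"
  using ring_hom_trans[OF S.const_hom cls.homh] by (simp add: comp_def \<epsilon>_eq[abs_def])

sublocale \<epsilon>: ring_hom_ring E \<E> \<epsilon>
  using \<epsilon>_hom by (intro ring_hom_ringI2) unfold_locales

lemma x_closed [simp]: "x \<in> carrier \<E>"
  by (simp add: x_eq)

lemma x_\<epsilon>: "e \<in> carrier E \<Longrightarrow> x \<otimes>\<^bsub>\<E>\<^esub> \<epsilon> e = \<epsilon> (\<sigma> e) \<otimes>\<^bsub>\<E>\<^esub> x"
  unfolding x_eq \<epsilon>_eq by (simp add: cls.hom_mult[symmetric] S.var_const[simplified] del: cls.hom_mult)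

lemma cls_mterm: "e \<in> carrier E \<Longrightarrow> cls (S.mterm e k) = \<epsilon> e \<otimes>\<^bsub>\<E>\<^esub> x [^]\<^bsub>\<E>\<^esub> k"
  unfolding x_eq \<epsilon>_eq by (subst S.mterm_eq) (auto simp: cls.hom_nat_pow)

lemma x_pow_n: "x [^]\<^bsub>\<E>\<^esub> n = \<epsilon> (\<iota> a)"
proof -
  have "cls z = \<zero>\<^bsub>\<E>\<^esub>" by (simp add: cls_zero_iff z_in_I)
  then have "cls (S.mterm \<one>\<^bsub>E\<^esub> n) \<ominus>\<^bsub>\<E>\<^esub> cls (S.mterm (\<iota> a) 0) = \<zero>\<^bsub>\<E>\<^esub>"
    by (simp add: z_def a_minus_def)
  then have "cls (S.mterm \<one>\<^bsub>E\<^esub> n) = cls (S.mterm (\<iota> a) 0)"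
    by (subst (asm) Q.r_right_minus_eq) auto
  moreover have "cls (S.mterm \<one>\<^bsub>E\<^esub> n) = x [^]\<^bsub>\<E>\<^esub> n"
    using cls_mterm[of "\<one>\<^bsub>E\<^esub>" n] by simp
  ultimately show ?thesis unfolding \<epsilon>_eq by simp
qed

text \<open>A constant has degree below \<open>n\<close>, so it lies in the ideal only if it is
  zero. The embedding of \<open>E\<close> is thus injective even when \<open>E\<close> is not a
  field.\<close>

lemma \<epsilon>_zero_iff:
  assumes "e \<in> carrier E"
  shows "\<epsilon> e = \<zero>\<^bsub>\<E>\<^esub> \<longleftrightarrow> e = \<zero>\<^bsub>E\<^esub>"
proof
  assume "\<epsilon> e = \<zero>\<^bsub>\<E>\<^esub>"
  then have "S.mterm e 0 \<in> I" using assms by (simp add: \<epsilon>_eq cls_zero_iff)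
  then have "S.mterm e 0 = \<zero>\<^bsub>S.P\<^esub>"
    using E.n_pos assms by (intro reduced_zero) (auto simp: S.mterm_P)
  then have "S.mterm e 0 0 = \<zero>\<^bsub>E\<^esub>" by (simp add: S.zero_P)
  then show "e = \<zero>\<^bsub>E\<^esub>" using assms by (simp add: S.mterm_P)
qed simp

sublocale Q: central_alg F \<E> "\<lambda>c. \<epsilon> (\<iota> c)"
proof unfold_locales
  show "(\<lambda>c. \<epsilon> (\<iota> c)) \<in> ring_hom F \<E>"
    using ring_hom_trans[OF E.f_hom \<epsilon>_hom] by (simp add: comp_def)
  show "r \<otimes>\<^bsub>\<E>\<^esub> \<epsilon> (\<iota> c) = \<epsilon> (\<iota> c) \<otimes>\<^bsub>\<E>\<^esub> r" if c: "c \<in> carrier F" and r: "r \<in> carrier \<E>" for c r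
  proof -
    obtain p where p: "p \<in> carrier S.P" "r = cls p" using cls_surj[OF r] by (elim bexE)
    have "p \<otimes>\<^bsub>S.P\<^esub> S.mterm (\<iota> c) 0 = S.mterm (\<iota> c) 0 \<otimes>\<^bsub>S.P\<^esub> p"
      using c p(1) by (simp add: S.mterm_mult S.mult_mterm \<sigma>_pow_\<iota> E.m_comm)
    then show ?thesis using c p by (simp add: \<epsilon>_eq cls.hom_mult[symmetric] del: cls.hom_mult)
  qed
  show "\<one>\<^bsub>\<E>\<^esub> \<noteq> \<zero>\<^bsub>\<E>\<^esub>" using \<epsilon>_zero_iff[of "\<one>\<^bsub>E\<^esub>"] E.nontrivial by simp
qed

abbreviation "B \<equiv> \<lambda>(i, j). \<epsilon> h [^]\<^bsub>\<E>\<^esub> (i::nat) \<otimes>\<^bsub>\<E>\<^esub> x [^]\<^bsub>\<E>\<^esub> (j::nat)"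
abbreviation "IJ \<equiv> {..<n} \<times> {..<n}"

lemma B_closed: "B \<in> IJ \<rightarrow> carrier \<E>"
  by auto

lemma \<epsilon>_el:
  assumes c: "c \<in> {..<n} \<rightarrow> carrier F"
  shows "\<epsilon> (E.el c) = (\<Oplus>\<^bsub>\<E>\<^esub>i\<in>{..<n}. \<epsilon> (\<iota> (c i)) \<otimes>\<^bsub>\<E>\<^esub> \<epsilon> h [^]\<^bsub>\<E>\<^esub> i)"
proof -
  have ci: "c i \<in> carrier F" if "i < n" for i using c that by auto
  have "\<epsilon> (E.el c) = (\<Oplus>\<^bsub>\<E>\<^esub>i\<in>{..<n}. \<epsilon> (\<iota> (c i) \<otimes>\<^bsub>E\<^esub> h [^]\<^bsub>E\<^esub> i))"
    unfolding E.lc_def using ci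
    by (intro additive_finsum) (auto intro: E.abelian_group_axioms Q.abelian_group_axioms)
  also have "\<dots> = (\<Oplus>\<^bsub>\<E>\<^esub>i\<in>{..<n}. \<epsilon> (\<iota> (c i)) \<otimes>\<^bsub>\<E>\<^esub> \<epsilon> h [^]\<^bsub>\<E>\<^esub> i)"
    using ci by (intro Q.finsum_cong') (auto simp: \<epsilon>.hom_nat_pow)
  finally show ?thesis .
qed

lemma cls_mterm_reduced:
  assumes e: "e \<in> carrier E"
  shows "\<exists>d\<in>carrier E. cls (S.mterm e k) = \<epsilon> d \<otimes>\<^bsub>\<E>\<^esub> x [^]\<^bsub>\<E>\<^esub> (k mod n)"
proof (intro bexI)
  have "x [^]\<^bsub>\<E>\<^esub> k = x [^]\<^bsub>\<E>\<^esub> (n * (k div n) + k mod n)" by simp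
  also have "\<dots> = (x [^]\<^bsub>\<E>\<^esub> n) [^]\<^bsub>\<E>\<^esub> (k div n) \<otimes>\<^bsub>\<E>\<^esub> x [^]\<^bsub>\<E>\<^esub> (k mod n)"
    by (simp only: Q.nat_pow_mult[symmetric] Q.nat_pow_pow x_closed)
  finally show "cls (S.mterm e k) = \<epsilon> (e \<otimes>\<^bsub>E\<^esub> \<iota> a [^]\<^bsub>E\<^esub> (k div n)) \<otimes>\<^bsub>\<E>\<^esub> x [^]\<^bsub>\<E>\<^esub> (k mod n)"
    unfolding cls_mterm[OF e] x_pow_n using e by (simp add: \<epsilon>.hom_nat_pow Q.m_assoc)
qed (use e in simp)

text \<open>Each \<open>e x^k\<close> reduces to \<open>d x^(k mod n)\<close> by
  \<open>x^n = a\<close>, and \<open>d\<close> expands in the powers of \<open>h\<close>.\<close>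

lemma cls_in_span:
  assumes p: "p \<in> carrier S.P"
  shows "\<exists>c\<in>IJ \<rightarrow> carrier F. cls p = Q.lc B IJ c"
proof -
  define W where "W = {Q.lc B IJ c |c. c \<in> IJ \<rightarrow> carrier F}"
  have WI: "Q.lc B IJ c \<in> W" if "c \<in> IJ \<rightarrow> carrier F" for c
    unfolding W_def using that by (intro CollectI exI[of _ c] conjI refl)
  have WD: "\<exists>c\<in>IJ \<rightarrow> carrier F. u = Q.lc B IJ c" if "u \<in> W" for u
    using that by (auto simp: W_def)
  have W_carrier: "W \<subseteq> carrier \<E>" using Q.lc_closed[OF B_closed] by (auto simp: W_def)
  have W_zero: "\<zero>\<^bsub>\<E>\<^esub> \<in> W" using WI[of "\<lambda>p. \<zero>\<^bsub>F\<^esub>"] Q.lc_zero[OF B_closed] by simp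
  have W_add: "u \<oplus>\<^bsub>\<E>\<^esub> v \<in> W" if u: "u \<in> W" and v: "v \<in> W" for u v
  proof -
    obtain c where c: "c \<in> IJ \<rightarrow> carrier F" "u = Q.lc B IJ c" using WD[OF u] by (elim bexE)
    obtain d where d: "d \<in> IJ \<rightarrow> carrier F" "v = Q.lc B IJ d" using WD[OF v] by (elim bexE)
    show ?thesis
      unfolding c(2) d(2) Q.lc_add[OF B_closed c(1) d(1)]
      using c(1) d(1) by (intro WI) (auto simp: Pi_def)
  qed
  have mterm_W: "cls (S.mterm e k) \<in> W" if e: "e \<in> carrier E" for e k
  proof -
    obtain d where d: "d \<in> carrier E" "cls (S.mterm e k) = \<epsilon> d \<otimes>\<^bsub>\<E>\<^esub> x [^]\<^bsub>\<E>\<^esub> (k mod n)"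
      using cls_mterm_reduced[OF e, of k] by (elim bexE)
    define c where "c = E.co d"
    have c: "c \<in> {..<n} \<rightarrow> carrier F" "E.el c = d" using E.co[OF d(1)] by (simp_all add: c_def)
    then have ci: "c i \<in> carrier F" if "i < n" for i using that by auto
    have "cls (S.mterm e k) =
        (\<Oplus>\<^bsub>\<E>\<^esub>i\<in>{..<n}. (\<epsilon> (\<iota> (c i)) \<otimes>\<^bsub>\<E>\<^esub> \<epsilon> h [^]\<^bsub>\<E>\<^esub> i) \<otimes>\<^bsub>\<E>\<^esub> x [^]\<^bsub>\<E>\<^esub> (k mod n))"
      unfolding d(2) c(2)[symmetric] \<epsilon>_el[OF c(1)] using ci by (intro Q.finsum_ldistr) auto
    also have "\<dots> \<in> W"
    proof (rule Q.finsum_mem[OF W_carrier W_zero W_add])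
      fix i assume i: "i \<in> {..<n}"
      then have ij: "(i, k mod n) \<in> IJ" using E.n_pos by simp
      have "Q.lc B IJ (\<lambda>p. if p = (i, k mod n) then c i else \<zero>\<^bsub>F\<^esub>) = \<epsilon> (\<iota> (c i)) \<otimes>\<^bsub>\<E>\<^esub> B (i, k mod n)"
        using ci i by (intro Q.lc_single[OF B_closed _ ij]) auto
      also have "\<dots> = (\<epsilon> (\<iota> (c i)) \<otimes>\<^bsub>\<E>\<^esub> \<epsilon> h [^]\<^bsub>\<E>\<^esub> i) \<otimes>\<^bsub>\<E>\<^esub> x [^]\<^bsub>\<E>\<^esub> (k mod n)"
        using ci i by (simp add: Q.m_assoc)
      finally show "(\<epsilon> (\<iota> (c i)) \<otimes>\<^bsub>\<E>\<^esub> \<epsilon> h [^]\<^bsub>\<E>\<^esub> i) \<otimes>\<^bsub>\<E>\<^esub> x [^]\<^bsub>\<E>\<^esub> (k mod n) \<in> W"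
        using WI[of "\<lambda>p. if p = (i, k mod n) then c i else \<zero>\<^bsub>F\<^esub>"] ci i by (simp add: Pi_def)
    qed
    finally show ?thesis .
  qed
  obtain m where m: "bound \<zero>\<^bsub>E\<^esub> m p" using E.bound_upD p by (auto simp: S.carrier_P)
  have "cls p = cls (\<Oplus>\<^bsub>S.P\<^esub>i\<in>{..m}. S.mterm (p i) i)" using S.finsum_mterm[OF p m] by simp
  also have "\<dots> = (\<Oplus>\<^bsub>\<E>\<^esub>i\<in>{..m}. cls (S.mterm (p i) i))"
    using p by (intro additive_finsum[where \<phi> = cls]) (auto intro: S.P.abelian_group_axioms Q.abelian_group_axioms)
  also have "\<dots> \<in> W" using mterm_W p by (intro Q.finsum_mem[OF W_carrier W_zero W_add]) auto
  finally show ?thesis by (rule WD)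
qed

text \<open>A linear relation between the monomials lifts to a skew polynomial of degree below
  \<open>n\<close> in the ideal, hence to zero. Its coefficient of \<open>x^k\<close> is the element
  of \<open>E\<close> with coordinates \<open>c (i, k)\<close>, so these vanish.\<close>

lemma lc_B_zero:
  assumes c: "c \<in> IJ \<rightarrow> carrier F" and zero: "Q.lc B IJ c = \<zero>\<^bsub>\<E>\<^esub>" and ik: "i < n" "k < n"
  shows "c (i, k) = \<zero>\<^bsub>F\<^esub>"
proof -
  have cij: "c (i, j) \<in> carrier F" if "i < n" "j < n" for i j using c that by auto
  define g where "g = (\<lambda>(i, j). \<iota> (c (i, j)) \<otimes>\<^bsub>E\<^esub> h [^]\<^bsub>E\<^esub> (i::nat))"
  have g: "g p \<in> carrier E" if "p \<in> IJ" for p using that cij by (auto simp: g_def)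
  define p where "p = (\<Oplus>\<^bsub>S.P\<^esub>r\<in>IJ. S.mterm (g r) (snd r))"
  have p_closed: "p \<in> carrier S.P" unfolding p_def using g by (intro S.P.finsum_closed) simp
  have "cls p = (\<Oplus>\<^bsub>\<E>\<^esub>r\<in>IJ. cls (S.mterm (g r) (snd r)))"
    unfolding p_def using g
    by (intro additive_finsum[where \<phi> = cls]) (auto intro: S.P.abelian_group_axioms Q.abelian_group_axioms)
  also have "\<dots> = Q.lc B IJ c"
    unfolding Q.lc_def
  proof (intro Q.finsum_cong' refl)
    fix r assume r: "r \<in> IJ"
    obtain i j where ij: "r = (i, j)" by (rule prod.exhaust)
    have "cls (S.mterm (g r) (snd r)) = \<epsilon> (\<iota> (c (i, j)) \<otimes>\<^bsub>E\<^esub> h [^]\<^bsub>E\<^esub> i) \<otimes>\<^bsub>\<E>\<^esub> x [^]\<^bsub>\<E>\<^esub> j"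
      using cls_mterm[OF g[OF r], of j] by (simp add: ij g_def)
    then show "cls (S.mterm (g r) (snd r)) = \<epsilon> (\<iota> (c r)) \<otimes>\<^bsub>\<E>\<^esub> B r"
      using cij r by (simp add: ij \<epsilon>.hom_nat_pow Q.m_assoc)
    next
    show "(\<lambda>r. \<epsilon> (\<iota> (c r)) \<otimes>\<^bsub>\<E>\<^esub> B r) \<in> IJ \<rightarrow> carrier \<E>"
      by (intro Pi_I Q.lc_term_closed[OF B_closed c])
  qed
  finally have "p \<in> I" using zero p_closed by (simp add: cls_zero_iff)
  moreover have coef: "p l = (\<Oplus>\<^bsub>E\<^esub>r\<in>IJ. if l = snd r then g r else \<zero>\<^bsub>E\<^esub>)" for l
  proof -
    have "p l = (\<Oplus>\<^bsub>E\<^esub>r\<in>IJ. S.mterm (g r) (snd r) l)"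
      unfolding p_def using g by (intro additive_finsum[where \<phi> = "\<lambda>r. r l"])
        (auto simp: S.add_P intro: S.P.abelian_group_axioms E.abelian_group_axioms)
    also have "\<dots> = (\<Oplus>\<^bsub>E\<^esub>r\<in>IJ. if l = snd r then g r else \<zero>\<^bsub>E\<^esub>)"
      using g by (intro E.finsum_cong') (auto simp: S.mterm_P simp del: split_paired_All)
    finally show ?thesis .
  qed
  moreover have "(\<Oplus>\<^bsub>E\<^esub>r\<in>IJ. if l = snd r then g r else \<zero>\<^bsub>E\<^esub>) = \<zero>\<^bsub>E\<^esub>" if "n \<le> l" for l
    using that by (intro E.add.finprod_one_eqI) auto
  ultimately have "p = \<zero>\<^bsub>S.P\<^esub>" by (intro reduced_zero) auto
  then have "(\<Oplus>\<^bsub>E\<^esub>r\<in>IJ. if k = snd r then g r else \<zero>\<^bsub>E\<^esub>) = \<zero>\<^bsub>E\<^esub>"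
    unfolding coef[symmetric] by (simp add: S.zero_P)
  moreover have "(\<Oplus>\<^bsub>E\<^esub>r\<in>IJ. if k = snd r then g r else \<zero>\<^bsub>E\<^esub>) = (\<Oplus>\<^bsub>E\<^esub>r\<in>(\<lambda>i. (i, k)) ` {..<n}. g r)"
    using g ik by (intro E.add.finprod_mono_neutral_cong_right) auto
  moreover have "\<dots> = (\<Oplus>\<^bsub>E\<^esub>i\<in>{..<n}. g (i, k))"
    using g ik by (intro E.finsum_reindex) (auto simp: inj_on_def)
  ultimately have "E.el (\<lambda>i. c (i, k)) = \<zero>\<^bsub>E\<^esub>" unfolding E.lc_def by (simp add: g_def)
  then show ?thesis using E.lc_eq_zeroD[of "\<lambda>i. c (i, k)" i] cij ik by (simp add: Pi_def)
qed

lemma symbol: "symbol_alg F n q \<E> (\<lambda>c. \<epsilon> (\<iota> c)) (\<epsilon> h) x s a"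
proof unfold_locales
  show "finite IJ" by simp
  show "B \<in> IJ \<rightarrow> carrier \<E>" by (rule B_closed)
  show "\<exists>c\<in>IJ \<rightarrow> carrier F. r = Q.lc B IJ c" if r: "r \<in> carrier \<E>" for r
  proof -
    obtain p where p: "p \<in> carrier S.P" "r = cls p" using cls_surj[OF r] by (elim bexE)
    show ?thesis unfolding p(2) by (rule cls_in_span[OF p(1)])
  qed
  show "c p = \<zero>\<^bsub>F\<^esub>" if "c \<in> IJ \<rightarrow> carrier F" "Q.lc B IJ c = \<zero>\<^bsub>\<E>\<^esub>" "p \<in> IJ" for c p
    using lc_B_zero[OF that(1,2), of "fst p" "snd p"] that(3) by auto
  show "x \<otimes>\<^bsub>\<E>\<^esub> \<epsilon> h = \<epsilon> (\<iota> q) \<otimes>\<^bsub>\<E>\<^esub> (\<epsilon> h \<otimes>\<^bsub>\<E>\<^esub> x)"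
    by (simp add: x_\<epsilon> \<sigma>_h Q.m_assoc)
  show "\<epsilon> h [^]\<^bsub>\<E>\<^esub> n = \<epsilon> (\<iota> s)" by (simp add: \<epsilon>.hom_nat_pow[symmetric] E.g_pow_n)
qed (simp_all add: x_pow_n)

end

lemma (in field) root_alg_cring:
  assumes "0 < n" "s \<in> carrier R"
  shows "cring (root_alg R n s)"
  unfolding root_alg_def by (rule Rupt_cring[OF binomial_poly(1)[OF assms]])

section \<open>From the embedded copy of \<open>E\<close> back to \<open>E\<close>\<close>

context cyclic_presentation
begin

text \<open>An inverse of \<open>\<epsilon> e\<close> taken inside the image has the form
  \<open>\<epsilon> d\<close>, and injectivity turns this into \<open>e d = 1\<close> in
  \<open>E\<close>.\<close>

lemma field_if_image_subfield:
  assumes H: "subfield (\<epsilon> ` carrier E) \<E>"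
  shows "field E"
proof (rule E.cring_fieldI)
  have "\<exists>d\<in>carrier E. e \<otimes>\<^bsub>E\<^esub> d = \<one>\<^bsub>E\<^esub>" if e: "e \<in> carrier E" "e \<noteq> \<zero>\<^bsub>E\<^esub>" for e
  proof -
    have "\<epsilon> e \<in> \<epsilon> ` carrier E - {\<zero>\<^bsub>\<E>\<^esub>}" using e \<epsilon>_zero_iff by simp
    note inv = Q.subfield_m_inv[OF H this]
    have "inv\<^bsub>\<E>\<^esub> \<epsilon> e \<in> \<epsilon> ` carrier E" using inv(1) by (rule DiffD1)
    then obtain d where d: "d \<in> carrier E" "inv\<^bsub>\<E>\<^esub> \<epsilon> e = \<epsilon> d" by (elim imageE)
    have "\<epsilon> (e \<otimes>\<^bsub>E\<^esub> d \<ominus>\<^bsub>E\<^esub> \<one>\<^bsub>E\<^esub>) = \<epsilon> e \<otimes>\<^bsub>\<E>\<^esub> \<epsilon> d \<ominus>\<^bsub>\<E>\<^esub> \<one>\<^bsub>\<E>\<^esub>"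
      using d(1) e by (simp add: a_minus_def)
    also have "\<dots> = \<zero>\<^bsub>\<E>\<^esub>" unfolding d(2)[symmetric] inv(2) by (simp add: a_minus_def Q.r_neg)
    finally have "e \<otimes>\<^bsub>E\<^esub> d \<ominus>\<^bsub>E\<^esub> \<one>\<^bsub>E\<^esub> = \<zero>\<^bsub>E\<^esub>"
      using d(1) e by (subst (asm) \<epsilon>_zero_iff) auto
    then show ?thesis using d(1) e by (intro bexI[of _ d]) (simp_all add: E.r_right_minus_eq)
  qed note inverse = this
  show "Units E = carrier E - {\<zero>\<^bsub>E\<^esub>}"
  proof (intro subset_antisym subsetI)
    fix e assume e: "e \<in> Units E"
    then have "e \<noteq> \<zero>\<^bsub>E\<^esub>" using E.nontrivial E.Units_l_inv_ex[OF e] by auto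
    then show "e \<in> carrier E - {\<zero>\<^bsub>E\<^esub>}" using E.Units_closed[OF e] by simp
  next
    fix e assume e: "e \<in> carrier E - {\<zero>\<^bsub>E\<^esub>}"
    then obtain d where "d \<in> carrier E" "e \<otimes>\<^bsub>E\<^esub> d = \<one>\<^bsub>E\<^esub>" using inverse[of e] by auto
    moreover from this have "d \<otimes>\<^bsub>E\<^esub> e = \<one>\<^bsub>E\<^esub>" using e by (simp add: E.m_comm)
    ultimately show "e \<in> Units E" using e unfolding Units_def by auto
  qed
qed

lemma cyclic_symbol:
  assumes "field E" "a \<noteq> \<zero>\<^bsub>F\<^esub>"
  shows "cyclic_symbol F n q \<E> (\<lambda>c. \<epsilon> (\<iota> c)) (\<epsilon> h) x s a E \<iota> h \<epsilon> \<sigma>"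
proof -
  interpret A: symbol_alg F n q \<E> "\<lambda>c. \<epsilon> (\<iota> c)" "\<epsilon> h" x s a by (rule symbol)
  show ?thesis
    using assms(2)
    by (intro cyclic_symbol.intro cyclic_symbol_axioms.intro symbol assms(1) E.binom_alg_axioms
        \<epsilon>_hom S.\<sigma>_hom \<sigma>_h x_\<epsilon> refl)
qed

end

text \<open>Cyclicity is an equivalence for the embedded copy of \<open>E\<close> as maximal
  subfield. For an unspecified subfield one implication holds in full and the other yields
  \<open>a \<noteq> 0\<close>; the conclusion \<open>field E\<close> fails in the example given with
  the definitions.\<close>

theorem theorem2p3:
  fixes F :: "('a, 'm) ring_scheme"
    and n :: nat
    and q s a :: 'a
    and \<sigma> :: "'a list set \<Rightarrow> 'a list set"
  defines "E \<equiv> root_alg F n s"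
    and "h \<equiv> root_alg_gen F n s"
    and "\<iota> \<equiv> root_alg_const F n s"
  defines "\<E> \<equiv> cyc_alg E \<sigma> n (\<iota> a)"
    and "\<epsilon> \<equiv> cyc_const E \<sigma> n (\<iota> a)"
    and "x \<equiv> cyc_var E \<sigma> n (\<iota> a)"
  defines "FE \<equiv> \<iota> ` carrier F"
    and "F\<E> \<equiv> (\<epsilon> \<circ> \<iota>) ` carrier F"
    and "E\<E> \<equiv> \<epsilon> ` carrier E"
  defines "G \<equiv> aut_group E FE"
  assumes "field F"
    and "n \<ge> 2"
    and "primitive_root_of_unity F n q"
    and "s \<in> carrier F"
    and "a \<in> carrier F"
    and "\<sigma> \<in> carrier (aut_group E FE)"
    and "\<sigma> h = \<iota> q \<otimes>\<^bsub>E\<^esub> h"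
  shows
   "(pirreducible\<^bsub>F\<^esub> (carrier F) (binomial_poly F n s) \<longleftrightarrow>
       s \<notin> (\<Union>m\<in>{m. m dvd n \<and> m \<noteq> 1}. mth_powers F m)) \<and>

    (pirreducible\<^bsub>F\<^esub> (carrier F) (binomial_poly F n s) \<longrightarrow>
       galois_extension E FE \<and>
       cyclic_group G \<and> carrier G = generate G {\<sigma>} \<and> group.ord G \<sigma> = n \<and> order G = n \<and>
       ring.dimension E n FE (carrier E)) \<and>

    (simple_ring \<E> \<longleftrightarrow> s \<noteq> \<zero>\<^bsub>F\<^esub> \<and> a \<noteq> \<zero>\<^bsub>F\<^esub>) \<and>
    (s \<noteq> \<zero>\<^bsub>F\<^esub> \<and> a \<noteq> \<zero>\<^bsub>F\<^esub> \<longrightarrow> central_simple_algebra F\<E> \<E> \<and> has_degree F\<E> \<E> n) \<and>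

    (s \<noteq> \<zero>\<^bsub>F\<^esub> \<and> a = \<zero>\<^bsub>F\<^esub> \<longrightarrow>
       radical \<E> = Idl\<^bsub>\<E>\<^esub> {x} \<and>
       alg_isomorphic F (\<E> Quot radical \<E>) (\<lambda>c. radical \<E> +>\<^bsub>\<E>\<^esub> \<epsilon> (\<iota> c)) E \<iota>) \<and>
    (s = \<zero>\<^bsub>F\<^esub> \<and> a \<noteq> \<zero>\<^bsub>F\<^esub> \<longrightarrow>
       radical \<E> = Idl\<^bsub>\<E>\<^esub> {\<epsilon> h} \<and>
       alg_isomorphic F (\<E> Quot radical \<E>) (\<lambda>c. radical \<E> +>\<^bsub>\<E>\<^esub> \<epsilon> (\<iota> c))
         (root_alg F n a) (root_alg_const F n a)) \<and>
    (s = \<zero>\<^bsub>F\<^esub> \<and> a = \<zero>\<^bsub>F\<^esub> \<longrightarrow>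
       radical \<E> = Idl\<^bsub>\<E>\<^esub> {x, \<epsilon> h} \<and>
       alg_isomorphic F (\<E> Quot radical \<E>) (\<lambda>c. radical \<E> +>\<^bsub>\<E>\<^esub> \<epsilon> (\<iota> c)) F (\<lambda>c. c)) \<and>

    (cyclic_algebra_via F\<E> \<E> E\<E> \<longleftrightarrow> field E \<and> a \<noteq> \<zero>\<^bsub>F\<^esub>) \<and>
    (field E \<and> a \<noteq> \<zero>\<^bsub>F\<^esub> \<longrightarrow> cyclic_algebra F\<E> \<E>) \<and>
    (cyclic_algebra F\<E> \<E> \<longrightarrow> a \<noteq> \<zero>\<^bsub>F\<^esub>) \<and>

    (field E \<and> a \<noteq> \<zero>\<^bsub>F\<^esub> \<longrightarrow>
       (alg_isomorphic F \<E> (\<epsilon> \<circ> \<iota>) (matrix_ring F n) (scalar_matrix F n) \<longleftrightarrow>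
        (\<exists>b\<in>Units E. \<iota> a = cyclic_norm E \<sigma> n b)))"
proof -
  interpret F: root_field F n q
    using \<open>field F\<close> \<open>n \<ge> 2\<close> \<open>primitive_root_of_unity F n q\<close>
    by (intro root_field.intro root_field_axioms.intro)
  have n: "0 < n" using \<open>n \<ge> 2\<close> by simp
  have BE: "binom_alg F E \<iota> n h s"
    unfolding E_def h_def \<iota>_def using n \<open>s \<in> carrier F\<close> by (rule F.root_alg_binom_alg)
  have CE: "cring E" unfolding E_def using n \<open>s \<in> carrier F\<close> by (rule F.root_alg_cring)
  have \<sigma>: "\<sigma> \<in> ring_hom E E" "\<And>c. c \<in> carrier F \<Longrightarrow> \<sigma> (\<iota> c) = \<iota> c"
    using \<open>\<sigma> \<in> carrier (aut_group E FE)\<close> by (simp_all add: mem_aut_group FE_def)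
  interpret C: cyclic_presentation F n q E \<iota> h s \<sigma> a
    using F.root_field_axioms CE BE \<sigma> \<open>a \<in> carrier F\<close> \<open>\<sigma> h = \<iota> q \<otimes>\<^bsub>E\<^esub> h\<close>
    by (intro cyclic_presentation.intro cyclic_presentation_axioms.intro skew_poly.intro skew_poly_axioms.intro)
  interpret A: symbol_alg F n q \<E> "\<lambda>c. \<epsilon> (\<iota> c)" "\<epsilon> h" x s a
    unfolding \<E>_def \<epsilon>_def x_def by (rule C.symbol)
  have irr: "pirreducible\<^bsub>F\<^esub> (carrier F) (binomial_poly F n s) \<longleftrightarrow> field E"
    unfolding E_def by (rule F.irreducible_iff(2)[OF \<open>s \<in> carrier F\<close>])
  have F\<E>: "F\<E> = (\<lambda>c. \<epsilon> (\<iota> c)) ` carrier F" by (simp add: F\<E>_def comp_def)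
  have galois: "galois_extension E FE \<and> cyclic_group G \<and> carrier G = generate G {\<sigma>} \<and>
      group.ord G \<sigma> = n \<and> order G = n \<and> ring.dimension E n FE (carrier E)" if "field E"
  proof -
    interpret K: kummer_field F n q E \<iota> h s
      using F.root_field_axioms BE that by (intro kummer_field.intro)
    have \<rho>: "\<sigma> \<in> carrier K.G" using \<open>\<sigma> \<in> carrier (aut_group E FE)\<close> by (simp add: FE_def)
    show ?thesis
      unfolding G_def FE_def
      using K.galois_generated[OF \<rho> \<open>\<sigma> h = \<iota> q \<otimes>\<^bsub>E\<^esub> h\<close>] K.dimension_L by (intro conjI)
  qed
  have via: "cyclic_algebra_via F\<E> \<E> E\<E>" and
    norm: "alg_isomorphic F \<E> (\<epsilon> \<circ> \<iota>) (matrix_ring F n) (scalar_matrix F n) \<longleftrightarrow>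
      (\<exists>b\<in>Units E. \<iota> a = cyclic_norm E \<sigma> n b)" if "field E" "a \<noteq> \<zero>\<^bsub>F\<^esub>"
  proof -
    interpret D: cyclic_symbol F n q \<E> "\<lambda>c. \<epsilon> (\<iota> c)" "\<epsilon> h" x s a E \<iota> h \<epsilon> \<sigma>
      unfolding \<E>_def \<epsilon>_def x_def by (rule C.cyclic_symbol[OF that])
    show "cyclic_algebra_via F\<E> \<E> E\<E>" unfolding F\<E> E\<E>_def by (rule D.cyclic_via)
    show "alg_isomorphic F \<E> (\<epsilon> \<circ> \<iota>) (matrix_ring F n) (scalar_matrix F n) \<longleftrightarrow>
        (\<exists>b\<in>Units E. \<iota> a = cyclic_norm E \<sigma> n b)"
      unfolding comp_def by (rule D.split_iff_norm)
  qed
  \<comment> \<open>A cyclic algebra is simple whatever its maximal subfield, and simplicity forces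
    \<open>a \<noteq> 0\<close>.\<close>
  have cyc_a: "a \<noteq> \<zero>\<^bsub>F\<^esub>" if "cyclic_algebra F\<E> \<E>"
    using that A.simple_iff by (auto simp: cyclic_algebra_def cyclic_algebra_via_def central_simple_algebra_def)
  have via_field: "field E" if "cyclic_algebra_via F\<E> \<E> E\<E>"
    using that C.field_if_image_subfield
    by (simp add: cyclic_algebra_via_def strictly_maximal_subfield_def E\<E>_def \<E>_def \<epsilon>_def)
  show ?thesis
  proof (intro conjI impI)
    show "pirreducible\<^bsub>F\<^esub> (carrier F) (binomial_poly F n s) \<longleftrightarrow>
        s \<notin> (\<Union>m\<in>{m. m dvd n \<and> m \<noteq> 1}. mth_powers F m)"
      by (rule F.irreducible_iff(1)[OF \<open>s \<in> carrier F\<close>])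
  next
    assume "pirreducible\<^bsub>F\<^esub> (carrier F) (binomial_poly F n s)"
    note * = galois[OF this[unfolded irr]]
    show "galois_extension E FE" using * by (elim conjE)
    show "cyclic_group G" using * by (elim conjE)
    show "carrier G = generate G {\<sigma>}" using * by (elim conjE)
    show "group.ord G \<sigma> = n" using * by (elim conjE)
    show "order G = n" using * by (elim conjE)
    show "ring.dimension E n FE (carrier E)" using * by (elim conjE)
  next
    show "simple_ring \<E> \<longleftrightarrow> s \<noteq> \<zero>\<^bsub>F\<^esub> \<and> a \<noteq> \<zero>\<^bsub>F\<^esub>" by (rule A.simple_iff)
  next
    assume "s \<noteq> \<zero>\<^bsub>F\<^esub> \<and> a \<noteq> \<zero>\<^bsub>F\<^esub>"
    then have sa: "s \<noteq> \<zero>\<^bsub>F\<^esub>" "a \<noteq> \<zero>\<^bsub>F\<^esub>" by simp_all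
    show "central_simple_algebra F\<E> \<E>" "has_degree F\<E> \<E> n"
      unfolding F\<E> by (rule A.central_simple[OF sa])+
  next
    assume "s \<noteq> \<zero>\<^bsub>F\<^esub> \<and> a = \<zero>\<^bsub>F\<^esub>"
    then have sa: "s \<noteq> \<zero>\<^bsub>F\<^esub>" "a = \<zero>\<^bsub>F\<^esub>" by simp_all
    show "radical \<E> = Idl\<^bsub>\<E>\<^esub> {x}"
      using sa A.x_in_W1 by (intro A.radical_eq_genideal) simp_all
    show "alg_isomorphic F (\<E> Quot radical \<E>) (\<lambda>c. radical \<E> +>\<^bsub>\<E>\<^esub> \<epsilon> (\<iota> c)) E \<iota>"
      unfolding A.radical_eq by (rule A.quot_iso_h[OF sa BE])
  next
    assume "s = \<zero>\<^bsub>F\<^esub> \<and> a \<noteq> \<zero>\<^bsub>F\<^esub>"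
    then have sa: "s = \<zero>\<^bsub>F\<^esub>" "a \<noteq> \<zero>\<^bsub>F\<^esub>" by simp_all
    show "radical \<E> = Idl\<^bsub>\<E>\<^esub> {\<epsilon> h}"
      using sa A.h_in_W1 by (intro A.radical_eq_genideal) simp_all
    show "alg_isomorphic F (\<E> Quot radical \<E>) (\<lambda>c. radical \<E> +>\<^bsub>\<E>\<^esub> \<epsilon> (\<iota> c))
        (root_alg F n a) (root_alg_const F n a)"
      unfolding A.radical_eq
      by (rule A.quot_iso_x[OF sa F.root_alg_binom_alg[OF n \<open>a \<in> carrier F\<close>]])
  next
    assume "s = \<zero>\<^bsub>F\<^esub> \<and> a = \<zero>\<^bsub>F\<^esub>"
    then have sa: "s = \<zero>\<^bsub>F\<^esub>" "a = \<zero>\<^bsub>F\<^esub>" by simp_all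
    show "radical \<E> = Idl\<^bsub>\<E>\<^esub> {x, \<epsilon> h}"
      using sa A.x_in_W1 A.h_in_W1 by (intro A.radical_eq_genideal) simp_all
    show "alg_isomorphic F (\<E> Quot radical \<E>) (\<lambda>c. radical \<E> +>\<^bsub>\<E>\<^esub> \<epsilon> (\<iota> c)) F (\<lambda>c. c)"
      unfolding A.radical_eq by (rule A.quot_iso_trivial[OF sa])
  next
    show "cyclic_algebra_via F\<E> \<E> E\<E> \<longleftrightarrow> field E \<and> a \<noteq> \<zero>\<^bsub>F\<^esub>"
      using via via_field cyc_a by (auto simp: cyclic_algebra_def)
  next
    assume "field E \<and> a \<noteq> \<zero>\<^bsub>F\<^esub>"
    then show "cyclic_algebra F\<E> \<E>" using via by (auto simp: cyclic_algebra_def)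
  next
    assume "cyclic_algebra F\<E> \<E>"
    then show "a \<noteq> \<zero>\<^bsub>F\<^esub>" by (rule cyc_a)
  next
    assume "field E \<and> a \<noteq> \<zero>\<^bsub>F\<^esub>"
    then show "alg_isomorphic F \<E> (\<epsilon> \<circ> \<iota>) (matrix_ring F n) (scalar_matrix F n) \<longleftrightarrow>
        (\<exists>b\<in>Units E. \<iota> a = cyclic_norm E \<sigma> n b)"
      using norm by (elim conjE)
  qed
qed

end
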